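(* Let $\lambda$ and $\mu$ be strict partitions with $\ell(\mu)=m\leq \ell(\lambda)=n$, and suppose $\rho_{n,m}=(n,n-1,\ldots,n-m+1)\subseteq \mu$ (containment of Young diagrams). Then \[{\mathfrak d}_{\lambda,\mu}^{\lambda}=d_{\lambda,\mu}^{\lambda},\] and moreover $d_{\lambda,\mu}^{\lambda}=2^{\binom{n}{2}-\binom{n-m}{2}}$ if $\mu=\rho_{n,m}$, and $d_{\lambda,\mu}^{\lambda}=0$ otherwise.
   Context: A strict partition is $\lambda=(\lambda_1>\lambda_2>\cdots>\lambda_\ell>0)$ of length $\ell(\lambda)=\ell$ and size $|\lambda|=\sum\lambda_i$; it is identified with its shifted diagram, whose $i$-th row (from the top) has $\lambda_i$ boxes and is indented $i-1$ units, so boxes are $(i,j)$ (matrix coordinates) with $i\le j\le i+\lambda_i-1$. $\rho_n=(n,n-1,\ldots,1)$ and $\rho_{n,m}=(n,n-1,\ldots,n-m+1)$ for $0\le m\le n$. Anderson–Fulton ring and $\mathfrak d$: Let $\mathfrak P=\mathbb Z[z,c_1,c_2,\ldots]/(c_{p,p}=0\ \forall p>0)$, where $c_0=1$, $c_k=0$ for $k<0$, and $c_{p,q}=\sum_{0\le a\le b\le q}(-1)^b\left(\binom{b}{a}+\binom{b-1}{a}\right)z^a c_{p+b-a}c_{q-b}$ (with $\binom{b-1}{a}=0$ for $b=0$). For a strict partition $\lambda$ of length $\ell$, set $\lambda_{\ell+1}=0$ if $\ell$ is odd and let $\sigma_\lambda$ be the Pfaffian of the skew matrix $(c_{\lambda_i,\lambda_j})$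 of even size. The $\sigma_\lambda$ form a $\mathbb Z[z]$-basis of $\mathfrak P$, and structure constants $\mathfrak D_{\lambda,\mu}^{\nu}\in\mathbb Z[z]$ are defined by $\sigma_\lambda\sigma_\mu=\sum_\nu \mathfrak D_{\lambda,\mu}^{\nu}\sigma_\nu$. (Equivalently, $\mathfrak D_{\lambda,\mu}^\nu$ is the $\mathsf T$-equivariant Schubert structure constant of the Lagrangian Grassmannian, written in the simple roots $\alpha_1,\dots,\alpha_n$, specialized at $\alpha_1\mapsto z$, $\alpha_i\mapsto 0$ for $i\ge2$.) Define \[{\mathfrak d}_{\lambda,\mu}^{\lambda}:=\frac{\mathfrak D_{\lambda,\mu}^{\lambda}}{2^{L-\Delta}z^{\Delta}},\qquad \Delta=|\lambda|+|\mu|-|\lambda|=|\mu|,\ L=\ell(\lambda)+\ell(\mu)-\ell(\lambda)=\ell(\mu).\] Shifted edge labeled tableaux: for shifted shapes $\lambda\subseteq\nu$, $\nu/\lambda$ is the set of boxes of $\nu$ not in $\lambda$; the diagonal edges are the southern edges of the diagonal boxes $(i,i)$ of $\nu$. A shifted edge labeled tableau of shape $\nu/\lambda$ with labels $[N]$ is a filling in which each box of $\nu/\lambda$ has exactly one label, each diagonal edge has a (possibly empty) set of labels, each $i\in[N]$ appears exactly once, labels strictly increase left to right along rows and top to bottom down columns, and each label on a diagonal edge is strictly larger than any label directly north of it. The set of these is $\mathsf{SELT}(\nu/\lambda,N)$. Jeu de taquin: an inner corner $\mathsf c$ of $\nu/\lambda$ is a box of $\lambda$ with no box of $\lambda$ immediately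 east or south of it. $\mathsf{jdt}_{\mathsf c}(T)$: place $\bullet$ in $\mathsf c$ and repeatedly apply: (1) if $\bullet$ has $a$ to its east and $b$ to its south with $b<a$ (or $a$ absent), swap $\bullet$ and $b$; (2) if $a<b$ (or $b$ absent), swap $\bullet$ and $a$; (3) if $\bullet$ is in a diagonal box with label $a$ to its east and label set $S$ on the diagonal edge below it, and $a<\min S$ or $S=\emptyset$, swap $\bullet$ and $a$; (4) if $\bullet$ is in a diagonal box with edge set $S$ below, $s=\min S<a$ (or $a$ absent), put $s$ in the box of $\bullet$ and replace $S$ by $S\setminus\{s\}$, and stop. Also stop when $\bullet$ has no labels directly south or east. Then remove $\bullet$ (its box is removed from the shape). Row rectification $\mathrm{Rect}(T)$: repeatedly apply $\mathsf{jdt}$ at a southmost inner corner of the current shape, $|\lambda|$ times, obtaining a straight-shape tableau. $S_\mu$ is the superstandard tableau of shape $\mu$: boxes of $\mu$ filled with $1,\ldots,|\mu|$ in English reading order (row by row, top to bottom, left to right). Define $d_{\lambda,\mu}^{\nu}=\#\{T\in\mathsf{SELT}(\nu/\lambda,|\mu|):\mathrm{Rect}(T)=S_\mu\}$. *)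

theory Defs
  imports
    "HOL-Library.Poly_Mapping"
    "HOL-Computational_Algebra.Fraction_Field"
    "HOL-Computational_Algebra.Polynomial"
    "HOL-Combinatorics.Permutations"
begin

section \<open>Strict partitions and shifted diagrams\<close>

definition strict_partition :: "nat list \<Rightarrow> bool"
  where "strict_partition lam \<longleftrightarrow> sorted_wrt (>) lam \<and> 0 \<notin> set lam"

text \<open>Boxes carry matrix coordinates starting at 1, while the list index starts at 0.\<close>

definition diagram :: "nat list \<Rightarrow> (nat \<times> nat) set"
  where "diagram lam =
    {(i, j). 1 \<le> i \<and> i \<le> length lam \<and> i \<le> j \<and> j < i + lam ! (i - 1)}"

definition rho :: "nat \<Rightarrow> nat \<Rightarrow> nat list"
  where "rho n m = map (\<lambda>i. n - i) [0..<m]"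


section \<open>The Anderson--Fulton ring\<close>

text \<open>
  The polynomial ring in z, c_1, c_2, ... over the integers is represented as the ring of
  polynomials in c_1, c_2, ... with coefficients in the polynomials in z.  The variable of
  index k is c_(k+1), so that there is no variable standing for c_0 = 1.
\<close>

type_synonym af_poly = "(nat \<Rightarrow>\<^sub>0 nat) \<Rightarrow>\<^sub>0 int poly"

definition af_const :: "int poly \<Rightarrow> af_poly"
  where "af_const p = Poly_Mapping.single 0 p"

definition af_z :: af_poly
  where "af_z = af_const [:0, 1:]"

definition af_c :: "nat \<Rightarrow> af_poly"
  where "af_c k = (if k = 0 then 1
    else Poly_Mapping.single (Poly_Mapping.single (k - 1) 1) 1)"

definition af_cc :: "nat \<Rightarrow> nat \<Rightarrow> af_poly"
  where "af_cc p q = (\<Sum>b\<le>q. \<Sum>a\<le>b.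
    (- 1) ^ b * of_nat ((b choose a) + (if b = 0 then 0 else (b - 1) choose a))
      * af_z ^ a * af_c (p + b - a) * af_c (q - b))"

text \<open>The ideal generated by a set is its span in the ring viewed as a module over itself.
  The module locale is not interpreted globally, because its simp rules would reassociate
  every product in a commutative ring.\<close>

lemma module_mult: "module ((*) :: 'a::comm_ring_1 \<Rightarrow> 'a \<Rightarrow> 'a)"
  by standard (simp_all add: algebra_simps)

definition af_ideal :: "af_poly set"
  where "af_ideal = module.span (*) {af_cc p p | p. p > 0}"

definition af_rel :: "af_poly \<Rightarrow> af_poly \<Rightarrow> bool"
  where "af_rel x y \<longleftrightarrow> x - y \<in> af_ideal"

lemma af_ideal_add: "x \<in> af_ideal \<Longrightarrow> y \<in> af_ideal \<Longrightarrow> x + y \<in> af_ideal"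
  unfolding af_ideal_def by (rule module.span_add[OF module_mult])

lemma af_ideal_neg: "x \<in> af_ideal \<Longrightarrow> - x \<in> af_ideal"
  unfolding af_ideal_def by (rule module.span_neg[OF module_mult])

lemma af_ideal_mult: "y \<in> af_ideal \<Longrightarrow> x * y \<in> af_ideal"
  unfolding af_ideal_def by (rule module.span_scale[OF module_mult])

lemma lookup_mult_zero:
  fixes f g :: af_poly
  shows "Poly_Mapping.lookup (f * g) 0 = Poly_Mapping.lookup f 0 * Poly_Mapping.lookup g 0"
proof -
  have eq: "0 = l + q \<longleftrightarrow> l = 0 \<and> q = 0" for l q :: "nat \<Rightarrow>\<^sub>0 nat"
    by (metis add_is_0 add.left_neutral lookup_add lookup_zero poly_mapping_eqI)
  have "Poly_Mapping.lookup f l * Sum_any (\<lambda>q. Poly_Mapping.lookup g q when 0 = l + q) =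
      (Poly_Mapping.lookup f 0 * Poly_Mapping.lookup g 0 when l = 0)" for l
    by (cases "l = 0") (simp_all add: eq)
  then show ?thesis by (simp add: lookup_mult)
qed

lemma lookup_af_c_zero:
  assumes "k > 0"
  shows "Poly_Mapping.lookup (af_c k) 0 = 0"
proof -
  have "Poly_Mapping.single (k - 1) (1::nat) \<noteq> 0"
    by (metis lookup_single_eq lookup_zero zero_neq_one)
  with assms show ?thesis
    by (simp add: af_c_def lookup_single_not_eq)
qed

lemma af_ideal_lookup_zero: "x \<in> af_ideal \<Longrightarrow> Poly_Mapping.lookup x 0 = 0"
  unfolding af_ideal_def
proof (induction rule: module.span_induct_alt[OF module_mult, consumes 1, case_names base step])
  case base
  show ?case by simp
next
  case (step a x y)
  then obtain p where "p > 0" "x = af_cc p p" by auto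
  then have "Poly_Mapping.lookup x 0 = 0"
    by (simp add: af_cc_def lookup_sum lookup_mult_zero lookup_af_c_zero)
  with step show ?case by (simp add: lookup_add lookup_mult_zero)
qed

lemma af_rel_equivp: "equivp af_rel"
proof (rule equivpI)
  show "reflp af_rel"
    by (auto simp: reflp_def af_rel_def af_ideal_def intro: module.span_zero[OF module_mult])
  show "symp af_rel"
    unfolding symp_def af_rel_def by (metis af_ideal_neg minus_diff_eq)
  show "transp af_rel"
  proof (rule transpI)
    fix x y z
    assume "af_rel x y" "af_rel y z"
    then have "(x - y) + (y - z) \<in> af_ideal"
      unfolding af_rel_def by (rule af_ideal_add)
    then show "af_rel x z"
      by (simp add: af_rel_def)
  qed
qed

quotient_type af_ring = af_poly / af_rel
  by (rule af_rel_equivp)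

instantiation af_ring :: comm_ring_1
begin

lift_definition zero_af_ring :: af_ring is 0 .
lift_definition one_af_ring :: af_ring is 1 .

lift_definition plus_af_ring :: "af_ring \<Rightarrow> af_ring \<Rightarrow> af_ring" is "(+)"
  unfolding af_rel_def by (metis add_diff_add af_ideal_add)

lift_definition uminus_af_ring :: "af_ring \<Rightarrow> af_ring" is uminus
  unfolding af_rel_def by (metis af_ideal_neg minus_diff_minus)

lift_definition minus_af_ring :: "af_ring \<Rightarrow> af_ring \<Rightarrow> af_ring" is "(-)"
proof -
  fix x y u v
  assume "af_rel x y" "af_rel u v"
  then have "(x - y) + - (u - v) \<in> af_ideal"
    unfolding af_rel_def by (intro af_ideal_add af_ideal_neg)
  then show "af_rel (x - u) (y - v)"
    by (simp add: af_rel_def algebra_simps)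
qed

lift_definition times_af_ring :: "af_ring \<Rightarrow> af_ring \<Rightarrow> af_ring" is "(*)"
proof -
  fix x y u v
  assume "af_rel x y" "af_rel u v"
  then have "u * (x - y) + y * (u - v) \<in> af_ideal"
    unfolding af_rel_def by (intro af_ideal_add af_ideal_mult)
  then show "af_rel (x * u) (y * v)"
    by (simp add: af_rel_def algebra_simps)
qed

instance
proof
  have af_rel_refl: "af_rel x x" for x
    using af_rel_equivp by (rule equivp_reflp)
  fix a b c :: af_ring
  show "a + b + c = a + (b + c)" by transfer (simp add: af_rel_refl add.assoc)
  show "a + b = b + a" by transfer (simp add: af_rel_refl add.commute)
  show "0 + a = a" by transfer (simp add: af_rel_refl)
  show "- a + a = 0" by transfer (simp add: af_rel_refl)
  show "a - b = a + - b" by transfer (simp add: af_rel_refl)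
  show "a * b * c = a * (b * c)" by transfer (simp add: af_rel_refl mult.assoc)
  show "a * b = b * a" by transfer (simp add: af_rel_refl mult.commute)
  show "1 * a = a" by transfer (simp add: af_rel_refl)
  show "(a + b) * c = a * c + b * c" by transfer (simp add: af_rel_refl distrib_right)
  show "(0::af_ring) \<noteq> 1"
  proof transfer
    show "\<not> af_rel 0 1"
      using af_ideal_lookup_zero[of "- 1"] by (auto simp: af_rel_def lookup_one)
  qed
qed

end

definition af_scale :: "int poly \<Rightarrow> af_ring \<Rightarrow> af_ring"
  where "af_scale p x = abs_af_ring (af_const p) * x"

text \<open>
  The sum over all perfect matchings of the indices 0, ..., 2k - 1, each matching being given by
  the one permutation that lists its pairs in increasing order, with increasing first elements.
\<close>

definition pfaffian :: "nat \<Rightarrow> (nat \<Rightarrow> nat \<Rightarrow> 'a::comm_ring_1) \<Rightarrow> 'a"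
  where "pfaffian k A =
    (\<Sum>\<pi> | \<pi> permutes {..<2 * k} \<and> (\<forall>i<k. \<pi> (2 * i) < \<pi> (2 * i + 1)) \<and>
            (\<forall>j<k. \<forall>i<j. \<pi> (2 * i) < \<pi> (2 * j)).
       of_int (sign \<pi>) * (\<Prod>i<k. A (\<pi> (2 * i)) (\<pi> (2 * i + 1))))"

definition part :: "nat list \<Rightarrow> nat \<Rightarrow> nat"
  where "part lam i = (if i < length lam then lam ! i else 0)"

definition af_sigma :: "nat list \<Rightarrow> af_ring"
  where "af_sigma lam = pfaffian ((length lam + 1) div 2)
    (\<lambda>i j. abs_af_ring (af_cc (part lam i) (part lam j)))"

text \<open>The \<^const>\<open>af_sigma\<close> of strict partitions form a basis over the polynomials in z, so
  there is exactly one such coefficient family.\<close>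

definition af_struct :: "nat list \<Rightarrow> nat list \<Rightarrow> nat list \<Rightarrow> int poly"
  where "af_struct lam mu = Poly_Mapping.lookup
    (THE D :: nat list \<Rightarrow>\<^sub>0 int poly. Poly_Mapping.keys D \<subseteq> Collect strict_partition \<and>
      af_sigma lam * af_sigma mu =
        (\<Sum>nu\<in>Poly_Mapping.keys D. af_scale (Poly_Mapping.lookup D nu) (af_sigma nu)))"

definition frak_d :: "nat list \<Rightarrow> nat list \<Rightarrow> nat list \<Rightarrow> int poly fract"
  where "frak_d lam mu nu =
    (let \<Delta> = int (sum_list lam) + int (sum_list mu) - int (sum_list nu);
         L = int (length lam) + int (length mu) - int (length nu)
     in Fraction_Field.Fract (af_struct lam mu nu) 1 / (2 powi (L - \<Delta>) * Fraction_Field.Fract [:0, 1:] 1 powi \<Delta>))"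


section \<open>Shifted edge labeled tableaux\<close>

text \<open>
  A tableau of shape nu/lambda records the boxes of lambda, the labels of the boxes of nu/lambda
  (a partial function whose domain is nu/lambda), and for each i the label set of the southern
  edge of the box (i,i).  The outer shape nu is the union of the inner shape and the domain of
  the box labels.
\<close>

record tableau =
  inner_shape :: "(nat \<times> nat) set"
  box_label :: "nat \<times> nat \<Rightarrow> nat option"
  edge_labels :: "nat \<Rightarrow> nat set"

datatype position = Box nat nat | Edge nat

fun labels_at :: "tableau \<Rightarrow> position \<Rightarrow> nat set"
  where
    "labels_at T (Box i j) = set_option (box_label T (i, j))"
  | "labels_at T (Edge i) = edge_labels T i"

definition SELT :: "nat list \<Rightarrow> nat list \<Rightarrow> nat \<Rightarrow> tableau set"
  where "SELT nu lam N = {T.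
    inner_shape T = diagram lam \<and>
    dom (box_label T) = diagram nu - diagram lam \<and>
    (\<forall>i. edge_labels T i \<noteq> {} \<longrightarrow> (i, i) \<in> diagram nu) \<and>
    (\<forall>p. labels_at T p \<subseteq> {1..N}) \<and>
    (\<forall>k\<in>{1..N}. \<exists>!p. k \<in> labels_at T p) \<and>
    (\<forall>i j j' a b. j < j' \<and> box_label T (i, j) = Some a \<and> box_label T (i, j') = Some b
      \<longrightarrow> a < b) \<and>
    (\<forall>i i' j a b. i < i' \<and> box_label T (i, j) = Some a \<and> box_label T (i', j) = Some b
      \<longrightarrow> a < b) \<and>
    (\<forall>i a. box_label T (i, i) = Some a \<longrightarrow> (\<forall>s\<in>edge_labels T i. a < s))}"


section \<open>Jeu de taquin and rectification\<close>

definition inner_corner :: "(nat \<times> nat) set \<Rightarrow> nat \<times> nat \<Rightarrow> bool"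
  where "inner_corner S c \<longleftrightarrow>
    c \<in> S \<and> (fst c, snd c + 1) \<notin> S \<and> (fst c + 1, snd c) \<notin> S"

text \<open>
  The bullet sits in the unlabeled box (i,j).  No box lies south of a diagonal box, so the first
  branch concerns the edge below the bullet, and the remaining branches move the bullet.
  Where the bullet stops without taking an edge label, its box stays out of the domain
  of the box labels, which removes it from the shape.
\<close>

partial_function (tailrec) slide ::
  "nat \<Rightarrow> nat \<Rightarrow> (nat \<times> nat \<Rightarrow> nat option) \<Rightarrow> (nat \<Rightarrow> nat set) \<Rightarrow>
    (nat \<times> nat \<Rightarrow> nat option) \<times> (nat \<Rightarrow> nat set)"
  where "slide i j f E =
    (if i = j \<and> E i \<noteq> {} \<and> (\<forall>a. f (i, j + 1) = Some a \<longrightarrow> Min (E i) < a)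
     then (f((i, j) \<mapsto> Min (E i)), E(i := E i - {Min (E i)}))
     else case f (i, j + 1) of
       None \<Rightarrow> (case f (i + 1, j) of
         None \<Rightarrow> (f, E)
       | Some b \<Rightarrow> slide (i + 1) j (f((i, j) \<mapsto> b, (i + 1, j) := None)) E)
     | Some a \<Rightarrow> (case f (i + 1, j) of
         None \<Rightarrow> slide i (j + 1) (f((i, j) \<mapsto> a, (i, j + 1) := None)) E
       | Some b \<Rightarrow>
           if b < a then slide (i + 1) j (f((i, j) \<mapsto> b, (i + 1, j) := None)) E
           else slide i (j + 1) (f((i, j) \<mapsto> a, (i, j + 1) := None)) E))"

definition jdt :: "nat \<times> nat \<Rightarrow> tableau \<Rightarrow> tableau"
  where "jdt c T =
    (let (f, E) = slide (fst c) (snd c) (box_label T) (edge_labels T)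
     in \<lparr>inner_shape = inner_shape T - {c}, box_label = f, edge_labels = E\<rparr>)"

definition southmost_corner :: "(nat \<times> nat) set \<Rightarrow> nat \<times> nat"
  where "southmost_corner S =
    (THE c. inner_corner S c \<and> (\<forall>c'. inner_corner S c' \<longrightarrow> fst c' \<le> fst c))"

definition rectify :: "tableau \<Rightarrow> tableau"
  where "rectify T =
    ((\<lambda>U. jdt (southmost_corner (inner_shape U)) U) ^^ card (inner_shape T)) T"

definition superstandard :: "nat list \<Rightarrow> tableau"
  where "superstandard mu =
    \<lparr>inner_shape = {},
     box_label = (\<lambda>(i, j). if (i, j) \<in> diagram mu
       then Some (sum_list (take (i - 1) mu) + (j - i + 1)) else None),
     edge_labels = (\<lambda>_. {})\<rparr>"

definition selt_count :: "nat list \<Rightarrow> nat list \<Rightarrow> nat list \<Rightarrow> nat"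
  where "selt_count lam mu nu =
    card {T \<in> SELT nu lam (sum_list mu). rectify T = superstandard mu}"

end

(*
  Combinatorial side. The skew shape lam/lam has no boxes, so a tableau is a distribution of the
  labels over the n diagonal edges, and row rectification treats the rows of lam from the bottom up.
  Suppose that the result of the slides of row i is to be superstandard with rows i, i+1, ... . Then
  it was already superstandard before these slides, and the slides can be undone in exactly two ways
  for each row with more than one box, depending on whether that row received its new label from the
  diagonal edge of its own row or of the next one; so row i contributes the factor 2^min(m, n-i).
  As no label ever gets to the right of column n, there is nothing to count when mu_1 > n, while
  mu_1 <= n forces mu = rho(n,m).

  Algebraic side. Sending c_k to the coefficient of u^k in prod_i (1 + (x_i + z) u) / (1 - x_i u),
  i = 1, ..., n, kills all c_(p,p). Partial fractions and Schur's Pfaffian turn the image of sigma_nu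
  into the sum over t from {1..l(nu)} to {x_1, ..., x_n} of
    prod_a A(t_a) t_a^(nu_a - 1) * prod_(a<b) (t_b - t_a) / (t_a + t_b + z),
  where A(x_i) is the residue weight of x_i. It vanishes for l(nu) > n, and for l(nu) = n it is an
  alternant times a factor that does not depend on nu. For n = l(lam) this shows that D^lam_(lam,mu) is
  the constant term of the image of sigma_mu, that is, the value of sigma_mu at c_k = binom(n,k) z^k.
  It is 0 if mu_1 > n, and for rho(n,m) setting a single variable to 0 gives a recursion in n with
  solution z^|rho(n,m)|.
*)
theory Submission
  imports Defs "HOL-Library.FuncSet" "HOL-Computational_Algebra.Formal_Power_Series"
begin

section \<open>Slides\<close>

text \<open>The last slide of a row starts on the diagonal. If its bullet moved east and turned
  south only beyond the second box, it would lift a label of the row below over a smaller one that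
  stays behind, and the rows of the result would no longer be ordered. So it takes an edge label at
  once or turns south after one step, whence the two ways of undoing a row.

  \<open>af_struct\<close> is a definite description, so existence and uniqueness of the expansion
  have to be proved: independence by the same evaluations in fewer variables, spanning by an order
  on the monomials in the c_k in which c_(p,p) = 0 removes repeated indices.

  The binomial sums in c_(p,q) are the coefficients of the inverse of (1 + (v + z) u) / (1 - v u),
  which arises from it by v -> - v - z; therefore c_(p,q) deletes one variable at a time.

  The formula for the image of sigma_nu has denominators x_i - x_j and says nothing at x = 0, where
  the constant term is taken. The work is done in the fraction field with distinct points, at most
  one of them 0, and constant terms are compared only after an identity has been read back in the
  polynomial ring.\<close>

type_synonym filling = "nat \<times> nat \<Rightarrow> nat option"

text \<open>The bound n will be the length of lam. It makes slides terminate: \<open>slide\<close>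
  goes on only into labeled boxes, and these have row <= column <= n.\<close>

definition bounded_cols :: "nat \<Rightarrow> filling \<Rightarrow> bool"
  where "bounded_cols n f \<longleftrightarrow> (\<forall>r c. f (r, c) \<noteq> None \<longrightarrow> r \<le> c \<and> c \<le> n)"

definition takes_edge :: "nat \<Rightarrow> nat \<Rightarrow> filling \<Rightarrow> (nat \<Rightarrow> nat set) \<Rightarrow> bool"
  where "takes_edge i j f E \<longleftrightarrow>
    i = j \<and> E i \<noteq> {} \<and> (\<forall>a. f (i, Suc j) = Some a \<longrightarrow> Min (E i) < a)"

lemma slide_edge:
  assumes "takes_edge i j f E"
  shows "slide i j f E = (f((i, j) \<mapsto> Min (E i)), E(i := E i - {Min (E i)}))"
  by (rule trans[OF slide.simps if_P]) (use assms in \<open>auto simp: takes_edge_def\<close>)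

lemma slide_stop:
  assumes "\<not> takes_edge i j f E" "f (i, Suc j) = None" "f (Suc i, j) = None"
  shows "slide i j f E = (f, E)"
  by (subst slide.simps) (use assms in \<open>auto simp: takes_edge_def\<close>)

lemma slide_south:
  assumes "\<not> takes_edge i j f E" "f (Suc i, j) = Some b" "\<And>a. f (i, Suc j) = Some a \<Longrightarrow> b < a"
  shows "slide i j f E = slide (Suc i) j (f((i, j) \<mapsto> b, (Suc i, j) := None)) E"
  by (subst slide.simps) (use assms in \<open>auto simp: takes_edge_def split: option.split\<close>)

lemma slide_east:
  assumes "\<not> takes_edge i j f E" "f (i, Suc j) = Some a" "\<And>b. f (Suc i, j) = Some b \<Longrightarrow> \<not> b < a"
  shows "slide i j f E = slide i (Suc j) (f((i, j) \<mapsto> a, (i, Suc j) := None)) E"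
  by (subst slide.simps) (use assms in \<open>auto simp: takes_edge_def split: option.split\<close>)

text \<open>Every move raises row plus column, which stays at most 2n by
  \<open>bounded_cols\<close>, so a run is finite. The result \<open>res\<close> is an argument of
  \<open>P\<close> because all steps of one run share it. A south move starts off the diagonal,
  since the labeled box below must have row at most column.\<close>

lemma slide_induct [consumes 4, case_names edge stop south east]:
  assumes "i \<le> j" "j \<le> n" "bounded_cols n f" "slide i j f E = res"
  assumes edge: "\<And>j f E. bounded_cols n f \<Longrightarrow> j \<le> n \<Longrightarrow> takes_edge j j f E \<Longrightarrow>
      P j j f E (f((j, j) \<mapsto> Min (E j)), E(j := E j - {Min (E j)}))"
    and stop: "\<And>i j f E. bounded_cols n f \<Longrightarrow> i \<le> j \<Longrightarrow> j \<le> n \<Longrightarrow> \<not> takes_edge i j f E \<Longrightarrow>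
      f (i, Suc j) = None \<Longrightarrow> f (Suc i, j) = None \<Longrightarrow> P i j f E (f, E)"
    and south: "\<And>i j f E b res. bounded_cols n f \<Longrightarrow> i < j \<Longrightarrow> j \<le> n \<Longrightarrow>
      f (Suc i, j) = Some b \<Longrightarrow> (\<And>a. f (i, Suc j) = Some a \<Longrightarrow> b < a) \<Longrightarrow>
      slide (Suc i) j (f((i, j) \<mapsto> b, (Suc i, j) := None)) E = res \<Longrightarrow> P (Suc i) j (f((i, j) \<mapsto> b, (Suc i, j) := None)) E res \<Longrightarrow> P i j f E res"
    and east: "\<And>i j f E a res. bounded_cols n f \<Longrightarrow> i \<le> j \<Longrightarrow> j < n \<Longrightarrow> \<not> takes_edge i j f E \<Longrightarrow>
      f (i, Suc j) = Some a \<Longrightarrow> (\<And>b. f (Suc i, j) = Some b \<Longrightarrow> \<not> b < a) \<Longrightarrow>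
      slide i (Suc j) (f((i, j) \<mapsto> a, (i, Suc j) := None)) E = res \<Longrightarrow> P i (Suc j) (f((i, j) \<mapsto> a, (i, Suc j) := None)) E res \<Longrightarrow> P i j f E res"
  shows "P i j f E res"
proof -
  have "P i j f E (slide i j f E)"
  using assms(1-3)
proof (induction "2 * n - (i + j)" arbitrary: i j f E rule: less_induct)
  case less
  note bd = less.prems(3)
  show ?case
  proof (cases "takes_edge i j f E")
    case True
    then have "i = j" by (simp add: takes_edge_def)
    with True less.prems edge show ?thesis by (simp add: slide_edge)
  next
    case not_edge: False
    consider (S) b where "f (Suc i, j) = Some b" "\<And>a. f (i, Suc j) = Some a \<Longrightarrow> b < a"
      | (E) a where "f (i, Suc j) = Some a" "\<And>b. f (Suc i, j) = Some b \<Longrightarrow> \<not> b < a"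
      | (N) "f (i, Suc j) = None" "f (Suc i, j) = None"
      by (metis not_None_eq option.inject)
    then show ?thesis
    proof cases
      case S
      have ij: "i < j" using bd S(1) unfolding bounded_cols_def
        by (metis Suc_eq_plus1 Suc_le_eq option.distinct(1))
      let ?g = "f((i, j) \<mapsto> b, (Suc i, j) := None)"
      have bd': "bounded_cols n ?g" using bd less.prems by (auto simp: bounded_cols_def)
      have "P (Suc i) j ?g E (slide (Suc i) j ?g E)"
        by (rule less.hyps) (use ij less.prems bd' in auto)
      then have "P i j f E (slide (Suc i) j ?g E)" by - (rule south[OF bd ij less.prems(2) S refl], assumption)
      then show ?thesis by (simp add: slide_south[OF not_edge S])
    next
      case E
      have jn: "j < n" using bd E(1) unfolding bounded_cols_def
        by (metis Suc_eq_plus1 Suc_le_eq option.distinct(1))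
      let ?g = "f((i, j) \<mapsto> a, (i, Suc j) := None)"
      have bd': "bounded_cols n ?g" using bd less.prems by (auto simp: bounded_cols_def)
      have "P i (Suc j) ?g E (slide i (Suc j) ?g E)"
        by (rule less.hyps) (use jn less.prems bd' in auto)
      then have "P i j f E (slide i (Suc j) ?g E)" by - (rule east[OF bd less.prems(1) jn not_edge E refl], assumption)
      then show ?thesis by (simp add: slide_east[OF not_edge E])
    next
      case N
      then show ?thesis using stop[OF bd less.prems(1,2) not_edge] by (simp add: slide_stop[OF not_edge])
    qed
  qed
qed
  then show ?thesis using assms(4) by simp
qed

definition quadrant :: "nat \<Rightarrow> nat \<Rightarrow> (nat \<times> nat) set"
  where "quadrant i j = {i..} \<times> {j..}"

text \<open>The bullet never moves north or west, and an edge set changes only in the column where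
  the bullet ends.\<close>

lemma slide_outside:
  assumes "i \<le> j" "j \<le> n" "bounded_cols n f" "slide i j f E = res"
  shows "(p \<notin> quadrant i j \<longrightarrow> fst res p = f p) \<and> (k < j \<longrightarrow> snd res k = E k)"
  using assms
proof (induction i j f E res rule: slide_induct)
  case (south i j f E b res)
  then show ?case by (cases p) (auto simp: quadrant_def)
next
  case (east i j f E a res)
  then show ?case by (cases p) (auto simp: quadrant_def)
qed (auto simp: quadrant_def)

text \<open>A slide reads only its quadrant and the edge sets from column j on. This permits
  replaying a slide of the lower rows inside a larger filling, and changing the labels on edges
  further left.\<close>

lemma slide_local:
  assumes "i \<le> j" "j \<le> n" "bounded_cols n f" "slide i j f E = res"
    and "\<And>p. p \<in> quadrant i j \<Longrightarrow> g p = f p" "\<And>k. k \<ge> j \<Longrightarrow> D k = E k"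
  shows "slide i j g D =
    ((\<lambda>p. if p \<in> quadrant i j then fst res p else g p), (\<lambda>k. if k \<ge> j then snd res k else D k))"
  using assms
proof (induction i j f E res arbitrary: g D rule: slide_induct)
  case (edge j f E)
  have e: "g (j, Suc j) = f (j, Suc j)" "D j = E j"
    using edge.prems by (auto simp: quadrant_def)
  with edge have "takes_edge j j g D" by (simp add: takes_edge_def)
  then show ?case using e edge.prems by (auto simp: slide_edge fun_eq_iff quadrant_def)
next
  case (stop i j f E)
  have e: "g (i, Suc j) = f (i, Suc j)" "g (Suc i, j) = f (Suc i, j)" "D j = E j"
    using stop.prems by (auto simp: quadrant_def)
  with stop have "\<not> takes_edge i j g D" by (auto simp: takes_edge_def)
  then have "slide i j g D = (g, D)" using e stop by (simp add: slide_stop)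
  then show ?case using stop.prems by (auto simp: fun_eq_iff)
next
  case (south i j f E b res)
  have e: "g (i, Suc j) = f (i, Suc j)" "g (Suc i, j) = Some b"
    using south by (auto simp: quadrant_def)
  have ne: "\<not> takes_edge i j g D" using south by (auto simp: takes_edge_def)
  let ?g = "g((i, j) \<mapsto> b, (Suc i, j) := None)"
  let ?f = "f((i, j) \<mapsto> b, (Suc i, j) := None)"
  have "bounded_cols n ?f" using south.hyps by (auto simp: bounded_cols_def)
  from slide_outside(1)[OF _ south.hyps(3) this south.hyps(6)] south.hyps(2)
  have out: "fst res p = ?f p" if "p \<notin> quadrant (Suc i) j" for p
    using that by simp
  have "slide i j g D = slide (Suc i) j ?g D"
    using slide_south[OF ne e(2)] e(1) south by simp
  also have "\<dots> = ((\<lambda>p. if p \<in> quadrant (Suc i) j then fst res p else ?g p),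
     (\<lambda>k. if k \<ge> j then snd res k else D k))"
    by (rule south.IH) (use south.prems in \<open>auto simp: quadrant_def\<close>)
  also have "\<dots> = ((\<lambda>p. if p \<in> quadrant i j then fst res p else g p),
     (\<lambda>k. if k \<ge> j then snd res k else D k))"
    using out south.prems by (auto simp: quadrant_def fun_eq_iff)
  finally show ?case .
next
  case (east i j f E a res)
  have e: "g (Suc i, j) = f (Suc i, j)" "g (i, Suc j) = Some a" "g (i, j) = f (i, j)" "D j = E j"
    using east by (auto simp: quadrant_def)
  have ne: "\<not> takes_edge i j g D" using east e by (auto simp: takes_edge_def)
  let ?g = "g((i, j) \<mapsto> a, (i, Suc j) := None)"
  let ?f = "f((i, j) \<mapsto> a, (i, Suc j) := None)"
  have "bounded_cols n ?f" using east.hyps by (auto simp: bounded_cols_def)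
  note out = slide_outside[OF _ _ this east.hyps(7)]
  have "slide i j g D = slide i (Suc j) ?g D"
    using slide_east[OF ne e(2)] e(1) east by simp
  also have "\<dots> = ((\<lambda>p. if p \<in> quadrant i (Suc j) then fst res p else ?g p),
     (\<lambda>k. if k \<ge> Suc j then snd res k else D k))"
    by (rule east.IH) (use east.prems in \<open>auto simp: quadrant_def\<close>)
  also have "\<dots> = ((\<lambda>p. if p \<in> quadrant i j then fst res p else g p),
     (\<lambda>k. if k \<ge> j then snd res k else D k))"
    using out east.hyps(2,3) east.prems by (auto simp: quadrant_def fun_eq_iff le_Suc_eq not_less_eq_eq)
  finally show ?case .
qed

section \<open>The invariant of row rectification\<close>

definition inner :: "nat \<Rightarrow> nat \<Rightarrow> (nat \<times> nat) set"
  where "inner i j = {(r, c). r < i \<or> r = i \<and> c < j}"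

text \<open>The tableau obtained when the boxes (r,c) with r < i, or r = i and c < j, are still empty; X
  holds the box of the bullet while a slide is in progress.\<close>

definition ok :: "nat \<Rightarrow> nat \<Rightarrow> nat \<Rightarrow> (nat \<times> nat) set \<Rightarrow> filling \<Rightarrow> (nat \<Rightarrow> nat set) \<Rightarrow> bool"
  where "ok n i j X f E \<longleftrightarrow>
    bounded_cols n f \<and> dom f \<inter> X = {} \<and> dom f \<inter> inner i j = {} \<and>
    (\<forall>r c r' c'. (r, c) \<in> dom f \<union> X \<longrightarrow> r' \<le> r \<longrightarrow> r' \<le> c' \<longrightarrow> c' \<le> c \<longrightarrow>
      (r', c') \<in> dom f \<union> X \<union> inner i j) \<and>
    (\<forall>r c r' c' a b. f (r, c) = Some a \<longrightarrow> f (r', c') = Some b \<longrightarrow> r \<le> r' \<longrightarrow> c \<le> c' \<longrightarrow>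
      (r, c) \<noteq> (r', c') \<longrightarrow> a < b) \<and>
    (\<forall>k. finite (E k)) \<and>
    (\<forall>k s r c a. s \<in> E k \<longrightarrow> f (r, c) = Some a \<longrightarrow> c \<le> k \<longrightarrow> a < s) \<and>
    (\<forall>k. E k \<noteq> {} \<longrightarrow> 0 < k \<and> k \<le> n \<and> (k, k) \<in> dom f \<union> X \<union> inner i j) \<and>
    (\<forall>p q a. f p = Some a \<longrightarrow> f q = Some a \<longrightarrow> p = q) \<and>
    (\<forall>k l s. s \<in> E k \<longrightarrow> s \<in> E l \<longrightarrow> k = l) \<and>
    (\<forall>p k a. f p = Some a \<longrightarrow> a \<notin> E k)"

lemma okD:
  assumes "ok n i j X f E"
  shows "bounded_cols n f" "dom f \<inter> X = {}" "dom f \<inter> inner i j = {}"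
    "\<And>r c r' c'. (r, c) \<in> dom f \<union> X \<Longrightarrow> r' \<le> r \<Longrightarrow> r' \<le> c' \<Longrightarrow> c' \<le> c \<Longrightarrow>
      (r', c') \<in> dom f \<union> X \<union> inner i j"
    "\<And>r c r' c' a b. f (r, c) = Some a \<Longrightarrow> f (r', c') = Some b \<Longrightarrow> r \<le> r' \<Longrightarrow> c \<le> c' \<Longrightarrow>
      (r, c) \<noteq> (r', c') \<Longrightarrow> a < b"
    "\<And>k. finite (E k)"
    "\<And>k s r c a. s \<in> E k \<Longrightarrow> f (r, c) = Some a \<Longrightarrow> c \<le> k \<Longrightarrow> a < s"
    "\<And>k. E k \<noteq> {} \<Longrightarrow> 0 < k \<and> k \<le> n \<and> (k, k) \<in> dom f \<union> X \<union> inner i j"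
    "\<And>p q a. f p = Some a \<Longrightarrow> f q = Some a \<Longrightarrow> p = q"
    "\<And>k l s. s \<in> E k \<Longrightarrow> s \<in> E l \<Longrightarrow> k = l"
    "\<And>p k a. f p = Some a \<Longrightarrow> a \<notin> E k"
proof -
  note c1 = assms[unfolded ok_def]
  note c2 = conjunct2[OF c1] note c3 = conjunct2[OF c2] note c4 = conjunct2[OF c3]
  note c5 = conjunct2[OF c4] note c6 = conjunct2[OF c5] note c7 = conjunct2[OF c6]
  note c8 = conjunct2[OF c7] note c9 = conjunct2[OF c8] note c10 = conjunct2[OF c9]
  show "bounded_cols n f" by (rule conjunct1[OF c1])
  show "dom f \<inter> X = {}" by (rule conjunct1[OF c2])
  show "dom f \<inter> inner i j = {}" by (rule conjunct1[OF c3])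
  show "\<And>r c r' c'. (r, c) \<in> dom f \<union> X \<Longrightarrow> r' \<le> r \<Longrightarrow> r' \<le> c' \<Longrightarrow> c' \<le> c \<Longrightarrow>
      (r', c') \<in> dom f \<union> X \<union> inner i j" by (rule conjunct1[OF c4, rule_format])
  show "\<And>r c r' c' a b. f (r, c) = Some a \<Longrightarrow> f (r', c') = Some b \<Longrightarrow> r \<le> r' \<Longrightarrow> c \<le> c' \<Longrightarrow>
      (r, c) \<noteq> (r', c') \<Longrightarrow> a < b" by (rule conjunct1[OF c5, rule_format])
  show "\<And>k. finite (E k)" by (rule conjunct1[OF c6, rule_format])
  show "\<And>k s r c a. s \<in> E k \<Longrightarrow> f (r, c) = Some a \<Longrightarrow> c \<le> k \<Longrightarrow> a < s"
    by (rule conjunct1[OF c7, rule_format])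
  show "\<And>k. E k \<noteq> {} \<Longrightarrow> 0 < k \<and> k \<le> n \<and> (k, k) \<in> dom f \<union> X \<union> inner i j"
    using conjunct1[OF c8] by blast
  show "\<And>p q a. f p = Some a \<Longrightarrow> f q = Some a \<Longrightarrow> p = q" by (rule conjunct1[OF c9, rule_format])
  show "\<And>k l s. s \<in> E k \<Longrightarrow> s \<in> E l \<Longrightarrow> k = l" by (rule conjunct1[OF c10, rule_format])
  show "\<And>p k a. f p = Some a \<Longrightarrow> a \<notin> E k" by (rule conjunct2[OF c10, rule_format])
qed

lemma okI:
  assumes "bounded_cols n f" "dom f \<inter> X = {}" "dom f \<inter> inner i j = {}"
    "\<And>r c r' c'. (r, c) \<in> dom f \<union> X \<Longrightarrow> r' \<le> r \<Longrightarrow> r' \<le> c' \<Longrightarrow> c' \<le> c \<Longrightarrow>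
      (r', c') \<in> dom f \<union> X \<union> inner i j"
    "\<And>r c r' c' a b. f (r, c) = Some a \<Longrightarrow> f (r', c') = Some b \<Longrightarrow> r \<le> r' \<Longrightarrow> c \<le> c' \<Longrightarrow>
      (r, c) \<noteq> (r', c') \<Longrightarrow> a < b"
    "\<And>k. finite (E k)"
    "\<And>k s r c a. s \<in> E k \<Longrightarrow> f (r, c) = Some a \<Longrightarrow> c \<le> k \<Longrightarrow> a < s"
    "\<And>k. E k \<noteq> {} \<Longrightarrow> 0 < k \<and> k \<le> n \<and> (k, k) \<in> dom f \<union> X \<union> inner i j"
    "\<And>p q a. f p = Some a \<Longrightarrow> f q = Some a \<Longrightarrow> p = q"
    "\<And>k l s. s \<in> E k \<Longrightarrow> s \<in> E l \<Longrightarrow> k = l"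
    "\<And>p k a. f p = Some a \<Longrightarrow> a \<notin> E k"
  shows "ok n i j X f E"
  unfolding ok_def
  by (rule conjI, rule assms(1), rule conjI, rule assms(2), rule conjI, rule assms(3),
    rule conjI, (intro allI impI, rule assms(4); assumption),
    rule conjI, (intro allI impI, rule assms(5); assumption),
    rule conjI, intro allI, rule assms(6),
    rule conjI, (intro allI impI, rule assms(7); assumption),
    rule conjI, (intro allI impI, rule assms(8), assumption),
    rule conjI, (intro allI impI, rule assms(9); assumption),
    rule conjI, (intro allI impI, rule assms(10); assumption),
    intro allI impI, rule assms(11), assumption)

text \<open>One move of the bullet from p to q. The order survives because b is the smallest label
  southeast of p. As \<open>ok\<close> asks an edge label to exceed every label in a column weakly
  to its left, a label that moves west also has to be below the edge labels it newly faces.\<close>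

lemma ok_move:
  assumes ok: "ok n i j {p} f E" and q: "f q = Some b" "fst p \<le> fst q" "snd p \<le> snd q"
    and p: "p \<notin> inner i j" "fst p \<le> snd p" "snd p \<le> n"
    and min: "\<And>x a. f x = Some a \<Longrightarrow> fst p \<le> fst x \<Longrightarrow> snd p \<le> snd x \<Longrightarrow> x \<noteq> q \<Longrightarrow> b < a"
    and edge: "\<And>k s. s \<in> E k \<Longrightarrow> snd p \<le> k \<Longrightarrow> b < s"
  shows "ok n i j {q} (f(p \<mapsto> b, q := None)) E"
proof -
  note D = okD[OF ok]
  have pq: "p \<noteq> q" using D(2) q by auto
  have dm: "dom (f(p \<mapsto> b, q := None)) \<union> {q} = dom f \<union> {p}" using q pq by auto
  show ?thesis
  proof (rule okI)
    show "bounded_cols n (f(p \<mapsto> b, q := None))"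
      using D(1) p unfolding bounded_cols_def by auto
    show "dom (f(p \<mapsto> b, q := None)) \<inter> inner i j = {}" using D(3) p by auto
    show "(r', c') \<in> dom (f(p \<mapsto> b, q := None)) \<union> {q} \<union> inner i j"
      if "(r, c) \<in> dom (f(p \<mapsto> b, q := None)) \<union> {q}" "r' \<le> r" "r' \<le> c'" "c' \<le> c" for r c r' c'
      using that D(4) unfolding dm by blast
    show "a < a'" if "(f(p \<mapsto> b, q := None)) (r, c) = Some a" "(f(p \<mapsto> b, q := None)) (r', c') = Some a'"
      "r \<le> r'" "c \<le> c'" "(r, c) \<noteq> (r', c')" for r c r' c' a a'
    proof -
      consider "(r, c) = p" "(r', c') \<noteq> p" | "(r', c') = p" "(r, c) \<noteq> p" | "(r, c) \<noteq> p" "(r', c') \<noteq> p"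
        using \<open>(r, c) \<noteq> (r', c')\<close> by blast
      then show ?thesis
      proof cases
        case 1 then show ?thesis using that min[of "(r', c')"] by (auto split: if_splits)
      next
        case 2
        then have "f (r, c) = Some a" "b = a'" "(r, c) \<noteq> (fst q, snd q)" "r \<le> fst q" "c \<le> snd q"
          using that q by (auto split: if_splits)
        then show ?thesis using D(5)[of r c a "fst q" "snd q" b] q by simp
      next
        case 3 then show ?thesis using that D(5) by (auto split: if_splits)
      qed
    qed
    show "finite (E k)" for k by (rule D(6))
    show "a < s" if "s \<in> E k" "(f(p \<mapsto> b, q := None)) (r, c) = Some a" "c \<le> k" for k s r c a
      using that D(7) edge by (auto split: if_splits)
    show "0 < k \<and> k \<le> n \<and> (k, k) \<in> dom (f(p \<mapsto> b, q := None)) \<union> {q} \<union> inner i j" if "E k \<noteq> {}" for k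
      using that D(8) unfolding dm by blast
    show "x = y" if "(f(p \<mapsto> b, q := None)) x = Some a" "(f(p \<mapsto> b, q := None)) y = Some a" for x y a
      using that D(9) q by (auto split: if_splits)
    show "a \<notin> E k" if "(f(p \<mapsto> b, q := None)) x = Some a" for x a k
      using that D(11) q by (auto split: if_splits)
  qed (use pq D(10) in auto)
qed

definition rest_labels :: "filling \<Rightarrow> (nat \<Rightarrow> nat set) \<Rightarrow> nat set"
  where "rest_labels f E = ran f \<union> (\<Union>k. E k)"

text \<open>Besides the invariant this records the conservation of labels: boxes keep all their
  labels, and a label that enters a box comes from an edge weakly right of the starting column. The
  count below argues from where a label can have come.\<close>

lemma slide_ok:
  assumes "r \<le> c" "c \<le> n" "bounded_cols n f" "slide r c f E = res"
    and "ok n i j {(r, c)} f E" "(r, c) \<notin> inner i j"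
  shows "ok n i j {} (fst res) (snd res) \<and> dom (fst res) \<subseteq> insert (r, c) (dom f) \<and>
    ran f \<subseteq> ran (fst res) \<and> ran (fst res) \<subseteq> ran f \<union> (\<Union>k\<in>{c..}. E k) \<and>
    rest_labels (fst res) (snd res) = rest_labels f E \<and> (\<forall>k. snd res k \<subseteq> E k)"
  using assms
proof (induction r c f E res rule: slide_induct)
  case (edge c f E)
  note D = okD[OF edge.prems(1)]
  let ?m = "Min (E c)"
  have m: "?m \<in> E c" "\<And>s. s \<in> E c \<Longrightarrow> s \<noteq> ?m \<Longrightarrow> ?m < s"
    using edge D(6)[of c] by (auto simp: takes_edge_def intro: Min_le le_neq_trans)
  \<comment> \<open>Nothing lies south of a diagonal box, so a label southeast of it is strictly to
    the right. The shape then has a right neighbour of the bullet, whose label is at most that label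
    and larger than the minimum of the edge.\<close>
  have east: "?m < a" if "f (r', c') = Some a" "c \<le> r'" "c \<le> c'" for r' c' a
  proof -
    have "r' \<le> c'" using that(1) D(1) by (auto simp: bounded_cols_def)
    have ne: "(r', c') \<noteq> (c, c)" using that(1) D(2) by auto
    with that(2,3) \<open>r' \<le> c'\<close> have "Suc c \<le> c'" by auto
    then have "(c, Suc c) \<in> dom f \<union> {(c, c)} \<union> inner i j"
      using D(4)[of r' c' c "Suc c"] that by auto
    then obtain a' where a': "f (c, Suc c) = Some a'" using edge.prems(2) by (auto simp: inner_def)
    then have "?m < a'" using edge.hyps by (auto simp: takes_edge_def)
    moreover have "a' \<le> a"
      using D(5)[OF a' that(1) that(2) \<open>Suc c \<le> c'\<close>] a' that(1)
      by (cases "(c, Suc c) = (r', c')") auto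
    ultimately show ?thesis by simp
  qed
  have m': "?m \<notin> ran f" using D(11) m(1) by (auto simp: ran_def)
  have np: "f (c, c) = None" using D(2) by auto
  let ?f = "f((c, c) \<mapsto> ?m)" and ?E = "E(c := E c - {?m})"
  have "ok n i j {} ?f ?E"
  proof (rule okI)
    show "bounded_cols n ?f" using D(1) edge.hyps by (auto simp: bounded_cols_def)
    show "dom ?f \<inter> inner i j = {}" using D(3) edge.prems(2) by auto
    show "(r', c') \<in> dom ?f \<union> {} \<union> inner i j"
      if "(r, d) \<in> dom ?f \<union> {}" "r' \<le> r" "r' \<le> c'" "c' \<le> d" for r d r' c'
      using D(4)[of r d r' c'] that by (auto split: if_splits)
    show "a < b" if "?f (r, d) = Some a" "?f (r', c') = Some b" "r \<le> r'" "d \<le> c'" "(r, d) \<noteq> (r', c')"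
      for r d r' c' a b
      using that D(5)[of r d a r' c' b] east[of r' c' b] D(7)[OF m(1), of r d a] by (auto split: if_splits)
    show "finite (?E k)" for k using D(6) by auto
    show "a < s" if "s \<in> ?E k" "?f (r, d) = Some a" "d \<le> k" for k s r d a
    proof (cases "(r, d) = (c, c)")
      case True
      then have a: "a = ?m" using that by simp
      show ?thesis
      proof (cases "k = c")
        case True then show ?thesis using that m a by auto
      next
        case False
        then have "c < k" using True that by auto
        \<comment> \<open>An edge further right is compared through its own diagonal box, which is
          filled: its label lies between the two edge labels.\<close>
        have "E k \<noteq> {}" using that \<open>k \<noteq> c\<close> by auto
        then have "(k, k) \<in> dom f" using D(8)[of k] \<open>c < k\<close> edge.prems(2) by (auto simp: inner_def)
        then obtain b where b: "f (k, k) = Some b" by auto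
        then have "?m < b" using east \<open>c < k\<close> by simp
        also have "b < s" using D(7)[OF _ b] that \<open>k \<noteq> c\<close> by simp
        finally show ?thesis using a by simp
      qed
    next
      case False
      then show ?thesis using that D(7)[of s k r d a] by (auto split: if_splits)
    qed
    show "0 < k \<and> k \<le> n \<and> (k, k) \<in> dom ?f \<union> {} \<union> inner i j" if "?E k \<noteq> {}" for k
      using that D(8)[of k] by (auto split: if_splits)
    show "p = q" if "?f p = Some a" "?f q = Some a" for p q a
      using that D(9)[of p a q] m' by (auto split: if_splits simp: ranI)
    show "k = l" if "s \<in> ?E k" "s \<in> ?E l" for k l s
      using that D(10) by (auto split: if_splits)
    show "a \<notin> ?E k" if "?f p = Some a" for p k a
    proof (cases "p = (c, c)")
      case True
      then have "a = ?m" using that by simp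
      then show ?thesis using D(10)[OF m(1), of k] by (cases "k = c") auto
    next
      case False
      then show ?thesis using that D(11)[of p a k] by (auto split: if_splits)
    qed
  qed auto
  moreover have "insert ?m (\<Union>k. ?E k) = (\<Union>k. E k)"
  proof (intro equalityI subsetI)
    fix x assume "x \<in> (\<Union>k. E k)"
    then obtain k where "x \<in> E k" by blast
    then show "x \<in> insert ?m (\<Union>k. ?E k)" by (cases "k = c") auto
  qed (use m(1) in \<open>auto split: if_splits\<close>)
  moreover have "ran ?f = insert ?m (ran f)" using np by (rule ran_map_upd)
  moreover have "\<forall>k. ?E k \<subseteq> E k" by auto
  moreover have "dom ?f = insert (c, c) (dom f)" by simp
  ultimately show ?case using m(1) unfolding rest_labels_def fst_conv snd_conv
    by (intro conjI) (assumption | blast)+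
next
  case (stop r c f E)
  note D = okD[OF stop.prems(1)]
  \<comment> \<open>Without an east and a south neighbour the shape leaves nothing southeast of the
    bullet, so its box may be dropped.\<close>
  have np: "(r', c') \<notin> dom f" if "r \<le> r'" "c \<le> c'" for r' c'
  proof
    assume a: "(r', c') \<in> dom f"
    then have "r' \<le> c'" using D(1) by (auto simp: bounded_cols_def)
    have "(r', c') \<noteq> (r, c)" using a D(2) by auto
    have "c < c' \<or> r < r' \<and> r < c"
      using \<open>r' \<le> c'\<close> \<open>(r', c') \<noteq> (r, c)\<close> that stop.hyps(2) by auto
    then have "(r, Suc c) \<in> dom f \<union> {(r, c)} \<union> inner i j \<or> (Suc r, c) \<in> dom f \<union> {(r, c)} \<union> inner i j"
      using D(4)[of r' c' r "Suc c"] D(4)[of r' c' "Suc r" c] a that stop.hyps(2) by auto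
    then show False using stop.hyps stop.prems(2) by (auto simp: inner_def)
  qed
  have "ok n i j {} f E"
  proof (rule okI)
    show "(r', c') \<in> dom f \<union> {} \<union> inner i j"
      if "(r1, c1) \<in> dom f \<union> {}" "r' \<le> r1" "r' \<le> c'" "c' \<le> c1" for r1 c1 r' c'
      using that D(4)[of r1 c1 r' c'] np[of r1 c1] by auto
    show "0 < k \<and> k \<le> n \<and> (k, k) \<in> dom f \<union> {} \<union> inner i j" if "E k \<noteq> {}" for k
      using that D(8)[of k] stop.hyps by (auto simp: takes_edge_def)
  qed (use D in \<open>auto intro: D(5) D(7)\<close>)
  then show ?case by auto
next
  case (south r c f E b res)
  note D = okD[OF south.prems(1)]
  have least: "b < a" if "f x = Some a" "r \<le> fst x" "c \<le> snd x" "x \<noteq> (Suc r, c)" for x a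
  proof (cases "Suc r \<le> fst x")
    case True
    then show ?thesis using D(5)[OF south.hyps(4), of "fst x" "snd x" a] that by (auto simp: prod_eq_iff)
  next
    case False
    then obtain c' where x: "x = (r, c')" using \<open>r \<le> fst x\<close> by (cases x) auto
    have "c \<noteq> c'" using that(1) x D(2) by auto
    then have "(r, Suc c) \<in> dom f \<union> {(r, c)} \<union> inner i j"
      using D(4)[of r c' r "Suc c"] x that south.hyps(2) by auto
    then obtain a' where a': "f (r, Suc c) = Some a'" using south.prems(2) by (auto simp: inner_def)
    then have "b < a'" using south.hyps by auto
    also have "a' \<le> a" using D(5)[OF a', of r c' a] x that a' \<open>c \<noteq> c'\<close>
      by (cases "c' = Suc c") auto
    finally show ?thesis .
  qed
  have ok: "ok n i j {(Suc r, c)} (f((r, c) \<mapsto> b, (Suc r, c) := None)) E"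
  proof (rule ok_move[OF south.prems(1) south.hyps(4)])
    show "b < s" if "s \<in> E k" "snd (r, c) \<le> k" for k s
      using D(7)[OF that(1) south.hyps(4)] that(2) by simp
  qed (use south least in auto)
  have dm: "dom f \<inter> {(r, c)} = {}" by (rule D(2))
  have rn: "ran (f((r, c) \<mapsto> b, (Suc r, c) := None)) = ran f"
  proof -
    have "x \<in> ran f" if "x \<in> ran (f((r, c) \<mapsto> b, (Suc r, c) := None))" for x
      using that south.hyps(4) by (auto simp: ran_def split: if_splits)
    moreover have "x \<in> ran (f((r, c) \<mapsto> b, (Suc r, c) := None))" if "x \<in> ran f" for x
    proof -
      from that obtain p where p: "f p = Some x" by (auto simp: ran_def)
      show ?thesis
      proof (cases "p = (Suc r, c)")
        case True
        then have "(f((r, c) \<mapsto> b, (Suc r, c) := None)) (r, c) = Some x" using p south.hyps(4) by simp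
        then show ?thesis by (rule ranI)
      next
        case False
        then have "(f((r, c) \<mapsto> b, (Suc r, c) := None)) p = Some x" using p dm by auto
        then show ?thesis by (rule ranI)
      qed
    qed
    ultimately show ?thesis by blast
  qed
  have "(Suc r, c) \<notin> inner i j" using south.prems(2) by (auto simp: inner_def)
  note IH = south.IH[OF ok this]
  have "insert (Suc r, c) (dom (f((r, c) \<mapsto> b, (Suc r, c) := None))) \<subseteq> insert (r, c) (dom f)"
    using south.hyps(4) by auto
  with IH have "dom (fst res) \<subseteq> insert (r, c) (dom f)" by (elim conjE) (rule subset_trans)
  with IH show ?case by (simp only: rn rest_labels_def simp_thms)
next
  case (east r c f E b res)
  note D = okD[OF east.prems(1)]
  have least: "b < a" if "f x = Some a" "r \<le> fst x" "c \<le> snd x" "x \<noteq> (r, Suc c)" for x a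
  proof (cases "Suc c \<le> snd x")
    case True
    then show ?thesis using D(5)[OF east.hyps(5), of "fst x" "snd x" a] that by (auto simp: prod_eq_iff)
  next
    case False
    then obtain r' where x: "x = (r', c)" using \<open>c \<le> snd x\<close> by (cases x) auto
    have "r \<noteq> r'" using that(1) x D(2) by auto
    moreover have "r' \<le> c" using x that(1) D(1) unfolding bounded_cols_def by (metis option.distinct(1))
    ultimately have "(Suc r, c) \<in> dom f \<union> {(r, c)} \<union> inner i j"
      using D(4)[of r' c "Suc r" c] x that by auto
    then obtain a' where a': "f (Suc r, c) = Some a'" using east.prems(2) by (auto simp: inner_def)
    then have "\<not> a' < b" using east.hyps by auto
    moreover have "a' \<noteq> b" using D(9)[OF a', of "(r, Suc c)"] east.hyps(5) by auto
    moreover have "a' \<le> a" using D(5)[OF a', of r' c a] x that a' \<open>r \<noteq> r'\<close>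
      by (cases "r' = Suc r") auto
    ultimately show ?thesis by simp
  qed
  have ok: "ok n i j {(r, Suc c)} (f((r, c) \<mapsto> b, (r, Suc c) := None)) E"
  proof (rule ok_move[OF east.prems(1) east.hyps(5)])
    show "b < s" if "s \<in> E k" "snd (r, c) \<le> k" for k s
    proof (cases "k = c")
      case False
      then show ?thesis using D(7)[OF that(1) east.hyps(5)] that(2) by simp
    next
      case True
      show ?thesis
      proof (cases "r = c")
        case eq: True
        \<comment> \<open>The bullet is on the diagonal and moves east, so it has refused the edge:
          the least edge label is not smaller than b, and it differs from b because labels are
          distinct.\<close>
        then have "\<not> Min (E c) < b" using east.hyps that True by (auto simp: takes_edge_def)
        moreover have "Min (E c) \<le> s" using that True D(6) by auto
        moreover have "s \<noteq> b" using D(11)[OF east.hyps(5), of k] that by auto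
        ultimately show ?thesis by simp
      next
        case False
        then have "(c, c) \<in> dom f" using D(8)[of c] that True east.prems(2) east.hyps(2)
          by (auto simp: inner_def)
        then obtain a where a: "f (c, c) = Some a" by auto
        then have "b < a" using least[OF a] east.hyps(2) by auto
        also have "a < s" using D(7)[OF _ a] that True by simp
        finally show ?thesis .
      qed
    qed
  qed (use east least in auto)
  have dm: "dom f \<inter> {(r, c)} = {}" by (rule D(2))
  have rn: "ran (f((r, c) \<mapsto> b, (r, Suc c) := None)) = ran f"
  proof -
    have "x \<in> ran f" if "x \<in> ran (f((r, c) \<mapsto> b, (r, Suc c) := None))" for x
      using that east.hyps(5) by (auto simp: ran_def split: if_splits)
    moreover have "x \<in> ran (f((r, c) \<mapsto> b, (r, Suc c) := None))" if "x \<in> ran f" for x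
    proof -
      from that obtain p where p: "f p = Some x" by (auto simp: ran_def)
      show ?thesis
      proof (cases "p = (r, Suc c)")
        case True
        then have "(f((r, c) \<mapsto> b, (r, Suc c) := None)) (r, c) = Some x" using p east.hyps(5) by simp
        then show ?thesis by (rule ranI)
      next
        case False
        then have "(f((r, c) \<mapsto> b, (r, Suc c) := None)) p = Some x" using p dm by auto
        then show ?thesis by (rule ranI)
      qed
    qed
    ultimately show ?thesis by blast
  qed
  have "(r, Suc c) \<notin> inner i j" using east.prems(2) by (auto simp: inner_def)
  note IH = east.IH[OF ok this]
  have "insert (r, Suc c) (dom (f((r, c) \<mapsto> b, (r, Suc c) := None))) \<subseteq> insert (r, c) (dom f)"
    using east.hyps(5) by auto
  with IH have "dom (fst res) \<subseteq> insert (r, c) (dom f)" by (elim conjE) (rule subset_trans)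
  moreover have "ran f \<union> (\<Union>k\<in>{Suc c..}. E k) \<subseteq> ran f \<union> (\<Union>k\<in>{c..}. E k)"
    by (intro Un_mono UN_mono) auto
  with IH have "ran (fst res) \<subseteq> ran f \<union> (\<Union>k\<in>{c..}. E k)"
    unfolding rn by (elim conjE) (rule subset_trans)
  ultimately show ?case using IH by (simp only: rn rest_labels_def simp_thms)
qed

section \<open>The slides of one row\<close>

text \<open>M is the last column of the row. Slide number k + 1 starts in column M - k, as the
  successive corners of the row do.\<close>

primrec row_slides :: "nat \<Rightarrow> nat \<Rightarrow> nat \<Rightarrow> filling \<times> (nat \<Rightarrow> nat set) \<Rightarrow> filling \<times> (nat \<Rightarrow> nat set)"
  where
    "row_slides M i 0 s = s"
  | "row_slides M i (Suc k) s = (case row_slides M i k s of (f, E) \<Rightarrow> slide i (M - k) f E)"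

definition below :: "nat \<Rightarrow> filling \<Rightarrow> filling"
  where "below i f = (\<lambda>(r, c). if i < r then f (r, c) else None)"

abbreviation level :: "nat \<Rightarrow> nat \<Rightarrow> filling \<Rightarrow> (nat \<Rightarrow> nat set) \<Rightarrow> bool"
  where "level n i f E \<equiv> ok n i i {} f E"

lemma ok_insert_bullet:
  assumes ok: "ok n i (Suc j) {} f E" and j: "i \<le> j" "j \<le> n"
  shows "ok n i j {(i, j)} f E"
proof -
  note D = okD[OF ok]
  have inner: "inner i (Suc j) = insert (i, j) (inner i j)"
    by (auto simp: inner_def)
  show ?thesis
  proof (rule okI)
    show "dom f \<inter> {(i, j)} = {}" "dom f \<inter> inner i j = {}" using D(3) inner by auto
    show "(r', c') \<in> dom f \<union> {(i, j)} \<union> inner i j"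
      if "(r, c) \<in> dom f \<union> {(i, j)}" "r' \<le> r" "r' \<le> c'" "c' \<le> c" for r c r' c'
    proof (cases "(r, c) = (i, j)")
      case True
      then show ?thesis using that by (auto simp: inner_def)
    next
      case False
      then show ?thesis using that D(4)[of r c r' c'] inner by auto
    qed
    show "0 < k \<and> k \<le> n \<and> (k, k) \<in> dom f \<union> {(i, j)} \<union> inner i j" if "E k \<noteq> {}" for k
      using D(8)[OF that] inner by auto
  qed (use D(1) D(6) D(9) D(10) D(11) in \<open>auto intro: D(5) D(7)\<close>)
qed

text \<open>The two sets of boxes still to be filled differ only at boxes that violate row <= column
  <= n, and no label sits there.\<close>

lemma level_Suc_iff:
  assumes "i \<le> n"
  shows "level n (Suc i) f E \<longleftrightarrow> ok n i (Suc n) {} f E"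
proof
  assume ok: "level n (Suc i) f E"
  note D = okD[OF ok]
  show "ok n i (Suc n) {} f E"
  proof (rule okI)
    show "dom f \<inter> inner i (Suc n) = {}"
      using D(3) by (auto simp: inner_def)
    show "(r', c') \<in> dom f \<union> {} \<union> inner i (Suc n)"
      if "(r, c) \<in> dom f \<union> {}" "r' \<le> r" "r' \<le> c'" "c' \<le> c" for r c r' c'
    proof -
      have "c \<le> n" using that D(1) by (auto simp: bounded_cols_def)
      moreover have "(r', c') \<in> dom f \<union> {} \<union> inner (Suc i) (Suc i)" by (rule D(4)[OF that])
      ultimately show ?thesis using that by (auto simp: inner_def)
    qed
    show "0 < k \<and> k \<le> n \<and> (k, k) \<in> dom f \<union> {} \<union> inner i (Suc n)" if "E k \<noteq> {}" for k
      using D(8)[OF that] by (auto simp: inner_def)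
  qed (use D(1) D(6) D(9) D(10) D(11) in \<open>auto intro: D(5) D(7)\<close>)
next
  assume ok: "ok n i (Suc n) {} f E"
  note D = okD[OF ok]
  show "level n (Suc i) f E"
  proof (rule okI)
    show "dom f \<inter> inner (Suc i) (Suc i) = {}"
    proof -
      have False if "(r, c) \<in> dom f" "(r, c) \<in> inner (Suc i) (Suc i)" for r c
      proof -
        have "r \<le> c" "c \<le> n" using that D(1) by (auto simp: bounded_cols_def)
        moreover have "(r, c) \<notin> inner i (Suc n)" using D(3) that by auto
        ultimately show False using that by (auto simp: inner_def)
      qed
      then show ?thesis by auto
    qed
    show "(r', c') \<in> dom f \<union> {} \<union> inner (Suc i) (Suc i)"
      if "(r, c) \<in> dom f \<union> {}" "r' \<le> r" "r' \<le> c'" "c' \<le> c" for r c r' c'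
      using D(4)[OF that] by (auto simp: inner_def)
    show "0 < k \<and> k \<le> n \<and> (k, k) \<in> dom f \<union> {} \<union> inner (Suc i) (Suc i)" if "E k \<noteq> {}" for k
      using D(8)[OF that] by (auto simp: inner_def)
  qed (use D(1) D(6) D(9) D(10) D(11) in \<open>auto intro: D(5) D(7)\<close>)
qed

text \<open>Forgetting the rows up to i turns their boxes into boxes still to be filled, while all
  edge labels stay. The lower rows thus form a state of the same kind, on which the recursion of the
  count rests.\<close>

lemma level_below:
  assumes ok: "level n i f E"
  shows "level n (Suc i) (below i f) E"
proof -
  note D = okD[OF ok]
  have dm: "below i f (r, c) = Some a \<longleftrightarrow> f (r, c) = Some a \<and> i < r" for r c a
    by (auto simp: below_def)
  show ?thesis
  proof (rule okI)
    show "bounded_cols n (below i f)" using D(1) by (auto simp: bounded_cols_def below_def)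
    show "dom (below i f) \<inter> inner (Suc i) (Suc i) = {}"
    proof -
      have False if "f (r, c) = Some a" "i < r" "(r, c) \<in> inner (Suc i) (Suc i)" for r c a
      proof -
        have "r \<le> c" using that D(1) by (auto simp: bounded_cols_def)
        then show False using that by (auto simp: inner_def)
      qed
      then show ?thesis by (auto simp: dm)
    qed
    show "(r', c') \<in> dom (below i f) \<union> {} \<union> inner (Suc i) (Suc i)"
      if "(r, c) \<in> dom (below i f) \<union> {}" "r' \<le> r" "r' \<le> c'" "c' \<le> c" for r c r' c'
    proof (cases "r' \<le> i")
      case True
      then show ?thesis by (auto simp: inner_def)
    next
      case False
      have "(r, c) \<in> dom f \<union> {}" using that by (auto simp: dm)
      from D(4)[OF this that(2-4)] False that show ?thesis by (auto simp: inner_def dm)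
    qed
    show "0 < k \<and> k \<le> n \<and> (k, k) \<in> dom (below i f) \<union> {} \<union> inner (Suc i) (Suc i)" if "E k \<noteq> {}" for k
      using D(8)[OF that] by (cases "i < k") (auto simp: inner_def dm)
    show "a < b" if "below i f (r, c) = Some a" "below i f (r', c') = Some b" "r \<le> r'" "c \<le> c'"
      "(r, c) \<noteq> (r', c')" for r c r' c' a b
      using that D(5) by (auto simp: dm)
    show "a < s" if "s \<in> E k" "below i f (r, c) = Some a" "c \<le> k" for k s r c a
      using that D(7) by (auto simp: dm)
    show "p = q" if "below i f p = Some a" "below i f q = Some a" for p q a
      using that D(9)[of p a q] by (cases p, cases q) (auto simp: dm)
    show "a \<notin> E k" if "below i f p = Some a" for p k a
      using that D(11)[of p a k] by (cases p) (auto simp: dm)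
  qed (use D(6) D(10) in auto)
qed

lemma row_slides_ok:
  assumes "level n (Suc i) f E" "i \<le> n" "k \<le> Suc n - i" "row_slides n i k (f, E) = (g, D)"
  shows "ok n i (Suc n - k) {} g D \<and> dom g \<subseteq> dom f \<union> {i} \<times> {Suc n - k..n} \<and> ran f \<subseteq> ran g \<and>
    ran g \<subseteq> ran f \<union> (\<Union>l\<in>{Suc n - k..}. E l) \<and> rest_labels g D = rest_labels f E \<and>
    (\<forall>l. D l \<subseteq> E l) \<and> (\<forall>l<Suc n - k. D l = E l)"
  using assms(3,4)
proof (induction k arbitrary: g D)
  case 0
  show ?case using 0 assms(1,2) by (simp add: level_Suc_iff)
next
  case (Suc k)
  obtain g1 D1 where gD: "row_slides n i k (f, E) = (g1, D1)" by force
  have IH: "ok n i (Suc n - k) {} g1 D1 \<and> dom g1 \<subseteq> dom f \<union> {i} \<times> {Suc n - k..n} \<and> ran f \<subseteq> ran g1 \<and>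
    ran g1 \<subseteq> ran f \<union> (\<Union>l\<in>{Suc n - k..}. E l) \<and> rest_labels g1 D1 = rest_labels f E \<and>
    (\<forall>l. D1 l \<subseteq> E l) \<and> (\<forall>l<Suc n - k. D1 l = E l)"
    by (rule Suc.IH[OF _ gD]) (use Suc.prems in simp)
  note I1 = conjunct1[OF IH] note R1 = conjunct2[OF IH] note I2 = conjunct1[OF R1]
  note R2 = conjunct2[OF R1] note I3 = conjunct1[OF R2] note R3 = conjunct2[OF R2]
  note I4 = conjunct1[OF R3] note R4 = conjunct2[OF R3] note I5 = conjunct1[OF R4]
  note I6 = conjunct1[OF conjunct2[OF R4]] note I7 = conjunct2[OF conjunct2[OF R4]]
  have nk: "i \<le> n - k" "n - k \<le> n" "Suc n - k = Suc (n - k)" "Suc n - Suc k = n - k" "k \<le> n"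
    using Suc.prems(1) assms(2) by auto
  have sl: "slide i (n - k) g1 D1 = (g, D)" using Suc.prems(2) gD by simp
  have b: "ok n i (n - k) {(i, n - k)} g1 D1" by (rule ok_insert_bullet) (use I1 nk in simp_all)
  have "(i, n - k) \<notin> inner i (n - k)" by (simp add: inner_def)
  from slide_ok[OF nk(1,2) okD(1)[OF b] sl b this]
  have S: "ok n i (n - k) {} g D" "dom g \<subseteq> insert (i, n - k) (dom g1)" "ran g1 \<subseteq> ran g"
    "ran g \<subseteq> ran g1 \<union> (\<Union>l\<in>{n - k..}. D1 l)" "rest_labels g D = rest_labels g1 D1" "\<And>l. D l \<subseteq> D1 l"
    by auto
  have out: "D l = D1 l" if "l < n - k" for l
    using slide_outside[OF nk(1,2) okD(1)[OF b] sl, of "(0, 0)" l] that by auto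
  have u1: "(\<Union>l\<in>{n - k..}. D1 l) \<subseteq> (\<Union>l\<in>{n - k..}. E l)" using I6 by blast
  have u2: "(\<Union>l\<in>{Suc n - k..}. E l) \<subseteq> (\<Union>l\<in>{n - k..}. E l)" by (intro UN_mono) auto
  have "ran g1 \<subseteq> ran f \<union> (\<Union>l\<in>{n - k..}. E l)"
    by (rule subset_trans[OF I4 Un_mono[OF subset_refl u2]])
  then have r: "ran g \<subseteq> ran f \<union> (\<Union>l\<in>{n - k..}. E l)"
    by (rule subset_trans[OF S(4) Un_least[OF _ le_supI2[OF u1]]])
  have d: "dom g \<subseteq> dom f \<union> {i} \<times> {n - k..n}"
  proof
    fix p assume "p \<in> dom g"
    then have "p = (i, n - k) \<or> p \<in> dom g1" using S(2) by blast
    then have "p = (i, n - k) \<or> p \<in> dom f \<or> p \<in> {i} \<times> {Suc n - k..n}" using I2 by blast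
    then show "p \<in> dom f \<union> {i} \<times> {n - k..n}" using nk by auto
  qed
  have "ran f \<subseteq> ran g" using I3 S(3) by (rule subset_trans)
  moreover have "\<forall>l. D l \<subseteq> E l" using I6 S(6) by blast
  moreover have "\<forall>l<n - k. D l = E l" using I7 out nk(3) by auto
  moreover have "rest_labels g D = rest_labels f E" using S(5) I5 by simp
  ultimately show ?case unfolding nk(4) using S(1) r d by (intro conjI)
qed

text \<open>Slides that start right of column l never see its edge set, so a label can be put there
  or taken away before or after these slides with the same effect.\<close>

lemma row_slides_edge_update:
  assumes "level n (Suc i) f E" "i \<le> n" "k \<le> Suc n - i" "row_slides n i k (f, E) = (g, D)"
    and "l < Suc n - k"
  shows "row_slides n i k (f, E(l := X)) = (g, D(l := X))"
  using assms(3-5)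
proof (induction k arbitrary: g D)
  case 0
  then show ?case by simp
next
  case (Suc k)
  obtain g1 D1 where gD: "row_slides n i k (f, E) = (g1, D1)" by force
  have k: "k \<le> Suc n - i" "l < Suc n - k" "i \<le> n - k" "n - k \<le> n" "l < n - k" using Suc.prems assms(2) by auto
  have b: "bounded_cols n g1" using row_slides_ok[OF assms(1,2) k(1) gD] okD(1) by blast
  have sl: "slide i (n - k) g1 D1 = (g, D)" using Suc.prems(2) gD by simp
  have "slide i (n - k) g1 (D1(l := X)) =
    ((\<lambda>p. if p \<in> quadrant i (n - k) then fst (g, D) p else g1 p),
     (\<lambda>m. if m \<ge> n - k then snd (g, D) m else (D1(l := X)) m))"
    by (rule slide_local[OF k(3,4) b sl]) (use k in auto)
  moreover have "g p = g1 p" if "p \<notin> quadrant i (n - k)" for p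
    using slide_outside[OF k(3,4) b sl, of p] that by auto
  moreover have "D m = D1 m" if "m < n - k" for m
    using slide_outside[OF k(3,4) b sl, of "(0, 0)" m] that by auto
  ultimately have "slide i (n - k) g1 (D1(l := X)) = (g, D(l := X))"
    using k by (auto simp: fun_eq_iff not_le)
  then show ?case using Suc.IH[OF k(1) gD k(2)] by (simp only: row_slides.simps prod.case)
qed

text \<open>The state halfway through row i: the bullets have come in from the right down to column
  j and pushed the entries of row i+1 up into row i, while g describes the lower rows.\<close>

definition raised :: "nat \<Rightarrow> nat \<Rightarrow> filling \<Rightarrow> filling \<Rightarrow> filling"
  where "raised i j f g = (\<lambda>(r, c).
    if r = i then (if j \<le> c then f (Suc i, c) else None)
    else if r = Suc i \<and> c < j then f (Suc i, c) else g (r, c))"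

text \<open>As long as the bullet starts right of the diagonal, it moves south, since the entry below is
  smaller than the one to the right, and then performs the corresponding slide one row further down.\<close>

lemma row_slides_raised:
  assumes lev: "level n (Suc i) f E" and i: "i < n" and full: "f (Suc i, n) \<noteq> None"
    and k: "k \<le> n - i" and g: "row_slides n (Suc i) k (below (Suc i) f, E) = (g, D)"
  shows "row_slides n i k (f, E) = (raised i (Suc n - k) f g, D)"
  using k g
proof (induction k arbitrary: g D)
  case 0
  note H = okD[OF lev]
  have "f (r, c) = None" if "r < Suc i \<or> c > n" for r c
  proof (rule ccontr)
    assume "f (r, c) \<noteq> None"
    then have "(r, c) \<notin> inner (Suc i) (Suc i)" "c \<le> n" using H(1,3) by (auto simp: bounded_cols_def)
    then show False using that by (auto simp: inner_def)
  qed
  then have "raised i (Suc n) f (below (Suc i) f) = f"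
    by (auto simp: raised_def below_def fun_eq_iff not_less less_Suc_eq_le)
  then show ?case using 0 by simp
next
  case (Suc k)
  obtain g1 D1 where gD: "row_slides n (Suc i) k (below (Suc i) f, E) = (g1, D1)" by force
  note H = okD[OF lev]
  have k: "k \<le> n - i" "k \<le> Suc n - Suc i" "Suc i \<le> n" "Suc i \<le> n - k" "n - k \<le> n" "i < n - k"
    "Suc n - k = Suc (n - k)" "Suc n - Suc k = n - k" using Suc.prems by auto
  let ?F = "raised i (Suc (n - k)) f g1"
  have IH: "row_slides n i k (f, E) = (?F, D1)" using Suc.IH[OF k(1) gD] k(7) by simp
  have ok1: "ok n (Suc i) (Suc (n - k)) {} g1 D1"
    using row_slides_ok[OF level_below[OF lev] k(3) k(2) gD] k(7) by simp
  have sl: "slide (Suc i) (n - k) g1 D1 = (g, D)" using Suc.prems(2) gD by simp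
  have row: "f (Suc i, c) \<noteq> None" if "Suc i \<le> c" "c \<le> n" for c
    using H(4)[of "Suc i" n "Suc i" c] full that by (auto simp: inner_def)
  obtain b where b: "f (Suc i, n - k) = Some b" using row[of "n - k"] k by auto
  have ne: "\<not> takes_edge i (n - k) ?F D1" using k(6) by (auto simp: takes_edge_def)
  have south: "?F (Suc i, n - k) = Some b" using b by (simp add: raised_def)
  have east: "b < a" if "?F (i, Suc (n - k)) = Some a" for a
    using that H(5)[OF b, of "Suc i" "Suc (n - k)" a] by (simp add: raised_def)
  let ?F' = "?F((i, n - k) \<mapsto> b, (Suc i, n - k) := None)"
  have g1n: "g1 (Suc i, c) = None" if "c \<le> n - k" for c
    using okD(3)[OF ok1] that by (auto simp: inner_def)
  have "slide i (n - k) ?F D1 = slide (Suc i) (n - k) ?F' D1"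
    by (rule slide_south[OF ne south east])
  also have "\<dots> = ((\<lambda>p. if p \<in> quadrant (Suc i) (n - k) then fst (g, D) p else ?F' p),
     (\<lambda>m. if m \<ge> n - k then snd (g, D) m else D1 m))"
    by (rule slide_local[OF k(4,5) okD(1)[OF ok1] sl])
      (use g1n in \<open>auto simp: quadrant_def raised_def split: if_splits\<close>)
  also have "\<dots> = (raised i (n - k) f g, D)"
  proof -
    have o1: "g p = g1 p" if "p \<notin> quadrant (Suc i) (n - k)" for p
      using slide_outside[OF k(4,5) okD(1)[OF ok1] sl, of p] that by auto
    have o2: "D m = D1 m" if "m < n - k" for m
      using slide_outside[OF k(4,5) okD(1)[OF ok1] sl, of "(0, 0)" m] that by auto
    have "(if p \<in> quadrant (Suc i) (n - k) then fst (g, D) p else ?F' p) = raised i (n - k) f g p" for p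
    proof -
      obtain r c where p: "p = (r, c)" by force
      show ?thesis
        using o1[of p] b unfolding p by (auto simp: quadrant_def raised_def not_less less_Suc_eq_le le_less)
    qed
    then show ?thesis using o2 by (auto simp: fun_eq_iff not_le)
  qed
  finally show ?case using IH k(8) by simp
qed

lemma row_slides_step:
  assumes "level n (Suc i) f E" "i \<le> n" "k \<le> n - i" "row_slides n i k (f, E) = (g, D)"
    and "slide i (n - k) g D = (h, C)"
  shows "bounded_cols n g" "dom h \<subseteq> insert (i, n - k) (dom g)"
proof -
  have ok: "ok n i (Suc n - k) {} g D" using row_slides_ok[OF assms(1,2) _ assms(4)] assms(2,3) by auto
  then show "bounded_cols n g" by (rule okD(1))
  have nk: "i \<le> n - k" "n - k \<le> n" "Suc n - k = Suc (n - k)" using assms(2,3) by auto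
  have b: "ok n i (n - k) {(i, n - k)} g D" by (rule ok_insert_bullet) (use ok nk in simp_all)
  have "(i, n - k) \<notin> inner i (n - k)" by (simp add: inner_def)
  from slide_ok[OF nk(1,2) okD(1)[OF b] assms(5) b this]
  show "dom h \<subseteq> insert (i, n - k) (dom g)" by simp
qed

text \<open>The first slide of the row starts in column n and finds nothing to the right, nothing
  below and, off the diagonal, no edge. Later slides enlarge the filled region at most by the box
  they start in.\<close>

lemma row_slides_last_column:
  assumes lev: "level n (Suc i) f E" and i: "i < n" and "f (Suc i, n) = None"
    and "0 < k" "k \<le> Suc n - i" "row_slides n i k (f, E) = (g, D)"
  shows "g (i, n) = None"
  using assms(4-6)
proof (induction k arbitrary: g D)
  case (Suc k)
  note H = okD[OF lev]
  obtain g1 D1 where gD: "row_slides n i k (f, E) = (g1, D1)" by force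
  have sl: "slide i (n - k) g1 D1 = (g, D)" using Suc.prems gD by simp
  show ?case
  proof (cases "k = 0")
    case True
    have "f (i, Suc n) = None" "f (i, n) = None" using H(1,3) by (auto simp: bounded_cols_def inner_def)
    moreover have "\<not> takes_edge i n f E" using i by (simp add: takes_edge_def)
    ultimately show ?thesis using slide_stop[of i n f E] sl gD True assms(3) by simp
  next
    case False
    then have "g1 (i, n) = None" using Suc.IH[OF _ _ gD] Suc.prems by simp
    moreover have "dom g \<subseteq> insert (i, n - k) (dom g1)"
      using row_slides_step(2)[OF lev _ _ gD sl] i Suc.prems by simp
    moreover have "n - k \<noteq> n" using False i Suc.prems by simp
    ultimately show ?thesis by auto
  qed
qed simp

text \<open>A bullet that runs through the row to its end vacates the last box; one that turns south
  leaves in the row the label that it lifted from the row below.\<close>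

lemma slide_along_row:
  assumes "i \<le> c" "c \<le> n" "bounded_cols n F" "slide i c F E = res"
    and "i < c" "F (i, c) = None" "\<And>c'. c < c' \<Longrightarrow> c' \<le> n \<Longrightarrow> F (i, c') \<noteq> None"
  shows "fst res (i, n) = None \<or> (\<exists>c' z. c \<le> c' \<and> F (Suc i, c') = Some z \<and> fst res (i, c') = Some z)"
  using assms
proof (induction i c F E res rule: slide_induct)
  case (stop i c F E)
  have "c = n"
  proof (rule ccontr)
    assume "c \<noteq> n"
    then show False using stop.prems(3)[of "Suc c"] stop.hyps by auto
  qed
  then show ?case using stop by simp
next
  case (south i c F E b res)
  let ?F = "F((i, c) \<mapsto> b, (Suc i, c) := None)"
  have "bounded_cols n ?F" using south.hyps by (auto simp: bounded_cols_def)
  from slide_outside[OF _ _ this south.hyps(6), of "(i, c)" 0] south.hyps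
  have "fst res (i, c) = Some b" by (auto simp: quadrant_def)
  then show ?case using south.hyps by auto
next
  case (east i c F E a res)
  let ?F = "F((i, c) \<mapsto> a, (i, Suc c) := None)"
  have "fst res (i, n) = None \<or> (\<exists>c' z. Suc c \<le> c' \<and> ?F (Suc i, c') = Some z \<and> fst res (i, c') = Some z)"
    by (rule east.IH) (use east.prems in auto)
  then show ?case by (auto dest: Suc_leD)
qed simp

section \<open>The last slide of a row, which starts on the diagonal\<close>

definition stack :: "nat \<Rightarrow> (nat \<Rightarrow> nat option) \<Rightarrow> filling \<Rightarrow> filling"
  where "stack i h g = (\<lambda>(r, c). if r = i then h c else g (r, c))"

text \<open>The slides of row i that start right of the diagonal push row i+1 up by one row and act
  below like the n - i slides of row i+1. What remains is the bullet on the diagonal.\<close>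

lemma row_slides_almost:
  assumes lev: "level n (Suc i) f E" and i: "i < n" and full: "f (Suc i, n) \<noteq> None"
    and g: "row_slides n (Suc i) (n - i) (below (Suc i) f, E) = (g, D)"
  shows "row_slides n i (Suc n - i) (f, E) =
    slide i i (stack i (\<lambda>c. if i < c then f (Suc i, c) else None) g) D"
proof -
  have "row_slides n i (n - i) (f, E) = (raised i (Suc i) f g, D)"
    using row_slides_raised[OF lev i full _ g] i by simp
  moreover have "raised i (Suc i) f g = stack i (\<lambda>c. if i < c then f (Suc i, c) else None) g"
  proof (rule ext)
    fix p :: "nat \<times> nat"
    obtain r c where p: "p = (r, c)" by force
    have ok: "ok n (Suc i) (Suc i) {} g D"
      using row_slides_ok[OF level_below[OF lev] _ _ g] i by (simp add: Suc_diff_le)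
    have n1: "g (Suc i, c) = None" if "c \<le> i" using okD(3)[OF ok] that by (auto simp: inner_def)
    have n2: "f (Suc i, c) = None" if "c \<le> i" using okD(3)[OF lev] that by (auto simp: inner_def)
    show "raised i (Suc i) f g p = stack i (\<lambda>c. if i < c then f (Suc i, c) else None) g p"
      unfolding p using n1 n2 by (auto simp: raised_def stack_def)
  qed
  ultimately show ?thesis using i by (simp add: Suc_diff_le)
qed

lemma slide_stack_edge:
  assumes "D i \<noteq> {}" "\<And>a. h (Suc i) = Some a \<Longrightarrow> Min (D i) < a"
  shows "slide i i (stack i h g) D = (stack i (h(i \<mapsto> Min (D i))) g, D(i := D i - {Min (D i)}))"
proof -
  have "takes_edge i i (stack i h g) D" using assms by (auto simp: takes_edge_def stack_def)
  then show ?thesis by (auto simp: slide_edge stack_def fun_eq_iff)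
qed

lemma slide_stack_east:
  assumes "h (Suc i) = Some b" "D i \<noteq> {} \<Longrightarrow> \<not> Min (D i) < b" "g (Suc i, i) = None"
  shows "slide i i (stack i h g) D = slide i (Suc i) (stack i (h(i \<mapsto> b, Suc i := None)) g) D"
proof -
  have ne: "\<not> takes_edge i i (stack i h g) D" using assms by (auto simp: takes_edge_def stack_def)
  have s: "stack i h g (i, Suc i) = Some b" and n: "\<And>a. stack i h g (Suc i, i) = Some a \<Longrightarrow> \<not> a < b"
    using assms by (auto simp: stack_def)
  have eq: "(stack i h g)((i, i) \<mapsto> b, (i, Suc i) := None) = stack i (h(i \<mapsto> b, Suc i := None)) g"
    by (auto simp: stack_def fun_eq_iff)
  show ?thesis using slide_east[OF ne s n] unfolding eq .
qed

text \<open>Having moved south, the bullet sits on the diagonal of row i+1 in place of y, and the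
  row above is out of its reach.\<close>

lemma slide_stack_south:
  assumes "g (Suc i, Suc i) = Some y" "\<And>a. h (Suc (Suc i)) = Some a \<Longrightarrow> y < a"
    and b: "bounded_cols n (g((Suc i, Suc i) := None))" "Suc i \<le> n"
    and R: "slide (Suc i) (Suc i) (g((Suc i, Suc i) := None)) D = (g', D')"
  shows "slide i (Suc i) (stack i h g) D = (stack i (h(Suc i \<mapsto> y)) g', D')"
proof -
  let ?h = "h(Suc i \<mapsto> y)" and ?g = "g((Suc i, Suc i) := None)"
  have "\<not> takes_edge i (Suc i) (stack i h g) D" by (simp add: takes_edge_def)
  moreover have "stack i h g (Suc i, Suc i) = Some y" "\<And>a. stack i h g (i, Suc (Suc i)) = Some a \<Longrightarrow> y < a"
    using assms by (auto simp: stack_def)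
  moreover have "(stack i h g)((i, Suc i) \<mapsto> y, (Suc i, Suc i) := None) = stack i ?h ?g"
    by (auto simp: stack_def fun_eq_iff)
  ultimately have "slide i (Suc i) (stack i h g) D = slide (Suc i) (Suc i) (stack i ?h ?g) D"
    by (simp add: slide_south)
  also have "\<dots> = ((\<lambda>p. if p \<in> quadrant (Suc i) (Suc i) then fst (g', D') p else stack i ?h ?g p),
     (\<lambda>k. if k \<ge> Suc i then snd (g', D') k else D k))"
    by (rule slide_local[OF _ b(2) b(1) R]) (auto simp: stack_def quadrant_def split: if_splits)
  also have "\<dots> = (stack i ?h g', D')"
  proof -
    have o1: "g' p = ?g p" if "p \<notin> quadrant (Suc i) (Suc i)" for p
      using slide_outside[OF _ b(2) b(1) R, of p] that by auto
    have o2: "D' m = D m" if "m < Suc i" for m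
      using slide_outside[OF _ b(2) b(1) R, of "(0, 0)" m] that by auto
    have "(if p \<in> quadrant (Suc i) (Suc i) then fst (g', D') p else stack i ?h ?g p) = stack i ?h g' p" for p
    proof (cases "p \<in> quadrant (Suc i) (Suc i)")
      case True
      then show ?thesis by (cases p) (auto simp: stack_def quadrant_def)
    next
      case False
      then show ?thesis using o1[OF False] by (cases p) (auto simp: stack_def)
    qed
    then show ?thesis using o2 by (auto simp: fun_eq_iff not_le)
  qed
  finally show ?thesis .
qed

text \<open>Boxwise shape of rho (n+1-i) m placed in rows i, ..., i+m-1, with every entry of a row smaller
  than all entries of later rows.\<close>

definition superstd :: "nat \<Rightarrow> nat \<Rightarrow> nat \<Rightarrow> filling \<Rightarrow> bool"
  where "superstd n i m f \<longleftrightarrow>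
    (\<forall>r c. f (r, c) \<noteq> None \<longleftrightarrow> i \<le> r \<and> r < i + m \<and> r \<le> c \<and> c \<le> n) \<and>
    (\<forall>r c r' c' a b. f (r, c) = Some a \<longrightarrow> f (r', c') = Some b \<longrightarrow> r < r' \<longrightarrow> a < b)"

lemma superstdD:
  assumes "superstd n i m f"
  shows "f (r, c) \<noteq> None \<longleftrightarrow> i \<le> r \<and> r < i + m \<and> r \<le> c \<and> c \<le> n"
    and "f (r, c) = Some a \<Longrightarrow> f (r', c') = Some b \<Longrightarrow> r < r' \<Longrightarrow> a < b"
  using conjunct1[OF assms[unfolded superstd_def]] conjunct2[OF assms[unfolded superstd_def], rule_format]
  by blast+

lemma below_stack: "below i (stack i h g) = below i g"
  by (auto simp: below_def stack_def fun_eq_iff)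

lemma level_row_None:
  assumes "level n i f E" "r < i"
  shows "f (r, c) = None"
  using okD(3)[OF assms(1)] assms(2) by (auto simp: inner_def)

lemma below_level: "level n (Suc i) f E \<Longrightarrow> below i f = f"
  using level_row_None by (fastforce simp: below_def fun_eq_iff not_less less_Suc_eq_le)

lemma south_east_cases:
  fixes u v :: "nat option"
  obtains (south) y where "u = Some y" "\<And>a. v = Some a \<Longrightarrow> y < a"
  | (east) a where "v = Some a" "\<And>y. u = Some y \<Longrightarrow> \<not> y < a"
  | (none) "u = None" "v = None"
proof (cases u)
  case None
  then show ?thesis using that(2,3) by (cases v) auto
next
  case (Some y)
  then show ?thesis using that(1,2) by (cases v; cases "y < the v") auto
qed

text \<open>The bullet on the diagonal decides. Taking the edge gives the first alternative. If it
  moves east, it must turn south at once: stopping leaves a gap in row i, and going on lifts a label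
  of row i+1 over the smaller one at the start of that row. The label y lifted by the turn is
  smaller than its right neighbour in row i, which forces it to come from the edge of row
  i+1.\<close>

lemma row_step_forward:
  assumes lev: "level n (Suc i) f E" and i: "i < n"
    and run: "row_slides n i (Suc n - i) (f, E) = (f', E')"
    and ss: "superstd n i (Suc m) f'"
  shows
    "(\<exists>e. f' (i, i) = Some e \<and> e \<in> E i \<and> (\<forall>c>i. f (Suc i, c) = f' (i, c)) \<and>
       row_slides n (Suc i) (n - i) (below (Suc i) f, E(i := E i - {e})) = (below i f', E')) \<or>
     (\<exists>y. f' (i, Suc i) = Some y \<and> y \<in> E (Suc i) \<and> f (Suc i, Suc i) = f' (i, i) \<and>
       (\<forall>c>Suc i. f (Suc i, c) = f' (i, c)) \<and>
       row_slides n (Suc i) (n - i) (below (Suc i) f, E(Suc i := E (Suc i) - {y})) = (below i f', E'))"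
proof -
  note H = okD[OF lev]
  have row': "f' (i, c) \<noteq> None" if "i \<le> c" "c \<le> n" for c
    using superstdD(1)[OF ss] that by simp
  have full: "f (Suc i, n) \<noteq> None"
  proof
    assume "f (Suc i, n) = None"
    from row_slides_last_column[OF lev i this _ _ run] i show False using row'[of n] by simp
  qed
  have row: "f (Suc i, c) \<noteq> None" if "Suc i \<le> c" "c \<le> n" for c
    using H(4)[of "Suc i" n "Suc i" c] full that by (auto simp: inner_def)
  obtain g D where gD: "row_slides n (Suc i) (n - i) (below (Suc i) f, E) = (g, D)" by force
  have levb: "level n (Suc (Suc i)) (below (Suc i) f) E" by (rule level_below[OF lev])
  have ks: "Suc i \<le> n" "n - i \<le> Suc n - Suc i" "i < Suc n - (n - i)" "Suc n - (n - i) = Suc i" using i by auto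
  note G = row_slides_ok[OF levb ks(1,2) gD]
  have okg: "level n (Suc i) g D" using G ks by simp
  have Di: "D i = E i" using G ks by auto
  let ?h = "\<lambda>c. if i < c then f (Suc i, c) else None"
  have last: "slide i i (stack i ?h g) D = (f', E')"
    using row_slides_almost[OF lev i full gD] run by simp
  have gi: "g (i, c) = None" "g (Suc i, i) = None" for c
    using okD(3)[OF okg] by (auto simp: inner_def)
  have bg: "below i g = g" by (rule below_level[OF okg])
  obtain b where b: "f (Suc i, Suc i) = Some b" using row[of "Suc i"] i by auto
  show ?thesis
  proof (cases "D i \<noteq> {} \<and> Min (D i) < b")
    case True
    let ?e = "Min (D i)"
    have "slide i i (stack i ?h g) D = (stack i (?h(i \<mapsto> ?e)) g, D(i := D i - {?e}))"
      by (rule slide_stack_edge) (use True b in auto)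
    then have f': "f' = stack i (?h(i \<mapsto> ?e)) g" and E': "E' = D(i := D i - {?e})" using last by auto
    have "?e \<in> E i" using Min_in[OF okD(6)[OF okg], of i] True Di by simp
    moreover have "f' (i, i) = Some ?e" "\<forall>c>i. f (Suc i, c) = f' (i, c)"
      unfolding f' by (auto simp: stack_def)
    moreover have "below i f' = g" unfolding f' below_stack bg ..
    moreover have "row_slides n (Suc i) (n - i) (below (Suc i) f, E(i := E i - {?e})) = (g, D(i := E i - {?e}))"
      by (rule row_slides_edge_update[OF levb ks(1,2) gD ks(3)])
    ultimately show ?thesis using E' Di by auto
  next
    case False
    have "slide i i (stack i ?h g) D = slide i (Suc i) (stack i (?h(i \<mapsto> b, Suc i := None)) g) D"
      by (rule slide_stack_east) (use False b gi in auto)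
    with last have east: "slide i (Suc i) (stack i (?h(i \<mapsto> b, Suc i := None)) g) D = (f', E')" by simp
    let ?h' = "?h(i \<mapsto> b, Suc i := None)"
    have bst: "bounded_cols n (stack i ?h' g)"
      using H(1) okD(1)[OF okg] i by (auto simp: bounded_cols_def stack_def)
    show ?thesis
    proof (cases rule: south_east_cases[of "g (Suc i, Suc i)" "?h' (Suc (Suc i))"])
      case Z: none
      then have "slide i (Suc i) (stack i ?h' g) D = (stack i ?h' g, D)"
        by (intro slide_stop) (auto simp: stack_def takes_edge_def)
      then have "f' = stack i ?h' g" using east by simp
      then have "f' (i, Suc i) = None" by (simp add: stack_def)
      then show ?thesis using row'[of "Suc i"] i by simp
    next
      case N: (east a)
      have Sn: "Suc (Suc i) \<le> n" using N(1) H(1) by (auto simp: bounded_cols_def)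
      let ?F = "stack i (?h'(Suc i \<mapsto> a, Suc (Suc i) := None)) g"
      have fe: "(stack i ?h' g)((i, Suc i) \<mapsto> a, (i, Suc (Suc i)) := None) = ?F"
        by (auto simp: stack_def fun_eq_iff)
      have "slide i (Suc i) (stack i ?h' g) D =
        slide i (Suc (Suc i)) ((stack i ?h' g)((i, Suc i) \<mapsto> a, (i, Suc (Suc i)) := None)) D"
        by (rule slide_east) (use N in \<open>auto simp: stack_def takes_edge_def\<close>)
      then have sl: "slide i (Suc (Suc i)) ?F D = (f', E')" using east unfolding fe by simp
      have bF: "bounded_cols n ?F" using bst i Sn unfolding fe[symmetric] by (auto simp: bounded_cols_def)
      \<comment> \<open>Row i of the result is filled in column n, so the bullet must have turned
        south in some column c' further right.\<close>
      have "fst (f', E') (i, n) = None \<or>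
        (\<exists>c' z. Suc (Suc i) \<le> c' \<and> ?F (Suc i, c') = Some z \<and> fst (f', E') (i, c') = Some z)"
        by (rule slide_along_row[OF _ Sn bF sl]) (use row in \<open>auto simp: stack_def\<close>)
      then obtain c' z where z: "Suc (Suc i) \<le> c'" "g (Suc i, c') = Some z" "f' (i, c') = Some z"
        using row'[of n] i by (auto simp: stack_def)
      have "g (Suc i, Suc i) \<noteq> None"
        using okD(4)[OF okg, of "Suc i" c' "Suc i" "Suc i"] z by (auto simp: inner_def)
      then obtain y where y: "g (Suc i, Suc i) = Some y" by auto
      have "y < z" using okD(5)[OF okg y z(2)] z(1) by simp
      have "fst (f', E') (Suc i, Suc i) = ?F (Suc i, Suc i)"
        using slide_outside[OF _ Sn bF sl, of "(Suc i, Suc i)" 0] by (auto simp: quadrant_def)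
      then have "f' (Suc i, Suc i) = Some y" using y by (simp add: stack_def)
      then have "z < y" using superstdD(2)[OF ss z(3)] by simp
      with \<open>y < z\<close> show ?thesis by simp
    next
      case S: (south y)
      let ?k = "n - Suc i"
      obtain g1 D1 where g1D: "row_slides n (Suc i) ?k (below (Suc i) f, E) = (g1, D1)" by force
      have k1: "?k \<le> Suc n - Suc i" "Suc n - ?k = Suc (Suc i)" "n - i = Suc ?k" "n - ?k = Suc i" using i by auto
      note G1 = row_slides_ok[OF levb ks(1) k1(1) g1D]
      have ok1: "ok n (Suc i) (Suc (Suc i)) {} g1 D1" using G1 k1 by simp
      have sl: "slide (Suc i) (Suc i) g1 D1 = (g, D)" using gD g1D k1 by simp
      have D1: "D1 (Suc i) = E (Suc i)" using G1 k1 by auto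
      have g1S: "g1 (Suc (Suc i), Suc i) = None" using okD(1)[OF ok1] unfolding bounded_cols_def by (meson Suc_n_not_le_n)
      have g10: "g1 (Suc i, Suc i) = None" using okD(3)[OF ok1] by (auto simp: inner_def)
      \<comment> \<open>Otherwise y was pulled in from the right. Such a label stems from a lower
        row or from an edge further right, hence exceeds the entry of row i+1 in column i+2, against
        the choice of the south move.\<close>
      have "takes_edge (Suc i) (Suc i) g1 D1"
      proof (rule ccontr)
        assume ne: "\<not> takes_edge (Suc i) (Suc i) g1 D1"
        show False
        proof (cases "g1 (Suc i, Suc (Suc i))")
          case None
          then have "g = g1" using slide_stop[OF ne None g1S] sl by simp
          then show False using S(1) g10 by simp
        next
          case (Some x)
          have Sn: "Suc (Suc i) \<le> n" using Some okD(1)[OF ok1] by (auto simp: bounded_cols_def)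
          let ?F = "g1((Suc i, Suc i) \<mapsto> x, (Suc i, Suc (Suc i)) := None)"
          have "slide (Suc i) (Suc (Suc i)) ?F D1 = (g, D)"
            using slide_east[OF ne Some] g1S sl by simp
          moreover have bF: "bounded_cols n ?F" using okD(1)[OF ok1] i by (auto simp: bounded_cols_def)
          ultimately have "g (Suc i, Suc i) = ?F (Suc i, Suc i)"
            using slide_outside[OF _ Sn bF, of "Suc i" D1 "(g, D)" "(Suc i, Suc i)" 0] by (auto simp: quadrant_def)
          then have "y = x" using S(1) by simp
          obtain a where a: "f (Suc i, Suc (Suc i)) = Some a" using row[of "Suc (Suc i)"] Sn by auto
          then have "x < a" using S(2)[of a] \<open>y = x\<close> by simp
          have "x \<in> ran g1" using Some by (rule ranI)
          then have "x \<in> ran (below (Suc i) f) \<or> (\<exists>l\<ge>Suc (Suc i). x \<in> E l)" using G1 k1 by auto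
          then show False
          proof
            assume "x \<in> ran (below (Suc i) f)"
            then obtain r c where "f (r, c) = Some x" "Suc i < r"
              by (auto simp: ran_def below_def split: if_splits)
            moreover from this have "r \<le> c" using H(1) by (auto simp: bounded_cols_def)
            ultimately have "a < x" using H(5)[OF a, of r c x] by auto
            then show False using \<open>x < a\<close> by simp
          next
            assume "\<exists>l\<ge>Suc (Suc i). x \<in> E l"
            then have "a < x" using H(7)[OF _ a] by auto
            then show False using \<open>x < a\<close> by simp
          qed
        qed
      qed
      from slide_edge[OF this] sl have g: "g = g1(((Suc i), Suc i) \<mapsto> Min (E (Suc i)))"
        and D: "D = D1(Suc i := E (Suc i) - {Min (E (Suc i))})" and Ene: "E (Suc i) \<noteq> {}"
        using \<open>takes_edge (Suc i) (Suc i) g1 D1\<close> D1 by (auto simp: takes_edge_def)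
      have y: "y = Min (E (Suc i))" using S(1) g by simp
      have yE: "y \<in> E (Suc i)" unfolding y using Min_in[OF H(6) Ene] .
      have gg1: "g((Suc i, Suc i) := None) = g1" using g g10 by (auto simp: fun_eq_iff)
      obtain g' D' where R: "slide (Suc i) (Suc i) g1 D = (g', D')" by force
      have "slide i (Suc i) (stack i ?h' g) D = (stack i (?h'(Suc i \<mapsto> y)) g', D')"
        by (rule slide_stack_south[where n = n and g = g and y = y and h = ?h'])
          (use S okD(1)[OF ok1] i R in \<open>auto simp: gg1\<close>)
      then have f': "f' = stack i (?h'(Suc i \<mapsto> y)) g'" and E': "E' = D'" using east by auto
      \<comment> \<open>Without y on its edge, the last slide of row i+1 does exactly what the
        bullet of row i does after lifting y.\<close>
      have "row_slides n (Suc i) ?k (below (Suc i) f, E(Suc i := E (Suc i) - {y})) =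
        (g1, D1(Suc i := E (Suc i) - {y}))"
        by (rule row_slides_edge_update[OF levb ks(1) k1(1) g1D]) (use k1 in simp)
      then have "row_slides n (Suc i) (n - i) (below (Suc i) f, E(Suc i := E (Suc i) - {y})) = (g', D')"
        using R D y k1(3,4) by (simp del: fun_upd_apply)
      moreover have "below i f' = g'"
      proof -
        have "g' p = g1 p" if "p \<notin> quadrant (Suc i) (Suc i)" for p
          using slide_outside[OF _ _ okD(1)[OF ok1] R, of p 0] that i by auto
        then have "g' (r, c) = None" if "r \<le> i" for r c
          using that okD(3)[OF ok1] by (auto simp: quadrant_def inner_def)
        then have "below i g' = g'" by (auto simp: below_def fun_eq_iff not_less)
        then show ?thesis unfolding f' below_stack .
      qed
      moreover have "f' (i, Suc i) = Some y" "f (Suc i, Suc i) = f' (i, i)"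
        "\<forall>c>Suc i. f (Suc i, c) = f' (i, c)"
        unfolding f' using b by (auto simp: stack_def)
      ultimately show ?thesis using yE E' by auto
    qed
  qed
qed

section \<open>Undoing the slides of a row\<close>

lemma level_stack:
  assumes lev: "level n (Suc (Suc i)) f E" and i: "i < n"
    and h: "\<And>c. h c \<noteq> None \<longleftrightarrow> Suc i \<le> c \<and> c \<le> n"
      "\<And>c c' a b. h c = Some a \<Longrightarrow> h c' = Some b \<Longrightarrow> c < c' \<Longrightarrow> a < b"
    and big: "\<And>x a c. x \<in> ran f \<or> (\<exists>k>i. x \<in> E k) \<Longrightarrow> h c = Some a \<Longrightarrow> a < x"
    and small: "\<And>k x c. k \<le> i \<Longrightarrow> x \<in> E k \<Longrightarrow> h c \<noteq> Some x"
    and e: "\<And>c. h c \<noteq> Some e" "e \<notin> ran f" "\<And>k. e \<notin> E k"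
    and l: "l = i \<and> 0 < i \<or> l = Suc i \<and> (\<forall>a. h (Suc i) = Some a \<longrightarrow> a < e)"
  shows "level n (Suc i) (stack (Suc i) h f) (E(l := insert e (E l)))"
proof -
  note D = okD[OF lev]
  let ?f = "stack (Suc i) h f" and ?E = "E(l := insert e (E l))"
  have f: "?f (r, c) = Some a \<longleftrightarrow> r = Suc i \<and> h c = Some a \<or> Suc i < r \<and> f (r, c) = Some a" for r c a
    using level_row_None[OF lev, of r c] by (cases "Suc i < r") (auto simp: stack_def)
  have hc: "Suc i \<le> c" "c \<le> n" if "h c = Some a" for c a using h(1)[of c] that by auto
  have fc: "r \<le> c" "c \<le> n" if "f (r, c) = Some a" for r c a using D(1) that by (auto simp: bounded_cols_def)
  show ?thesis
  proof (rule okI)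
    show "bounded_cols n ?f" unfolding bounded_cols_def
      using f hc fc by (metis not_None_eq)
    show "dom ?f \<inter> {} = {}" by simp
    show "dom ?f \<inter> inner (Suc i) (Suc i) = {}" using f hc by (fastforce simp: inner_def)
    show "(r', c') \<in> dom ?f \<union> {} \<union> inner (Suc i) (Suc i)"
      if "(r, c) \<in> dom ?f \<union> {}" "r' \<le> r" "r' \<le> c'" "c' \<le> c" for r c r' c'
    proof -
      have cn: "c \<le> n" using that(1) f hc fc by auto
      consider "r' \<le> i" | "r' = Suc i" | "Suc i < r'" by linarith
      then show ?thesis
      proof cases
        case 1 then show ?thesis by (simp add: inner_def)
      next
        case 2
        then have "h c' \<noteq> None" using h(1)[of c'] that cn by simp
        then show ?thesis using 2 f by auto
      next
        case 3
        then have "(r, c) \<in> dom f \<union> {}" using that f by auto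
        from D(4)[OF this that(2-4)] 3 that have "(r', c') \<in> dom f" by (auto simp: inner_def)
        then show ?thesis using 3 f by auto
      qed
    qed
    show "a < b" if "?f (r, c) = Some a" "?f (r', c') = Some b" "r \<le> r'" "c \<le> c'"
      "(r, c) \<noteq> (r', c')" for r c r' c' a b
    proof -
      have "Suc i \<le> r" using f[of r c a] that(1) by auto
      then consider "r = Suc i" "r' = Suc i" | "r = Suc i" "Suc i < r'" | "Suc i < r" "Suc i < r'"
        using \<open>r \<le> r'\<close> by linarith
      then show ?thesis
      proof cases
        case 1 then show ?thesis using that f h(2)[of c a c' b] by auto
      next
        case 2 then show ?thesis using that f big[of b c a] by (auto intro: ranI)
      next
        case 3 then show ?thesis using that f D(5)[of r c a r' c' b] by auto
      qed
    qed
    show "finite (?E k)" for k using D(6) by auto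
    show "a < s" if "s \<in> ?E k" "?f (r, c) = Some a" "c \<le> k" for k s r c a
    proof -
      have c: "Suc i \<le> c" using that f hc fc by (metis le_trans less_imp_le)
      then have k: "i < k" using that by simp
      show ?thesis
      proof (cases "s \<in> E k")
        case True
        then show ?thesis using that f k big[of s c a] D(7)[OF True, of r c a] by auto
      next
        case False
        \<comment> \<open>On the edge of row i+1 the new label has only the entry of row i+1 in
          column i+1 to its west, and the premise on l compares it with that entry.\<close>
        then have "k = Suc i" "s = e" "\<forall>a. h (Suc i) = Some a \<longrightarrow> a < e"
          using that l k by (auto split: if_splits)
        moreover from this have "c = Suc i" using c that by simp
        moreover from this have "r = Suc i" using that f fc[of r c a] by auto
        ultimately show ?thesis using that f by auto
      qed
    qed
    show "0 < k \<and> k \<le> n \<and> (k, k) \<in> dom ?f \<union> {} \<union> inner (Suc i) (Suc i)" if "?E k \<noteq> {}" for k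
    proof -
      have kk: "0 < k \<and> k \<le> n" using that D(8)[of k] l i by (auto split: if_splits)
      consider "k \<le> i" | "k = Suc i" | "Suc i < k" by linarith
      then show ?thesis
      proof cases
        case 1 then show ?thesis using kk by (simp add: inner_def)
      next
        case 2
        then have "h k \<noteq> None" using h(1)[of k] kk by simp
        then show ?thesis using 2 kk f by auto
      next
        case 3
        then have "E k \<noteq> {}" using that l by (auto split: if_splits)
        from D(8)[OF this] 3 have "(k, k) \<in> dom f" by (auto simp: inner_def)
        then show ?thesis using 3 kk f by auto
      qed
    qed
    show "p = q" if "?f p = Some a" "?f q = Some a" for p q a
    proof -
      obtain r c r' c' where p: "p = (r, c)" "q = (r', c')" by (cases p, cases q)
      have hi: "c = c'" if "h c = Some a" "h c' = Some a" for c c'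
        using h(2)[of c a c' a] h(2)[of c' a c a] that by (cases c c' rule: linorder_cases) auto
      have hf: False if "h c = Some a" "f x = Some a" for c x using big[of a c a] that by (auto intro: ranI)
      show ?thesis using that p f hi[of c c'] hf[of c q] hf[of c' p] D(9)[of p a q] by auto
    qed
    show "k = k'" if "s \<in> ?E k" "s \<in> ?E k'" for k k' s
      using that D(10)[of s k k'] e(3) by (auto split: if_splits)
    show "a \<notin> ?E k" if "?f p = Some a" for p k a
    proof -
      obtain r c where p: "p = (r, c)" by force
      have "a \<noteq> e" using that f e p by (auto intro: ranI)
      moreover have "a \<notin> E k"
      proof
        assume aE: "a \<in> E k"
        have "h c = Some a \<or> f p = Some a" using that p f by auto
        then show False
        proof
          assume h: "h c = Some a"
          show False
          proof (cases "k \<le> i")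
            case True
            then show False using small[OF True aE, of c] h by simp
          next
            case False
            then have "\<exists>k>i. a \<in> E k" using aE not_le by blast
            then show False using big[of a c a] h by blast
          qed
        qed (use D(11)[of p a k] aE in blast)
      qed
      ultimately show ?thesis by auto
    qed
  qed
qed

text \<open>The two ways of undoing the slides of row i: the new label came from the diagonal edge of row i
  (first place of the row) or from the one of row i+1 (second place).\<close>

definition unslide_first :: "nat \<Rightarrow> filling \<Rightarrow> filling \<times> (nat \<Rightarrow> nat set) \<Rightarrow> filling \<times> (nat \<Rightarrow> nat set)"
  where "unslide_first i f' = (\<lambda>(f, E).
    (stack (Suc i) (\<lambda>c. if i < c then f' (i, c) else None) f, E(i := insert (the (f' (i, i))) (E i))))"

definition unslide_second :: "nat \<Rightarrow> filling \<Rightarrow> filling \<times> (nat \<Rightarrow> nat set) \<Rightarrow> filling \<times> (nat \<Rightarrow> nat set)"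
  where "unslide_second i f' = (\<lambda>(f, E).
    (stack (Suc i) (\<lambda>c. if c = Suc i then f' (i, i) else if i < c then f' (i, c) else None) f,
     E(Suc i := insert (the (f' (i, Suc i))) (E (Suc i)))))"

context
  fixes n i m f' E' f E
  assumes lev': "level n i f' E'" and i: "0 < i" "i < n" and ss: "superstd n i (Suc m) f'"
    and lev: "level n (Suc (Suc i)) f E"
    and run: "row_slides n (Suc i) (n - i) (f, E) = (below i f', E')"
begin

text \<open>For \<open>unslide_big\<close>: such a label ends up in a lower row of the result or
  stays on an edge right of i. In the second case it exceeds the label of its diagonal box, which
  lies in a lower row. The order of the rows of f' then makes it larger than row i.\<close>

lemma unslide_edge_below: "k < Suc i \<Longrightarrow> E k = E' k"
  and unslide_big: "x \<in> ran f \<or> (\<exists>k>i. x \<in> E k) \<Longrightarrow> f' (i, c) = Some a \<Longrightarrow> a < x"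
proof -
  have ks: "Suc i \<le> n" "n - i \<le> Suc n - Suc i" "Suc n - (n - i) = Suc i" using i by auto
  note G = row_slides_ok[OF lev ks(1,2) run, unfolded ks(3)]
  show *: "E k = E' k" if "k < Suc i" for k using G that by simp
  show "a < x" if "x \<in> ran f \<or> (\<exists>k>i. x \<in> E k)" "f' (i, c) = Some a"
  proof -
    have "x \<in> ran (below i f') \<or> (\<exists>k>i. x \<in> E' k)" using that(1)
    proof
      assume "x \<in> ran f" then show ?thesis using G by blast
    next
      assume "\<exists>k>i. x \<in> E k"
      then obtain k where k: "k > i" "x \<in> E k" by blast
      then have "x \<in> rest_labels f E" by (auto simp: rest_labels_def)
      then have "x \<in> ran (below i f') \<or> (\<exists>l. x \<in> E' l)" using G by (auto simp: rest_labels_def)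
      then show ?thesis
      proof
        assume "\<exists>l. x \<in> E' l"
        then obtain l where l: "x \<in> E' l" by blast
        then have "x \<in> E l" using G by blast
        then have "l = k" using okD(10)[OF lev] k(2) by blast
        then show ?thesis using l k by blast
      qed simp
    qed
    then show ?thesis
    proof
      assume "x \<in> ran (below i f')"
      then obtain r c' where "f' (r, c') = Some x" "i < r" by (auto simp: ran_def below_def split: if_splits)
      then show ?thesis using superstdD(2)[OF ss that(2)] by blast
    next
      assume "\<exists>k>i. x \<in> E' k"
      then obtain k where k: "i < k" "x \<in> E' k" by blast
      then have "(k, k) \<in> dom f'" using okD(8)[OF lev', of k] by (auto simp: inner_def)
      then obtain w where w: "f' (k, k) = Some w" by auto
      then have "a < w" using superstdD(2)[OF ss that(2)] k by blast
      also have "w < x" using okD(7)[OF lev' k(2) w] by simp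
      finally show ?thesis .
    qed
  qed
qed

lemma unslide_row: "f' (i, c) \<noteq> None \<longleftrightarrow> i \<le> c \<and> c \<le> n"
  using superstdD(1)[OF ss, of i c] by simp

lemma unslide_row_mono: "f' (i, c) = Some a \<Longrightarrow> f' (i, c') = Some b \<Longrightarrow> c < c' \<Longrightarrow> a < b"
  using okD(5)[OF lev', of i c a i c' b] by simp

lemma unslide_small: "k \<le> i \<Longrightarrow> x \<in> E k \<Longrightarrow> f' (i, c) \<noteq> Some x"
  using unslide_edge_below[of k] okD(11)[OF lev', of "(i, c)" x k] by auto

lemma unslide_new: "f' (i, c) = Some e \<Longrightarrow> e \<notin> ran f" "f' (i, c) = Some e \<Longrightarrow> e \<notin> E k"
  using unslide_big[of e c e] unslide_small[of k e c] by (blast, metis less_irrefl not_le)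

lemma stack_below: "(\<And>c. h c = f' (i, c)) \<Longrightarrow> stack i h (below i f') = f'"
  using level_row_None[OF lev'] by (force simp: stack_def below_def fun_eq_iff not_less le_less)

text \<open>Put on the edge of row i, the first label e of the row is the minimum there, since a
  diagonal box is smaller than its edge, and it is smaller than the rest of the row. So the diagonal
  bullet takes it.\<close>

lemma unslide_first_level:
  "case unslide_first i f' (f, E) of (h, D) \<Rightarrow> level n (Suc i) h D \<and> row_slides n i (Suc n - i) (h, D) = (f', E')"
proof -
  have ks: "Suc i \<le> n" "n - i \<le> Suc n - Suc i" "Suc n - (n - i) = Suc i" "i < Suc n - (n - i)" using i by auto
  obtain e where e: "f' (i, i) = Some e" using unslide_row[of i] i by auto
  let ?h = "\<lambda>c. if i < c then f' (i, c) else None"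
  let ?f = "stack (Suc i) ?h f" and ?E = "E(i := insert e (E i))"
  have lev1: "level n (Suc i) ?f ?E"
  proof (rule level_stack[OF lev i(2)])
    show "?h c \<noteq> None \<longleftrightarrow> Suc i \<le> c \<and> c \<le> n" for c using unslide_row[of c] by auto
    show "a < b" if "?h c = Some a" "?h c' = Some b" "c < c'" for c c' a b
      using that unslide_row_mono by (auto split: if_splits)
    show "a < x" if "x \<in> ran f \<or> (\<exists>k>i. x \<in> E k)" "?h c = Some a" for x a c
      using that unslide_big by (auto split: if_splits)
    show "?h c \<noteq> Some x" if "k \<le> i" "x \<in> E k" for k x c using unslide_small[OF that] by simp
    show "?h c \<noteq> Some e" for c using unslide_row_mono[OF e, of c e] by auto
    show "e \<notin> ran f" "e \<notin> E k" for k using unslide_new[OF e] by auto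
  qed (use i in simp)
  have full: "?f (Suc i, n) \<noteq> None" using unslide_row[of n] i by (simp add: stack_def)
  have bf: "below (Suc i) ?f = f" unfolding below_stack using below_level[OF lev] .
  let ?D = "E'(i := insert e (E i))"
  have "row_slides n (Suc i) (n - i) (f, ?E) = (below i f', ?D)"
    by (rule row_slides_edge_update[OF lev ks(1,2) run ks(4)])
  then have almost: "row_slides n i (Suc n - i) (?f, ?E) =
    slide i i (stack i (\<lambda>c. if i < c then ?f (Suc i, c) else None) (below i f')) ?D"
    using row_slides_almost[OF lev1 i(2) full] unfolding bf by blast
  have Ei: "E i = E' i" using unslide_edge_below[of i] by simp
  have min: "Min (?D i) = e"
  proof (rule Min_eqI)
    show "finite (?D i)" using okD(6)[OF lev] by simp
    show "e \<le> x" if "x \<in> ?D i" for x using that okD(7)[OF lev' _ e, of x i] Ei by auto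
  qed simp
  let ?g = "\<lambda>c. if i < c then ?f (Suc i, c) else None"
  have g: "?g c = (if i < c then f' (i, c) else None)" for c by (simp add: stack_def)
  have "slide i i (stack i ?g (below i f')) ?D = (stack i (?g(i \<mapsto> Min (?D i))) (below i f'), ?D(i := ?D i - {Min (?D i)}))"
  proof (rule slide_stack_edge)
    show "?D i \<noteq> {}" by simp
    show "Min (?D i) < a" if "?g (Suc i) = Some a" for a
      using that unslide_row_mono[OF e, of "Suc i" a] unfolding min g by simp
  qed
  also have "stack i (?g(i \<mapsto> Min (?D i))) (below i f') = f'"
  proof (rule stack_below)
    show "(?g(i \<mapsto> Min (?D i))) c = f' (i, c)" for c
      using e unslide_row[of c] unfolding min by (auto simp: stack_def)
  qed
  also have "?D(i := ?D i - {Min (?D i)}) = E'"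
    using unslide_new(2)[OF e, of i] Ei unfolding min by (auto simp: fun_eq_iff)
  finally have "row_slides n i (Suc n - i) (?f, ?E) = (f', E')" unfolding almost .
  with lev1 show ?thesis unfolding unslide_first_def e option.sel prod.case by (rule conjI)
qed

text \<open>With y on the edge of row i+1, the last slide of row i+1 takes y. The bullet of row i
  refuses its own edge, whose labels exceed e, moves e west and finds y below it, smaller than the
  right neighbour. Lifting y leaves the lower rows as if y had never been there.\<close>

lemma unslide_second_level:
  "case unslide_second i f' (f, E) of (h, D) \<Rightarrow> level n (Suc i) h D \<and> row_slides n i (Suc n - i) (h, D) = (f', E')"
proof -
  let ?k = "n - Suc i"
  have ks: "Suc i \<le> n" "?k \<le> Suc n - Suc i" "Suc n - ?k = Suc (Suc i)" "n - i = Suc ?k" "n - ?k = Suc i"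
    using i by auto
  obtain e where e: "f' (i, i) = Some e" using unslide_row[of i] i by auto
  obtain y where y: "f' (i, Suc i) = Some y" using unslide_row[of "Suc i"] i by auto
  have ey: "e < y" using unslide_row_mono[OF e y] by simp
  let ?h = "\<lambda>c. if c = Suc i then f' (i, i) else if i < c then f' (i, c) else None"
  let ?f = "stack (Suc i) ?h f" and ?E = "E(Suc i := insert y (E (Suc i)))"
  have hc: "\<exists>c'. f' (i, c') = Some x \<and> c' \<noteq> Suc i" if "?h c = Some x" for c x
    using that by (auto split: if_splits)
  have lev1: "level n (Suc i) ?f ?E"
  proof (rule level_stack[OF lev i(2)])
    show "?h c \<noteq> None \<longleftrightarrow> Suc i \<le> c \<and> c \<le> n" for c using unslide_row[of c] e i by auto
    show "a < b" if "?h c = Some a" "?h c' = Some b" "c < c'" for c c' a b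
      using that unslide_row_mono[of i a c' b] unslide_row_mono[of c a c' b] by (auto split: if_splits)
    show "a < x" if "x \<in> ran f \<or> (\<exists>k>i. x \<in> E k)" "?h c = Some a" for x a c
      using hc[OF that(2)] unslide_big[OF that(1)] by blast
    show "?h c \<noteq> Some x" if "k \<le> i" "x \<in> E k" for k x c
      using hc[of c x] unslide_small[OF that] by blast
    show "?h c \<noteq> Some y" for c
    proof
      assume "?h c = Some y"
      from hc[OF this] obtain c' where "f' (i, c') = Some y" "c' \<noteq> Suc i" by blast
      then show False using okD(9)[OF lev' y, of "(i, c')"] by simp
    qed
    show "y \<notin> ran f" "y \<notin> E k" for k using unslide_new[OF y] by auto
  qed (use e ey in simp)
  have full: "?f (Suc i, n) \<noteq> None" using unslide_row[of n] i e by (simp add: stack_def)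
  have bf: "below (Suc i) ?f = f" unfolding below_stack using below_level[OF lev] .
  obtain g1 D1 where g1D: "row_slides n (Suc i) ?k (f, E) = (g1, D1)" by force
  note G1 = row_slides_ok[OF lev ks(1,2) g1D, unfolded ks(3)]
  have ok1: "ok n (Suc i) (Suc (Suc i)) {} g1 D1" using G1 by simp
  have sl: "slide (Suc i) (Suc i) g1 D1 = (below i f', E')" using run g1D ks by simp
  have D1: "D1 k = E k" if "k < Suc (Suc i)" for k using G1 that by simp
  let ?D = "D1(Suc i := insert y (E (Suc i)))"
  have run1: "row_slides n (Suc i) ?k (f, ?E) = (g1, ?D)"
    by (rule row_slides_edge_update[OF lev ks(1,2) g1D]) (use ks in simp)
  have ybig: "y < x" if "x \<in> ran f \<or> (\<exists>k>i. x \<in> E k)" for x using unslide_big[OF that y] .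
  have min: "Min (?D (Suc i)) = y"
  proof (rule Min_eqI)
    show "finite (?D (Suc i))" using okD(6)[OF lev] by simp
    show "y \<le> x" if "x \<in> ?D (Suc i)" for x
    proof (cases "x = y")
      case False
      then have "x \<in> E (Suc i)" using that by simp
      then show ?thesis using ybig[of x] by (meson lessI less_imp_le)
    qed simp
  qed simp
  have te: "takes_edge (Suc i) (Suc i) g1 ?D"
  proof -
    have "y < a" if "g1 (Suc i, Suc (Suc i)) = Some a" for a
    proof -
      have "a \<in> ran g1" using that by (rule ranI)
      then have "a \<in> ran f \<union> (\<Union>k\<in>{Suc (Suc i)..}. E k)" using G1 subsetD by (elim conjE)
      then have "a \<in> ran f \<or> (\<exists>k\<ge>Suc (Suc i). a \<in> E k)" by auto
      then show ?thesis using ybig[of a] by (meson Suc_lessD less_eq_Suc_le)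
    qed
    then show ?thesis unfolding takes_edge_def min by simp
  qed
  let ?gy = "g1((Suc i, Suc i) \<mapsto> y)"
  have "?D(Suc i := ?D (Suc i) - {y}) = D1"
    using unslide_new(2)[OF y, of "Suc i"] D1[of "Suc i"] by (auto simp: fun_eq_iff)
  then have "slide (Suc i) (Suc i) g1 ?D = (?gy, D1)"
    using slide_edge[OF te] unfolding min by simp
  then have run2: "row_slides n (Suc i) (n - i) (f, ?E) = (?gy, D1)"
    using run1 ks by (simp del: fun_upd_apply)
  have almost: "row_slides n i (Suc n - i) (?f, ?E) =
    slide i i (stack i (\<lambda>c. if i < c then ?f (Suc i, c) else None) ?gy) D1"
    using row_slides_almost[OF lev1 i(2) full] run2 unfolding bf by blast
  let ?g = "\<lambda>c. if i < c then ?f (Suc i, c) else None"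
  have g: "?g c = (if i < c then ?h c else None)" for c by (simp add: stack_def)
  have g1n: "g1 (Suc i, c) = None" if "c \<le> Suc i" for c using okD(3)[OF ok1] that by (auto simp: inner_def)
  have "slide i i (stack i ?g ?gy) D1 = slide i (Suc i) (stack i (?g(i \<mapsto> e, Suc i := None)) ?gy) D1"
  proof (rule slide_stack_east)
    show "?g (Suc i) = Some e" using e by (simp add: stack_def)
    show "\<not> Min (D1 i) < e" if "D1 i \<noteq> {}"
    proof -
      have "D1 i = E' i" using D1[of i] unslide_edge_below[of i] by simp
      moreover have "Min (D1 i) \<in> D1 i" using Min_in[OF okD(6)[OF ok1] that] .
      ultimately show ?thesis using okD(7)[OF lev' _ e, of "Min (D1 i)" i] by simp
    qed
    show "?gy (Suc i, i) = None" using g1n[of i] by simp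
  qed
  also have "\<dots> = (stack i (?g(i \<mapsto> e, Suc i := None, Suc i \<mapsto> y)) (below i f'), E')"
  proof (rule slide_stack_south[where n = n])
    show "?gy (Suc i, Suc i) = Some y" by simp
    show "y < a" if "(?g(i \<mapsto> e, Suc i := None)) (Suc (Suc i)) = Some a" for a
      using that unslide_row_mono[OF y, of "Suc (Suc i)" a] by (simp add: stack_def)
    have gg: "?gy((Suc i, Suc i) := None) = g1" using g1n[of "Suc i"] by (auto simp: fun_eq_iff)
    show "bounded_cols n (?gy((Suc i, Suc i) := None))" unfolding gg by (rule okD(1)[OF ok1])
    show "slide (Suc i) (Suc i) (?gy((Suc i, Suc i) := None)) D1 = (below i f', E')" unfolding gg by (rule sl)
  qed (use ks in simp)
  also have "stack i (?g(i \<mapsto> e, Suc i := None, Suc i \<mapsto> y)) (below i f') = f'"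
  proof (rule stack_below)
    show "(?g(i \<mapsto> e, Suc i := None, Suc i \<mapsto> y)) c = f' (i, c)" for c
      using e y unslide_row[of c] by (auto simp: stack_def)
  qed
  finally have "row_slides n i (Suc n - i) (?f, ?E) = (f', E')" unfolding almost .
  with lev1 show ?thesis unfolding unslide_second_def y option.sel prod.case by (rule conjI)
qed

end

section \<open>Counting tableaux\<close>

definition row_fiber :: "nat \<Rightarrow> nat \<Rightarrow> filling \<times> (nat \<Rightarrow> nat set) \<Rightarrow> (filling \<times> (nat \<Rightarrow> nat set)) set"
  where "row_fiber n i s = {(f, E). level n (Suc i) f E \<and> row_slides n i (Suc n - i) (f, E) = s}"

text \<open>Slides only remove labels from edges. If no label has entered a box, conservation gives
  equal unions, and disjointness then makes each edge set equal.\<close>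

lemma edges_eqI:
  fixes D E :: "nat \<Rightarrow> nat set"
  assumes "\<And>l. D l \<subseteq> E l" "(\<Union>l. E l) \<subseteq> (\<Union>l. D l)" "\<And>k l s. s \<in> E k \<Longrightarrow> s \<in> E l \<Longrightarrow> k = l"
  shows "D = E"
proof (rule ext)
  fix l
  have "x \<in> D l" if "x \<in> E l" for x
  proof -
    have "x \<in> (\<Union>l. E l)" using that by blast
    then have "x \<in> (\<Union>l. D l)" by (rule subsetD[OF assms(2)])
    then obtain k where k: "x \<in> D k" by blast
    have "x \<in> E k" by (rule subsetD[OF assms(1) k])
    then have "k = l" by (rule assms(3)[OF _ that])
    then show ?thesis using k by simp
  qed
  then show "D l = E l" using assms(1) by blast
qed

lemma level_empty_iff:
  "level n i Map.empty E \<longleftrightarrow> (\<forall>k. finite (E k)) \<and> (\<forall>k. E k \<noteq> {} \<longrightarrow> 0 < k \<and> k \<le> n \<and> k < i) \<and>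
    (\<forall>k l s. s \<in> E k \<longrightarrow> s \<in> E l \<longrightarrow> k = l)" (is "_ \<longleftrightarrow> ?R")
proof
  assume ok: "level n i Map.empty E"
  show ?R using okD(6)[OF ok] okD(8)[OF ok] okD(10)[OF ok] by (auto simp: inner_def)
next
  assume R: ?R
  show "level n i Map.empty E"
    by (rule okI) (use R in \<open>auto simp: inner_def bounded_cols_def\<close>)
qed

lemma level_top_empty:
  assumes "level n (Suc n) f E" shows "f = Map.empty"
proof (rule ext)
  fix p :: "nat \<times> nat"
  obtain r c where p: "p = (r, c)" by force
  show "f p = None"
  proof (rule ccontr)
    assume "f p \<noteq> None"
    then have "r \<le> c" "c \<le> n" "\<not> r < Suc n"
      using okD(1)[OF assms] level_row_None[OF assms] p by (auto simp: bounded_cols_def)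
    then show False by simp
  qed
qed

lemma ok_remove_edge_label:
  assumes "ok n i j X f E"
  shows "ok n i j X f (E(l := E l - Y))"
proof -
  note D = okD[OF assms]
  show ?thesis
  proof (rule okI)
    show "finite ((E(l := E l - Y)) k)" for k using D(6) by simp
    show "0 < k \<and> k \<le> n \<and> (k, k) \<in> dom f \<union> X \<union> inner i j" if "(E(l := E l - Y)) k \<noteq> {}" for k
    proof -
      have "E k \<noteq> {}" using that by (auto split: if_splits)
      then show ?thesis by (rule D(8))
    qed
    show "a < s" if "s \<in> (E(l := E l - Y)) k" "f (r, c) = Some a" "c \<le> k" for k s r c a
      using that D(7)[of s k r c a] by (auto split: if_splits)
    show "k = k'" if "s \<in> (E(l := E l - Y)) k" "s \<in> (E(l := E l - Y)) k'" for k k' s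
      using that D(10)[of s k k'] by (auto split: if_splits)
    show "a \<notin> (E(l := E l - Y)) k" if "f p = Some a" for p k a
      using that D(11)[of p a k] by (auto split: if_splits)
  qed (fact D(1) D(2) D(3) D(4) D(5) D(9))+
qed

text \<open>Labels never leave the boxes, so an empty result comes from an empty filling with the
  same edges. Conversely the edges from column i on are empty here, and the slides find nothing to
  take.\<close>

lemma row_fiber_empty:
  assumes lev: "level n i Map.empty E'" and i: "i \<le> n"
  shows "row_fiber n i (Map.empty, E') = {(Map.empty, E')}"
proof -
  have lev1: "level n (Suc i) Map.empty E'" using lev unfolding level_empty_iff by (meson less_SucI)
  have none: "E' l = {}" if "l \<ge> i" for l using lev that unfolding level_empty_iff by (meson not_le)
  obtain g D where gD: "row_slides n i (Suc n - i) (Map.empty, E') = (g, D)" by force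
  note G = row_slides_ok[OF lev1 i order_refl gD]
  have si: "Suc n - (Suc n - i) = i" using i by simp
  have "ran g \<subseteq> {}" using G none unfolding si by auto
  then have g: "g = Map.empty" by (auto simp: ran_def fun_eq_iff) (metis not_None_eq)
  have "D = E'"
  proof (rule edges_eqI)
    show "D l \<subseteq> E' l" for l using G by simp
    show "(\<Union>l. E' l) \<subseteq> (\<Union>l. D l)" using G g by (simp add: rest_labels_def)
  qed (rule okD(10)[OF lev])
  then have mem: "(Map.empty, E') \<in> row_fiber n i (Map.empty, E')"
    using lev1 gD g by (simp add: row_fiber_def)
  have "f = Map.empty \<and> E = E'" if "(f, E) \<in> row_fiber n i (Map.empty, E')" for f E
  proof -
    have lf: "level n (Suc i) f E" and rf: "row_slides n i (Suc n - i) (f, E) = (Map.empty, E')"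
      using that by (auto simp: row_fiber_def)
    note F = row_slides_ok[OF lf i order_refl rf]
    have "ran f \<subseteq> {}" using F by simp
    then have f: "f = Map.empty" by (auto simp: ran_def fun_eq_iff) (metis not_None_eq)
    have "E' = E"
    proof (rule edges_eqI)
      show "E' l \<subseteq> E l" for l using F by simp
      show "(\<Union>l. E l) \<subseteq> (\<Union>l. E' l)" using F f by (simp add: rest_labels_def)
    qed (rule okD(10)[OF lf])
    then show ?thesis using f by simp
  qed
  then show ?thesis using mem by auto
qed

text \<open>Row n has a single box, on the diagonal. Its label can only come from the edge below, so
  this row contributes no factor 2.\<close>

lemma row_fiber_bottom:
  assumes lev: "level n n f' E'" and n: "0 < n" and ss: "superstd n n (Suc 0) f'"
  shows "\<exists>E. row_fiber n n (f', E') = {(Map.empty, E)}"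
proof -
  obtain e where e: "f' (n, n) = Some e" using superstdD(1)[OF ss, of n n] by auto
  have f': "f' = [(n, n) \<mapsto> e]"
  proof (rule ext)
    fix p :: "nat \<times> nat"
    obtain r c where p: "p = (r, c)" by force
    show "f' p = [(n, n) \<mapsto> e] p"
    proof (cases "r = n \<and> c = n")
      case True
      then show ?thesis using e p by simp
    next
      case False
      then have "\<not> (n \<le> r \<and> r < n + Suc 0 \<and> r \<le> c \<and> c \<le> n)" by auto
      then have "f' (r, c) = None" using superstdD(1)[OF ss, of r c] by blast
      then show ?thesis using False p by simp
    qed
  qed
  note D = okD[OF lev]
  let ?E = "E'(n := insert e (E' n))"
  have eE: "e \<notin> E' k" for k using D(11)[OF e] .
  have lev1: "level n (Suc n) Map.empty ?E" unfolding level_empty_iff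
  proof (intro conjI allI impI)
    show "finite (?E k)" for k using D(6) by simp
    show "k = l" if "s \<in> ?E k" "s \<in> ?E l" for k l s using that D(10)[of s k l] eE by (auto split: if_splits)
    fix k assume "?E k \<noteq> {}"
    then have "k = n \<or> E' k \<noteq> {}" by (auto split: if_splits)
    then have "0 < k \<and> k \<le> n"
    proof
      assume "E' k \<noteq> {}"
      then show ?thesis using D(8) by blast
    qed (use n in simp)
    then show "0 < k" "k \<le> n" "k < Suc n" by auto
  qed
  have min: "Min (?E n) = e"
  proof (rule Min_eqI)
    show "finite (?E n)" using D(6)[of n] by simp
    show "e \<le> x" if "x \<in> ?E n" for x
    proof (cases "x = e")
      case False
      then have "x \<in> E' n" using that by simp
      then show ?thesis using D(7)[OF _ e, of x n] by simp
    qed simp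
  qed simp
  have one: "Suc n - n = Suc 0" by simp
  have "takes_edge n n Map.empty ?E" by (simp add: takes_edge_def)
  from slide_edge[OF this, unfolded min] have "slide n n Map.empty ?E = (f', E')"
    using eE[of n] f' by (auto simp: fun_eq_iff)
  then have mem: "(Map.empty, ?E) \<in> row_fiber n n (f', E')"
    using lev1 unfolding row_fiber_def one by (simp del: fun_upd_apply)
  have "f = Map.empty \<and> E = ?E" if "(f, E) \<in> row_fiber n n (f', E')" for f E
  proof -
    have lf: "level n (Suc n) f E" and rf: "slide n n f E = (f', E')"
      using that unfolding row_fiber_def one by auto
    have f: "f = Map.empty" by (rule level_top_empty[OF lf])
    have te: "takes_edge n n f E"
    proof (rule ccontr)
      assume "\<not> takes_edge n n f E"
      then have "slide n n f E = (f, E)" by (rule slide_stop) (simp_all add: f)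
      then show False using rf f f' by (metis fst_conv fun_upd_same option.distinct(1))
    qed
    from slide_edge[OF te] rf f have 1: "f' = [(n, n) \<mapsto> Min (E n)]" "E' = E(n := E n - {Min (E n)})" by auto
    then have "e = Min (E n)" using e by simp
    moreover have "Min (E n) \<in> E n" using te Min_in[OF okD(6)[OF lf]] by (auto simp: takes_edge_def)
    ultimately have "E = ?E" unfolding 1(2) by (auto simp: fun_eq_iff)
    then show ?thesis using f by simp
  qed
  then have all: "\<And>f E. (f, E) \<in> row_fiber n n (f', E') \<Longrightarrow> (f, E) = (Map.empty, ?E)" by blast
  have "row_fiber n n (f', E') \<subseteq> {(Map.empty, ?E)}"
  proof
    fix s assume "s \<in> row_fiber n n (f', E')"
    then have "s = (Map.empty, ?E)" by (rule all[of "fst s" "snd s", unfolded prod.collapse])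
    then show "s \<in> {(Map.empty, ?E)}" by (simp only: singleton_iff)
  qed
  moreover have "{(Map.empty, ?E)} \<subseteq> row_fiber n n (f', E')" using mem by (rule insert_subsetI) (rule empty_subsetI)
  ultimately show ?thesis by (intro exI[where x = ?E] equalityI)
qed

lemma row_fiber_split:
  assumes lev': "level n i f' E'" and i: "0 < i" "i < n" and ss: "superstd n i (Suc m) f'"
  shows "row_fiber n i (f', E') = unslide_first i f' ` row_fiber n (Suc i) (below i f', E') \<union>
    unslide_second i f' ` row_fiber n (Suc i) (below i f', E')"
proof (intro equalityI subsetI)
  fix s assume "s \<in> row_fiber n i (f', E')"
  then obtain f E where s: "s = (f, E)" and lev: "level n (Suc i) f E"
    and run: "row_slides n i (Suc n - i) (f, E) = (f', E')" by (auto simp: row_fiber_def)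
  have f0: "f (r, c) = None" if "r < Suc i \<or> c < Suc i" for r c
  proof (rule ccontr)
    assume "f (r, c) \<noteq> None"
    then have "r \<le> c" "\<not> r < Suc i"
      using okD(1)[OF lev] level_row_None[OF lev] by (auto simp: bounded_cols_def)
    then show False using that by simp
  qed
  have lb: "level n (Suc (Suc i)) (below (Suc i) f) (E(l := E l - Y))" for l Y
    by (rule ok_remove_edge_label[OF level_below[OF lev]])
  from row_step_forward[OF lev i(2) run ss]
  show "s \<in> unslide_first i f' ` row_fiber n (Suc i) (below i f', E') \<union>
    unslide_second i f' ` row_fiber n (Suc i) (below i f', E')"
  proof (elim disjE exE conjE)
    fix e
    assume e: "f' (i, i) = Some e" "e \<in> E i" "\<forall>c>i. f (Suc i, c) = f' (i, c)"
      and r: "row_slides n (Suc i) (n - i) (below (Suc i) f, E(i := E i - {e})) = (below i f', E')"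
    have "unslide_first i f' (below (Suc i) f, E(i := E i - {e})) = (f, E)"
      using e f0 by (auto simp: unslide_first_def stack_def below_def fun_eq_iff)
    moreover have "(below (Suc i) f, E(i := E i - {e})) \<in> row_fiber n (Suc i) (below i f', E')"
      using lb r unfolding row_fiber_def by (simp del: fun_upd_apply)
    ultimately show ?thesis unfolding s by (metis UnI1 imageI)
  next
    fix y
    assume y: "f' (i, Suc i) = Some y" "y \<in> E (Suc i)" "f (Suc i, Suc i) = f' (i, i)"
      "\<forall>c>Suc i. f (Suc i, c) = f' (i, c)"
      and r: "row_slides n (Suc i) (n - i) (below (Suc i) f, E(Suc i := E (Suc i) - {y})) = (below i f', E')"
    have "unslide_second i f' (below (Suc i) f, E(Suc i := E (Suc i) - {y})) = (f, E)"
      using y f0 by (auto simp: unslide_second_def stack_def below_def fun_eq_iff)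
    moreover have "(below (Suc i) f, E(Suc i := E (Suc i) - {y})) \<in> row_fiber n (Suc i) (below i f', E')"
      using lb r unfolding row_fiber_def by (simp del: fun_upd_apply)
    ultimately show ?thesis unfolding s by (metis UnI2 imageI)
  qed
next
  fix s assume "s \<in> unslide_first i f' ` row_fiber n (Suc i) (below i f', E') \<union>
    unslide_second i f' ` row_fiber n (Suc i) (below i f', E')"
  then obtain f E where fE: "s = unslide_first i f' (f, E) \<or> s = unslide_second i f' (f, E)"
    and lev: "level n (Suc (Suc i)) f E" and run: "row_slides n (Suc i) (n - i) (f, E) = (below i f', E')"
    by (auto simp: row_fiber_def)
  show "s \<in> row_fiber n i (f', E')"
    using fE unslide_first_level[OF lev' i ss lev run] unslide_second_level[OF lev' i ss lev run]
    by (auto simp: row_fiber_def)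
qed

lemma fun_upd_insert_inj:
  assumes eq: "E(k := insert e (E k)) = D(k := insert e (D k))" and "e \<notin> E k" "e \<notin> D k"
  shows "E = D"
proof (rule ext)
  fix l
  show "E l = D l"
  proof (cases "l = k")
    case True
    have "insert e (E k) = insert e (D k)" using fun_cong[OF eq, of k] by simp
    then show ?thesis using True assms(2,3) by (simp add: insert_ident)
  next
    case False
    then show ?thesis using fun_cong[OF eq, of l] by simp
  qed
qed

text \<open>The two families of preimages are disjoint: the first box of row i+1 holds the second
  entry of row i in one and the first entry in the other. Before the slides only the n - i rows i+1,
  ..., n are available, which caps the number of rows and ends the doubling.\<close>

lemma card_row_fiber:
  assumes "level n i f' E'" "0 < i" "i \<le> n" "superstd n i m f'" "m \<le> Suc n - i"
  shows "card (row_fiber n i (f', E')) = 2 ^ min m (n - i) \<and>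
    (\<forall>(f, E)\<in>row_fiber n i (f', E'). superstd n (Suc i) (min m (n - i)) f)"
  using assms
proof (induction m arbitrary: i f' E')
  case 0
  have "f' (r, c) = None" for r c
    using superstdD(1)[OF 0(4), of r c] by (metis add_0_right not_le)
  then have "f' = Map.empty" by (simp add: fun_eq_iff)
  then have "row_fiber n i (f', E') = {(Map.empty, E')}" using row_fiber_empty 0 by simp
  then show ?case by (simp add: superstd_def)
next
  case (Suc m)
  show ?case
  proof (cases "i = n")
    case True
    then have m: "m = 0" using Suc.prems by simp
    obtain E where "row_fiber n n (f', E') = {(Map.empty, E)}"
      using row_fiber_bottom[of n f' E'] Suc.prems True m by auto
    then show ?thesis using True m by (simp add: superstd_def)
  next
    case False
    then have i: "i < n" using Suc.prems by simp
    note P = Suc.prems(1,2) i Suc.prems(4)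
    let ?F = "row_fiber n (Suc i) (below i f', E')"
    have ss': "superstd n (Suc i) m (below i f')"
      using Suc.prems(4) unfolding superstd_def by (auto simp: below_def split: if_splits)
    have "card ?F = 2 ^ min m (n - Suc i) \<and>
      (\<forall>(f, E)\<in>?F. superstd n (Suc (Suc i)) (min m (n - Suc i)) f)"
      by (rule Suc.IH[OF level_below[OF Suc.prems(1)] _ _ ss']) (use i Suc.prems in auto)
    then have IH: "card ?F = 2 ^ min m (n - Suc i)"
      "\<And>f E. (f, E) \<in> ?F \<Longrightarrow> superstd n (Suc (Suc i)) (min m (n - Suc i)) f" by auto
    have fin: "finite ?F" using IH(1) by (metis card.infinite power_not_zero zero_neq_numeral)
    have F: "level n (Suc (Suc i)) f E" "row_slides n (Suc i) (n - i) (f, E) = (below i f', E')"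
      if "(f, E) \<in> ?F" for f E using that by (auto simp: row_fiber_def)
    obtain e where e: "f' (i, i) = Some e" using superstdD(1)[OF Suc.prems(4), of i i] i by auto
    obtain y where y: "f' (i, Suc i) = Some y" using superstdD(1)[OF Suc.prems(4), of i "Suc i"] i by auto
    have row: "f' (i, c) \<noteq> None \<longleftrightarrow> i \<le> c \<and> c \<le> n" for c
      using superstdD(1)[OF Suc.prems(4), of i c] by auto
    have ey: "e < y" using okD(5)[OF Suc.prems(1) e y] by simp
    have inj1: "inj_on (unslide_first i f') ?F"
    proof (rule inj_onI)
      fix s t assume st: "s \<in> ?F" "t \<in> ?F" "unslide_first i f' s = unslide_first i f' t"
      obtain f E g D where s: "s = (f, E)" "t = (g, D)" by (cases s, cases t)
      note fF = F[OF st(1)[unfolded s]] and gF = F[OF st(2)[unfolded s]]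
      note eqs = st(3)[unfolded s unslide_first_def prod.case e option.sel prod.inject]
      have "f = g"
        using arg_cong[OF conjunct1[OF eqs], of "below (Suc i)"]
        unfolding below_stack below_level[OF fF(1)] below_level[OF gF(1)] .
      moreover have "E = D"
        by (rule fun_upd_insert_inj[OF conjunct2[OF eqs]])
          (use unslide_new(2)[OF P fF e] unslide_new(2)[OF P gF e] in blast)+
      ultimately show "s = t" unfolding s by simp
    qed
    have inj2: "inj_on (unslide_second i f') ?F"
    proof (rule inj_onI)
      fix s t assume st: "s \<in> ?F" "t \<in> ?F" "unslide_second i f' s = unslide_second i f' t"
      obtain f E g D where s: "s = (f, E)" "t = (g, D)" by (cases s, cases t)
      note fF = F[OF st(1)[unfolded s]] and gF = F[OF st(2)[unfolded s]]
      note eqs = st(3)[unfolded s unslide_second_def prod.case y option.sel prod.inject]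
      have "f = g"
        using arg_cong[OF conjunct1[OF eqs], of "below (Suc i)"]
        unfolding below_stack below_level[OF fF(1)] below_level[OF gF(1)] .
      moreover have "E = D"
        by (rule fun_upd_insert_inj[OF conjunct2[OF eqs]])
          (use unslide_new(2)[OF P fF y] unslide_new(2)[OF P gF y] in blast)+
      ultimately show "s = t" unfolding s by simp
    qed
    have first_at: "fst (unslide_first i f' s) (Suc i, Suc i) = Some y" for s
      using y by (cases s) (simp add: unslide_first_def stack_def)
    have second_at: "fst (unslide_second i f' s) (Suc i, Suc i) = Some e" for s
      using e by (cases s) (simp add: unslide_second_def stack_def)
    have disj: "unslide_first i f' ` ?F \<inter> unslide_second i f' ` ?F = {}"
    proof -
      have "unslide_first i f' s \<noteq> unslide_second i f' t" for s t
        using first_at[of s] second_at[of t] ey by auto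
      then show ?thesis by blast
    qed
    have mn: "min (Suc m) (n - i) = Suc (min m (n - Suc i))" using i by simp
    have "card (row_fiber n i (f', E')) = card ?F + card ?F"
      unfolding row_fiber_split[OF P] using card_Un_disjoint[OF _ _ disj] fin
      by (simp add: card_image inj1 inj2)
    then have "card (row_fiber n i (f', E')) = 2 ^ min (Suc m) (n - i)" using IH(1) mn by simp
    moreover have "superstd n (Suc i) (Suc (min m (n - Suc i))) f"
      if "(f, E) \<in> row_fiber n i (f', E')" for f E
    proof -
      obtain g D where gD: "(g, D) \<in> ?F" and
        fE: "(f, E) = unslide_first i f' (g, D) \<or> (f, E) = unslide_second i f' (g, D)"
        using \<open>(f, E) \<in> row_fiber n i (f', E')\<close> unfolding row_fiber_split[OF P] by auto
      note big = unslide_big[OF P F[OF gD]]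
      note ssg = IH(2)[OF gD]
      \<comment> \<open>In both cases row i+1 of the preimage consists of entries of row i of the
        result, and everything below is larger, so the preimage is superstandard again.\<close>
      obtain h where f: "f = stack (Suc i) h g" and h1: "\<And>c. h c \<noteq> None \<longleftrightarrow> Suc i \<le> c \<and> c \<le> n"
        and h2: "\<And>c a. h c = Some a \<Longrightarrow> \<exists>c'. f' (i, c') = Some a"
      proof (rule disjE[OF fE])
        assume "(f, E) = unslide_first i f' (g, D)"
        then show thesis
          by (intro that[of "\<lambda>c. if i < c then f' (i, c) else None"])
            (use row in \<open>auto simp: unslide_first_def split: if_splits\<close>)
      next
        assume "(f, E) = unslide_second i f' (g, D)"
        then show thesis
          by (intro that[of "\<lambda>c. if c = Suc i then f' (i, i) else if i < c then f' (i, c) else None"])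
            (use row i in \<open>auto simp: unslide_second_def split: if_splits\<close>)
      qed
      have g0: "g (r, c) = None" if "r < Suc (Suc i)" for r c using level_row_None[OF F(1)[OF gD] that] .
      show ?thesis unfolding superstd_def
      proof (intro conjI allI impI)
        show "f (r, c) \<noteq> None \<longleftrightarrow> Suc i \<le> r \<and> r < Suc i + Suc (min m (n - Suc i)) \<and> r \<le> c \<and> c \<le> n" for r c
          using superstdD(1)[OF ssg, of r c] h1[of c] by (cases "r = Suc i") (auto simp: f stack_def)
        show "a < b" if "f (r, c) = Some a" "f (r', c') = Some b" "r < r'" for r c r' c' a b
        proof (cases "r = Suc i")
          case True
          then have "h c = Some a" "b \<in> ran g" using that by (auto simp: f stack_def intro: ranI)
          then show ?thesis using h2 big by blast
        next
          case False
          then have "g (r, c) = Some a" using that(1) by (simp add: f stack_def)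
          then have "Suc (Suc i) \<le> r" using g0[of r c] by (cases "r < Suc (Suc i)") auto
          then have "g (r', c') = Some b" using that by (simp add: f stack_def)
          then show ?thesis using superstdD(2)[OF ssg \<open>g (r, c) = Some a\<close>] that(3) by blast
        qed
      qed
    qed
    ultimately show ?thesis unfolding mn by auto
  qed
qed

section \<open>All rows together\<close>

primrec rows_slides :: "nat \<Rightarrow> nat \<Rightarrow> filling \<times> (nat \<Rightarrow> nat set) \<Rightarrow> filling \<times> (nat \<Rightarrow> nat set)"
  where
    "rows_slides n 0 s = s"
  | "rows_slides n (Suc k) s = row_slides n (n - k) (Suc k) (rows_slides n k s)"

definition preimages :: "nat \<Rightarrow> nat \<Rightarrow> filling \<times> (nat \<Rightarrow> nat set) \<Rightarrow> (nat \<Rightarrow> nat set) set"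
  where "preimages n k s = {E. level n (Suc n) Map.empty E \<and> rows_slides n k (Map.empty, E) = s}"

lemma rows_slides_level:
  assumes "level n (Suc n) Map.empty E" "k \<le> n" "rows_slides n k (Map.empty, E) = (f, D)"
  shows "level n (Suc n - k) f D \<and> rest_labels f D = (\<Union>l. E l)"
  using assms(2,3)
proof (induction k arbitrary: f D)
  case 0
  then show ?case using assms(1) by (auto simp: rest_labels_def)
next
  case (Suc k)
  obtain g C where gC: "rows_slides n k (Map.empty, E) = (g, C)" by force
  have IH: "level n (Suc n - k) g C" "rest_labels g C = (\<Union>l. E l)"
    using Suc.IH[OF _ gC] Suc.prems(1) by simp_all
  have k: "Suc n - k = Suc (n - k)" "n - k \<le> n" "Suc k \<le> Suc n - (n - k)" "Suc n - Suc k = n - k"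
    using Suc.prems(1) by auto
  have "row_slides n (n - k) (Suc k) (g, C) = (f, D)" using Suc.prems(2) gC by simp
  from row_slides_ok[OF IH(1)[unfolded k(1)] k(2,3) this] IH(2)
  show ?case unfolding k(4) by simp
qed

text \<open>Row n - l has l + 1 boxes up to column n and contributes 2^(min m l), with l = 0 for the
  bottom row. The cap changes m into min m k, but the rows below have l < k and do not
  notice.\<close>

lemma card_preimages:
  assumes "k \<le> n" "level n (Suc n - k) f E" "superstd n (Suc n - k) m f" "m \<le> k"
  shows "card (preimages n k (f, E)) = 2 ^ (\<Sum>l<k. min m l)"
  using assms
proof (induction k arbitrary: m f E)
  case 0
  have "f = Map.empty" using level_top_empty[of n f E] 0 by simp
  then have "preimages n 0 (f, E) = {E}" using 0 by (auto simp: preimages_def)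
  then show ?case by simp
next
  case (Suc k)
  define i where "i = n - k"
  have i: "Suc n - Suc k = i" "Suc n - k = Suc i" "0 < i" "i \<le> n" "Suc n - i = Suc k" "n - i = k" "k \<le> n"
    using Suc.prems(1) by (auto simp: i_def)
  note lev = Suc.prems(2)[unfolded i(1)] and ss = Suc.prems(3)[unfolded i(1)]
  let ?F = "row_fiber n i (f, E)"
  have F: "card ?F = 2 ^ min m k" "\<And>g D. (g, D) \<in> ?F \<Longrightarrow> superstd n (Suc i) (min m k) g"
    using card_row_fiber[OF lev i(3,4) ss] Suc.prems(4) unfolding i by auto
  have fin: "finite ?F" using F(1) by (metis card.infinite power_not_zero zero_neq_numeral)
  have c: "card (preimages n k s) = 2 ^ (\<Sum>l<k. min m l)" if s: "s \<in> ?F" for s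
  proof -
    obtain g D where gD: "s = (g, D)" by force
    have "card (preimages n k (g, D)) = 2 ^ (\<Sum>l<k. min (min m k) l)"
      by (rule Suc.IH[OF i(7)]) (use s gD F(2) in \<open>auto simp: row_fiber_def i\<close>)
    moreover have "(\<Sum>l<k. min (min m k) l) = (\<Sum>l<k. min m l)" by (rule sum.cong) auto
    ultimately show ?thesis using gD by simp
  qed
  have "preimages n (Suc k) (f, E) = (\<Union>s\<in>?F. preimages n k s)"
  proof (intro equalityI subsetI)
    fix D assume D: "D \<in> preimages n (Suc k) (f, E)"
    obtain g C where gC: "rows_slides n k (Map.empty, D) = (g, C)" by force
    have D1: "level n (Suc n) Map.empty D" "row_slides n i (Suc k) (g, C) = (f, E)"
      using D gC by (auto simp: preimages_def i_def)
    then have "(g, C) \<in> ?F"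
      using rows_slides_level[OF D1(1) i(7) gC] by (simp add: row_fiber_def i)
    moreover have "D \<in> preimages n k (g, C)" using D1(1) gC by (simp add: preimages_def)
    ultimately show "D \<in> (\<Union>s\<in>?F. preimages n k s)" by (rule UN_I)
  next
    fix D assume "D \<in> (\<Union>s\<in>?F. preimages n k s)"
    then obtain s where s: "s \<in> ?F" "D \<in> preimages n k s" by blast
    then have "row_slides n i (Suc k) s = (f, E)" by (auto simp: row_fiber_def i)
    then show "D \<in> preimages n (Suc k) (f, E)" using s(2) by (auto simp: preimages_def i_def)
  qed
  moreover have "card (\<Union>s\<in>?F. preimages n k s) = (\<Sum>s\<in>?F. card (preimages n k s))"
  proof (rule card_UN_disjoint[OF fin])
    show "\<forall>s\<in>?F. finite (preimages n k s)"
      using c by (metis card.infinite power_not_zero zero_neq_numeral)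
    show "\<forall>s\<in>?F. \<forall>t\<in>?F. s \<noteq> t \<longrightarrow> preimages n k s \<inter> preimages n k t = {}"
      by (auto simp: preimages_def)
  qed
  moreover have "(\<Sum>s\<in>?F. card (preimages n k s)) = card ?F * 2 ^ (\<Sum>l<k. min m l)"
    using c by simp
  ultimately show ?case using F(1) by (simp add: power_add[symmetric] add.commute)
qed

text \<open>A row of lam may extend beyond the columns that labels can reach. A slide that starts
  right of column n finds nothing to the right or below and ends at once.\<close>

lemma row_slides_skip:
  assumes bd: "bounded_cols n f" and rows: "\<And>c. f (i, c) = None" and i: "i \<le> n" "n \<le> M"
  shows "row_slides M i (M - n + k) (f, E) = row_slides n i k (f, E)"
proof (induction k)
  case 0
  have "row_slides M i k (f, E) = (f, E)" if "k \<le> M - n" for k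
    using that
  proof (induction k)
    case (Suc k)
    have "f (Suc i, M - k) = None" using bd Suc.prems unfolding bounded_cols_def
      by (metis Suc_le_lessD less_diff_conv less_diff_conv2 linorder_not_le nat_le_linear add.commute add_leD1)
    then have "slide i (M - k) f E = (f, E)"
      using Suc.prems i rows by (intro slide_stop) (auto simp: takes_edge_def)
    then show ?case using Suc by simp
  qed simp
  then show ?case by simp
next
  case (Suc k)
  have "M - (M - n + k) = n - k" using i by simp
  then show ?case using Suc by (simp split: prod.split)
qed

section \<open>Diagrams, corners and rectification\<close>

lemma diagram_snoc:
  "diagram (xs @ [x]) = diagram xs \<union> {Suc (length xs)} \<times> {Suc (length xs)..<Suc (length xs) + x}"
  by (auto simp: diagram_def nth_append le_Suc_eq split: if_splits)

lemma card_diagram: "card (diagram xs) = sum_list xs"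
proof -
  have "finite (diagram xs) \<and> card (diagram xs) = sum_list xs"
  proof (induction xs rule: rev_induct)
    case Nil
    have "diagram [] = {}" by (auto simp: diagram_def)
    then show ?case by simp
  next
    case (snoc x xs)
    have "diagram xs \<inter> {Suc (length xs)} \<times> {Suc (length xs)..<Suc (length xs) + x} = {}"
      by (auto simp: diagram_def)
    then show ?case using snoc by (simp add: diagram_snoc card_Un_disjoint)
  qed
  then show ?thesis ..
qed

lemma southmost_corner_snoc:
  "southmost_corner (diagram (xs @ [Suc t])) = (Suc (length xs), Suc (length xs) + t)"
proof -
  let ?S = "diagram (xs @ [Suc t])" and ?L = "Suc (length xs)"
  have row: "(?L, j) \<in> ?S \<longleftrightarrow> ?L \<le> j \<and> j \<le> ?L + t" for j by (auto simp: diagram_def)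
  have le: "fst c \<le> ?L" if "inner_corner ?S c" for c using that by (auto simp: inner_corner_def diagram_def)
  have c: "inner_corner ?S (?L, ?L + t)" by (auto simp: inner_corner_def row diagram_def)
  show ?thesis unfolding southmost_corner_def
  proof (rule the_equality)
    show "inner_corner ?S (?L, ?L + t) \<and> (\<forall>c'. inner_corner ?S c' \<longrightarrow> fst c' \<le> fst (?L, ?L + t))"
      using c le by simp
    fix d assume d: "inner_corner ?S d \<and> (\<forall>c'. inner_corner ?S c' \<longrightarrow> fst c' \<le> fst d)"
    then have "?L \<le> fst d" using c by fastforce
    then have "fst d = ?L" using le d by (meson le_antisym)
    then show "d = (?L, ?L + t)" using d row[of "snd d"] row[of "snd d + 1"]
      by (cases d) (auto simp: inner_corner_def)
  qed
qed

definition jdt_step :: "tableau \<Rightarrow> tableau"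
  where "jdt_step U = jdt (southmost_corner (inner_shape U)) U"

text \<open>The southmost corner walks west through the last row box by box, so rectification
  performs the slides in the order of \<open>row_slides\<close>. The row ends in column length xs +
  x.\<close>

lemma jdt_row:
  assumes "inner_shape T = diagram (xs @ [x])" "k \<le> x"
  shows "inner_shape ((jdt_step ^^ k) T) = diagram (xs @ [x - k]) \<and>
    (box_label ((jdt_step ^^ k) T), edge_labels ((jdt_step ^^ k) T)) =
      row_slides (length xs + x) (Suc (length xs)) k (box_label T, edge_labels T)"
  using assms(2)
proof (induction k)
  case 0
  then show ?case using assms(1) by simp
next
  case (Suc k)
  let ?U = "(jdt_step ^^ k) T"
  obtain t where t: "x - k = Suc t" "x - Suc k = t" using Suc.prems by (cases "x - k") auto
  have col: "length xs + x - k = Suc (length xs) + t" using t Suc.prems by simp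
  have IH: "inner_shape ?U = diagram (xs @ [Suc t])"
    "row_slides (length xs + x) (Suc (length xs)) k (box_label T, edge_labels T) = (box_label ?U, edge_labels ?U)"
    using Suc t by auto
  obtain f E where fE: "slide (Suc (length xs)) (Suc (length xs) + t) (box_label ?U) (edge_labels ?U) = (f, E)"
    by force
  have "jdt_step ?U = \<lparr>inner_shape = diagram (xs @ [Suc t]) - {(Suc (length xs), Suc (length xs) + t)},
      box_label = f, edge_labels = E\<rparr>"
    using fE unfolding jdt_step_def jdt_def IH(1) southmost_corner_snoc by simp
  moreover have "diagram (xs @ [Suc t]) - {(Suc (length xs), Suc (length xs) + t)} = diagram (xs @ [t])"
    unfolding diagram_snoc by (auto simp: diagram_def)
  ultimately show ?case using IH(2) fE col t by simp
qed

text \<open>In the shifted diagram the first bound says that every row reaches column length xs, so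
  that cutting off the columns beyond leaves a full staircase; the second says that no row ends
  right of the first one.\<close>

lemma strict_partition_nth:
  assumes "strict_partition xs" "j < length xs"
  shows "length xs - j \<le> xs ! j" "xs ! j + j \<le> xs ! 0"
proof -
  have step: "xs ! Suc i < xs ! i" if "Suc i < length xs" for i
    using assms(1) that by (auto simp: strict_partition_def sorted_wrt_iff_nth_less)
  have pos: "0 < xs ! i" if "i < length xs" for i
    using assms(1) that by (metis gr0I nth_mem strict_partition_def)
  show "length xs - j \<le> xs ! j" using assms(2)
  proof (induction "length xs - j" arbitrary: j)
    case (Suc d)
    show ?case
    proof (cases "Suc j < length xs")
      case True
      then have "length xs - Suc j \<le> xs ! Suc j" using Suc by simp
      then show ?thesis using step[OF True] by simp
    next
      case False
      then show ?thesis using pos[OF Suc.prems] Suc.prems by simp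
    qed
  qed simp
  show "xs ! j + j \<le> xs ! 0" using assms(2)
  proof (induction j)
    case (Suc j)
    then show ?case using step[of j] by simp
  qed simp
qed

lemma jdt_rows:
  assumes sp: "strict_partition lam" and n: "length lam = n"
    and T: "inner_shape T = diagram lam" "box_label T = Map.empty" "edge_labels T = E"
    and lev: "level n (Suc n) Map.empty E" and k: "k \<le> n"
  shows "inner_shape ((jdt_step ^^ sum_list (drop (n - k) lam)) T) = diagram (take (n - k) lam) \<and>
    (box_label ((jdt_step ^^ sum_list (drop (n - k) lam)) T),
     edge_labels ((jdt_step ^^ sum_list (drop (n - k) lam)) T)) = rows_slides n k (Map.empty, E)"
  using k
proof (induction k)
  case 0
  then show ?case using T n by simp
next
  case (Suc k)
  define L where "L = n - Suc k"
  have L: "L < n" "n - k = Suc L" "n - Suc k = L" "n = L + Suc k" using Suc.prems by (auto simp: L_def)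
  define U where "U = (jdt_step ^^ sum_list (drop (n - k) lam)) T"
  let ?x = "lam ! L"
  have x: "Suc k \<le> ?x" using strict_partition_nth(1)[OF sp, of L] L n by simp
  have tk: "take (n - k) lam = take L lam @ [?x]" "drop L lam = ?x # drop (n - k) lam" "length (take L lam) = L"
    using L n by (simp_all add: take_Suc_conv_app_nth Cons_nth_drop_Suc)
  have IH: "inner_shape U = diagram (take L lam @ [?x])"
    "(box_label U, edge_labels U) = rows_slides n k (Map.empty, E)"
    using Suc.IH Suc.prems unfolding U_def tk(1) by auto
  obtain f D where fD: "rows_slides n k (Map.empty, E) = (f, D)" by force
  have lev': "level n (Suc (Suc L)) f D"
    using rows_slides_level[OF lev _ fD] Suc.prems L by (simp add: Suc_diff_le)
  have skip: "row_slides (L + ?x) (Suc L) ?x (f, D) = row_slides n (Suc L) (Suc k) (f, D)"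
  proof -
    have "L + ?x - n + Suc k = ?x" using x L by simp
    moreover have "row_slides (L + ?x) (Suc L) (L + ?x - n + Suc k) (f, D) = row_slides n (Suc L) (Suc k) (f, D)"
      by (rule row_slides_skip[OF okD(1)[OF lev'] level_row_None[OF lev']]) (use x L in auto)
    ultimately show ?thesis by simp
  qed
  have f: "(jdt_step ^^ sum_list (drop (n - Suc k) lam)) T = (jdt_step ^^ ?x) U"
  proof -
    have "sum_list (drop (n - Suc k) lam) = ?x + sum_list (drop (n - k) lam)"
      unfolding L(3) tk(2) by (rule sum_list.Cons)
    then show ?thesis by (simp only: funpow_add comp_apply U_def)
  qed
  from jdt_row[OF IH(1), of ?x] have
    "inner_shape ((jdt_step ^^ ?x) U) = diagram (take L lam @ [0])"
    "(box_label ((jdt_step ^^ ?x) U), edge_labels ((jdt_step ^^ ?x) U)) = row_slides (L + ?x) (Suc L) ?x (f, D)"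
    using IH(2) fD unfolding tk(3) by simp_all
  moreover have "diagram (take L lam @ [0]) = diagram (take L lam)" unfolding diagram_snoc by simp
  moreover have "rows_slides n (Suc k) (Map.empty, E) = row_slides n (Suc L) (Suc k) (f, D)" using fD L by simp
  ultimately show ?case unfolding f by (simp only: L(3) skip simp_thms)
qed

lemma rectify_edge_only:
  assumes "strict_partition lam" "length lam = n" "level n (Suc n) Map.empty E"
    and "rows_slides n n (Map.empty, E) = (f, D)"
  shows "rectify \<lparr>inner_shape = diagram lam, box_label = Map.empty, edge_labels = E\<rparr> =
    \<lparr>inner_shape = {}, box_label = f, edge_labels = D\<rparr>"
proof -
  let ?T = "\<lparr>inner_shape = diagram lam, box_label = Map.empty, edge_labels = E\<rparr>"
  have "diagram [] = {}" by (auto simp: diagram_def)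
  then show ?thesis
    using jdt_rows[OF assms(1,2) _ _ _ assms(3), of ?T n] assms(4)
    unfolding rectify_def jdt_step_def[abs_def, symmetric] by (simp add: card_diagram)
qed

section \<open>Tableaux of shape lam/lam and their number\<close>

abbreviation std_box :: "nat list \<Rightarrow> filling"
  where "std_box mu \<equiv> box_label (superstandard mu)"

lemma std_box_eq:
  "std_box mu (i, j) = (if (i, j) \<in> diagram mu then Some (sum_list (take (i - 1) mu) + (j - i + 1)) else None)"
  by (simp add: superstandard_def)

text \<open>As slides conserve labels, this determines the label set of every tableau that rectifies
  to the superstandard one.\<close>

lemma ran_std_box: "ran (std_box mu) = {1..sum_list mu}"
proof (induction mu rule: rev_induct)
  case Nil
  have "diagram [] = {}" by (auto simp: diagram_def)
  then have "std_box [] = Map.empty" by (auto simp: superstandard_def)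
  then show ?case by simp
next
  case (snoc x xs)
  let ?L = "Suc (length xs)"
  have old: "std_box (xs @ [x]) (i, j) = std_box xs (i, j)" if "i \<noteq> ?L" for i j
  proof (cases "i - 1 \<le> length xs")
    case True
    then show ?thesis using that unfolding std_box_eq diagram_snoc by auto
  next
    case False
    then show ?thesis unfolding std_box_eq by (auto simp: diagram_def)
  qed
  have none: "std_box xs (?L, j) = None" for j unfolding std_box_eq by (auto simp: diagram_def)
  have new: "std_box (xs @ [x]) (?L, j) = (if ?L \<le> j \<and> j < ?L + x then Some (sum_list xs + (j - ?L + 1)) else None)" for j
    unfolding std_box_eq diagram_snoc by (auto simp: diagram_def)
  have "ran (std_box (xs @ [x])) = ran (std_box xs) \<union> {sum_list xs <.. sum_list xs + x}"
  proof (intro equalityI subsetI)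
    fix a assume "a \<in> ran (std_box (xs @ [x]))"
    then obtain i j where a: "std_box (xs @ [x]) (i, j) = Some a" by (auto simp: ran_def)
    show "a \<in> ran (std_box xs) \<union> {sum_list xs <.. sum_list xs + x}"
    proof (cases "i = ?L")
      case True
      then show ?thesis using a unfolding True new by (auto split: if_splits)
    next
      case False
      then show ?thesis using a old by (auto intro: ranI)
    qed
  next
    fix a assume "a \<in> ran (std_box xs) \<union> {sum_list xs <.. sum_list xs + x}"
    then show "a \<in> ran (std_box (xs @ [x]))"
    proof
      assume "a \<in> ran (std_box xs)"
      then obtain i j where a: "std_box xs (i, j) = Some a" by (auto simp: ran_def)
      moreover have "i \<noteq> ?L" using a none by auto
      ultimately show ?thesis using old by (metis ranI)
    next
      assume "a \<in> {sum_list xs <.. sum_list xs + x}"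
      then have "std_box (xs @ [x]) (?L, ?L + (a - sum_list xs - 1)) = Some a" unfolding new by auto
      then show ?thesis by (rule ranI)
    qed
  qed
  then show ?case using snoc by auto
qed

text \<open>Without labeled boxes the order conditions are void. What remains is the assignment of
  labels to diagonal edges, which is exactly an initial state of the slides.\<close>

lemma SELT_same_shape:
  assumes lam: "strict_partition lam"
  shows "SELT lam lam N = (\<lambda>E. \<lparr>inner_shape = diagram lam, box_label = Map.empty, edge_labels = E\<rparr>) `
    {E. level (length lam) (Suc (length lam)) Map.empty E \<and> (\<Union>l. E l) = {1..N}}"
    (is "_ = ?T ` ?X")
proof (intro equalityI subsetI)
  have diag: "(i, i) \<in> diagram lam \<longleftrightarrow> 0 < i \<and> i \<le> length lam" for i
  proof (cases "0 < i \<and> i \<le> length lam")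
    case True
    then have "i - 1 < length lam" by linarith
    from strict_partition_nth(1)[OF lam this] True have "0 < lam ! (i - 1)" by linarith
    then show ?thesis using True by (simp add: diagram_def)
  qed (auto simp: diagram_def)
  {
    fix T assume T: "T \<in> SELT lam lam N"
    let ?E = "edge_labels T"
    have dom: "dom (box_label T) = {}" using T by (simp add: SELT_def)
    then have eq: "T = ?T ?E" using T by (simp add: SELT_def)
    have sub: "\<forall>p. labels_at T p \<subseteq> {1..N}" and ex: "\<forall>k\<in>{1..N}. \<exists>!p. k \<in> labels_at T p"
      and d: "\<forall>i. ?E i \<noteq> {} \<longrightarrow> (i, i) \<in> diagram lam"
      using T by (simp_all add: SELT_def)
    have sub': "?E i \<subseteq> {1..N}" for i using sub[rule_format, of "Edge i"] by simp
    have "k = l" if "s \<in> ?E k" "s \<in> ?E l" for k l s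
    proof -
      have "s \<in> labels_at T (Edge k)" "s \<in> labels_at T (Edge l)" using that by auto
      moreover have "\<exists>!p. s \<in> labels_at T p" using ex sub' that by blast
      ultimately have "Edge k = Edge l" by blast
      then show ?thesis by simp
    qed
    moreover have "finite (?E i)" for i using sub' finite_subset by blast
    ultimately have "level (length lam) (Suc (length lam)) Map.empty ?E"
      unfolding level_empty_iff using d diag by auto
    moreover have "(\<Union>l. ?E l) = {1..N}"
    proof
      show "(\<Union>l. ?E l) \<subseteq> {1..N}" using sub' by blast
      show "{1..N} \<subseteq> (\<Union>l. ?E l)"
      proof
        fix k assume "k \<in> {1..N}"
        then obtain p where "k \<in> labels_at T p" using ex by blast
        then show "k \<in> (\<Union>l. ?E l)" using dom by (cases p) auto
      qed
    qed
    ultimately show "T \<in> ?T ` ?X" using eq by blast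
  next
    fix T assume "T \<in> ?T ` ?X"
    then obtain E where T: "T = ?T E" and lev: "level (length lam) (Suc (length lam)) Map.empty E"
      and U: "(\<Union>l. E l) = {1..N}" by blast
    have "\<exists>!p. k \<in> labels_at T p" if k: "k \<in> {1..N}" for k
    proof -
      obtain i where i: "k \<in> E i" using U k by blast
      show ?thesis
      proof (rule ex1I[of _ "Edge i"])
        show "k \<in> labels_at T (Edge i)" using i T by simp
        fix p assume p: "k \<in> labels_at T p"
        then show "p = Edge i" using i lev unfolding T level_empty_iff by (cases p) auto
      qed
    qed
    moreover have "labels_at T p \<subseteq> {1..N}" for p using U T by (cases p) auto
    moreover have "(i, i) \<in> diagram lam" if "E i \<noteq> {}" for i
      using lev that unfolding level_empty_iff diag by blast
    ultimately show "T \<in> SELT lam lam N" unfolding SELT_def by (simp add: T)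
  }
qed

lemma selt_count_same_shape:
  assumes lam: "strict_partition lam"
  shows "selt_count lam mu lam = card (preimages (length lam) (length lam) (std_box mu, \<lambda>_. {}))"
proof -
  let ?n = "length lam"
  let ?T = "\<lambda>E. \<lparr>inner_shape = diagram lam, box_label = Map.empty, edge_labels = E\<rparr>"
  have "{T \<in> SELT lam lam (sum_list mu). rectify T = superstandard mu} =
    ?T ` preimages ?n ?n (std_box mu, \<lambda>_. {})"
  proof -
    have rect: "rectify (?T E) = superstandard mu \<longleftrightarrow> rows_slides ?n ?n (Map.empty, E) = (std_box mu, \<lambda>_. {})"
      if "level ?n (Suc ?n) Map.empty E" for E
    proof -
      obtain f D where fD: "rows_slides ?n ?n (Map.empty, E) = (f, D)" by force
      show ?thesis unfolding rectify_edge_only[OF lam refl that fD] fD by (auto simp: superstandard_def)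
    qed
    have lab: "(\<Union>l. E l) = {1..sum_list mu}"
      if "level ?n (Suc ?n) Map.empty E" "rows_slides ?n ?n (Map.empty, E) = (std_box mu, \<lambda>_. {})" for E
      using rows_slides_level[OF that(1) order_refl that(2)] by (simp add: rest_labels_def ran_std_box)
    show ?thesis unfolding SELT_same_shape[OF lam] preimages_def using rect lab by blast
  qed
  moreover have "inj_on ?T A" for A by (rule inj_onI) simp
  ultimately show ?thesis unfolding selt_count_def by (simp add: card_image)
qed

text \<open>At n = m the sum is 0 + 1 + ... + (m - 1); each further step in n adds m to both
  sides.\<close>

lemma sum_min_eq:
  assumes "m \<le> n"
  shows "(\<Sum>l<n. min m l) = (n choose 2) - ((n - m) choose 2)"
proof -
  have "(\<Sum>l<n. min m l) + ((n - m) choose 2) = n choose 2"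
    using assms
  proof (induction n rule: dec_induct)
    case base
    have "(\<Sum>l<m. min m l) = (\<Sum>l<m. l)" by (rule sum.cong) auto
    then show ?case by (simp add: gauss_sum_nat[symmetric] choose_two lessThan_atLeast0 Sum_Ico_nat)
  next
    case (step k)
    then show ?case by (simp add: Suc_diff_le numeral_2_eq_2)
  qed
  then show ?thesis by simp
qed

text \<open>Containment bounds the parts of mu from below by those of rho; once the first part is at
  most n, strictness gives the same bound from above.\<close>

lemma rho_containment:
  assumes mu: "strict_partition mu" "length mu = m" and m: "m \<le> n" and sub: "diagram (rho n m) \<subseteq> diagram mu"
    and le: "m = 0 \<or> mu ! 0 \<le> n"
  shows "mu = rho n m"
proof (rule nth_equalityI)
  show "length mu = length (rho n m)" using mu by (simp add: rho_def)
  fix i assume i: "i < length mu"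
  then have rho: "rho n m ! i = n - i" using mu by (simp add: rho_def)
  have "(Suc i, n) \<in> diagram (rho n m)"
    using i mu m rho by (auto simp: diagram_def rho_def)
  then have "(Suc i, n) \<in> diagram mu" using sub by blast
  then have "n - i \<le> mu ! i" by (auto simp: diagram_def)
  moreover have "mu ! i + i \<le> n" using strict_partition_nth(2)[OF mu(1) i] le i mu by simp
  ultimately show "mu ! i = rho n m ! i" using rho by simp
qed

lemma std_box_rho:
  assumes m: "m \<le> n"
  shows "superstd n 1 m (std_box (rho n m))" "level n 1 (std_box (rho n m)) (\<lambda>_. {})"
proof -
  let ?f = "std_box (rho n m)"
  have dg: "(i, j) \<in> diagram (rho n m) \<longleftrightarrow> 1 \<le> i \<and> i \<le> m \<and> i \<le> j \<and> j \<le> n" for i j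
    using m by (auto simp: diagram_def rho_def)
  have f: "?f (i, j) = Some a \<longleftrightarrow> 1 \<le> i \<and> i \<le> m \<and> i \<le> j \<and> j \<le> n \<and>
      a = sum_list (take (i - 1) (rho n m)) + (j - i + 1)" for i j a
    unfolding std_box_eq dg by auto
  have rows: "a < b" if "?f (r, c) = Some a" "?f (r', c') = Some b" "r < r'" for r c r' c' a b
  proof -
    have r: "1 \<le> r" "r \<le> m" "r \<le> c" "c \<le> n" using that(1) unfolding f by auto
    have "take r (rho n m) = take (r - 1) (rho n m) @ [n - (r - 1)]"
      using r by (cases r) (auto simp: take_Suc_conv_app_nth rho_def)
    then have "sum_list (take r (rho n m)) = sum_list (take (r - 1) (rho n m)) + (n - (r - 1))" by simp
    moreover have "sum_list (take r (rho n m)) \<le> sum_list (take (r' - 1) (rho n m))"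
    proof -
      have d: "r' - 1 = r + (r' - 1 - r)" using that(3) by simp
      show ?thesis by (subst d) (simp add: take_add)
    qed
    moreover have "a = sum_list (take (r - 1) (rho n m)) + (c - r + 1)"
      "b = sum_list (take (r' - 1) (rho n m)) + (c' - r' + 1)" using that(1,2) unfolding f by blast+
    moreover have "c - r + 1 \<le> n - (r - 1)" using r by linarith
    ultimately show ?thesis by linarith
  qed
  show ss: "superstd n 1 m ?f" unfolding superstd_def
  proof (intro conjI allI impI)
    show "?f (r, c) \<noteq> None \<longleftrightarrow> 1 \<le> r \<and> r < 1 + m \<and> r \<le> c \<and> c \<le> n" for r c
      unfolding std_box_eq dg by auto
  qed (use rows in blast)
  have row: "a < b" if "?f (r, c) = Some a" "?f (r, c') = Some b" "c < c'" for r c c' a b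
    using that unfolding f by auto
  show "level n 1 ?f (\<lambda>_. {})"
  proof (rule okI)
    show "bounded_cols n ?f" using f by (auto simp: bounded_cols_def)
    show "dom ?f \<inter> inner 1 1 = {}" using f by (auto simp: inner_def)
    show "(r', c') \<in> dom ?f \<union> {} \<union> inner 1 1" if "(r, c) \<in> dom ?f \<union> {}" "r' \<le> r" "r' \<le> c'" "c' \<le> c"
      for r c r' c'
      using that superstdD(1)[OF ss, of r c] superstdD(1)[OF ss, of r' c'] by (cases "r' = 0") (auto simp: inner_def)
    show "a < b" if "?f (r, c) = Some a" "?f (r', c') = Some b" "r \<le> r'" "c \<le> c'" "(r, c) \<noteq> (r', c')"
      for r c r' c' a b
      using that rows[of r c a r' c' b] row[of r c a c' b] by (cases "r = r'") auto
    show "p = q" if "?f p = Some a" "?f q = Some a" for p q a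
    proof -
      obtain r c r' c' where p: "p = (r, c)" "q = (r', c')" by (cases p, cases q)
      show ?thesis
        using that rows[of r c a r' c' a] rows[of r' c' a r c a] row[of r c a c' a] row[of r c' a c a]
        unfolding p by (cases r r' rule: linorder_cases; cases c c' rule: linorder_cases) auto
    qed
  qed auto
qed

theorem selt_count_formula:
  assumes lam: "strict_partition lam" and mu: "strict_partition mu"
    and "length mu = m" "length lam = n" "m \<le> n" "diagram (rho n m) \<subseteq> diagram mu"
  shows "selt_count lam mu lam = (if mu = rho n m then 2 ^ ((n choose 2) - ((n - m) choose 2)) else 0)"
proof (cases "mu = rho n m")
  case True
  have "card (preimages n n (std_box mu, \<lambda>_. {})) = 2 ^ (\<Sum>l<n. min m l)"
    using card_preimages[of n n "std_box mu" "\<lambda>_. {}" m] std_box_rho[OF assms(5)] assms(5) True by simp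
  then show ?thesis using True selt_count_same_shape[OF lam] assms(4) sum_min_eq[OF assms(5)] by simp
next
  case False
  \<comment> \<open>Slides keep all labels in columns up to n, so a preimage would force mu_1 <= n
    and hence mu = rho n m.\<close>
  have "preimages n n (std_box mu, \<lambda>_. {}) = {}"
  proof (rule ccontr)
    assume "preimages n n (std_box mu, \<lambda>_. {}) \<noteq> {}"
    then obtain E where "level n (Suc n) Map.empty E" "rows_slides n n (Map.empty, E) = (std_box mu, \<lambda>_. {})"
      by (auto simp: preimages_def)
    then have "level n (Suc n - n) (std_box mu) (\<lambda>_. {})" using rows_slides_level by blast
    then have b: "bounded_cols n (std_box mu)" by (rule okD(1))
    have "m = 0 \<or> mu ! 0 \<le> n"
    proof (cases "m = 0")
      case False
      then have "0 < mu ! 0" using strict_partition_nth(1)[OF mu, of 0] assms(3) by simp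
      then have "(1, mu ! 0) \<in> diagram mu" using False assms(3) by (auto simp: diagram_def)
      then have "std_box mu (1, mu ! 0) \<noteq> None" by (simp add: std_box_eq)
      then show ?thesis using b by (auto simp: bounded_cols_def)
    qed simp
    then show False using rho_containment[OF mu assms(3,5,6)] False by blast
  qed
  then show ?thesis using False selt_count_same_shape[OF lam] assms(4) by simp
qed

section \<open>Pfaffians\<close>

definition matchings :: "nat \<Rightarrow> (nat \<Rightarrow> nat) set"
  where "matchings k = {\<pi>. \<pi> permutes {..<2 * k} \<and> (\<forall>i<k. \<pi> (2 * i) < \<pi> (2 * i + 1)) \<and>
    (\<forall>j<k. \<forall>i<j. \<pi> (2 * i) < \<pi> (2 * j))}"

lemma pfaffian_matchings:
  "pfaffian k A = (\<Sum>\<pi>\<in>matchings k. of_int (sign \<pi>) * (\<Prod>i<k. A (\<pi> (2 * i)) (\<pi> (2 * i + 1))))"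
  by (simp add: pfaffian_def matchings_def)

lemma matchings_less:
  assumes "\<pi> \<in> matchings k" "i < k"
  shows "\<pi> (2 * i) < \<pi> (2 * i + 1)" "\<pi> (2 * i + 1) < 2 * k"
proof -
  show "\<pi> (2 * i) < \<pi> (2 * i + 1)" using assms by (simp add: matchings_def)
  have "\<pi> permutes {..<2 * k}" using assms by (simp add: matchings_def)
  then have "\<pi> (2 * i + 1) \<in> {..<2 * k}" using assms(2) by (subst permutes_in_image) auto
  then show "\<pi> (2 * i + 1) < 2 * k" by simp
qed

lemma pfaffian_cong:
  assumes "\<And>a b. a < b \<Longrightarrow> b < 2 * k \<Longrightarrow> A a b = B a b"
  shows "pfaffian k A = pfaffian k B"
  unfolding pfaffian_matchings
proof (rule sum.cong[OF refl])
  fix \<pi> assume "\<pi> \<in> matchings k"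
  then have "(\<Prod>i<k. A (\<pi> (2 * i)) (\<pi> (2 * i + 1))) = (\<Prod>i<k. B (\<pi> (2 * i)) (\<pi> (2 * i + 1)))"
    using matchings_less by (intro prod.cong[OF refl] assms) auto
  then show "of_int (sign \<pi>) * (\<Prod>i<k. A (\<pi> (2 * i)) (\<pi> (2 * i + 1))) =
    of_int (sign \<pi>) * (\<Prod>i<k. B (\<pi> (2 * i)) (\<pi> (2 * i + 1)))" by simp
qed

lemma pfaffian_0: "pfaffian 0 A = 1"
proof -
  have "matchings 0 = {id}" by (auto simp: matchings_def)
  then show ?thesis by (simp add: pfaffian_matchings)
qed

text \<open>The increasing enumeration of the numbers different from 0 and j, for j > 0.\<close>

definition omit :: "nat \<Rightarrow> nat \<Rightarrow> nat"
  where "omit j a = (if a + 1 < j then a + 1 else a + 2)"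

text \<open>The cycle that carries 1 to j and closes up 2, ..., j. It sends a + 2 to
  \<open>omit j a\<close>, so the positions from 2 on enumerate what is left after removing 0 and
  j.\<close>

definition to_front :: "nat \<Rightarrow> nat \<Rightarrow> nat"
  where "to_front j x = (if x = 1 then j else if 2 \<le> x \<and> x \<le> j then x - 1 else x)"

text \<open>Passing from j to j + 1 composes one more adjacent transposition.\<close>

lemma to_front_permutes: "1 \<le> j \<Longrightarrow> to_front j permutes {1..j} \<and> sign (to_front j) = (- 1) ^ (j - 1)"
proof (induction j rule: nat_induct_at_least)
  case base
  have "to_front 1 = id" by (auto simp: to_front_def fun_eq_iff)
  then show ?case by (simp only: permutes_id sign_id diff_self_eq_0 power_0 simp_thms)
next
  case (Suc j)
  have eq: "to_front (Suc j) = transpose j (Suc j) \<circ> to_front j"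
    using Suc.hyps by (auto simp: to_front_def fun_eq_iff transpose_def)
  have p: "to_front j permutes {1..Suc j}" using Suc.IH by (auto intro: permutes_subset)
  have t: "transpose j (Suc j) permutes {1..Suc j}" using Suc.hyps by (intro permutes_swap_id) auto
  have "sign (to_front (Suc j)) = sign (transpose j (Suc j)) * sign (to_front j)"
    unfolding eq using p t by (intro sign_compose permutation_permutes[THEN iffD2]) auto
  also have "\<dots> = (- 1) ^ (Suc j - 1)" using Suc by (cases j) (auto simp: sign_swap_id)
  finally show ?case using permutes_compose[OF p t] unfolding eq by (intro conjI)
qed

text \<open>The pair of 0 and j is put in front of sigma. Shifting by 2 keeps the sign and the cycle
  contributes (-1)^(j-1), so this form as a composition yields the sign of the expansion.\<close>

definition extend_matching :: "nat \<Rightarrow> nat \<Rightarrow> (nat \<Rightarrow> nat) \<Rightarrow> nat \<Rightarrow> nat"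
  where "extend_matching k j \<sigma> = to_front j \<circ> map_permutation {..<2 * k} (\<lambda>x. x + 2) \<sigma>"

lemma extend_matching_apply:
  assumes "\<sigma> permutes {..<2 * k}"
  shows "extend_matching k j \<sigma> x = (if x = 0 then to_front j 0 else if x = 1 then j else
    if x < 2 * k + 2 then omit j (\<sigma> (x - 2)) else to_front j x)"
proof -
  have inj: "inj_on (\<lambda>x::nat. x + 2) {..<2 * k}" by (simp add: inj_on_def)
  have "map_permutation {..<2 * k} (\<lambda>x. x + 2) \<sigma> x = (if 2 \<le> x \<and> x < 2 * k + 2 then \<sigma> (x - 2) + 2 else x)"
  proof (cases "2 \<le> x \<and> x < 2 * k + 2")
    case True
    then have x: "x = (x - 2) + 2" "x - 2 \<in> {..<2 * k}" by auto
    show ?thesis using map_permutation_apply[OF inj x(2), of \<sigma>] x True by auto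
  next
    case False
    then have "x \<notin> (\<lambda>x. x + 2) ` {..<2 * k}" by auto
    then show ?thesis using False by (auto simp: map_permutation_def restrict_id_def)
  qed
  then show ?thesis by (auto simp: extend_matching_def to_front_def omit_def)
qed

lemma extend_matching_props:
  assumes \<sigma>: "\<sigma> permutes {..<2 * k}" and j: "1 \<le> j" "j \<le> 2 * k + 1"
  shows "extend_matching k j \<sigma> permutes {..<2 * Suc k}"
    "sign (extend_matching k j \<sigma>) = (- 1) ^ (j - 1) * sign \<sigma>"
proof -
  have inj: "inj_on (\<lambda>x::nat. x + 2) {..<2 * k}" by (simp add: inj_on_def)
  have "map_permutation {..<2 * k} (\<lambda>x. x + 2) \<sigma> permutes (\<lambda>x. x + 2) ` {..<2 * k}"
    by (rule map_permutation_permutes) (use inj \<sigma> in \<open>auto simp: bij_betw_def\<close>)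
  then have m: "map_permutation {..<2 * k} (\<lambda>x. x + 2) \<sigma> permutes {..<2 * Suc k}"
    by (rule permutes_subset) auto
  have f: "to_front j permutes {..<2 * Suc k}"
    using to_front_permutes[OF j(1)] j by (auto intro: permutes_subset)
  show "extend_matching k j \<sigma> permutes {..<2 * Suc k}"
    unfolding extend_matching_def by (rule permutes_compose[OF m f])
  have "sign (extend_matching k j \<sigma>) = sign (to_front j) * sign (map_permutation {..<2 * k} (\<lambda>x. x + 2) \<sigma>)"
    unfolding extend_matching_def using m f by (intro sign_compose permutation_permutes[THEN iffD2]) auto
  then show "sign (extend_matching k j \<sigma>) = (- 1) ^ (j - 1) * sign \<sigma>"
    using to_front_permutes[OF j(1)] sign_map_permutation[OF inj \<sigma>] by simp
qed

lemma extend_matching_in: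
  assumes \<sigma>: "\<sigma> \<in> matchings k" and j: "1 \<le> j" "j \<le> 2 * k + 1"
  shows "extend_matching k j \<sigma> \<in> matchings (Suc k)"
proof -
  let ?e = "extend_matching k j \<sigma>"
  have p: "\<sigma> permutes {..<2 * k}" using \<sigma> by (simp add: matchings_def)
  have mono: "omit j a < omit j b" if "a < b" for a b using that by (auto simp: omit_def)
  have e0: "?e 0 = 0" and e1: "?e 1 = j" and e2: "?e (x + 2) = omit j (\<sigma> x)" if "x < 2 * k" for x
    using that by (auto simp: extend_matching_apply[OF p] to_front_def)
  have z: "?e 0 = 0" by (simp add: extend_matching_apply[OF p] to_front_def)
  have o: "?e 1 = j" by (simp add: extend_matching_apply[OF p])
  have "?e (2 * i) < ?e (2 * i + 1)" if "i < Suc k" for i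
  proof (cases i)
    case 0 then show ?thesis using z o j by simp
  next
    case (Suc l)
    then have "?e (2 * i) = omit j (\<sigma> (2 * l))" "?e (2 * i + 1) = omit j (\<sigma> (2 * l + 1))"
      using e2[of "2 * l"] e2[of "2 * l + 1"] that by (auto simp: numeral_2_eq_2)
    then show ?thesis using mono matchings_less(1)[OF \<sigma>, of l] Suc that by simp
  qed
  moreover have "?e (2 * i) < ?e (2 * l)" if "l < Suc k" "i < l" for i l
  proof -
    obtain l' where l': "l = Suc l'" using \<open>i < l\<close> by (cases l) auto
    then have el: "?e (2 * l) = omit j (\<sigma> (2 * l'))" using e2[of "2 * l'"] that by (simp add: numeral_2_eq_2)
    show ?thesis
    proof (cases i)
      case 0 then show ?thesis using z el by (simp add: omit_def)
    next
      case (Suc i')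
      then have "?e (2 * i) = omit j (\<sigma> (2 * i'))" using e2[of "2 * i'"] that l' by (simp add: numeral_2_eq_2)
      moreover have "\<sigma> (2 * i') < \<sigma> (2 * l')" using \<sigma> that Suc l' by (simp add: matchings_def)
      ultimately show ?thesis using el mono by simp
    qed
  qed
  ultimately show ?thesis using extend_matching_props(1)[OF p j] by (simp add: matchings_def)
qed

text \<open>A matching of 2k + 2 points is a partner j of 0 together with a matching of the other
  points. In list form 0 comes first, because it can neither be a second element nor begin a later
  pair.\<close>

lemma matchings_Suc_bij:
  "bij_betw (\<lambda>(j, \<sigma>). extend_matching k j \<sigma>) ({1..2 * k + 1} \<times> matchings k) (matchings (Suc k))"
proof (rule bij_betw_imageI)
  have omit_inj: "omit j a = omit j b \<Longrightarrow> a = b" for j a b by (auto simp: omit_def split: if_splits)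
  show "inj_on (\<lambda>(j, \<sigma>). extend_matching k j \<sigma>) ({1..2 * k + 1} \<times> matchings k)"
  proof (rule inj_onI, clarify)
    fix j \<sigma> j' \<sigma>'
    assume \<sigma>: "\<sigma> \<in> matchings k" "\<sigma>' \<in> matchings k" and eq: "extend_matching k j \<sigma> = extend_matching k j' \<sigma>'"
    have p: "\<sigma> permutes {..<2 * k}" "\<sigma>' permutes {..<2 * k}" using \<sigma> by (auto simp: matchings_def)
    have jj: "j = j'" using fun_cong[OF eq, of 1] by (simp add: extend_matching_apply p)
    have "\<sigma> x = \<sigma>' x" for x
    proof (cases "x < 2 * k")
      case True
      then show ?thesis using fun_cong[OF eq, of "x + 2"] omit_inj
        by (simp add: extend_matching_apply p jj)
    next
      case False
      then show ?thesis using p by (simp add: permutes_def)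
    qed
    then show "j = j' \<and> \<sigma> = \<sigma>'" using jj by auto
  qed
  show "(\<lambda>(j, \<sigma>). extend_matching k j \<sigma>) ` ({1..2 * k + 1} \<times> matchings k) = matchings (Suc k)"
  proof (intro equalityI subsetI)
    fix \<pi> assume "\<pi> \<in> (\<lambda>(j, \<sigma>). extend_matching k j \<sigma>) ` ({1..2 * k + 1} \<times> matchings k)"
    then show "\<pi> \<in> matchings (Suc k)" using extend_matching_in by auto
  next
    fix \<pi> assume \<pi>: "\<pi> \<in> matchings (Suc k)"
    then have p: "\<pi> permutes {..<2 * Suc k}" and inc: "\<And>i. i < Suc k \<Longrightarrow> \<pi> (2 * i) < \<pi> (2 * i + 1)"
      and dec: "\<And>i l. l < Suc k \<Longrightarrow> i < l \<Longrightarrow> \<pi> (2 * i) < \<pi> (2 * l)" by (auto simp: matchings_def)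
    have inj: "inj \<pi>" by (rule permutes_inj[OF p])
    have into: "\<pi> x < 2 * Suc k" if "x < 2 * Suc k" for x
      using that permutes_in_image[OF p, of x] by simp
    have pi0: "\<pi> 0 = 0"
    proof -
      have "0 \<in> \<pi> ` {..<2 * Suc k}" using permutes_image[OF p] by simp
      then obtain x where x: "\<pi> x = 0" "x < 2 * Suc k" by auto
      show ?thesis
      proof (cases "even x")
        case True
        then obtain i where i: "x = 2 * i" by (elim evenE)
        then show ?thesis using dec[of i 0] x by (cases "i = 0") auto
      next
        case False
        then obtain i where "x = 2 * i + 1" by (elim oddE)
        then show ?thesis using inc[of i] x by simp
      qed
    qed
    define j where "j = \<pi> 1"
    have j: "1 \<le> j" "j \<le> 2 * k + 1" using inc[of 0] into[of 1] pi0 by (auto simp: j_def)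
    \<comment> \<open>The inverse of \<open>omit j\<close> on the numbers other than 0 and
      j.\<close>
    define u where "u = (\<lambda>y. if y < j then y - 1 else y - (2::nat))"
    have other: "\<pi> (x + 2) \<noteq> 0" "\<pi> (x + 2) \<noteq> j" for x
      using injD[OF inj, of "x + 2" 0] injD[OF inj, of "x + 2" 1] pi0 by (auto simp: j_def)
    have ou: "omit j (u y) = y" if "y \<noteq> 0" "y \<noteq> j" for y using that j by (auto simp: omit_def u_def)
    have u_lt: "u y < 2 * k" if "y < 2 * Suc k" "y \<noteq> 0" "y \<noteq> j" for y
      using that j by (auto simp: u_def)
    have u_mono: "u y < u y'" if "y < y'" "y \<noteq> 0" "y \<noteq> j" "y' \<noteq> j" for y y' using that j by (auto simp: u_def)
    define \<sigma> where "\<sigma> = (\<lambda>x. if x < 2 * k then u (\<pi> (x + 2)) else x)"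
    have \<sigma>p: "\<sigma> permutes {..<2 * k}"
    proof (rule inj_imp_permutes)
      show "inj_on \<sigma> {..<2 * k}"
      proof (rule inj_onI)
        fix x y assume xy: "x \<in> {..<2 * k}" "y \<in> {..<2 * k}" "\<sigma> x = \<sigma> y"
        then have "omit j (u (\<pi> (x + 2))) = omit j (u (\<pi> (y + 2)))" by (simp add: \<sigma>_def)
        then have "\<pi> (x + 2) = \<pi> (y + 2)" using ou other by metis
        then show "x = y" using injD[OF inj, of "x + 2" "y + 2"] by simp
      qed
      show "\<sigma> x \<in> {..<2 * k}" if "x \<in> {..<2 * k}" for x
        using that u_lt[OF into other] by (simp add: \<sigma>_def)
    qed (auto simp: \<sigma>_def)
    have "\<sigma> \<in> matchings k"
    proof -
      have "\<sigma> (2 * i) < \<sigma> (2 * i + 1)" if "i < k" for i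
        using that u_mono[OF inc[of "Suc i"]] other[of "2 * i"] other[of "2 * i + 1"] by (simp add: \<sigma>_def)
      moreover have "\<sigma> (2 * i) < \<sigma> (2 * l)" if "l < k" "i < l" for i l
        using that u_mono[OF dec[of "Suc l" "Suc i"]] other[of "2 * i"] other[of "2 * l"] by (simp add: \<sigma>_def)
      ultimately show ?thesis using \<sigma>p by (simp add: matchings_def)
    qed
    moreover have "\<pi> = extend_matching k j \<sigma>"
    proof (rule ext)
      fix x
      consider "x = 0" | "x = 1" | y where "x = y + 2" "y < 2 * k" | "x \<ge> 2 * Suc k"
      proof -
        consider "x = 0" | "x = 1" | "2 \<le> x" "x < 2 * Suc k" | "x \<ge> 2 * Suc k" by linarith
        then show thesis
        proof cases
          case 3 then show thesis by (intro that(3)[of "x - 2"]) auto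
        qed (use that in auto)
      qed
      then show "\<pi> x = extend_matching k j \<sigma> x"
      proof cases
        case 1 then show ?thesis using pi0 by (simp add: extend_matching_apply[OF \<sigma>p] to_front_def)
      next
        case 2 then show ?thesis by (simp add: extend_matching_apply[OF \<sigma>p] j_def)
      next
        case 3
        have "\<sigma> y = u (\<pi> (y + 2))" using 3 by (simp add: \<sigma>_def)
        then show ?thesis using ou[OF other[of y]] 3 extend_matching_apply[OF \<sigma>p, of j "y + 2"] by simp
      next
        case 4
        then show ?thesis using p permutes_not_in[OF extend_matching_props(1)[OF \<sigma>p j]] by (simp add: permutes_not_in)
      qed
    qed
    ultimately show "\<pi> \<in> (\<lambda>(j, \<sigma>). extend_matching k j \<sigma>) ` ({1..2 * k + 1} \<times> matchings k)"
      using j by (intro image_eqI[of _ _ "(j, \<sigma>)"]) auto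
  qed
qed

text \<open>The expansion of a Pfaffian along its first row: the matchings are sorted by the partner
  j of 0.\<close>

lemma pfaffian_Suc:
  "pfaffian (Suc k) A =
    (\<Sum>j=1..2 * k + 1. (- 1) ^ (j - 1) * A 0 j * pfaffian k (\<lambda>a b. A (omit j a) (omit j b)))"
proof -
  let ?w = "\<lambda>\<pi> k A. of_int (sign \<pi>) * (\<Prod>i<k. A (\<pi> (2 * i)) (\<pi> (2 * i + 1)))"
  have "pfaffian (Suc k) A = (\<Sum>x\<in>{1..2 * k + 1} \<times> matchings k. ?w (case x of (j, \<sigma>) \<Rightarrow> extend_matching k j \<sigma>) (Suc k) A)"
    unfolding pfaffian_matchings by (rule sum.reindex_bij_betw[OF matchings_Suc_bij, symmetric])
  also have "\<dots> = (\<Sum>x\<in>{1..2 * k + 1} \<times> matchings k. case x of (j, \<sigma>) \<Rightarrow>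
    (- 1) ^ (j - 1) * A 0 j * ?w \<sigma> k (\<lambda>a b. A (omit j a) (omit j b)))"
  proof (rule sum.cong[OF refl], clarify)
    fix j \<sigma> assume j: "j \<in> {1..2 * k + 1}" and \<sigma>: "\<sigma> \<in> matchings k"
    have p: "\<sigma> permutes {..<2 * k}" using \<sigma> by (simp add: matchings_def)
    have s: "sign (extend_matching k j \<sigma>) = (- 1) ^ (j - 1) * sign \<sigma>"
      by (rule extend_matching_props(2)[OF p]) (use j in auto)
    have "(\<Prod>i<Suc k. A (extend_matching k j \<sigma> (2 * i)) (extend_matching k j \<sigma> (2 * i + 1))) =
      A 0 j * (\<Prod>i<k. A (omit j (\<sigma> (2 * i))) (omit j (\<sigma> (2 * i + 1))))"
      unfolding prod.lessThan_Suc_shift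
      by (intro arg_cong2[of _ _ _ _ "(*)"] prod.cong refl)
        (auto simp: extend_matching_apply[OF p] to_front_def)
    then show "?w (extend_matching k j \<sigma>) (Suc k) A =
      (- 1) ^ (j - 1) * A 0 j * ?w \<sigma> k (\<lambda>a b. A (omit j a) (omit j b))"
      unfolding s by (simp add: mult_ac)
  qed
  also have "\<dots> = (\<Sum>j=1..2 * k + 1. \<Sum>\<sigma>\<in>matchings k.
    (- 1) ^ (j - 1) * A 0 j * ?w \<sigma> k (\<lambda>a b. A (omit j a) (omit j b)))"
    by (rule sum.cartesian_product[symmetric])
  finally show ?thesis unfolding pfaffian_matchings by (simp only: sum_distrib_left)
qed

text \<open>The signs of all perfect matchings add up to 1. The spanning argument needs this,
  because there all terms of a Pfaffian have the same leading monomial.\<close>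

lemma pfaffian_ones: "pfaffian k (\<lambda>_ _. 1) = 1"
proof (induction k)
  case 0
  show ?case by (rule pfaffian_0)
next
  case (Suc k)
  have "(\<Sum>j=1..2 * k + 1. (- 1) ^ (j - 1)) = (1 :: 'a)" for k
    by (induction k) auto
  then show ?case by (simp add: pfaffian_Suc Suc)
qed

section \<open>Pfaffians with bilinear entries\<close>

lemma sum_PiE_pairs:
  fixes H :: "nat \<Rightarrow> 'b \<Rightarrow> 'b \<Rightarrow> 'a::comm_ring_1"
  shows "(\<Sum>t\<in>PiE {..<2 * k} (\<lambda>_. X). \<Prod>i<k. H i (t (2 * i)) (t (2 * i + 1))) =
    (\<Prod>i<k. \<Sum>u\<in>X. \<Sum>v\<in>X. H i u v)"
proof (induction k)
  case (Suc k)
  let ?B = "PiE {..<2 * k} (\<lambda>_. X)"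
  let ?f = "\<lambda>(u, v, t). (t(2 * k := u))(2 * k + 1 := v)"
  have inj: "inj_on ?f (X \<times> X \<times> ?B)"
  proof (rule inj_onI)
    fix p q assume pq: "p \<in> X \<times> X \<times> ?B" "q \<in> X \<times> X \<times> ?B" "?f p = ?f q"
    obtain u v t u' v' t' where d: "p = (u, v, t)" "q = (u', v', t')" by (cases p, cases q)
    have t: "t \<in> ?B" "t' \<in> ?B" and eq: "(t(2 * k := u))(2 * k + 1 := v) = (t'(2 * k := u'))(2 * k + 1 := v')"
      using pq unfolding d by (auto simp del: fun_upd_apply)
    have "t x = t' x" for x
      using fun_cong[OF eq, of x] t by (cases "x < 2 * k") (auto simp: PiE_def extensional_def)
    then show "p = q" using fun_cong[OF eq, of "2 * k"] fun_cong[OF eq, of "2 * k + 1"] unfolding d by auto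
  qed
  have img: "?f ` (X \<times> X \<times> ?B) = PiE {..<2 * Suc k} (\<lambda>_. X)"
  proof (intro equalityI subsetI)
    fix t assume t: "t \<in> PiE {..<2 * Suc k} (\<lambda>_. X)"
    let ?s = "restrict t {..<2 * k}"
    have mem: "t x \<in> X" if "x < 2 * Suc k" for x using PiE_mem[OF t, of x] that by simp
    have "t x = ?f (t (2 * k), t (2 * k + 1), ?s) x" for x
      using PiE_arb[OF t, of x] by (cases "x < 2 * Suc k") (auto simp: less_Suc_eq)
    then have "t = ?f (t (2 * k), t (2 * k + 1), ?s)" by (rule ext)
    moreover have "?s \<in> ?B" by (rule PiE_I) (use mem in auto)
    then have "(t (2 * k), t (2 * k + 1), ?s) \<in> X \<times> X \<times> ?B" using mem by simp
    ultimately show "t \<in> ?f ` (X \<times> X \<times> ?B)" by (rule image_eqI)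
  next
    fix t assume "t \<in> ?f ` (X \<times> X \<times> ?B)"
    then obtain u v s where t: "t = (s(2 * k := u))(2 * k + 1 := v)" and uv: "u \<in> X" "v \<in> X" and s: "s \<in> ?B"
      by auto
    show "t \<in> PiE {..<2 * Suc k} (\<lambda>_. X)"
    proof (rule PiE_I)
      show "t x \<in> X" if "x \<in> {..<2 * Suc k}" for x
        using that uv PiE_mem[OF s, of x] unfolding t by (auto simp: less_Suc_eq)
      show "t x = undefined" if "x \<notin> {..<2 * Suc k}" for x
        using that PiE_arb[OF s, of x] unfolding t by auto
    qed
  qed
  have "(\<Sum>t\<in>PiE {..<2 * Suc k} (\<lambda>_. X). \<Prod>i<Suc k. H i (t (2 * i)) (t (2 * i + 1))) =
    (\<Sum>x\<in>X \<times> X \<times> ?B. \<Prod>i<Suc k. H i (?f x (2 * i)) (?f x (2 * i + 1)))"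
    unfolding img[symmetric] by (rule sum.reindex[OF inj, unfolded comp_def])
  also have "\<dots> = (\<Sum>(u, v, t)\<in>X \<times> X \<times> ?B. H k u v * (\<Prod>i<k. H i (t (2 * i)) (t (2 * i + 1))))"
  proof (rule sum.cong[OF refl], clarify)
    fix u v t
    have "(\<Prod>i<k. H i (((t(2 * k := u))(2 * k + 1 := v)) (2 * i)) (((t(2 * k := u))(2 * k + 1 := v)) (2 * i + 1))) =
      (\<Prod>i<k. H i (t (2 * i)) (t (2 * i + 1)))" by (rule prod.cong) auto
    then show "(\<Prod>i<Suc k. H i (((t(2 * k := u))(2 * k + 1 := v)) (2 * i)) (((t(2 * k := u))(2 * k + 1 := v)) (2 * i + 1))) =
      H k u v * (\<Prod>i<k. H i (t (2 * i)) (t (2 * i + 1)))" by (simp add: mult.commute)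
  qed
  also have "\<dots> = (\<Sum>u\<in>X. \<Sum>v\<in>X. H k u v) * (\<Sum>t\<in>?B. \<Prod>i<k. H i (t (2 * i)) (t (2 * i + 1)))"
    by (simp add: sum.cartesian_product[symmetric] sum_distrib_left[symmetric] sum_distrib_right[symmetric])
  finally show ?case using Suc by (simp add: mult.commute)
qed simp

lemma sum_PiE_permute:
  assumes p: "\<pi> permutes {..<N::nat}"
  shows "(\<Sum>t\<in>PiE {..<N} (\<lambda>_. X). \<Phi> (restrict (t \<circ> \<pi>) {..<N})) = (\<Sum>t\<in>PiE {..<N} (\<lambda>_. X). \<Phi> t)"
proof (rule sum.reindex_bij_witness[of _ "\<lambda>t. restrict (t \<circ> inv \<pi>) {..<N}" "\<lambda>t. restrict (t \<circ> \<pi>) {..<N}"])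
  have q: "inv \<pi> permutes {..<N}" by (rule permutes_inv[OF p])
  have in1: "\<pi> x < N \<longleftrightarrow> x < N" and in2: "inv \<pi> x < N \<longleftrightarrow> x < N" for x
    using permutes_in_image[OF p, of x] permutes_in_image[OF q, of x] by auto
  show "restrict (restrict (t \<circ> \<pi>) {..<N} \<circ> inv \<pi>) {..<N} = t" if "t \<in> PiE {..<N} (\<lambda>_. X)" for t
    using that in1 in2 permutes_inverses[OF p] by (auto simp: fun_eq_iff PiE_def extensional_def restrict_def)
  show "restrict (restrict (t \<circ> inv \<pi>) {..<N} \<circ> \<pi>) {..<N} = t" if "t \<in> PiE {..<N} (\<lambda>_. X)" for t
    using that in1 in2 permutes_inverses[OF p] by (auto simp: fun_eq_iff PiE_def extensional_def restrict_def)
  show "restrict (t \<circ> \<pi>) {..<N} \<in> PiE {..<N} (\<lambda>_. X)" if "t \<in> PiE {..<N} (\<lambda>_. X)" for t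
    using that in1 by (auto simp: PiE_def Pi_def)
  show "restrict (t \<circ> inv \<pi>) {..<N} \<in> PiE {..<N} (\<lambda>_. X)" if "t \<in> PiE {..<N} (\<lambda>_. X)" for t
    using that in2 by (auto simp: PiE_def Pi_def)
qed simp

lemma prod_pairs: "(\<Prod>i<k. g (2 * i) * g (2 * i + 1)) = (\<Prod>a<2 * k. g a)" for g :: "nat \<Rightarrow> 'a::comm_monoid_mult"
  by (induction k) (simp_all add: mult.assoc)

text \<open>Expanding the product over the pairs of one matching chooses a point at every position.
  Relabelling the positions by the matching makes the factor in front the same for all matchings,
  and the sum over the matchings recombines to a Pfaffian in the chosen points.\<close>

lemma pfaffian_sum:
  fixes g :: "nat \<Rightarrow> 'b \<Rightarrow> 'a::comm_ring_1" and S :: "'b \<Rightarrow> 'b \<Rightarrow> 'a"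
  shows "pfaffian k (\<lambda>a b. \<Sum>u\<in>X. \<Sum>v\<in>X. g a u * g b v * S u v) =
    (\<Sum>t\<in>PiE {..<2 * k} (\<lambda>_. X). (\<Prod>a<2 * k. g a (t a)) * pfaffian k (\<lambda>a b. S (t a) (t b)))"
proof -
  have "(\<Prod>i<k. \<Sum>u\<in>X. \<Sum>v\<in>X. g (\<pi> (2 * i)) u * g (\<pi> (2 * i + 1)) v * S u v) =
    (\<Sum>t\<in>PiE {..<2 * k} (\<lambda>_. X). (\<Prod>a<2 * k. g a (t a)) * (\<Prod>i<k. S (t (\<pi> (2 * i))) (t (\<pi> (2 * i + 1)))))"
    if "\<pi> \<in> matchings k" for \<pi>
  proof -
    have p: "\<pi> permutes {..<2 * k}" using that by (simp add: matchings_def)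
    let ?\<Phi> = "\<lambda>t. \<Prod>i<k. g (\<pi> (2 * i)) (t (2 * i)) * g (\<pi> (2 * i + 1)) (t (2 * i + 1)) * S (t (2 * i)) (t (2 * i + 1))"
    have "(\<Prod>i<k. \<Sum>u\<in>X. \<Sum>v\<in>X. g (\<pi> (2 * i)) u * g (\<pi> (2 * i + 1)) v * S u v) =
      (\<Sum>t\<in>PiE {..<2 * k} (\<lambda>_. X). ?\<Phi> t)"
      by (rule sum_PiE_pairs[symmetric])
    also have "\<dots> = (\<Sum>t\<in>PiE {..<2 * k} (\<lambda>_. X). ?\<Phi> (restrict (t \<circ> \<pi>) {..<2 * k}))"
      by (rule sum_PiE_permute[OF p, symmetric])
    also have "\<dots> = (\<Sum>t\<in>PiE {..<2 * k} (\<lambda>_. X). (\<Prod>a<2 * k. g a (t a)) * (\<Prod>i<k. S (t (\<pi> (2 * i))) (t (\<pi> (2 * i + 1)))))"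
    proof (rule sum.cong[OF refl])
      fix t
      have "?\<Phi> (restrict (t \<circ> \<pi>) {..<2 * k}) =
        (\<Prod>i<k. g (\<pi> (2 * i)) (t (\<pi> (2 * i))) * g (\<pi> (2 * i + 1)) (t (\<pi> (2 * i + 1))) * S (t (\<pi> (2 * i))) (t (\<pi> (2 * i + 1))))"
        by (rule prod.cong) auto
      also have "\<dots> = (\<Prod>a<2 * k. g (\<pi> a) (t (\<pi> a))) * (\<Prod>i<k. S (t (\<pi> (2 * i))) (t (\<pi> (2 * i + 1))))"
        by (simp only: prod.distrib prod_pairs[symmetric, of "\<lambda>a. g (\<pi> a) (t (\<pi> a))"])
      also have "(\<Prod>a<2 * k. g (\<pi> a) (t (\<pi> a))) = (\<Prod>a<2 * k. g a (t a))"
        by (rule prod.permute[OF p, unfolded comp_def, symmetric])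
      finally show "?\<Phi> (restrict (t \<circ> \<pi>) {..<2 * k}) =
        (\<Prod>a<2 * k. g a (t a)) * (\<Prod>i<k. S (t (\<pi> (2 * i))) (t (\<pi> (2 * i + 1))))" .
    qed
    finally show ?thesis .
  qed
  then have "pfaffian k (\<lambda>a b. \<Sum>u\<in>X. \<Sum>v\<in>X. g a u * g b v * S u v) =
    (\<Sum>\<pi>\<in>matchings k. \<Sum>t\<in>PiE {..<2 * k} (\<lambda>_. X). of_int (sign \<pi>) *
      ((\<Prod>a<2 * k. g a (t a)) * (\<Prod>i<k. S (t (\<pi> (2 * i))) (t (\<pi> (2 * i + 1))))))"
    unfolding pfaffian_matchings by (simp add: sum_distrib_left)
  also have "\<dots> = (\<Sum>t\<in>PiE {..<2 * k} (\<lambda>_. X). \<Sum>\<pi>\<in>matchings k. of_int (sign \<pi>) *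
      ((\<Prod>a<2 * k. g a (t a)) * (\<Prod>i<k. S (t (\<pi> (2 * i))) (t (\<pi> (2 * i + 1))))))"
    by (rule sum.swap)
  finally show ?thesis unfolding pfaffian_matchings by (simp add: sum_distrib_left mult_ac)
qed

section \<open>Partial fractions and Schur's Pfaffian\<close>

definition weight :: "'a::field \<Rightarrow> 'a set \<Rightarrow> 'a \<Rightarrow> 'a"
  where "weight z V v = (2 * v + z) * (\<Prod>u\<in>V - {v}. (u + v + z) / (v - u))"

lemma monic_linear_prod:
  fixes f :: "'b \<Rightarrow> 'a::field"
  assumes "finite V"
  shows "degree (\<Prod>u\<in>V. [:f u, 1:]) = card V" "coeff (\<Prod>u\<in>V. [:f u, 1:]) (card V) = 1"
proof -
  show d: "degree (\<Prod>u\<in>V. [:f u, 1:]) = card V"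
    by (subst degree_prod_eq_sum_degree) auto
  have "lead_coeff (\<Prod>u\<in>V. [:f u, 1:]) = 1" by (subst lead_coeff_prod) simp
  then show "coeff (\<Prod>u\<in>V. [:f u, 1:]) (card V) = 1" unfolding d .
qed

text \<open>Numerator and denominator are monic of the same degree in y, so their difference has
  degree below card V and is determined by its values on V. There only the term of v survives, and
  \<open>weight\<close> is the residue at v.\<close>

lemma partial_fractions:
  fixes z :: "'a::field"
  assumes V: "finite V" and y: "y \<notin> V"
  shows "(\<Prod>u\<in>V. (y + u + z) / (y - u)) = 1 + (\<Sum>v\<in>V. weight z V v / (y - v))"
proof -
  define P where "P = (\<Prod>u\<in>V. [:u + z, 1:])"
  define Q where "Q = (\<Prod>u\<in>V. [:- u, 1:])"
  define T where "T = (\<Sum>v\<in>V. smult (weight z V v) (\<Prod>u\<in>V - {v}. [:- u, 1:]))"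
  have pP: "poly P x = (\<Prod>u\<in>V. x + u + z)" for x by (simp add: P_def poly_prod add_ac)
  have pQ: "poly Q x = (\<Prod>u\<in>V. x - u)" for x by (simp add: Q_def poly_prod add_ac)
  have pT: "poly T x = (\<Sum>v\<in>V. weight z V v * (\<Prod>u\<in>V - {v}. x - u))" for x
    by (simp add: T_def poly_sum poly_prod)
  have eq: "P - Q = T"
  proof (cases "V = {}")
    case True
    then show ?thesis by (simp add: P_def Q_def T_def)
  next
    case False
    then have c: "0 < card V" using V by (simp add: card_gt_0_iff)
    show ?thesis
    proof (rule poly_eqI_degree[of V])
      have "coeff (P - Q) (card V) = 0" "degree (P - Q) \<le> card V"
        unfolding P_def Q_def
        using monic_linear_prod[OF V, of "\<lambda>u. u + z"] monic_linear_prod[OF V, of uminus]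
        by (simp, intro degree_diff_le) simp_all
      then show "degree (P - Q) < card V"
        using c by (metis degree_0 eq_zero_or_degree_less)
      have "degree T \<le> card V - 1"
        unfolding T_def
      proof (rule degree_sum_le[OF V])
        fix v assume "v \<in> V"
        then have "degree (\<Prod>u\<in>V - {v}. [:- u, 1:]) = card V - 1"
          using monic_linear_prod(1)[of "V - {v}" uminus] V by simp
        then show "degree (smult (weight z V v) (\<Prod>u\<in>V - {v}. [:- u, 1:])) \<le> card V - 1"
          using degree_smult_le by metis
      qed
      then show "degree T < card V" using c by simp
      show "poly (P - Q) x = poly T x" if x: "x \<in> V" for x
      proof -
        have "poly Q x = 0" unfolding pQ using V x by (intro prod_zero) auto
        moreover have "(\<Prod>u\<in>V - {v}. x - u) = 0" if "v \<in> V" "v \<noteq> x" for v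
          using V x that by (intro prod_zero) auto
        then have "poly T x = weight z V x * (\<Prod>u\<in>V - {x}. x - u)"
          unfolding pT by (subst sum.remove[OF V x]) (auto intro: sum.neutral)
        moreover have "\<dots> = (2 * x + z) * (\<Prod>u\<in>V - {x}. u + x + z)"
        proof -
          have "(\<Prod>u\<in>V - {x}. x - u) \<noteq> 0" using V by auto
          then show ?thesis unfolding weight_def prod_dividef by simp
        qed
        moreover have "poly P x = (2 * x + z) * (\<Prod>u\<in>V - {x}. u + x + z)"
        proof -
          have "(\<Prod>u\<in>V - {x}. x + u + z) = (\<Prod>u\<in>V - {x}. u + x + z)"
            by (rule prod.cong[OF refl]) (metis add.commute)
          then show ?thesis unfolding pP prod.remove[OF V x, of "\<lambda>u. x + u + z"] mult_2 by (rule arg_cong)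
        qed
        ultimately show ?thesis by simp
      qed
    qed
  qed
  have Q0: "poly Q y \<noteq> 0" unfolding pQ using V y by simp
  have "poly P y = poly Q y + poly T y" using arg_cong[OF eq, of "\<lambda>p. poly p y"] by (simp add: algebra_simps)
  then have "poly P y / poly Q y = 1 + poly T y / poly Q y" using Q0 by (simp add: field_simps)
  moreover have "poly T y / poly Q y = (\<Sum>v\<in>V. weight z V v / (y - v))"
    unfolding pT sum_divide_distrib
  proof (rule sum.cong[OF refl])
    fix v assume v: "v \<in> V"
    have "poly Q y = (y - v) * (\<Prod>u\<in>V - {v}. y - u)" unfolding pQ by (rule prod.remove[OF V v])
    moreover have "(\<Prod>u\<in>V - {v}. y - u) \<noteq> 0" using V y by auto
    ultimately show "weight z V v * (\<Prod>u\<in>V - {v}. y - u) / poly Q y = weight z V v / (y - v)" by simp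
  qed
  ultimately show ?thesis unfolding pP pQ by (simp add: prod_dividef)
qed

text \<open>A new point x multiplies the summand of v by 1 + (2v + z)/(x - v). The corrections are
  the partial fractions of the summand that belongs to x, so together they leave only (-1)^(card V),
  and the sum alternates between 0 and 1.\<close>

lemma prod_ratio_sum:
  fixes z :: "'a::field"
  assumes "finite V"
  shows "(\<Sum>v\<in>V. \<Prod>u\<in>V - {v}. (u + v + z) / (u - v)) = (if odd (card V) then 1 else 0)"
  using assms
proof (induction V)
  case (insert x V)
  let ?k = "\<lambda>v. \<Prod>u\<in>V - {v}. (u + v + z) / (u - v)"
  have neg: "(\<Prod>u\<in>W. (u + v + z) / (u - v)) = (- 1) ^ card W * (\<Prod>u\<in>W. (u + v + z) / (v - u))"
    if "finite W" for v W
  proof -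
    have "(\<Prod>u\<in>W. (u + v + z) / (u - v)) = (\<Prod>u\<in>W. - 1 * ((u + v + z) / (v - u)))"
      by (rule prod.cong[OF refl]) (metis divide_minus_right minus_diff_eq mult_minus1)
    then show ?thesis by (simp only: prod.distrib prod_constant)
  qed
  have summand: "(\<Prod>u\<in>insert x V - {v}. (u + v + z) / (u - v)) =
      ?k v - (- 1) ^ card V * (weight z V v / (x - v))" if v: "v \<in> V" for v
  proof -
    have xv: "x \<noteq> v" using insert v by auto
    have "insert x V - {v} = insert x (V - {v})" using xv by auto
    then have "(\<Prod>u\<in>insert x V - {v}. (u + v + z) / (u - v)) = (x + v + z) / (x - v) * ?k v"
      using insert by simp
    also have "(x + v + z) / (x - v) = 1 + (2 * v + z) / (x - v)" using xv by (simp add: field_simps)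
    also have "(1 + (2 * v + z) / (x - v)) * ?k v = ?k v + (2 * v + z) * ?k v / (x - v)" by (simp add: field_simps)
    also have "(2 * v + z) * ?k v = - ((- 1) ^ card V * weight z V v)"
    proof -
      have "(- 1 :: 'a) ^ card V = - ((- 1) ^ card (V - {v}))"
        using insert.hyps(1) v by (simp add: card_Suc_Diff1[symmetric] power_Suc[symmetric] del: power_Suc card_Diff_insert)
          (metis card_Suc_Diff1 mult_minus1 power_Suc)
      then show ?thesis unfolding neg[OF finite_Diff[OF insert.hyps(1)]] weight_def by simp
    qed
    finally show ?thesis by (simp add: field_simps)
  qed
  have "(\<Sum>v\<in>insert x V. \<Prod>u\<in>insert x V - {v}. (u + v + z) / (u - v)) =
    (\<Prod>u\<in>V. (u + x + z) / (u - x)) + (\<Sum>v\<in>V. ?k v - (- 1) ^ card V * (weight z V v / (x - v)))"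
    using insert by (simp add: summand)
  also have "\<dots> = (- 1) ^ card V * (\<Prod>u\<in>V. (x + u + z) / (x - u)) + (\<Sum>v\<in>V. ?k v) -
      (- 1) ^ card V * (\<Sum>v\<in>V. weight z V v / (x - v))"
    unfolding neg[OF insert.hyps(1)] by (simp add: sum_subtractf sum_distrib_left add_ac)
  also have "\<dots> = (- 1) ^ card V + (\<Sum>v\<in>V. ?k v)"
    unfolding partial_fractions[OF insert.hyps(1,2)] by (simp add: algebra_simps)
  finally show ?case using insert by auto
qed simp

definition skip :: "nat \<Rightarrow> nat \<Rightarrow> nat"
  where "skip j a = (if a < j then a else Suc a)"

definition pairs :: "nat \<Rightarrow> (nat \<times> nat) set"
  where "pairs n = {(a, b). a < b \<and> b < n}"

lemma finite_pairs: "finite (pairs n)"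
  by (rule finite_subset[of _ "{..n} \<times> {..n}"]) (auto simp: pairs_def)

definition pair_prod :: "('b \<Rightarrow> 'b \<Rightarrow> 'a::comm_ring_1) \<Rightarrow> nat \<Rightarrow> (nat \<Rightarrow> 'b) \<Rightarrow> 'a"
  where "pair_prod S n y = (\<Prod>(a, b)\<in>pairs n. S (y a) (y b))"

lemma skip_bij: "j \<le> n \<Longrightarrow> bij_betw (skip j) {..<n} ({..n} - {j})"
  by (rule bij_betw_byWitness[of _ "\<lambda>b. if b < j then b else b - 1"]) (auto simp: skip_def)

lemma skip_less_iff: "skip j a < skip j b \<longleftrightarrow> a < b"
  by (auto simp: skip_def)

text \<open>All pairs that contain j are written with j in front; the j pairs in which it came
  second change sign.\<close>

lemma pair_prod_extract:
  assumes skew: "\<And>u v. S u v = - S v u" and j: "j \<le> n"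
  shows "pair_prod S (Suc n) y = (- 1) ^ j * (\<Prod>i\<in>{..n} - {j}. S (y j) (y i)) * pair_prod S n (y \<circ> skip j)"
proof -
  let ?A = "(\<lambda>a. (a, j)) ` {..<j}" and ?B = "(\<lambda>b. (j, b)) ` {j<..n}"
  let ?C = "map_prod (skip j) (skip j) ` pairs n"
  let ?f = "\<lambda>(a, b). S (y a) (y b)"
  have skj: "skip j a \<noteq> j" for a by (auto simp: skip_def)
  have eq: "pairs (Suc n) = ?A \<union> ?B \<union> ?C"
  proof (intro equalityI subsetI)
    fix p assume p: "p \<in> pairs (Suc n)"
    obtain a b where ab: "p = (a, b)" "a < b" "b \<le> n" using p by (auto simp: pairs_def)
    show "p \<in> ?A \<union> ?B \<union> ?C"
    proof (cases "a = j \<or> b = j")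
      case False
      note b = bij_betw_imp_surj_on[OF skip_bij[OF j]]
      have ai: "a \<in> skip j ` {..<n}" and bi: "b \<in> skip j ` {..<n}" unfolding b using False ab by auto
      obtain a' where "a = skip j a'" "a' \<in> {..<n}" using ai by (rule imageE)
      moreover obtain b' where "b = skip j b'" "b' \<in> {..<n}" using bi by (rule imageE)
      ultimately have "p = map_prod (skip j) (skip j) (a', b')" "(a', b') \<in> pairs n"
        using ab skip_less_iff[of j a' b'] by (auto simp: pairs_def)
      then show ?thesis by blast
    qed (use ab in auto)
  next
    fix p assume "p \<in> ?A \<union> ?B \<union> ?C"
    then show "p \<in> pairs (Suc n)" using j by (auto simp: pairs_def skip_def)
  qed
  have "prod ?f (pairs (Suc n)) = prod ?f ?A * prod ?f ?B * prod ?f ?C"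
    unfolding eq using finite_pairs skj
    by (subst prod.union_disjoint; (subst prod.union_disjoint)?) (auto simp: skj[symmetric])
  moreover have "prod ?f ?A = (- 1) ^ j * (\<Prod>i<j. S (y j) (y i))"
  proof -
    have "prod ?f ?A = (\<Prod>a<j. S (y a) (y j))" by (subst prod.reindex) (auto simp: inj_on_def)
    also have "\<dots> = (\<Prod>a<j. - 1 * S (y j) (y a))" using skew by (intro prod.cong refl) (metis mult_minus1)
    finally show ?thesis by (simp only: prod.distrib prod_constant card_lessThan)
  qed
  moreover have "prod ?f ?B = (\<Prod>i\<in>{j<..n}. S (y j) (y i))" by (subst prod.reindex) (auto simp: inj_on_def)
  moreover have "prod ?f ?C = pair_prod S n (y \<circ> skip j)"
  proof -
    have "inj_on (map_prod (skip j) (skip j)) (pairs n)"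
      by (auto simp: inj_on_def skip_def split: if_splits)
    then show ?thesis unfolding pair_prod_def by (subst prod.reindex) (auto intro!: prod.cong)
  qed
  moreover have "(\<Prod>i\<in>{..n} - {j}. S (y j) (y i)) = (\<Prod>i<j. S (y j) (y i)) * (\<Prod>i\<in>{j<..n}. S (y j) (y i))"
  proof -
    have ev: "{..n} - {j} = {..<j} \<union> {j<..n}" using j by auto
    show ?thesis unfolding ev by (rule prod.union_disjoint) auto
  qed
  ultimately show ?thesis by (simp add: pair_prod_def mult_ac)
qed

lemma pair_prod_eq_0:
  assumes "a < b" "b < n" "S (y a) (y b) = 0"
  shows "pair_prod S n y = 0"
  unfolding pair_prod_def
  by (rule prod_zero[OF finite_pairs]) (use assms in \<open>auto simp: pairs_def\<close>)

definition schur_ratio :: "'a::field \<Rightarrow> 'a \<Rightarrow> 'a \<Rightarrow> 'a"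
  where "schur_ratio z u v = (v - u) / (u + v + z)"

lemma schur_ratio_skew: "schur_ratio z u v = - schur_ratio z v u"
  by (simp only: schur_ratio_def minus_divide_left minus_diff_eq add.commute[of v u])

lemma schur_ratio_self [simp]: "schur_ratio z u u = 0"
  by (simp add: schur_ratio_def)

text \<open>For distinct points this is \<open>prod_ratio_sum\<close> for the even number of points
  consisting of the v_j and s = - y_0 - z: the ratios with s turn into the factors S(y_0, v_j). If
  two of the points coincide, the left side is 0 and the only two surviving terms on the right
  cancel.\<close>

lemma pair_prod_expand:
  fixes y :: "nat \<Rightarrow> 'a::field"
  assumes n: "odd n" and nz: "\<And>a b. a < b \<Longrightarrow> b \<le> n \<Longrightarrow> y a + y b + z \<noteq> 0"
  defines "S \<equiv> schur_ratio z" and "v \<equiv> y \<circ> Suc"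
  shows "pair_prod S (Suc n) y =
    (\<Sum>j<n. (- 1) ^ j * S (y 0) (v j) * pair_prod S (n - 1) (v \<circ> skip j))"
proof -
  have skew: "S a b = - S b a" for a b unfolding S_def by (rule schur_ratio_skew)
  have extr: "pair_prod S (Suc n) y = (- 1) ^ j * (\<Prod>i\<in>{..n} - {j}. S (y j) (y i)) * pair_prod S n (y \<circ> skip j)"
    if "j \<le> n" for j n and y :: "nat \<Rightarrow> 'a" by (rule pair_prod_extract[OF skew that])
  obtain m where m: "n = Suc m" using n by (cases n) auto
  have ni: "{..n} - {0} = Suc ` {..<n}"
    unfolding image_Suc_lessThan by auto
  have "y \<circ> skip 0 = v" by (auto simp: v_def skip_def)
  then have lhs: "pair_prod S (Suc n) y = (\<Prod>i<n. S (y 0) (v i)) * pair_prod S n v"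
    using extr[of 0 n y] unfolding ni by (simp add: prod.reindex v_def)
  show ?thesis
  proof (cases "inj_on v {..<n}")
    case inj: True
    define V where "V = v ` {..<n}"
    have V: "finite V" "card V = n" using inj by (auto simp: V_def card_image)
    have sumV: "(\<Sum>w\<in>V. h w) = (\<Sum>j<n. h (v j))" and prodV: "(\<Prod>w\<in>V. h w) = (\<Prod>j<n. h (v j))" for h
      unfolding V_def by (rule sum.reindex[OF inj, unfolded comp_def], rule prod.reindex[OF inj, unfolded comp_def])
    define s where "s = - y 0 - z"
    have sV: "s \<notin> V"
    proof
      assume "s \<in> V"
      then obtain i where i: "i < n" "s = y (Suc i)" by (auto simp: V_def v_def)
      have "y 0 + y (Suc i) + z = 0" unfolding i(2)[symmetric] s_def by simp
      then show False using nz[of 0 "Suc i"] i(1) by simp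
    qed
    let ?k = "\<lambda>w. \<Prod>u\<in>V - {w}. (u + w + z) / (u - w)"
    have "(\<Sum>w\<in>insert s V. \<Prod>u\<in>insert s V - {w}. (u + w + z) / (u - w)) = 0"
      using prod_ratio_sum[of "insert s V" z] V sV n by simp
    moreover have "(\<Sum>w\<in>insert s V. \<Prod>u\<in>insert s V - {w}. (u + w + z) / (u - w)) =
      (\<Prod>u\<in>V. S (y 0) u) - (\<Sum>w\<in>V. S (y 0) w * ?k w)"
    proof -
      have "(\<Prod>u\<in>insert s V - {w}. (u + w + z) / (u - w)) = - (S (y 0) w * ?k w)" if "w \<in> V" for w
      proof -
        have "insert s V - {w} = insert s (V - {w})" using sV that by auto
        moreover have "(s + w + z) / (s - w) = - S (y 0) w"
        proof -
          have "s - w = - (y 0 + w + z)" "s + w + z = w - y 0" by (simp_all add: s_def)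
          then show ?thesis unfolding S_def schur_ratio_def by (simp only: divide_minus_right)
        qed
        ultimately show ?thesis using V sV by simp
      qed
      moreover have "(u + s + z) / (u - s) = S (y 0) u" for u
        by (simp add: s_def S_def schur_ratio_def add_ac)
      ultimately show ?thesis using V sV by (simp add: sum_negf)
    qed
    ultimately have key: "(\<Prod>u\<in>V. S (y 0) u) = (\<Sum>w\<in>V. S (y 0) w * ?k w)" by simp
    have summand: "(- 1) ^ j * pair_prod S m (v \<circ> skip j) = pair_prod S n v * ?k (v j)" if j: "j < n" for j
    proof -
      have ex: "pair_prod S n v = (- 1) ^ j * (\<Prod>i\<in>{..m} - {j}. S (v j) (v i)) * pair_prod S m (v \<circ> skip j)"
        using extr[of j m v] j m by simp
      have "V - {v j} = v ` ({..m} - {j})" "inj_on v ({..m} - {j})"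
        using inj j m unfolding V_def by (auto simp: inj_on_def lessThan_Suc_atMost)
      then have k: "?k (v j) = (\<Prod>i\<in>{..m} - {j}. (v i + v j + z) / (v i - v j))" by (simp add: prod.reindex)
      have "(v i + v j + z) / (v i - v j) * S (v j) (v i) = 1" if "i \<in> {..m} - {j}" for i
      proof -
        have "v i \<noteq> v j" using inj that j m by (auto simp: inj_on_def lessThan_Suc_atMost)
        moreover have "v i + v j + z \<noteq> 0"
          using nz[of "Suc i" "Suc j"] nz[of "Suc j" "Suc i"] that j m
          by (cases i j rule: linorder_cases) (auto simp: v_def add_ac)
        ultimately show ?thesis by (simp add: S_def schur_ratio_def add_ac)
      qed
      then have "?k (v j) * (\<Prod>i\<in>{..m} - {j}. S (v j) (v i)) = 1"
        unfolding k prod.distrib[symmetric] by simp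
      then show ?thesis unfolding ex by (simp add: mult_ac)
    qed
    have "(\<Sum>j<n. (- 1) ^ j * S (y 0) (v j) * pair_prod S (n - 1) (v \<circ> skip j)) =
      (\<Sum>j<n. pair_prod S n v * (S (y 0) (v j) * ?k (v j)))"
    proof (rule sum.cong[OF refl])
      fix j assume "j \<in> {..<n}"
      then show "(- 1) ^ j * S (y 0) (v j) * pair_prod S (n - 1) (v \<circ> skip j) =
        pair_prod S n v * (S (y 0) (v j) * ?k (v j))"
        using summand[of j] m by (simp add: mult_ac)
    qed
    also have "\<dots> = pair_prod S n v * (\<Sum>w\<in>V. S (y 0) w * ?k w)"
      unfolding sumV sum_distrib_left ..
    also have "\<dots> = pair_prod S n v * (\<Prod>i<n. S (y 0) (v i))"
      unfolding key[symmetric] prodV ..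
    finally show ?thesis by (rule trans[OF trans[OF lhs mult.commute] sym])
  next
    case False
    then obtain a b where "a < n" "b < n" "v a = v b" "a \<noteq> b" unfolding inj_on_def by auto
    then obtain p q where pq: "p < q" "q < n" "v p = v q" by (cases a b rule: linorder_cases) auto
    have "S (v p) (v q) = 0" using pq by (simp add: S_def)
    then have "pair_prod S n v = 0" by (rule pair_prod_eq_0[OF pq(1,2)])
    then have l0: "pair_prod S (Suc n) y = 0" unfolding lhs by (simp only: mult_zero_right)
    obtain k where k: "m = Suc k" using pq m by (cases m) auto
    have other: "pair_prod S m (v \<circ> skip j) = 0" if "j < n" "j \<noteq> p" "j \<noteq> q" for j
    proof -
      have "j \<le> m" using that m by simp
      note b = bij_betw_imp_surj_on[OF skip_bij[OF this]]
      have pi: "p \<in> skip j ` {..<m}" and qi: "q \<in> skip j ` {..<m}" unfolding b using pq that m by auto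
      obtain p' where "p = skip j p'" "p' \<in> {..<m}" using pi by (rule imageE)
      moreover obtain q' where "q = skip j q'" "q' \<in> {..<m}" using qi by (rule imageE)
      ultimately show ?thesis using pq skip_less_iff[of j p' q']
        by (intro pair_prod_eq_0[of p' q']) (auto simp: S_def)
    qed
    let ?X = "\<lambda>u. (\<Prod>i\<in>{..m} - {p, q}. S u (v i))"
    have ep: "pair_prod S m (v \<circ> skip p) = (- 1) ^ (q - 1) * ?X (v q) * pair_prod S k (v \<circ> skip p \<circ> skip (q - 1))"
    proof -
      have "bij_betw (skip p) ({..k} - {q - 1}) ({..m} - {p, q})"
        by (rule bij_betw_byWitness[of _ "\<lambda>b. if b < p then b else b - 1"])
          (use pq m k in \<open>auto simp: skip_def\<close>)
      then have "(\<Prod>i\<in>{..k} - {q - 1}. S (v q) (v (skip p i))) = ?X (v q)"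
        by (rule prod.reindex_bij_betw)
      moreover have "(v \<circ> skip p) (q - 1) = v q" using pq by (auto simp: skip_def)
      ultimately show ?thesis
        using extr[of "q - 1" k "v \<circ> skip p"] pq m k by simp
    qed
    have eq: "pair_prod S m (v \<circ> skip q) = (- 1) ^ p * ?X (v p) * pair_prod S k (v \<circ> skip q \<circ> skip p)"
    proof -
      have "bij_betw (skip q) ({..k} - {p}) ({..m} - {p, q})"
        by (rule bij_betw_byWitness[of _ "\<lambda>b. if b < q then b else b - 1"])
          (use pq m k in \<open>auto simp: skip_def\<close>)
      then have "(\<Prod>i\<in>{..k} - {p}. S (v p) (v (skip q i))) = ?X (v p)"
        by (rule prod.reindex_bij_betw)
      moreover have "(v \<circ> skip q) p = v p" using pq by (auto simp: skip_def)
      ultimately show ?thesis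
        using extr[of p k "v \<circ> skip q"] pq m k by simp
    qed
    have comm: "v \<circ> skip p \<circ> skip (q - 1) = v \<circ> skip q \<circ> skip p"
      using pq by (auto simp: skip_def fun_eq_iff)
    have "(\<Sum>j<n. (- 1) ^ j * S (y 0) (v j) * pair_prod S (n - 1) (v \<circ> skip j)) =
      (\<Sum>j\<in>{p, q}. (- 1) ^ j * S (y 0) (v j) * pair_prod S m (v \<circ> skip j))"
      using other pq m by (intro sum.mono_neutral_cong_right) auto
    also have "\<dots> = 0"
    proof -
      define Y where "Y = ?X (v q) * pair_prod S k (v \<circ> skip q \<circ> skip p)"
      have Y: "pair_prod S m (v \<circ> skip p) = (- 1) ^ (q - 1) * Y" "pair_prod S m (v \<circ> skip q) = (- 1) ^ p * Y"
        unfolding ep eq comm Y_def pq(3) by (rule mult.assoc)+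
      \<comment> \<open>Once p is removed, q has become q - 1, whereas p keeps its place when q is
        removed. This shift by one gives opposite signs.\<close>
      have "(- 1 :: 'a) ^ p * (- 1) ^ (q - 1) + (- 1) ^ q * (- 1) ^ p = 0"
        using pq by (cases q) auto
      then have "S (y 0) (v q) * Y * ((- 1) ^ p * (- 1) ^ (q - 1) + (- 1) ^ q * (- 1) ^ p) = 0" by (simp only: mult_zero_right)
      then show ?thesis using pq Y by (simp add: algebra_simps)
    qed
    finally show ?thesis using l0 by simp
  qed
qed

text \<open>The product and the Pfaffian have the same expansion along the first point. Only sums of
  points at different positions have to be nonzero, so the point - z / 2, whose double cancels z,
  may occur once.\<close>

theorem schur_pfaffian:
  fixes y :: "nat \<Rightarrow> 'a::field"
  assumes "\<And>a b. a < b \<Longrightarrow> b < 2 * k \<Longrightarrow> y a + y b + z \<noteq> 0"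
  shows "pfaffian k (\<lambda>a b. schur_ratio z (y a) (y b)) = pair_prod (schur_ratio z) (2 * k) y"
  using assms
proof (induction k arbitrary: y)
  case 0
  have "pairs 0 = {}" by (auto simp: pairs_def)
  then show ?case by (simp add: pfaffian_0 pair_prod_def)
next
  case (Suc k)
  let ?S = "schur_ratio z"
  have om: "omit (Suc j) a = Suc (skip j a)" for j a by (auto simp: omit_def skip_def)
  have "pfaffian (Suc k) (\<lambda>a b. ?S (y a) (y b)) =
    (\<Sum>j<2 * k + 1. (- 1) ^ j * ?S (y 0) (y (Suc j)) * pfaffian k (\<lambda>a b. ?S (y (Suc (skip j a))) (y (Suc (skip j b)))))"
    unfolding pfaffian_Suc
    by (rule sum.reindex_bij_witness[of _ Suc "\<lambda>j. j - 1"]) (auto simp: om[symmetric])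
  also have "\<dots> = (\<Sum>j<2 * k + 1. (- 1) ^ j * ?S (y 0) ((y \<circ> Suc) j) * pair_prod ?S (2 * k + 1 - 1) (y \<circ> Suc \<circ> skip j))"
  proof (rule sum.cong[OF refl])
    fix j assume "j \<in> {..<2 * k + 1}"
    have "pfaffian k (\<lambda>a b. ?S (y (Suc (skip j a))) (y (Suc (skip j b)))) =
      pair_prod ?S (2 * k) (\<lambda>a. y (Suc (skip j a)))"
    proof (rule Suc.IH)
      fix a b assume "a < b" "b < 2 * k"
      then show "y (Suc (skip j a)) + y (Suc (skip j b)) + z \<noteq> 0"
        by (intro Suc.prems) (auto simp: skip_def)
    qed
    then show "(- 1) ^ j * ?S (y 0) (y (Suc j)) * pfaffian k (\<lambda>a b. ?S (y (Suc (skip j a))) (y (Suc (skip j b)))) =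
      (- 1) ^ j * ?S (y 0) ((y \<circ> Suc) j) * pair_prod ?S (2 * k + 1 - 1) (y \<circ> Suc \<circ> skip j)"
      by (simp add: comp_def)
  qed
  also have "\<dots> = pair_prod ?S (Suc (2 * k + 1)) y"
    by (rule pair_prod_expand[symmetric]) (use Suc.prems in auto)
  finally show ?case by simp
qed

section \<open>The Pfaffians of a symmetrized power series\<close>

text \<open>The factor (1 + (x + z) u) / (1 - x u), with the geometric series in place of the
  denominator so that it exists over every commutative ring.\<close>

definition fac :: "'a::comm_ring_1 \<Rightarrow> 'a \<Rightarrow> 'a fps"
  where "fac z x = (1 + fps_const (x + z) * fps_X) * Abs_fps (\<lambda>k. x ^ k)"

definition cser :: "'a::comm_ring_1 \<Rightarrow> ('i \<Rightarrow> 'a) \<Rightarrow> 'i set \<Rightarrow> nat \<Rightarrow> 'a"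
  where "cser z x I k = fps_nth (\<Prod>i\<in>I. fac z (x i)) k"

text \<open>Together with \<open>pf\<close> this copies c_(p,q) and sigma for an arbitrary ring and
  an arbitrary sequence c: they occur over the polynomials, over their fraction field and over the
  polynomials in z.\<close>

definition cc :: "'a::comm_ring_1 \<Rightarrow> (nat \<Rightarrow> 'a) \<Rightarrow> nat \<Rightarrow> nat \<Rightarrow> 'a"
  where "cc z c p q = (\<Sum>b\<le>q. \<Sum>a\<le>b. (- 1) ^ b *
    of_nat ((b choose a) + (if b = 0 then 0 else (b - 1) choose a)) * z ^ a * c (p + b - a) * c (q - b))"

definition pf :: "'a::comm_ring_1 \<Rightarrow> (nat \<Rightarrow> 'a) \<Rightarrow> nat list \<Rightarrow> 'a"
  where "pf z c xs = pfaffian ((length xs + 1) div 2) (\<lambda>i j. cc z c (part xs i) (part xs j))"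

lemma fac_nth: "fps_nth (fac z x) 0 = 1" "fps_nth (fac z x) (Suc k) = (2 * x + z) * x ^ k"
  by (simp_all add: fac_def distrib_right mult.assoc algebra_simps)

lemma geometric_fps: "(1 - fps_const x * fps_X) * Abs_fps (\<lambda>k. x ^ k) = (1 :: 'a::comm_ring_1 fps)"
proof (rule fps_ext)
  fix k show "fps_nth ((1 - fps_const x * fps_X) * Abs_fps (\<lambda>k. x ^ k)) k = fps_nth 1 k"
    by (cases k) (simp_all add: left_diff_distrib mult.assoc)
qed

text \<open>The substitution x -> - x - z exchanges numerator and denominator, because x + z becomes
  - x.\<close>

lemma fac_inverse: "fac z x * fac z (- x - z) = 1"
proof -
  have "fac z (- x - z) = (1 - fps_const x * fps_X) * Abs_fps (\<lambda>k. (- x - z) ^ k)"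
    by (simp add: fac_def fps_const_neg[symmetric] del: fps_const_neg)
  moreover have "1 + fps_const (x + z) * fps_X = 1 - fps_const (- x - z) * fps_X"
  proof -
    have "- x - z = - (x + z)" by simp
    then have e: "fps_const (- x - z) = - fps_const (x + z)" by (metis fps_const_neg)
    show ?thesis unfolding e by (simp only: mult_minus_left diff_minus_eq_add)
  qed
  ultimately have "fac z x * fac z (- x - z) = ((1 - fps_const x * fps_X) * Abs_fps (\<lambda>k. x ^ k)) *
    ((1 - fps_const (- x - z) * fps_X) * Abs_fps (\<lambda>k. (- x - z) ^ k))"
    by (simp add: fac_def mult_ac)
  then show ?thesis by (simp add: geometric_fps)
qed

lemma cser_0 [simp]: "cser z x I 0 = 1"
proof (cases "finite I")
  case True
  then have "fps_nth (\<Prod>i\<in>I. fac z (x i)) 0 = 1" by (induction I) (simp_all add: fac_nth)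
  then show ?thesis by (simp add: cser_def)
qed (simp add: cser_def)

lemma cser_insert_rec:
  assumes "finite I" "i \<notin> I"
  shows "cser z x (insert i I) (Suc k) =
    x i * cser z x (insert i I) k + cser z x I (Suc k) + (x i + z) * cser z x I k"
proof -
  let ?P = "\<Prod>j\<in>I. fac z (x j)"
  have "(1 - fps_const (x i) * fps_X) * (fac z (x i) * ?P) =
    (1 + fps_const (x i + z) * fps_X) * ((1 - fps_const (x i) * fps_X) * Abs_fps (\<lambda>k. x i ^ k)) * ?P"
    by (simp add: fac_def mult_ac)
  also have "\<dots> = (1 + fps_const (x i + z) * fps_X) * ?P" by (simp add: geometric_fps)
  finally have "fps_nth ((1 - fps_const (x i) * fps_X) * (fac z (x i) * ?P)) (Suc k) =
    fps_nth ((1 + fps_const (x i + z) * fps_X) * ?P) (Suc k)" by simp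
  then show ?thesis using assms
    by (simp add: cser_def left_diff_distrib distrib_right mult.assoc algebra_simps)
qed

abbreviation cset :: "'a::comm_ring_1 \<Rightarrow> 'a set \<Rightarrow> nat \<Rightarrow> 'a"
  where "cset z V \<equiv> cser z (\<lambda>v. v) V"

text \<open>With y = 1/u the product of the factors is the left side of
  \<open>partial_fractions\<close>, and 1/(y - v) is the sum of all v^k u^(k+1). The proof compares
  coefficients by adding one point at a time.\<close>

lemma cset_power_sum:
  fixes z :: "'a::field"
  assumes "finite V"
  shows "cset z V (Suc k) = (\<Sum>v\<in>V. weight z V v * v ^ k)"
  using assms
proof (induction V arbitrary: k)
  case empty
  then show ?case by (simp add: cser_def)
next
  case (insert y V)
  have wv: "weight z (insert y V) v = weight z V v * ((v + y + z) / (v - y))" if v: "v \<in> V" for v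
  proof -
    have "insert y V - {v} = insert y (V - {v})" using insert v by auto
    then show ?thesis using insert by (simp add: weight_def mult_ac add_ac)
  qed
  have "insert y V - {y} = V" using insert by auto
  then have "weight z (insert y V) y = (2 * y + z) * (\<Prod>u\<in>V. (y + u + z) / (y - u))"
    by (simp add: weight_def add_ac)
  then have wy: "weight z (insert y V) y = (2 * y + z) * (1 + (\<Sum>v\<in>V. weight z V v / (y - v)))"
    unfolding partial_fractions[OF insert.hyps] .
  have split: "(\<Sum>v\<in>insert y V. weight z (insert y V) v * v ^ k) =
    weight z (insert y V) y * y ^ k + (\<Sum>v\<in>V. weight z V v * ((v + y + z) / (v - y)) * v ^ k)" for k
    using insert.hyps wv by simp
  show ?case
  proof (induction k)
    case 0
    have "weight z V v * ((v + y + z) / (v - y)) = weight z V v - (2 * y + z) * (weight z V v / (y - v))"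
      if "v \<in> V" for v
    proof -
      have "v \<noteq> y" using insert that by auto
      then have "v - y \<noteq> 0" by simp
      moreover have "weight z V v / (y - v) = - (weight z V v / (v - y))"
        by (metis minus_diff_eq minus_divide_right)
      ultimately show ?thesis by (simp add: field_simps)
    qed
    then have "(\<Sum>v\<in>V. weight z V v * ((v + y + z) / (v - y))) =
      (\<Sum>v\<in>V. weight z V v) - (2 * y + z) * (\<Sum>v\<in>V. weight z V v / (y - v))"
      by (simp add: sum_subtractf sum_distrib_left)
    then have "(\<Sum>v\<in>insert y V. weight z (insert y V) v * v ^ 0) = (2 * y + z) + (\<Sum>v\<in>V. weight z V v)"
      unfolding split wy by (simp add: algebra_simps)
    then show ?case using insert.IH[of 0] cser_insert_rec[OF insert.hyps, of z "\<lambda>v. v" 0] by simp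
  next
    case (Suc k)
    have e: "y * (weight z V v * ((v + y + z) / (v - y)) * v ^ k) + weight z V v * v ^ Suc k + (y + z) * (weight z V v * v ^ k) =
      weight z V v * ((v + y + z) / (v - y)) * v ^ Suc k" if "v \<in> V" for v
    proof -
      have "v - y \<noteq> 0" using insert that by auto
      then have "(v + y + z) / (v - y) * y + (v + y + z) = (v + y + z) / (v - y) * v"
        by (simp add: field_simps)
      then have "weight z V v * v ^ k * ((v + y + z) / (v - y) * y + (v + y + z)) =
        weight z V v * v ^ k * ((v + y + z) / (v - y) * v)" by simp
      then show ?thesis by (simp add: algebra_simps)
    qed
    have "cset z (insert y V) (Suc (Suc k)) = y * (\<Sum>v\<in>insert y V. weight z (insert y V) v * v ^ k) +
      (\<Sum>v\<in>V. weight z V v * v ^ Suc k) + (y + z) * (\<Sum>v\<in>V. weight z V v * v ^ k)"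
      using cser_insert_rec[OF insert.hyps, of z "\<lambda>v. v" "Suc k"] Suc insert.IH[of k] insert.IH[of "Suc k"] by simp
    also have "\<dots> = weight z (insert y V) y * y ^ Suc k +
      (\<Sum>v\<in>V. y * (weight z V v * ((v + y + z) / (v - y)) * v ^ k) + weight z V v * v ^ Suc k + (y + z) * (weight z V v * v ^ k))"
      unfolding split sum.distrib sum_distrib_left distrib_left by (simp add: mult_ac)
    also have "\<dots> = (\<Sum>v\<in>insert y V. weight z (insert y V) v * v ^ Suc k)"
      unfolding split using e by simp
    finally show ?case .
  qed
qed

text \<open>The origin of the binomial coefficients in c_(p,q): for b > 0 the two binomial sums are
  (z + v)^b and v (z + v)^(b-1), and up to the sign (-1)^b they add up to the coefficient of u^b in
  the inverse of the factor of v.\<close>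

lemma binomial_fac:
  fixes z v :: "'a::comm_ring_1"
  shows "(\<Sum>a\<le>b. (- 1) ^ b * of_nat ((b choose a) + (if b = 0 then 0 else (b - 1) choose a)) * z ^ a * v ^ (b - a)) =
    fps_nth (fac z (- v - z)) b"
proof (cases b)
  case 0
  then show ?thesis by (simp add: fac_nth)
next
  case (Suc k)
  have 1: "(\<Sum>a\<le>Suc k. of_nat (Suc k choose a) * z ^ a * v ^ (Suc k - a)) = (z + v) ^ Suc k"
    by (rule binomial_ring[symmetric])
  have "(\<Sum>a\<le>Suc k. of_nat (k choose a) * z ^ a * v ^ (Suc k - a)) =
    (\<Sum>a\<le>k. v * (of_nat (k choose a) * z ^ a * v ^ (k - a)))"
    by (simp add: Suc_diff_le mult_ac binomial_eq_0 cong: sum.cong_simp)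
  also have "\<dots> = v * (z + v) ^ k" unfolding sum_distrib_left[symmetric] binomial_ring ..
  finally have 2: "(\<Sum>a\<le>Suc k. of_nat (k choose a) * z ^ a * v ^ (Suc k - a)) = v * (z + v) ^ k" .
  have "(\<Sum>a\<le>b. (- 1) ^ b * of_nat ((b choose a) + (if b = 0 then 0 else (b - 1) choose a)) * z ^ a * v ^ (b - a)) =
    (- 1) ^ b * ((\<Sum>a\<le>Suc k. of_nat (Suc k choose a) * z ^ a * v ^ (Suc k - a)) +
      (\<Sum>a\<le>Suc k. of_nat (k choose a) * z ^ a * v ^ (Suc k - a)))"
    unfolding sum_distrib_left sum.distrib[symmetric] Suc
    by (rule sum.cong) (simp_all add: algebra_simps del: binomial_Suc_Suc)
  also have "\<dots> = (- 1) ^ Suc k * ((z + v) ^ k * (2 * v + z))" unfolding 1 2 Suc power_Suc[of "z + v"] by (simp add: algebra_simps)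
  also have "\<dots> = (2 * (- v - z) + z) * (- v - z) ^ k"
  proof -
    have "- v - z = - 1 * (z + v)" by simp
    then have "(- v - z) ^ k = (- 1) ^ k * (z + v) ^ k" by (simp only: power_mult_distrib)
    then show ?thesis by (simp add: algebra_simps)
  qed
  finally show ?thesis unfolding Suc fac_nth by simp
qed

lemma cc_zero_right: "c 0 = 1 \<Longrightarrow> cc z c p 0 = c p"
  by (simp add: cc_def)

text \<open>If c is a weighted power sum from index 1 on, summing over a first turns c_(p,q) into a
  sum over v of the coefficient of u^q in the series of c divided by the factor of v. The indices p
  + b - a are all positive because p is.\<close>

lemma cc_power_sum:
  fixes z :: "'a::field"
  assumes "finite V" and c: "\<And>k. c (Suc k) = (\<Sum>v\<in>V. w v * v ^ k)" and p: "0 < p"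
  shows "cc z c p q = (\<Sum>v\<in>V. w v * v ^ (p - 1) * (\<Sum>b\<le>q. fps_nth (fac z (- v - z)) b * c (q - b)))"
proof -
  let ?k = "\<lambda>a b::nat. (- 1) ^ b * of_nat ((b choose a) + (if b = 0 then 0 else (b - 1) choose a)) * z ^ a :: 'a"
  have "cc z c p q = (\<Sum>b\<le>q. \<Sum>a\<le>b. \<Sum>v\<in>V. w v * v ^ (p - 1) * (?k a b * v ^ (b - a)) * c (q - b))"
    unfolding cc_def
  proof (intro sum.cong refl)
    fix b a :: nat assume "a \<in> {..b}"
    then have pe: "p + b - a = Suc ((p - 1) + (b - a))" using p by auto
    have "c (p + b - a) = (\<Sum>v\<in>V. w v * v ^ (p - 1) * v ^ (b - a))" unfolding pe c power_add mult.assoc ..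
    then show "?k a b * c (p + b - a) * c (q - b) = (\<Sum>v\<in>V. w v * v ^ (p - 1) * (?k a b * v ^ (b - a)) * c (q - b))"
      by (simp only: sum_distrib_left sum_distrib_right) (simp only: mult_ac)
  qed
  also have "\<dots> = (\<Sum>v\<in>V. \<Sum>b\<le>q. \<Sum>a\<le>b. w v * v ^ (p - 1) * (?k a b * v ^ (b - a)) * c (q - b))"
  proof -
    have "(\<Sum>b\<le>q. \<Sum>a\<le>b. \<Sum>v\<in>V. w v * v ^ (p - 1) * (?k a b * v ^ (b - a)) * c (q - b)) =
      (\<Sum>b\<le>q. \<Sum>v\<in>V. \<Sum>a\<le>b. w v * v ^ (p - 1) * (?k a b * v ^ (b - a)) * c (q - b))"
      by (intro sum.cong refl sum.swap)
    also have "\<dots> = (\<Sum>v\<in>V. \<Sum>b\<le>q. \<Sum>a\<le>b. w v * v ^ (p - 1) * (?k a b * v ^ (b - a)) * c (q - b))"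
      by (rule sum.swap)
    finally show ?thesis .
  qed
  also have "\<dots> = (\<Sum>v\<in>V. w v * v ^ (p - 1) * (\<Sum>b\<le>q. fps_nth (fac z (- v - z)) b * c (q - b)))"
  proof (rule sum.cong[OF refl])
    fix v
    have "(\<Sum>a\<le>b. w v * v ^ (p - 1) * (?k a b * v ^ (b - a)) * c (q - b)) =
      w v * v ^ (p - 1) * (fps_nth (fac z (- v - z)) b * c (q - b))" for b
    proof -
      have "(\<Sum>a\<le>b. w v * v ^ (p - 1) * (?k a b * v ^ (b - a)) * c (q - b)) =
        w v * v ^ (p - 1) * (\<Sum>a\<le>b. ?k a b * v ^ (b - a)) * c (q - b)"
        by (simp only: sum_distrib_left sum_distrib_right)
      then show ?thesis unfolding binomial_fac by (simp only: mult.assoc)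
    qed
    then show "(\<Sum>b\<le>q. \<Sum>a\<le>b. w v * v ^ (p - 1) * (?k a b * v ^ (b - a)) * c (q - b)) =
      w v * v ^ (p - 1) * (\<Sum>b\<le>q. fps_nth (fac z (- v - z)) b * c (q - b))"
      by (simp only: sum_distrib_left)
  qed
  finally show ?thesis .
qed

lemma cset_remove:
  assumes "finite V" "v \<in> V"
  shows "cset z (V - {v}) q = (\<Sum>b\<le>q. fps_nth (fac z (- v - z)) b * cset z V (q - b))"
proof -
  have "(\<Prod>u\<in>V. fac z u) = fac z v * (\<Prod>u\<in>V - {v}. fac z u)" by (rule prod.remove[OF assms])
  then have "fac z (- v - z) * (\<Prod>u\<in>V. fac z u) = (fac z v * fac z (- v - z)) * (\<Prod>u\<in>V - {v}. fac z u)"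
    by (simp only: mult_ac)
  then have "(\<Prod>u\<in>V - {v}. fac z u) = fac z (- v - z) * (\<Prod>u\<in>V. fac z u)" by (simp add: fac_inverse)
  then show ?thesis by (simp add: cser_def fps_mult_nth atMost_atLeast0)
qed

text \<open>Division by the factor of v deletes v from V, so c_(p,q) pairs each v with the remaining
  points. Passing from V to V without v multiplies the weight of u by the Schur ratio.\<close>

lemma cc_cset:
  fixes z :: "'a::field"
  assumes V: "finite V" and nz: "\<And>u v. u \<in> V \<Longrightarrow> v \<in> V \<Longrightarrow> u \<noteq> v \<Longrightarrow> u + v + z \<noteq> 0"
    and pq: "0 < p" "0 < q"
  shows "cc z (cset z V) p q = (\<Sum>v\<in>V. \<Sum>u\<in>V. (weight z V v * v ^ (p - 1)) * (weight z V u * u ^ (q - 1)) * schur_ratio z v u)"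
proof -
  have "cc z (cset z V) p q = (\<Sum>v\<in>V. weight z V v * v ^ (p - 1) * cset z (V - {v}) q)"
    unfolding cc_power_sum[OF V cset_power_sum[OF V] pq(1)]
    by (intro sum.cong refl) (simp add: cset_remove[OF V])
  also have "\<dots> = (\<Sum>v\<in>V. \<Sum>u\<in>V. (weight z V v * v ^ (p - 1)) * (weight z V u * u ^ (q - 1)) * schur_ratio z v u)"
  proof (rule sum.cong[OF refl])
    fix v assume v: "v \<in> V"
    have q: "q = Suc (q - 1)" using pq by simp
    have "cset z (V - {v}) q = (\<Sum>u\<in>V - {v}. weight z (V - {v}) u * u ^ (q - 1))"
      by (subst q) (rule cset_power_sum, use V in simp)
    also have "\<dots> = (\<Sum>u\<in>V - {v}. weight z V u * u ^ (q - 1) * schur_ratio z v u)"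
    proof (rule sum.cong[OF refl])
      fix u assume u: "u \<in> V - {v}"
      have "V - {u} = insert v (V - {v} - {u})" using u v by auto
      then have "weight z V u = weight z (V - {v}) u * ((v + u + z) / (u - v))"
        using V by (simp add: weight_def mult_ac)
      moreover have "(v + u + z) / (u - v) * schur_ratio z v u = 1"
      proof -
        have "v + u + z \<noteq> 0" "u - v \<noteq> 0" using nz[of v u] u v by auto
        then show ?thesis by (simp add: schur_ratio_def)
      qed
      ultimately have e: "weight z (V - {v}) u = weight z V u * schur_ratio z v u" by (simp only: mult.assoc mult_1_right)
      then show "weight z (V - {v}) u * u ^ (q - 1) = weight z V u * u ^ (q - 1) * schur_ratio z v u"
        unfolding e by (simp only: mult_ac)
    qed
    \<comment> \<open>The term u = v may be added because the ratio of a point with itself is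
      0.\<close>
    also have "\<dots> = (\<Sum>u\<in>V. weight z V u * u ^ (q - 1) * schur_ratio z v u)"
      using V v by (intro sum.mono_neutral_left) auto
    finally show "weight z V v * v ^ (p - 1) * cset z (V - {v}) q =
      (\<Sum>u\<in>V. (weight z V v * v ^ (p - 1)) * (weight z V u * u ^ (q - 1)) * schur_ratio z v u)"
      by (simp add: sum_distrib_left mult.assoc)
  qed
  finally show ?thesis .
qed

lemma pairs_Suc: "pairs (Suc n) = (\<lambda>a. (a, n)) ` {..<n} \<union> pairs n"
  by (auto simp: pairs_def less_Suc_eq)

lemma pair_prod_Suc: "pair_prod S (Suc n) y = (\<Prod>a<n. S (y a) (y n)) * pair_prod S n y"
proof -
  have "(\<lambda>a. (a, n)) ` {..<n} \<inter> pairs n = {}" by (auto simp: pairs_def)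
  then have "pair_prod S (Suc n) y = (\<Prod>(a, b)\<in>(\<lambda>a. (a, n)) ` {..<n}. S (y a) (y b)) * pair_prod S n y"
    unfolding pair_prod_def pairs_Suc by (intro prod.union_disjoint) (auto simp: finite_pairs)
  also have "(\<Prod>(a, b)\<in>(\<lambda>a. (a, n)) ` {..<n}. S (y a) (y b)) = (\<Prod>a<n. S (y a) (y n))"
    by (subst prod.reindex) (auto simp: inj_on_def)
  finally show ?thesis .
qed

lemma pair_prod_cong: "(\<And>a. a < n \<Longrightarrow> y a = y' a) \<Longrightarrow> pair_prod S n y = pair_prod S n y'"
  unfolding pair_prod_def by (rule prod.cong) (auto simp: pairs_def)

text \<open>For an odd number of parts the Pfaffian is bordered by c(p,0) = c(p), which is the pairing of
  v with the additional point - z/2.\<close>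

theorem pf_cset:
  fixes z :: "'a::field"
  assumes two: "(2 :: 'a) \<noteq> 0" and V: "finite V" and nz: "\<And>u v. u \<in> V \<Longrightarrow> v \<in> V \<Longrightarrow> u + v + z \<noteq> 0"
    and pos: "0 \<notin> set xs"
  shows "pf z (cset z V) xs = (\<Sum>t\<in>PiE {..<length xs} (\<lambda>_. V).
    (\<Prod>a<length xs. weight z V (t a) * t a ^ (xs ! a - 1)) * pair_prod (schur_ratio z) (length xs) t)"
proof -
  define l where "l = length xs"
  define k where "k = (l + 1) div 2"
  define B where "B = - z / 2"
  define X where "X = insert B V"
  \<comment> \<open>The genuine rows range over V. The bordering row, present for odd l, is pinned
    to the point - z / 2, and its value -1 compensates the ratio of v with that point.\<close>
  define g where "g = (\<lambda>a v. if a < l then (if v = B then 0 else weight z V v * v ^ (xs ! a - 1))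
    else (if v = B then - 1 else 0))"
  let ?S = "schur_ratio z"
  have "2 * B = - z" using two by (simp add: B_def)
  then have B2: "B + B + z = 0" by (metis add.left_inverse mult_2)
  then have BV: "B \<notin> V" using nz[of B B] by auto
  have SB: "?S v B = - 1" if "v \<in> V" for v
  proof -
    have "v \<noteq> B" using that BV by auto
    then have ne: "v + B + z \<noteq> 0" using B2 by (metis add.assoc add_right_cancel add.commute)
    have eq: "B - v = - (v + B + z)" using B2 by (simp add: algebra_simps)
    show ?thesis unfolding schur_ratio_def eq by (simp only: minus_divide_left[symmetric] divide_self[OF ne])
  qed
  have VB: "v + B + z \<noteq> 0" if "v \<in> V" for v using SB[OF that] by (auto simp: schur_ratio_def)
  have finX: "finite X" using V by (simp add: X_def)
  have part_pos: "0 < part xs a" "part xs a = xs ! a" if "a < l" for a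
    using that pos by (auto simp: part_def l_def) (metis gr0I nth_mem)
  have entries: "cc z (cset z V) (part xs a) (part xs b) = (\<Sum>u\<in>X. \<Sum>v\<in>X. g a u * g b v * ?S u v)"
    if ab: "a < b" "b < 2 * k" for a b
  proof (cases "b < l")
    case True
    have a: "a < l" using ab True by simp
    have "(\<Sum>u\<in>X. \<Sum>v\<in>X. g a u * g b v * ?S u v) = (\<Sum>u\<in>V. \<Sum>v\<in>V. g a u * g b v * ?S u v)"
      unfolding X_def using V BV a True by (simp add: g_def)
    also have "\<dots> = (\<Sum>u\<in>V. \<Sum>v\<in>V. (weight z V u * u ^ (xs ! a - 1)) * (weight z V v * v ^ (xs ! b - 1)) * ?S u v)"
      using BV a True by (intro sum.cong refl) (auto simp: g_def)
    finally show ?thesis using cc_cset[OF V nz] part_pos[OF a] part_pos[OF True] by simp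
  next
    case False
    then have b: "b = l" "a < l" using ab by (auto simp: k_def)
    have p: "part xs a = Suc (xs ! a - 1)" using part_pos[OF b(2)] by simp
    have "part xs b = 0" using b by (simp add: part_def l_def)
    then have "cc z (cset z V) (part xs a) (part xs b) = cset z V (part xs a)" by (simp add: cc_zero_right)
    also have "\<dots> = (\<Sum>u\<in>V. weight z V u * u ^ (xs ! a - 1))" unfolding p by (rule cset_power_sum[OF V])
    also have "\<dots> = (\<Sum>u\<in>V. g a u * g b B * ?S u B)"
      using b BV SB by (intro sum.cong refl) (auto simp: g_def)
    also have "\<dots> = (\<Sum>u\<in>V. \<Sum>v\<in>X. g a u * g b v * ?S u v)"
    proof (rule sum.cong[OF refl])
      fix u
      have "(\<Sum>v\<in>V. g a u * g b v * ?S u v) = 0" using b BV by (intro sum.neutral) (auto simp: g_def)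
      then show "g a u * g b B * ?S u B = (\<Sum>v\<in>X. g a u * g b v * ?S u v)"
        unfolding X_def using V BV by simp
    qed
    also have "\<dots> = (\<Sum>u\<in>X. \<Sum>v\<in>X. g a u * g b v * ?S u v)"
      unfolding X_def using V BV b by (simp add: g_def)
    finally show ?thesis .
  qed
  have "pf z (cset z V) xs = pfaffian k (\<lambda>a b. \<Sum>u\<in>X. \<Sum>v\<in>X. g a u * g b v * ?S u v)"
    unfolding pf_def using pfaffian_cong[OF entries] by (simp add: k_def l_def)
  also have "\<dots> = (\<Sum>t\<in>PiE {..<2 * k} (\<lambda>_. X). (\<Prod>a<2 * k. g a (t a)) * pfaffian k (\<lambda>a b. ?S (t a) (t b)))"
    by (rule pfaffian_sum)
  also have "\<dots> = (\<Sum>t\<in>PiE {..<2 * k} (\<lambda>_. X). (\<Prod>a<2 * k. g a (t a)) * pair_prod ?S (2 * k) t)"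
  proof (rule sum.cong[OF refl])
    fix t assume t: "t \<in> PiE {..<2 * k} (\<lambda>_. X)"
    show "(\<Prod>a<2 * k. g a (t a)) * pfaffian k (\<lambda>a b. ?S (t a) (t b)) = (\<Prod>a<2 * k. g a (t a)) * pair_prod ?S (2 * k) t"
    proof (cases "\<exists>a<2 * k. g a (t a) = 0")
      case True
      then have "(\<Prod>a<2 * k. g a (t a)) = 0" by (intro prod_zero) auto
      then show ?thesis by simp
    next
      case False
      \<comment> \<open>A vanishing sum needs the point - z / 2 at both positions, but a < l is a
        genuine row, where g is 0 at that point.\<close>
      have "t a + t b + z \<noteq> 0" if "a < b" "b < 2 * k" for a b
      proof -
        have al: "a < l" using that by (auto simp: k_def)
        have "g a (t a) \<noteq> 0" using False that by simp
        then have "t a \<noteq> B" using al by (auto simp: g_def)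
        moreover have "t a \<in> X" "t b \<in> X" using PiE_mem[OF t] that by auto
        ultimately show ?thesis using nz VB by (auto simp: X_def)
      qed
      then show ?thesis by (subst schur_pfaffian) auto
    qed
  qed
  also have "\<dots> = (\<Sum>t\<in>PiE {..<l} (\<lambda>_. V). (\<Prod>a<l. weight z V (t a) * t a ^ (xs ! a - 1)) * pair_prod ?S l t)"
  proof (cases "even l")
    case True
    then have kl: "2 * k = l" by (auto simp: k_def elim!: evenE)
    show ?thesis unfolding kl
    proof (rule sum.mono_neutral_cong_right)
      show "finite (PiE {..<l} (\<lambda>_. X))" using finX by (intro finite_PiE) auto
      show "PiE {..<l} (\<lambda>_. V) \<subseteq> PiE {..<l} (\<lambda>_. X)" by (intro PiE_mono) (auto simp: X_def)
      show "\<forall>t\<in>PiE {..<l} (\<lambda>_. X) - PiE {..<l} (\<lambda>_. V). (\<Prod>a<l. g a (t a)) * pair_prod ?S l t = 0"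
      proof
        fix t assume t: "t \<in> PiE {..<l} (\<lambda>_. X) - PiE {..<l} (\<lambda>_. V)"
        then obtain a where "a < l" "t a \<notin> V" by (auto simp: PiE_def Pi_def)
        moreover have "t a \<in> X" using t \<open>a < l\<close> by (auto simp: PiE_def Pi_def)
        ultimately have "g a (t a) = 0" by (auto simp: X_def g_def)
        then have "(\<Prod>a<l. g a (t a)) = 0" using \<open>a < l\<close> by (intro prod_zero) auto
        then show "(\<Prod>a<l. g a (t a)) * pair_prod ?S l t = 0" by simp
      qed
      fix t assume "t \<in> PiE {..<l} (\<lambda>_. V)"
      then have "g a (t a) = weight z V (t a) * t a ^ (xs ! a - 1)" if "a < l" for a
        using that BV by (auto simp: g_def PiE_def Pi_def)
      then show "(\<Prod>a<l. g a (t a)) * pair_prod ?S l t =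
        (\<Prod>a<l. weight z V (t a) * t a ^ (xs ! a - 1)) * pair_prod ?S l t" by simp
    qed
  next
    case False
    then have kl: "2 * k = Suc l" by (auto simp: k_def elim!: oddE)
    let ?e = "\<lambda>t::nat \<Rightarrow> 'a. t(l := B)"
    have inj: "inj_on ?e (PiE {..<l} (\<lambda>_. V))"
    proof (rule inj_onI)
      fix s t assume st: "s \<in> PiE {..<l} (\<lambda>_. V)" "t \<in> PiE {..<l} (\<lambda>_. V)" "?e s = ?e t"
      show "s = t"
      proof (rule PiE_ext[OF st(1,2)])
        fix i assume "i \<in> {..<l}"
        then show "s i = t i" using fun_cong[OF st(3), of i] by simp
      qed
    qed
    have "(\<Sum>t\<in>PiE {..<Suc l} (\<lambda>_. X). (\<Prod>a<Suc l. g a (t a)) * pair_prod ?S (Suc l) t) =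
      (\<Sum>t\<in>?e ` PiE {..<l} (\<lambda>_. V). (\<Prod>a<Suc l. g a (t a)) * pair_prod ?S (Suc l) t)"
    proof (rule sum.mono_neutral_right)
      show "finite (PiE {..<Suc l} (\<lambda>_. X))" using finX by (intro finite_PiE) auto
      show "?e ` PiE {..<l} (\<lambda>_. V) \<subseteq> PiE {..<Suc l} (\<lambda>_. X)"
      proof
        fix t assume "t \<in> ?e ` PiE {..<l} (\<lambda>_. V)"
        then obtain s where s: "t = ?e s" "s \<in> PiE {..<l} (\<lambda>_. V)" by (rule imageE)
        show "t \<in> PiE {..<Suc l} (\<lambda>_. X)"
        proof (rule PiE_I)
          show "t x \<in> X" if "x \<in> {..<Suc l}" for x
            using that PiE_mem[OF s(2), of x] unfolding s(1) X_def by (cases "x = l") auto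
          show "t x = undefined" if "x \<notin> {..<Suc l}" for x
            using that PiE_arb[OF s(2), of x] unfolding s(1) by auto
        qed
      qed
      show "\<forall>t\<in>PiE {..<Suc l} (\<lambda>_. X) - ?e ` PiE {..<l} (\<lambda>_. V). (\<Prod>a<Suc l. g a (t a)) * pair_prod ?S (Suc l) t = 0"
      proof (rule ballI, rule ccontr)
        fix t assume t: "t \<in> PiE {..<Suc l} (\<lambda>_. X) - ?e ` PiE {..<l} (\<lambda>_. V)"
          and ne: "(\<Prod>a<Suc l. g a (t a)) * pair_prod ?S (Suc l) t \<noteq> 0"
        have g0: "g a (t a) \<noteq> 0" if "a < Suc l" for a
        proof
          assume "g a (t a) = 0"
          then have "(\<Prod>a<Suc l. g a (t a)) = 0" using that by (intro prod_zero) auto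
          then show False using ne by simp
        qed
        have tX: "t a \<in> X" if "a < Suc l" for a using t that by (auto simp: PiE_def Pi_def)
        have tV: "t a \<in> V" if "a < l" for a using g0[of a] tX[of a] that by (auto simp: g_def X_def)
        have tB: "t l = B" using g0[of l] by (auto simp: g_def split: if_splits)
        have "restrict t {..<l} \<in> PiE {..<l} (\<lambda>_. V)" using tV by auto
        moreover have "t x = ?e (restrict t {..<l}) x" for x
          using t tB PiE_arb[of t "{..<Suc l}" "\<lambda>_. X" x] by (cases "x < Suc l") (auto simp: less_Suc_eq)
        ultimately have "t \<in> ?e ` PiE {..<l} (\<lambda>_. V)" by (intro image_eqI[of _ _ "restrict t {..<l}"] ext)
        then show False using t by simp
      qed
    qed
    also have "\<dots> = (\<Sum>t\<in>PiE {..<l} (\<lambda>_. V). (\<Prod>a<Suc l. g a (?e t a)) * pair_prod ?S (Suc l) (?e t))"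
      by (rule sum.reindex[OF inj, unfolded comp_def])
    also have "\<dots> = (\<Sum>t\<in>PiE {..<l} (\<lambda>_. V). (\<Prod>a<l. weight z V (t a) * t a ^ (xs ! a - 1)) * pair_prod ?S l t)"
    proof (rule sum.cong[OF refl])
      fix t assume t: "t \<in> PiE {..<l} (\<lambda>_. V)"
      have tV: "t a \<in> V" if "a < l" for a using PiE_mem[OF t] that by simp
      have "(\<Prod>a<l. g a (?e t a)) = (\<Prod>a<l. weight z V (t a) * t a ^ (xs ! a - 1))"
        using tV BV by (intro prod.cong refl) (auto simp: g_def)
      moreover have "g l (?e t l) = - 1" by (simp add: g_def)
      moreover have "(\<Prod>a<l. ?S (?e t a) (?e t l)) = (\<Prod>a<l. - 1)"
        using tV SB by (intro prod.cong refl) auto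
      \<comment> \<open>The l ratios with - z / 2 and the value of g in the bordering row are l + 1
        factors -1, and l is odd here.\<close>
      moreover have "(\<Prod>a<l. - 1 :: 'a) = - 1" using False by simp
      moreover have "pair_prod ?S l (?e t) = pair_prod ?S l t" by (rule pair_prod_cong) simp
      ultimately show "(\<Prod>a<Suc l. g a (?e t a)) * pair_prod ?S (Suc l) (?e t) =
        (\<Prod>a<l. weight z V (t a) * t a ^ (xs ! a - 1)) * pair_prod ?S l t"
        unfolding pair_prod_Suc prod.lessThan_Suc by simp
    qed
    finally show ?thesis unfolding kl .
  qed
  finally show ?thesis unfolding l_def .
qed

section \<open>Ring homomorphisms\<close>

locale comm_ring_hom =
  fixes h :: "'a::comm_ring_1 \<Rightarrow> 'b::comm_ring_1"
  assumes add: "h (a + b) = h a + h b" and mult: "h (a * b) = h a * h b" and one: "h 1 = 1"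
begin

lemma zero: "h 0 = 0"
  using add[of 0 0] by simp

lemma uminus: "h (- a) = - h a"
  using add[of a "- a"] zero by (simp add: eq_neg_iff_add_eq_0 add.commute)

lemma diff: "h (a - b) = h a - h b"
  using add[of a "- b"] by (simp add: uminus)

lemma sum: "h (\<Sum>i\<in>I. f i) = (\<Sum>i\<in>I. h (f i))"
  by (induction I rule: infinite_finite_induct) (simp_all add: zero add)

lemma prod: "h (\<Prod>i\<in>I. f i) = (\<Prod>i\<in>I. h (f i))"
  by (induction I rule: infinite_finite_induct) (simp_all add: one mult)

lemma power: "h (a ^ k) = h a ^ k"
  by (induction k) (simp_all add: one mult)

lemma of_nat: "h (of_nat k) = of_nat k"
  by (induction k) (simp_all add: zero one add)

lemma of_int: "h (of_int k) = of_int k"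
  by (cases k) (simp_all add: of_nat uminus diff one)

lemma pfaffian: "h (pfaffian k A) = pfaffian k (\<lambda>i j. h (A i j))"
  by (simp add: pfaffian_def sum mult prod of_int)

lemma cc: "h (cc z c p q) = cc (h z) (\<lambda>k. h (c k)) p q"
  by (simp add: cc_def sum mult power of_nat uminus one flip: of_nat_add)

lemma pf: "h (pf z c xs) = pf (h z) (\<lambda>k. h (c k)) xs"
  by (simp add: pf_def pfaffian cc)

lemma fac: "h (fps_nth (fac z x) k) = fps_nth (fac (h z) (h x)) k"
proof -
  have "h 2 = 2" using of_nat[of 2] by simp
  then show ?thesis by (cases k) (simp_all add: fac_nth one mult add power)
qed

lemma cser: "h (cser z x I k) = cser (h z) (\<lambda>i. h (x i)) I k"
proof (induction I arbitrary: k rule: infinite_finite_induct)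
  case (insert i I)
  then show ?case
    by (simp add: cser_def fps_mult_nth sum mult fac)
qed (simp_all add: cser_def one zero)

end

section \<open>Evaluation of the Anderson--Fulton ring\<close>

lemma sum_keys_single: "(\<Sum>m\<in>Poly_Mapping.keys p. Poly_Mapping.single m (Poly_Mapping.lookup p m)) = p"
proof (rule poly_mapping_eqI)
  fix k
  have "Poly_Mapping.lookup (\<Sum>m\<in>Poly_Mapping.keys p. Poly_Mapping.single m (Poly_Mapping.lookup p m)) k =
    (\<Sum>m\<in>Poly_Mapping.keys p. if m = k then Poly_Mapping.lookup p k else 0)"
    unfolding lookup_sum by (rule sum.cong) (auto simp: lookup_single when_def)
  also have "\<dots> = Poly_Mapping.lookup p k" by (simp add: in_keys_iff)
  finally show "Poly_Mapping.lookup (\<Sum>m\<in>Poly_Mapping.keys p. Poly_Mapping.single m (Poly_Mapping.lookup p m)) k =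
    Poly_Mapping.lookup p k" .
qed

definition mono_val :: "(nat \<Rightarrow> af_poly) \<Rightarrow> (nat \<Rightarrow>\<^sub>0 nat) \<Rightarrow> af_poly"
  where "mono_val g m = (\<Prod>k\<in>Poly_Mapping.keys m. g k ^ Poly_Mapping.lookup m k)"

lemma mono_val_superset:
  assumes "finite A" "Poly_Mapping.keys m \<subseteq> A"
  shows "mono_val g m = (\<Prod>k\<in>A. g k ^ Poly_Mapping.lookup m k)"
  unfolding mono_val_def using assms by (intro prod.mono_neutral_left) (auto simp: in_keys_iff)

lemma mono_val_add: "mono_val g (m + n) = mono_val g m * mono_val g n"
proof -
  let ?A = "Poly_Mapping.keys m \<union> Poly_Mapping.keys n"
  have "mono_val g (m + n) = (\<Prod>k\<in>?A. g k ^ Poly_Mapping.lookup (m + n) k)"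
    by (rule mono_val_superset) (simp_all add: keys_add)
  also have "\<dots> = (\<Prod>k\<in>?A. g k ^ Poly_Mapping.lookup m k) * (\<Prod>k\<in>?A. g k ^ Poly_Mapping.lookup n k)"
    by (simp add: lookup_add power_add prod.distrib)
  finally show ?thesis by (simp add: mono_val_superset[of ?A])
qed

text \<open>Substitution for the variables c_1, c_2, ..., fixing the polynomials in z. The index is
  shifted: g k replaces c_(k+1).\<close>

definition subst :: "(nat \<Rightarrow> af_poly) \<Rightarrow> af_poly \<Rightarrow> af_poly"
  where "subst g p = (\<Sum>m\<in>Poly_Mapping.keys p. af_const (Poly_Mapping.lookup p m) * mono_val g m)"

lemma af_const_hom: "comm_ring_hom af_const"
  by unfold_locales (simp_all add: af_const_def single_add mult_single single_one)

lemma af_const_0: "af_const 0 = 0"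
  by (rule comm_ring_hom.zero[OF af_const_hom])

lemma subst_superset:
  assumes "finite A" "Poly_Mapping.keys p \<subseteq> A"
  shows "subst g p = (\<Sum>m\<in>A. af_const (Poly_Mapping.lookup p m) * mono_val g m)"
  unfolding subst_def using assms by (intro sum.mono_neutral_left) (auto simp: in_keys_iff af_const_0)

lemma subst_add: "subst g (p + q) = subst g p + subst g q"
proof -
  let ?A = "Poly_Mapping.keys p \<union> Poly_Mapping.keys q"
  have "subst g (p + q) = (\<Sum>m\<in>?A. af_const (Poly_Mapping.lookup (p + q) m) * mono_val g m)"
    by (rule subst_superset) (simp_all add: keys_add)
  also have "\<dots> = (\<Sum>m\<in>?A. af_const (Poly_Mapping.lookup p m) * mono_val g m) +
      (\<Sum>m\<in>?A. af_const (Poly_Mapping.lookup q m) * mono_val g m)"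
    by (simp add: lookup_add comm_ring_hom.add[OF af_const_hom] distrib_right sum.distrib)
  finally show ?thesis by (simp add: subst_superset[of ?A])
qed

lemma subst_0: "subst g 0 = 0"
  by (simp add: subst_def)

lemma subst_sum: "subst g (\<Sum>i\<in>I. f i) = (\<Sum>i\<in>I. subst g (f i))"
  by (induction I rule: infinite_finite_induct) (simp_all add: subst_0 subst_add)

lemma subst_single: "subst g (Poly_Mapping.single m a) = af_const a * mono_val g m"
  by (subst subst_superset[of "{m}"]) auto

lemma subst_mult: "subst g (p * q) = subst g p * subst g q"
proof -
  have "subst g (p * q) = subst g (\<Sum>m\<in>Poly_Mapping.keys p. \<Sum>n\<in>Poly_Mapping.keys q.
      Poly_Mapping.single m (Poly_Mapping.lookup p m) * Poly_Mapping.single n (Poly_Mapping.lookup q n))"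
    using sum_keys_single[of p] sum_keys_single[of q] by (simp add: sum_product[symmetric])
  also have "\<dots> = (\<Sum>m\<in>Poly_Mapping.keys p. \<Sum>n\<in>Poly_Mapping.keys q.
      (af_const (Poly_Mapping.lookup p m) * mono_val g m) * (af_const (Poly_Mapping.lookup q n) * mono_val g n))"
    by (simp add: subst_sum mult_single subst_single mono_val_add comm_ring_hom.mult[OF af_const_hom] mult_ac)
  also have "\<dots> = subst g p * subst g q" unfolding subst_def by (simp add: sum_product)
  finally show ?thesis .
qed

lemma subst_const: "subst g (af_const p) = af_const p"
  by (simp add: af_const_def[of p] subst_single mono_val_def)

lemma subst_hom: "comm_ring_hom (subst g)"
  by unfold_locales (use subst_const[of g 1] in \<open>simp_all add: subst_add subst_mult comm_ring_hom.one[OF af_const_hom]\<close>)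

lemma subst_c: "subst g (af_c k) = (if k = 0 then 1 else g (k - 1))"
  by (simp add: af_c_def comm_ring_hom.one[OF subst_hom] subst_single mono_val_def comm_ring_hom.one[OF af_const_hom])

lemma af_cc_eq: "af_cc p q = cc af_z af_c p q"
  by (simp add: af_cc_def cc_def)

lemma subst_ideal:
  assumes "\<And>p. 0 < p \<Longrightarrow> subst g (af_cc p p) = 0" "y \<in> af_ideal"
  shows "subst g y = 0"
  using assms(2) unfolding af_ideal_def
proof (induction rule: module.span_induct_alt[OF module_mult, consumes 1, case_names base step])
  case base
  show ?case by (rule subst_0)
next
  case (step a x y)
  then show ?case using assms(1) by (auto simp: subst_add subst_mult)
qed

lemma abs_hom: "comm_ring_hom abs_af_ring"
  by unfold_locales (simp_all add: plus_af_ring.abs_eq times_af_ring.abs_eq one_af_ring_def)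

text \<open>Weights and ratios need a field: identities are proved in the fraction field and pulled
  back along this embedding.\<close>

definition emb :: "'a::idom \<Rightarrow> 'a fract"
  where "emb a = Fraction_Field.Fract a 1"

lemma emb_hom: "comm_ring_hom emb"
  by unfold_locales (simp_all add: emb_def One_fract_def)

lemma emb_eq_iff: "emb a = emb b \<longleftrightarrow> a = b"
  by (simp add: emb_def eq_fract)

lemma lookup_zero_hom: "comm_ring_hom (\<lambda>p :: af_poly. Poly_Mapping.lookup p 0)"
  by unfold_locales (simp_all add: lookup_add lookup_mult_zero lookup_one)

lemma emb_cser:
  assumes "inj_on x I"
  shows "emb (cser z x I k) = cset (emb z) ((\<lambda>i. emb (x i)) ` I) k"
proof -
  have "inj_on (\<lambda>i. emb (x i)) I" using assms by (auto simp: inj_on_def emb_eq_iff)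
  then show ?thesis
    unfolding comm_ring_hom.cser[OF emb_hom] by (simp add: cser_def prod.reindex)
qed

lemma two_fract: "(2 :: af_poly fract) \<noteq> 0"
proof -
  have "Poly_Mapping.lookup (2 :: af_poly) 0 = 2"
    using comm_ring_hom.of_nat[OF lookup_zero_hom, of 2] by simp
  then have "emb (2 :: af_poly) \<noteq> emb 0" unfolding emb_eq_iff by auto
  moreover have "emb (of_nat 2 :: af_poly) = of_nat 2" by (rule comm_ring_hom.of_nat[OF emb_hom])
  moreover have "emb (0 :: af_poly) = 0" by (rule comm_ring_hom.zero[OF emb_hom])
  ultimately show ?thesis by simp
qed

lemma fract_eq_neg:
  fixes a :: "af_poly fract"
  assumes "a = - a" shows "a = 0"
proof -
  have "a + a = 0" using assms by (simp only: eq_neg_iff_add_eq_0)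
  then have "2 * a = 0" by (simp only: mult_2)
  then show ?thesis using two_fract by simp
qed

text \<open>For p = q the double sum in \<open>cc_cset\<close> is antisymmetric in its two points,
  hence equal to its negative, and 2 is invertible in the fraction field. This relation lets the
  evaluation pass to the quotient ring.\<close>

lemma cc_diag_zero:
  fixes x :: "'i \<Rightarrow> af_poly"
  assumes "finite I" "inj_on x I" "\<And>i j. i \<in> I \<Longrightarrow> j \<in> I \<Longrightarrow> x i + x j + z \<noteq> 0" "0 < p"
  shows "cc z (cser z x I) p p = 0"
proof -
  let ?V = "(\<lambda>i. emb (x i)) ` I"
  have nz: "u + v + emb z \<noteq> 0" if "u \<in> ?V" "v \<in> ?V" for u v
  proof -
    from that obtain i j where "i \<in> I" "j \<in> I" "u = emb (x i)" "v = emb (x j)" by auto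
    then have "u + v + emb z = emb (x i + x j + z)" "x i + x j + z \<noteq> 0"
      using assms(3) by (auto simp: comm_ring_hom.add[OF emb_hom])
    then show ?thesis using emb_eq_iff comm_ring_hom.zero[OF emb_hom] by metis
  qed
  let ?f = "\<lambda>u v. (weight (emb z) ?V u * u ^ (p - 1)) * (weight (emb z) ?V v * v ^ (p - 1)) * schur_ratio (emb z) u v"
  let ?X = "\<Sum>u\<in>?V. \<Sum>v\<in>?V. ?f u v"
  have "emb (cc z (cser z x I) p p) = ?X"
    unfolding comm_ring_hom.cc[OF emb_hom] emb_cser[OF assms(2)]
    by (rule cc_cset) (use assms nz in auto)
  moreover have "?X = - ?X"
  proof -
    have "?X = (\<Sum>v\<in>?V. \<Sum>u\<in>?V. ?f u v)" by (rule sum.swap)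
    also have "\<dots> = (\<Sum>v\<in>?V. \<Sum>u\<in>?V. - ?f v u)"
    proof (intro sum.cong refl)
      fix u v show "?f u v = - ?f v u" by (subst schur_ratio_skew) (simp add: mult_ac)
    qed
    finally show ?thesis by (simp only: sum_negf)
  qed
  then have "?X = 0" by (rule fract_eq_neg)
  ultimately show ?thesis using emb_eq_iff comm_ring_hom.zero[OF emb_hom] by metis
qed

section \<open>Evaluation in n variables\<close>

definition var :: "nat \<Rightarrow> af_poly"
  where "var i = Poly_Mapping.single (Poly_Mapping.single i 1) 1"

text \<open>Here \<open>af_poly\<close> plays a second part, as the polynomials in x_0, x_1, ...
  over the polynomials in z. The definition goes through a representative; \<open>eval_abs\<close>
  shows that its choice does not matter.\<close>

definition eval :: "nat \<Rightarrow> af_ring \<Rightarrow> af_poly"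
  where "eval n r = subst (\<lambda>k. cser af_z var {..<n} (Suc k)) (rep_af_ring r)"

lemma var_monomials:
  "Poly_Mapping.single i (1::nat) \<noteq> 0" "Poly_Mapping.single i (1::nat) = Poly_Mapping.single j 1 \<longleftrightarrow> i = j"
proof -
  show "Poly_Mapping.single i (1::nat) \<noteq> 0" by (metis lookup_single_eq lookup_zero zero_neq_one)
  show "Poly_Mapping.single i (1::nat) = Poly_Mapping.single j 1 \<longleftrightarrow> i = j"
    by (metis lookup_single_eq lookup_single_not_eq zero_neq_one)
qed

lemma lookup_var: "Poly_Mapping.lookup (var i) (Poly_Mapping.single j 1) = (if i = j then 1 else 0)"
  "Poly_Mapping.lookup (var i) 0 = 0"
  using var_monomials[of i] var_monomials(2)[of i j]
  by (auto simp: var_def lookup_single when_def)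

lemma inj_var: "inj var"
  by (rule injI) (metis lookup_var(1) zero_neq_one)

lemma lookup_af_z: "Poly_Mapping.lookup af_z m = (if m = 0 then [:0, 1:] else 0)"
  by (auto simp: af_z_def af_const_def lookup_single when_def)

lemma var_sum_nz: "var i + var j + af_z \<noteq> 0"
proof
  assume "var i + var j + af_z = 0"
  then have "Poly_Mapping.lookup (var i + var j + af_z) 0 = 0" by simp
  then show False by (simp add: lookup_add lookup_var(2) lookup_af_z)
qed

lemma eval_abs: "eval n (abs_af_ring y) = subst (\<lambda>k. cser af_z var {..<n} (Suc k)) y"
proof -
  let ?g = "\<lambda>k. cser af_z var {..<n} (Suc k)"
  have "(if k = 0 then 1 else ?g (k - 1)) = cser af_z var {..<n} k" for k by (cases k) auto
  then have "subst ?g (af_cc p p) = cc af_z (cser af_z var {..<n}) p p" for p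
    unfolding af_cc_eq comm_ring_hom.cc[OF subst_hom] subst_c by (simp add: af_z_def subst_const)
  then have z: "subst ?g (af_cc p p) = 0" if "0 < p" for p
    using cc_diag_zero[of "{..<n}" var af_z p] that var_sum_nz inj_on_subset[OF inj_var] by simp
  have "af_rel (rep_af_ring (abs_af_ring y)) y"
    by (metis Quotient3_af_ring Quotient3_rep_abs af_rel_equivp equivp_reflp)
  then have "subst ?g (rep_af_ring (abs_af_ring y) - y) = 0"
    unfolding af_rel_def by (intro subst_ideal[OF z])
  then show ?thesis unfolding eval_def by (simp add: comm_ring_hom.diff[OF subst_hom])
qed

lemma af_ring_cases: obtains y where "r = abs_af_ring y"
  by (metis Quotient3_abs_rep Quotient3_af_ring)

lemma eval_hom: "comm_ring_hom (eval n)"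
proof
  fix a b :: af_ring
  obtain p q where ab: "a = abs_af_ring p" "b = abs_af_ring q" by (metis af_ring_cases)
  show "eval n (a + b) = eval n a + eval n b"
    unfolding ab comm_ring_hom.add[OF abs_hom, symmetric] eval_abs by (rule subst_add)
  show "eval n (a * b) = eval n a * eval n b"
    unfolding ab comm_ring_hom.mult[OF abs_hom, symmetric] eval_abs by (rule subst_mult)
  show "eval n 1 = 1"
    unfolding comm_ring_hom.one[OF abs_hom, symmetric] eval_abs by (rule comm_ring_hom.one[OF subst_hom])
qed

lemma af_sigma_eq: "af_sigma lam = abs_af_ring (pf af_z af_c lam)"
  by (simp add: af_sigma_def comm_ring_hom.pfaffian[OF abs_hom] pf_def af_cc_eq)

lemma eval_sigma: "eval n (af_sigma lam) = pf af_z (cser af_z var {..<n}) lam"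
proof -
  have "(if k = 0 then 1 else cser af_z var {..<n} (Suc (k - 1))) = cser af_z var {..<n} k" for k by (cases k) auto
  then show ?thesis
    unfolding af_sigma_eq eval_abs comm_ring_hom.pf[OF subst_hom] subst_c by (simp add: af_z_def subst_const)
qed

lemma eval_scale: "eval n (af_scale p r) = af_const p * eval n r"
  by (simp add: af_scale_def comm_ring_hom.mult[OF eval_hom] eval_abs subst_const)

section \<open>Alternants and linear independence\<close>

lemma schur_pair_prod_noninj:
  assumes "\<not> inj_on t {..<l}"
  shows "pair_prod (schur_ratio z) l t = 0"
proof -
  obtain a b where "a < l" "b < l" "t a = t b" "a \<noteq> b" using assms unfolding inj_on_def by auto
  then obtain p q where "p < q" "q < l" "t p = t q" by (cases a b rule: linorder_cases) auto
  then show ?thesis by (intro pair_prod_eq_0[of p q]) auto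
qed

lemma emb_pf:
  fixes x :: "'i \<Rightarrow> af_poly"
  assumes I: "finite I" "inj_on x I" "\<And>i j. i \<in> I \<Longrightarrow> j \<in> I \<Longrightarrow> x i + x j + z \<noteq> 0"
    and pos: "0 \<notin> set xs"
  defines "V \<equiv> (\<lambda>i. emb (x i)) ` I"
  shows "emb (pf z (cser z x I) xs) = (\<Sum>t\<in>PiE {..<length xs} (\<lambda>_. V).
    (\<Prod>a<length xs. weight (emb z) V (t a) * t a ^ (xs ! a - 1)) * pair_prod (schur_ratio (emb z)) (length xs) t)"
proof -
  have nz: "u + v + emb z \<noteq> 0" if uv: "u \<in> V" "v \<in> V" for u v
  proof -
    from uv obtain i j where "i \<in> I" "j \<in> I" "u = emb (x i)" "v = emb (x j)" by (auto simp: V_def)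
    then have "u + v + emb z = emb (x i + x j + z)" "x i + x j + z \<noteq> 0"
      using I(3) by (auto simp: comm_ring_hom.add[OF emb_hom])
    then show ?thesis using emb_eq_iff comm_ring_hom.zero[OF emb_hom] by metis
  qed
  have "emb (pf z (cser z x I) xs) = pf (emb z) (cset (emb z) V) xs"
    unfolding comm_ring_hom.pf[OF emb_hom] emb_cser[OF I(2)] V_def ..
  also have "\<dots> = (\<Sum>t\<in>PiE {..<length xs} (\<lambda>_. V).
    (\<Prod>a<length xs. weight (emb z) V (t a) * t a ^ (xs ! a - 1)) * pair_prod (schur_ratio (emb z)) (length xs) t)"
    by (rule pf_cset[OF two_fract]) (use I(1) nz pos in \<open>auto simp: V_def\<close>)
  finally show ?thesis .
qed

abbreviation pf_var :: "nat \<Rightarrow> nat list \<Rightarrow> af_poly"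
  where "pf_var n xs \<equiv> pf af_z (cser af_z var {..<n}) xs"

abbreviation K_z :: "af_poly fract"
  where "K_z \<equiv> emb af_z"

abbreviation K_var :: "nat \<Rightarrow> af_poly fract"
  where "K_var i \<equiv> emb (var i)"

lemma inj_K_var: "inj_on K_var A"
  using inj_var by (auto simp: inj_on_def emb_eq_iff inj_def)

lemma emb_nz: "emb a \<noteq> 0 \<longleftrightarrow> a \<noteq> 0"
  using emb_eq_iff[of a 0] comm_ring_hom.zero[OF emb_hom] by metis

lemma K_var_sum_nz: "K_var i + K_var j + K_z \<noteq> 0"
  unfolding comm_ring_hom.add[OF emb_hom, symmetric] emb_nz by (rule var_sum_nz)

lemmas emb_pf_var = emb_pf[of "{..<n}" var af_z for n, OF finite_lessThan inj_on_subset[OF inj_var subset_UNIV] var_sum_nz]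

text \<open>With more parts than variables every choice t repeats a point, and the ratio of a point
  with itself is 0.\<close>

lemma pf_var_too_long:
  assumes "n < length xs" "0 \<notin> set xs"
  shows "pf_var n xs = 0"
proof -
  have "emb (pf_var n xs) = 0"
    unfolding emb_pf_var[OF assms(2)]
  proof (rule sum.neutral, rule ballI)
    fix t assume t: "t \<in> PiE {..<length xs} (\<lambda>_. K_var ` {..<n})"
    have "\<not> inj_on t {..<length xs}"
    proof
      assume "inj_on t {..<length xs}"
      then have "length xs \<le> card (K_var ` {..<n})"
        using card_inj_on_le[of t "{..<length xs}" "K_var ` {..<n}"] t by (auto simp: PiE_def Pi_def)
      also have "\<dots> = n" by (simp add: card_image inj_K_var)
      finally show False using assms(1) by simp
    qed
    then show "(\<Prod>a<length xs. weight K_z (K_var ` {..<n}) (t a) * t a ^ (xs ! a - 1)) *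
      pair_prod (schur_ratio K_z) (length xs) t = 0"
      by (simp add: schur_pair_prod_noninj)
  qed
  then show ?thesis using emb_nz by blast
qed

text \<open>The product over all ordered pairs of distinct positions is invariant under w and, up to
  a fixed sign, is the square of \<open>pair_prod\<close>. In a domain equal squares leave only a
  sign.\<close>

lemma pair_prod_permute:
  fixes S :: "'b \<Rightarrow> 'b \<Rightarrow> 'a::idom"
  assumes skew: "\<And>u v. S u v = - S v u" and w: "w permutes {..<m}"
  shows "pair_prod S m (y \<circ> w) = pair_prod S m y \<or> pair_prod S m (y \<circ> w) = - pair_prod S m y"
proof -
  define D where "D = {(a, b). a < m \<and> b < m \<and> a \<noteq> b}"
  have D: "D = pairs m \<union> prod.swap ` pairs m" by (auto simp: D_def pairs_def)
  have dis: "pairs m \<inter> prod.swap ` pairs m = {}" by (auto simp: pairs_def)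
  have sq: "(\<Prod>(a, b)\<in>D. S (y a) (y b)) = (- 1) ^ card (pairs m) * (pair_prod S m y)\<^sup>2" for y
  proof -
    have "(\<Prod>(a, b)\<in>prod.swap ` pairs m. S (y a) (y b)) = (\<Prod>(a, b)\<in>pairs m. S (y b) (y a))"
      by (subst prod.reindex) (auto simp: case_prod_unfold)
    also have "\<dots> = (\<Prod>(a, b)\<in>pairs m. - 1 * S (y a) (y b))"
    proof (rule prod.cong[OF refl])
      fix p :: "nat \<times> nat"
      show "(case p of (a, b) \<Rightarrow> S (y b) (y a)) = (case p of (a, b) \<Rightarrow> - 1 * S (y a) (y b))"
        using skew[of "y (snd p)" "y (fst p)"] by (simp add: case_prod_unfold)
    qed
    also have "\<dots> = (- 1) ^ card (pairs m) * pair_prod S m y"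
      by (simp only: case_prod_unfold prod.distrib prod_constant pair_prod_def)
    finally show ?thesis
      unfolding D prod.union_disjoint[OF finite_pairs finite_imageI[OF finite_pairs] dis]
      by (simp add: pair_prod_def[symmetric] power2_eq_square mult_ac)
  qed
  have wl: "w a < m \<longleftrightarrow> a < m" for a using permutes_in_image[OF w, of a] by simp
  have winj: "w a = w b \<longleftrightarrow> a = b" for a b using permutes_inj[OF w] by (auto simp: inj_def)
  have "bij_betw (map_prod w w) D D"
  proof (rule bij_betw_imageI)
    show "inj_on (map_prod w w) D" by (auto simp: inj_on_def winj)
    show "map_prod w w ` D = D"
    proof (intro equalityI subsetI)
      fix p assume "p \<in> D"
      then obtain a b where p: "p = (a, b)" "a < m" "b < m" "a \<noteq> b" by (auto simp: D_def)
      obtain a' b' where "a = w a'" "b = w b'" using permutes_surj[OF w] by (metis surjD)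
      then have "p = map_prod w w (a', b')" "(a', b') \<in> D" using p wl winj by (auto simp: D_def)
      then show "p \<in> map_prod w w ` D" by blast
    qed (auto simp: D_def wl winj)
  qed
  then have "(\<Prod>(a, b)\<in>D. S ((y \<circ> w) a) ((y \<circ> w) b)) = (\<Prod>(a, b)\<in>D. S (y a) (y b))"
    using prod.reindex_bij_betw[of "map_prod w w" D D "\<lambda>(a, b). S (y a) (y b)"]
    by (simp add: case_prod_unfold)
  then have "(- 1) ^ card (pairs m) * (pair_prod S m (y \<circ> w))\<^sup>2 = (- 1) ^ card (pairs m) * (pair_prod S m y)\<^sup>2"
    unfolding sq .
  then have "(pair_prod S m (y \<circ> w))\<^sup>2 = (pair_prod S m y)\<^sup>2" by simp
  then show ?thesis unfolding power2_eq_iff .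
qed

text \<open>An injective map from m positions to the m points of y is y composed with a
  permutation.\<close>

lemma sum_PiE_permutations:
  fixes m :: nat
  assumes y: "inj_on y {..<m}" and F: "\<And>t. t \<in> PiE {..<m} (\<lambda>_. y ` {..<m}) \<Longrightarrow> \<not> inj_on t {..<m} \<Longrightarrow> F t = 0"
  shows "(\<Sum>t\<in>PiE {..<m} (\<lambda>_. y ` {..<m}). F t) =
    (\<Sum>w | w permutes {..<m}. F (restrict (y \<circ> w) {..<m}))"
proof -
  let ?P = "PiE {..<m} (\<lambda>_. y ` {..<m})" and ?e = "\<lambda>w. restrict (y \<circ> w) {..<m}"
  have inj: "inj_on ?e {w. w permutes {..<m}}"
  proof (rule inj_onI)
    fix w w' assume w: "w \<in> {w. w permutes {..<m}}" "w' \<in> {w. w permutes {..<m}}" "?e w = ?e w'"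
    show "w = w'"
    proof (rule ext)
      fix a
      show "w a = w' a"
      proof (cases "a < m")
        case True
        then have "y (w a) = y (w' a)" using fun_cong[OF w(3), of a] by simp
        moreover have "w a < m" "w' a < m" using w True permutes_in_image by fastforce+
        ultimately show ?thesis using y by (auto simp: inj_on_def)
      next
        case False
        then show ?thesis using w by (auto simp: permutes_def)
      qed
    qed
  qed
  have img: "?e ` {w. w permutes {..<m}} = {t \<in> ?P. inj_on t {..<m}}"
  proof (intro equalityI subsetI)
    fix t assume "t \<in> ?e ` {w. w permutes {..<m}}"
    then obtain w where w: "w permutes {..<m}" and t: "t = ?e w" by auto
    have wl: "w a < m" if "a < m" for a using permutes_in_image[OF w, of a] that by simp
    have "inj_on t {..<m}"
    proof (rule inj_onI)
      fix a b assume ab: "a \<in> {..<m}" "b \<in> {..<m}" "t a = t b"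
      then have "y (w a) = y (w b)" by (simp add: t)
      then have "w a = w b" using y wl ab by (auto simp: inj_on_def)
      then show "a = b" using permutes_inj[OF w] by (simp add: inj_def)
    qed
    moreover have "t \<in> ?P" unfolding t using wl by auto
    ultimately show "t \<in> {t \<in> ?P. inj_on t {..<m}}" by simp
  next
    fix t assume "t \<in> {t \<in> ?P. inj_on t {..<m}}"
    then have t: "t \<in> ?P" "inj_on t {..<m}" by auto
    define w where "w = (\<lambda>a. if a < m then inv_into {..<m} y (t a) else a)"
    have ta: "t a \<in> y ` {..<m}" if "a < m" for a using PiE_mem[OF t(1)] that by simp
    have yw: "y (w a) = t a" if "a < m" for a using f_inv_into_f[OF ta[OF that]] that by (simp add: w_def)
    have wm: "w a \<in> {..<m}" if "a < m" for a using inv_into_into[OF ta[OF that]] that by (simp add: w_def)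
    have "w permutes {..<m}"
    proof (rule inj_imp_permutes)
      show "inj_on w {..<m}"
      proof (rule inj_onI)
        fix a b assume ab: "a \<in> {..<m}" "b \<in> {..<m}" "w a = w b"
        then have "t a = t b" using yw by (metis lessThan_iff)
        then show "a = b" using t(2) ab by (auto simp: inj_on_def)
      qed
      show "w a \<in> {..<m}" if "a \<in> {..<m}" for a using wm that by simp
    qed (auto simp: w_def)
    moreover have "t = ?e w"
    proof (rule ext)
      fix a show "t a = ?e w a" using yw[of a] PiE_arb[OF t(1), of a] by (cases "a < m") auto
    qed
    ultimately show "t \<in> ?e ` {w. w permutes {..<m}}" by blast
  qed
  have "(\<Sum>t\<in>?P. F t) = (\<Sum>t\<in>{t \<in> ?P. inj_on t {..<m}}. F t)"
    by (rule sum.mono_neutral_right) (use F in \<open>auto intro!: finite_PiE\<close>)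
  also have "\<dots> = (\<Sum>w | w permutes {..<m}. F (?e w))"
    unfolding img[symmetric] using sum.reindex[OF inj, of F] by (simp add: comp_def)
  finally show ?thesis .
qed

text \<open>The sign by which w changes the pair product, read off from that product itself. The
  extraction of coefficients below rests on its value 1 at the identity.\<close>

definition eps :: "nat \<Rightarrow> (nat \<Rightarrow> nat) \<Rightarrow> int"
  where "eps m w = (if pair_prod (schur_ratio K_z) m (K_var \<circ> w) = pair_prod (schur_ratio K_z) m K_var then 1 else - 1)"

definition alternant :: "nat \<Rightarrow> nat list \<Rightarrow> af_poly"
  where "alternant m xs = (\<Sum>w | w permutes {..<m}. of_int (eps m w) * (\<Prod>a<m. var (w a) ^ (xs ! a - 1)))"

definition common_factor :: "nat \<Rightarrow> af_poly fract"
  where "common_factor m = (\<Prod>a<m. weight K_z (K_var ` {..<m}) (K_var a)) * pair_prod (schur_ratio K_z) m K_var"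

lemma common_factor_nz: "common_factor m \<noteq> 0"
proof -
  have w: "weight K_z (K_var ` {..<m}) (K_var a) \<noteq> 0" for a
  proof -
    have "2 * K_var a + K_z \<noteq> 0" using K_var_sum_nz[of a a] by (simp only: mult_2 not_False_eq_True)
    moreover have "(u + K_var a + K_z) / (K_var a - u) \<noteq> 0" if "u \<in> K_var ` {..<m} - {K_var a}" for u
      using that K_var_sum_nz by auto
    ultimately show ?thesis unfolding weight_def by (auto simp: prod_zero_iff)
  qed
  have "schur_ratio K_z (K_var a) (K_var b) \<noteq> 0" if "a < b" for a b
  proof -
    have "K_var b \<noteq> K_var a" using that inj_K_var[of UNIV] by (auto simp: inj_def)
    then show ?thesis using K_var_sum_nz[of a b] by (simp add: schur_ratio_def)
  qed
  then have "pair_prod (schur_ratio K_z) m K_var \<noteq> 0"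
    unfolding pair_prod_def prod_zero_iff[OF finite_pairs] by (auto simp: pairs_def)
  then show ?thesis unfolding common_factor_def using w by (simp add: prod_zero_iff)
qed

text \<open>With as many parts as variables only permutations of the variables contribute. For each
  of them the weights multiply to the same product and the pair product changes by a sign, so xs
  enters through the alternant alone.\<close>

lemma emb_pf_var_alternant:
  assumes len: "length xs = m" and pos: "0 \<notin> set xs"
  shows "emb (pf_var m xs) = common_factor m * emb (alternant m xs)"
proof -
  let ?S = "schur_ratio K_z" and ?V = "K_var ` {..<m}"
  let ?F = "\<lambda>t. (\<Prod>a<m. weight K_z ?V (t a) * t a ^ (xs ! a - 1)) * pair_prod ?S m t"
  have "emb (pf_var m xs) = (\<Sum>t\<in>PiE {..<m} (\<lambda>_. ?V). ?F t)"
    unfolding emb_pf_var[OF pos] len ..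
  also have "\<dots> = (\<Sum>w | w permutes {..<m}. ?F (restrict (K_var \<circ> w) {..<m}))"
    by (rule sum_PiE_permutations[OF inj_K_var]) (simp add: schur_pair_prod_noninj)
  also have "\<dots> = (\<Sum>w | w permutes {..<m}. common_factor m * emb (of_int (eps m w) * (\<Prod>a<m. var (w a) ^ (xs ! a - 1))))"
  proof (rule sum.cong[OF refl])
    fix w assume "w \<in> {w. w permutes {..<m}}"
    then have w: "w permutes {..<m}" by simp
    have "pair_prod ?S m (restrict (K_var \<circ> w) {..<m}) = pair_prod ?S m (K_var \<circ> w)"
      by (rule pair_prod_cong) simp
    also have "\<dots> = of_int (eps m w) * pair_prod ?S m K_var"
      using pair_prod_permute[of ?S, OF schur_ratio_skew w, of K_var] by (auto simp: eps_def)
    finally have p: "pair_prod ?S m (restrict (K_var \<circ> w) {..<m}) = of_int (eps m w) * pair_prod ?S m K_var" .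
    have "(\<Prod>a<m. weight K_z ?V (restrict (K_var \<circ> w) {..<m} a) * restrict (K_var \<circ> w) {..<m} a ^ (xs ! a - 1)) =
      (\<Prod>a<m. weight K_z ?V (K_var (w a))) * (\<Prod>a<m. K_var (w a) ^ (xs ! a - 1))"
      unfolding prod.distrib[symmetric] by (rule prod.cong) auto
    also have "(\<Prod>a<m. weight K_z ?V (K_var (w a))) = (\<Prod>a<m. weight K_z ?V (K_var a))"
      by (rule prod.permute[OF w, unfolded comp_def, symmetric])
    finally have q: "(\<Prod>a<m. weight K_z ?V (restrict (K_var \<circ> w) {..<m} a) * restrict (K_var \<circ> w) {..<m} a ^ (xs ! a - 1)) =
      (\<Prod>a<m. weight K_z ?V (K_var a)) * (\<Prod>a<m. K_var (w a) ^ (xs ! a - 1))" .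
    show "?F (restrict (K_var \<circ> w) {..<m}) =
      common_factor m * emb (of_int (eps m w) * (\<Prod>a<m. var (w a) ^ (xs ! a - 1)))"
      unfolding p q common_factor_def comm_ring_hom.mult[OF emb_hom] comm_ring_hom.of_int[OF emb_hom]
        comm_ring_hom.prod[OF emb_hom] comm_ring_hom.power[OF emb_hom] by (simp only: mult_ac)
  qed
  also have "\<dots> = common_factor m * emb (alternant m xs)"
    unfolding alternant_def comm_ring_hom.sum[OF emb_hom] by (rule sum_distrib_left[symmetric])
  finally show ?thesis .
qed

definition expo :: "nat \<Rightarrow> nat list \<Rightarrow> (nat \<Rightarrow> nat) \<Rightarrow> (nat \<Rightarrow>\<^sub>0 nat)"
  where "expo m xs w = (\<Sum>a<m. Poly_Mapping.single (w a) (xs ! a - 1))"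

lemma var_power: "var i ^ e = Poly_Mapping.single (Poly_Mapping.single i e) 1"
  by (induction e) (simp_all add: var_def mult_single single_add[symmetric])

lemma var_prod: "(\<Prod>a<m. var (w a) ^ (xs ! a - 1)) = Poly_Mapping.single (expo m xs w) 1"
  by (induction m) (simp_all add: expo_def var_power mult_single)

lemma lookup_expo:
  assumes "w permutes {..<m}"
  shows "a < m \<Longrightarrow> Poly_Mapping.lookup (expo m xs w) (w a) = xs ! a - 1"
    and "m \<le> i \<Longrightarrow> Poly_Mapping.lookup (expo m xs w) i = 0"
proof -
  show "Poly_Mapping.lookup (expo m xs w) (w a) = xs ! a - 1" if "a < m"
  proof -
    have "Poly_Mapping.lookup (expo m xs w) (w a) = (\<Sum>b<m. if b = a then xs ! a - 1 else 0)"
      unfolding expo_def lookup_sum using permutes_inj[OF assms]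
      by (intro sum.cong refl) (auto simp: lookup_single when_def inj_def)
    then show ?thesis using that by simp
  qed
  show "Poly_Mapping.lookup (expo m xs w) i = 0" if "m \<le> i"
  proof -
    have "w b \<noteq> i" if "b < m" for b using permutes_in_image[OF assms, of b] that \<open>m \<le> i\<close> by auto
    then show ?thesis unfolding expo_def lookup_sum by (intro sum.neutral) (auto simp: lookup_single when_def)
  qed
qed

lemma lookup_single_times: "Poly_Mapping.lookup (Poly_Mapping.single m 1 * g :: af_poly) (m + q) = Poly_Mapping.lookup g q"
proof -
  have eq: "Poly_Mapping.single m 1 * g = (\<Sum>k\<in>Poly_Mapping.keys g. Poly_Mapping.single (m + k) (Poly_Mapping.lookup g k))"
    by (subst (1) sum_keys_single[of g, symmetric]) (simp add: sum_distrib_left mult_single)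
  have "Poly_Mapping.lookup (Poly_Mapping.single m 1 * g) (m + q) =
    (\<Sum>k\<in>Poly_Mapping.keys g. if k = q then Poly_Mapping.lookup g q else 0)"
    unfolding eq lookup_sum by (intro sum.cong refl) (auto simp: lookup_single when_def)
  then show ?thesis by (simp add: in_keys_iff)
qed

lemma lookup_single_times_0:
  assumes "\<And>q. e \<noteq> m + q"
  shows "Poly_Mapping.lookup (Poly_Mapping.single m 1 * g :: af_poly) e = 0"
proof (rule ccontr)
  assume "Poly_Mapping.lookup (Poly_Mapping.single m 1 * g) e \<noteq> 0"
  then have "e \<in> Poly_Mapping.keys (Poly_Mapping.single m 1 * g)" by (simp add: in_keys_iff)
  then obtain a b where "e = a + b" "a \<in> Poly_Mapping.keys (Poly_Mapping.single m (1 :: int poly))"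
    using keys_mult by blast
  then show False using assms by (auto split: if_splits)
qed

text \<open>Comparing the exponent of each variable shows that xs and ys have the same parts up to
  order. Both decrease strictly, so they agree, and distinct parts leave only the identity.\<close>

lemma expo_eq_imp:
  assumes w: "w permutes {..<m}" and xs: "strict_partition xs" "length xs = m" and ys: "strict_partition ys" "length ys = m"
    and eq: "expo m xs w = expo m ys id"
  shows "xs = ys \<and> w = id"
proof -
  have pos: "0 < zs ! a" if "strict_partition zs" "a < length zs" for zs a
    using that by (metis gr0I nth_mem strict_partition_def)
  have nth: "xs ! a = ys ! w a" if a: "a < m" for a
  proof -
    have wa: "w a < m" using permutes_in_image[OF w, of a] a by simp
    have "xs ! a - 1 = ys ! w a - 1"
      using lookup_expo(1)[OF w a, of xs] lookup_expo(1)[OF permutes_id wa, of ys] eq by simp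
    then show ?thesis using pos[OF xs(1)] pos[OF ys(1)] a wa xs ys by (metis Suc_pred' Suc_eq_plus1 diff_Suc_1)
  qed
  have dist: "distinct zs" if "strict_partition zs" for zs
    using that unfolding strict_partition_def by (auto simp: distinct_conv_nth sorted_wrt_iff_nth_less) (metis less_irrefl linorder_neqE_nat)
  have sub: "set xs \<subseteq> set ys"
  proof
    fix v assume "v \<in> set xs"
    then obtain a where "a < m" "v = xs ! a" using xs(2) by (auto simp: in_set_conv_nth)
    moreover have "w a < m" using permutes_in_image[OF w, of a] \<open>a < m\<close> by simp
    ultimately show "v \<in> set ys" using nth ys(2) by simp
  qed
  have "set xs = set ys"
    by (rule card_subset_eq[OF _ sub]) (use distinct_card[OF dist[OF xs(1)]] distinct_card[OF dist[OF ys(1)]] xs ys in auto)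
  moreover have "sorted_wrt (<) (rev xs)" "sorted_wrt (<) (rev ys)"
    using xs(1) ys(1) by (auto simp: strict_partition_def sorted_wrt_rev)
  ultimately have "rev xs = rev ys" by (intro strict_sorted_equal) auto
  then have xy: "xs = ys" by simp
  have "w a = a" for a
  proof (cases "a < m")
    case True
    then have "w a < m" using permutes_in_image[OF w, of a] by simp
    then show ?thesis using nth[OF True] True dist[OF xs(1)] xs(2) xy by (metis nth_eq_iff_index_eq)
  next
    case False
    then show ?thesis using w by (simp add: permutes_def)
  qed
  then show ?thesis using xy by auto
qed

lemma lookup_of_int_times: "Poly_Mapping.lookup (of_int c * f :: af_poly) e = of_int c * Poly_Mapping.lookup f e"
proof -
  have n: "Poly_Mapping.lookup (of_nat k * f :: af_poly) e = of_nat k * Poly_Mapping.lookup f e" for k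
    by (induction k) (simp_all add: distrib_right lookup_add)
  show ?thesis by (cases c) (simp_all add: n lookup_minus lookup_uminus left_diff_distrib flip: of_nat_Suc)
qed

lemma lookup_const_times: "Poly_Mapping.lookup (af_const d * f) e = d * Poly_Mapping.lookup f e"
proof -
  have eq: "af_const d * f = (\<Sum>k\<in>Poly_Mapping.keys f. Poly_Mapping.single k (d * Poly_Mapping.lookup f k))"
    by (subst (1) sum_keys_single[of f, symmetric]) (simp add: sum_distrib_left mult_single af_const_def)
  have "Poly_Mapping.lookup (af_const d * f) e =
    (\<Sum>k\<in>Poly_Mapping.keys f. if k = e then d * Poly_Mapping.lookup f e else 0)"
    unfolding eq lookup_sum by (intro sum.cong refl) (auto simp: lookup_single when_def)
  then show ?thesis by (simp add: in_keys_iff)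
qed

lemma eps_id: "eps m id = 1"
  by (simp add: eps_def)

lemma lookup_alternant:
  assumes lam: "strict_partition lam" "length lam = m" and xs: "strict_partition xs" "length xs = m"
  shows "Poly_Mapping.lookup (alternant m xs) (expo m lam id) = (if xs = lam then 1 else 0)"
proof -
  let ?e = "expo m lam id"
  have fin: "finite {w. w permutes {..<m}}" by (simp add: finite_permutations)
  have "Poly_Mapping.lookup (alternant m xs) ?e = (\<Sum>w | w permutes {..<m}. if w = id then (if xs = lam then 1 else 0) else 0)"
    unfolding alternant_def lookup_sum lookup_of_int_times var_prod
  proof (rule sum.cong[OF refl])
    fix w assume "w \<in> {w. w permutes {..<m}}"
    then have "w permutes {..<m}" by simp
    from expo_eq_imp[OF this xs lam] show "of_int (eps m w) * Poly_Mapping.lookup (Poly_Mapping.single (expo m xs w) 1) ?e =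
      (if w = id then (if xs = lam then 1 else 0) else 0)"
      by (cases "xs = lam \<and> w = id") (auto simp: lookup_single when_def eps_id)
  qed
  then show ?thesis using fin by (simp add: permutes_id)
qed

text \<open>All monomials of the alternant have the same total degree in the variables, so in the
  product this monomial arises only from the constant term of g, and then only from the permutation
  that yields exactly this monomial.\<close>

lemma lookup_alternant_times:
  assumes lam: "strict_partition lam" "length lam = m"
  shows "Poly_Mapping.lookup (alternant m lam * g) (expo m lam id) = Poly_Mapping.lookup g 0"
proof -
  let ?e = "expo m lam id"
  have fin: "finite {w. w permutes {..<m}}" by (simp add: finite_permutations)
  have deg: "(\<Sum>i<m. Poly_Mapping.lookup (expo m lam w) i) = (\<Sum>a<m. lam ! a - 1)" if w: "w permutes {..<m}" for w
  proof -
    have "(\<Sum>i<m. Poly_Mapping.lookup (expo m lam w) i) = (\<Sum>a<m. Poly_Mapping.lookup (expo m lam w) (w a))"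
      by (rule sum.permute[OF w, unfolded comp_def])
    then show ?thesis using lookup_expo(1)[OF w] by simp
  qed
  have other: "Poly_Mapping.lookup (Poly_Mapping.single (expo m lam w) 1 * g) ?e = 0"
    if w: "w permutes {..<m}" and ne: "w \<noteq> id" for w
  proof (rule lookup_single_times_0, rule notI)
    fix q
    assume e: "?e = expo m lam w + q"
    have "Poly_Mapping.lookup q i = 0" for i
    proof (cases "i < m")
      case True
      have "(\<Sum>i<m. Poly_Mapping.lookup q i) = 0"
        using deg[OF w] deg[OF permutes_id] by (simp add: e lookup_add sum.distrib)
      then show ?thesis using True by simp
    next
      case False
      then have "Poly_Mapping.lookup ?e i = 0" using lookup_expo(2)[OF permutes_id] by simp
      then show ?thesis by (simp add: e lookup_add)
    qed
    then have "q = 0" by (simp add: poly_mapping_eqI)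
    then show False using expo_eq_imp[OF w lam lam] e ne by simp
  qed
  have "Poly_Mapping.lookup (alternant m lam * g) ?e =
    (\<Sum>w | w permutes {..<m}. of_int (eps m w) * Poly_Mapping.lookup (Poly_Mapping.single (expo m lam w) 1 * g) ?e)"
    unfolding alternant_def sum_distrib_right lookup_sum mult.assoc lookup_of_int_times var_prod ..
  also have "\<dots> = (\<Sum>w | w permutes {..<m}. if w = id then Poly_Mapping.lookup g 0 else 0)"
  proof (rule sum.cong[OF refl])
    fix w assume "w \<in> {w. w permutes {..<m}}"
    then show "of_int (eps m w) * Poly_Mapping.lookup (Poly_Mapping.single (expo m lam w) 1 * g) ?e =
      (if w = id then Poly_Mapping.lookup g 0 else 0)"
      using other[of w] lookup_single_times[of ?e g 0] by (auto simp: eps_id)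
  qed
  also have "\<dots> = Poly_Mapping.lookup g 0" using fin by (simp add: permutes_id)
  finally show ?thesis .
qed

text \<open>In m variables the classes with more than m parts vanish, those with fewer parts have
  coefficient 0 by assumption, and from the rest the nonzero common factor cancels.\<close>

lemma pf_var_cancel:
  assumes N: "finite N" "N \<subseteq> Collect strict_partition" and short: "\<And>\<nu>. \<nu> \<in> N \<Longrightarrow> length \<nu> < m \<Longrightarrow> d \<nu> = 0"
    and lam: "strict_partition lam" "length lam = m"
    and eq: "pf_var m lam * g = (\<Sum>\<nu>\<in>N. af_const (d \<nu>) * pf_var m \<nu>)"
  shows "alternant m lam * g = (\<Sum>\<nu>\<in>{\<nu> \<in> N. length \<nu> = m}. af_const (d \<nu>) * alternant m \<nu>)"
proof -
  let ?M = "{\<nu> \<in> N. length \<nu> = m}"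
  have pos: "0 \<notin> set \<nu>" if "\<nu> \<in> N" for \<nu> using N(2) that by (auto simp: strict_partition_def)
  have "(\<Sum>\<nu>\<in>N. af_const (d \<nu>) * pf_var m \<nu>) = (\<Sum>\<nu>\<in>?M. af_const (d \<nu>) * pf_var m \<nu>)"
  proof (rule sum.mono_neutral_right[OF N(1)])
    show "\<forall>\<nu>\<in>N - ?M. af_const (d \<nu>) * pf_var m \<nu> = 0"
    proof
      fix \<nu> assume \<nu>: "\<nu> \<in> N - ?M"
      then consider "length \<nu> < m" | "m < length \<nu>" by (auto simp: neq_iff)
      then show "af_const (d \<nu>) * pf_var m \<nu> = 0"
      proof cases
        case 1
        then show ?thesis using short \<nu> by (simp add: af_const_0)
      next
        case 2
        then show ?thesis using pf_var_too_long pos \<nu> by simp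
      qed
    qed
  qed auto
  note M = this
  have "0 \<notin> set lam" using lam(1) by (simp add: strict_partition_def)
  then have "common_factor m * emb (alternant m lam * g) = emb (pf_var m lam * g)"
    unfolding comm_ring_hom.mult[OF emb_hom] emb_pf_var_alternant[OF lam(2) \<open>0 \<notin> set lam\<close>] by (simp only: mult.assoc)
  also have "\<dots> = emb (\<Sum>\<nu>\<in>?M. af_const (d \<nu>) * pf_var m \<nu>)" unfolding eq M ..
  also have "\<dots> = (\<Sum>\<nu>\<in>?M. emb (af_const (d \<nu>)) * (common_factor m * emb (alternant m \<nu>)))"
    unfolding comm_ring_hom.sum[OF emb_hom] comm_ring_hom.mult[OF emb_hom]
    by (intro sum.cong refl) (use emb_pf_var_alternant pos in auto)
  also have "\<dots> = common_factor m * emb (\<Sum>\<nu>\<in>?M. af_const (d \<nu>) * alternant m \<nu>)"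
    unfolding comm_ring_hom.sum[OF emb_hom] comm_ring_hom.mult[OF emb_hom] sum_distrib_left
    by (intro sum.cong refl) (simp only: mult_ac)
  finally show ?thesis by (simp add: common_factor_nz emb_eq_iff)
qed

lemma lookup_sum_alternant:
  assumes "finite M" "\<And>\<nu>. \<nu> \<in> M \<Longrightarrow> strict_partition \<nu> \<and> length \<nu> = m" "strict_partition lam" "length lam = m"
  shows "Poly_Mapping.lookup (\<Sum>\<nu>\<in>M. af_const (d \<nu>) * alternant m \<nu>) (expo m lam id) = (if lam \<in> M then d lam else 0)"
proof -
  have "Poly_Mapping.lookup (\<Sum>\<nu>\<in>M. af_const (d \<nu>) * alternant m \<nu>) (expo m lam id) =
    (\<Sum>\<nu>\<in>M. if \<nu> = lam then d lam else 0)"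
    unfolding lookup_sum lookup_const_times
    by (rule sum.cong[OF refl]) (use assms lookup_alternant in auto)
  then show ?thesis using assms(1) by simp
qed

text \<open>Induction on the number of parts: in as many variables as nu has parts, the shorter
  classes are already gone and the longer ones vanish, and the leading monomials of the alternants
  separate the remaining coefficients.\<close>

lemma coefficients_below:
  assumes N: "finite N" "N \<subseteq> Collect strict_partition"
    and zero: "\<And>m. m < n \<Longrightarrow> (\<Sum>\<nu>\<in>N. af_const (d \<nu>) * pf_var m \<nu>) = 0"
    and \<nu>: "\<nu> \<in> N" "length \<nu> < n"
  shows "d \<nu> = 0"
  using \<nu>
proof (induction "length \<nu>" arbitrary: \<nu> rule: less_induct)
  case less
  let ?m = "length \<nu>"
  have sp: "strict_partition \<nu>" using less.prems N by auto
  have "alternant ?m \<nu> * 0 = (\<Sum>\<nu>'\<in>{\<nu>' \<in> N. length \<nu>' = ?m}. af_const (d \<nu>') * alternant ?m \<nu>')"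
  proof (rule pf_var_cancel[OF N _ sp refl])
    show "d \<nu>' = 0" if "\<nu>' \<in> N" "length \<nu>' < ?m" for \<nu>' using less.hyps[OF that(2,1)] less.prems that by simp
    show "pf_var ?m \<nu> * 0 = (\<Sum>\<nu>\<in>N. af_const (d \<nu>) * pf_var ?m \<nu>)" using zero[OF less.prems(2)] by simp
  qed
  then have "Poly_Mapping.lookup (\<Sum>\<nu>'\<in>{\<nu>' \<in> N. length \<nu>' = ?m}. af_const (d \<nu>') * alternant ?m \<nu>') (expo ?m \<nu> id) = 0"
    by simp
  moreover have "Poly_Mapping.lookup (\<Sum>\<nu>'\<in>{\<nu>' \<in> N. length \<nu>' = ?m}. af_const (d \<nu>') * alternant ?m \<nu>') (expo ?m \<nu> id) =
    (if \<nu> \<in> {\<nu>' \<in> N. length \<nu>' = ?m} then d \<nu> else 0)"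
    by (rule lookup_sum_alternant[OF _ _ sp refl]) (use N in auto)
  ultimately show ?case using less.prems(1) by simp
qed

lemma eval_expansion:
  "eval m (\<Sum>\<nu>\<in>N. af_scale (d \<nu>) (af_sigma \<nu>)) = (\<Sum>\<nu>\<in>N. af_const (d \<nu>) * pf_var m \<nu>)"
  by (simp add: comm_ring_hom.sum[OF eval_hom] eval_scale eval_sigma)

lemma af_sigma_independent:
  assumes N: "finite N" "N \<subseteq> Collect strict_partition"
    and zero: "(\<Sum>\<nu>\<in>N. af_scale (d \<nu>) (af_sigma \<nu>)) = 0" and \<nu>: "\<nu> \<in> N"
  shows "d \<nu> = 0"
proof (rule coefficients_below[OF N _ \<nu> lessI])
  fix m
  show "(\<Sum>\<nu>\<in>N. af_const (d \<nu>) * pf_var m \<nu>) = 0"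
    unfolding eval_expansion[symmetric] zero by (rule comm_ring_hom.zero[OF eval_hom])
qed

text \<open>Evaluation in fewer than length lam variables kills \<sigma>_lam, and evaluation in exactly length lam variables
  turns it into a multiple of an alternant, whose leading monomial picks out the constant term of r.\<close>

theorem af_sigma_times_coefficient:
  assumes N: "finite N" "N \<subseteq> Collect strict_partition" and lam: "strict_partition lam"
    and eq: "af_sigma lam * r = (\<Sum>\<nu>\<in>N. af_scale (d \<nu>) (af_sigma \<nu>))"
  shows "(if lam \<in> N then d lam else 0) = Poly_Mapping.lookup (eval (length lam) r) 0"
proof -
  let ?m = "length lam"
  have ev: "pf_var k lam * eval k r = (\<Sum>\<nu>\<in>N. af_const (d \<nu>) * pf_var k \<nu>)" for k
    using arg_cong[OF eq, of "eval k"] by (simp add: eval_expansion comm_ring_hom.mult[OF eval_hom] eval_sigma)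
  have zero: "(\<Sum>\<nu>\<in>N. af_const (d \<nu>) * pf_var k \<nu>) = 0" if "k < ?m" for k
    using ev[of k] pf_var_too_long[of k lam] that lam by (simp add: strict_partition_def)
  have "alternant ?m lam * eval ?m r = (\<Sum>\<nu>\<in>{\<nu> \<in> N. length \<nu> = ?m}. af_const (d \<nu>) * alternant ?m \<nu>)"
    by (rule pf_var_cancel[OF N _ lam refl ev]) (rule coefficients_below[OF N zero])
  moreover have "Poly_Mapping.lookup (\<Sum>\<nu>\<in>{\<nu> \<in> N. length \<nu> = ?m}. af_const (d \<nu>) * alternant ?m \<nu>) (expo ?m lam id) =
    (if lam \<in> {\<nu> \<in> N. length \<nu> = ?m} then d lam else 0)"
    by (rule lookup_sum_alternant[OF _ _ lam refl]) (use N in auto)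
  ultimately show ?thesis using lookup_alternant_times[OF lam refl, of "eval ?m r"] by simp
qed

section \<open>The Schubert classes span\<close>

lemma module_af_scale: "module af_scale"
  by unfold_locales (simp_all add: af_scale_def comm_ring_hom.add[OF af_const_hom] comm_ring_hom.add[OF abs_hom]
    comm_ring_hom.mult[OF af_const_hom] comm_ring_hom.mult[OF abs_hom] comm_ring_hom.one[OF af_const_hom]
    comm_ring_hom.one[OF abs_hom] algebra_simps)

abbreviation af_span :: "af_ring set \<Rightarrow> af_ring set"
  where "af_span \<equiv> module.span af_scale"

lemmas af_span_base = module.span_base[OF module_af_scale]
lemmas af_span_zero = module.span_zero[OF module_af_scale]
lemmas af_span_add = module.span_add[OF module_af_scale]
lemmas af_span_diff = module.span_diff[OF module_af_scale]
lemmas af_span_neg = module.span_neg[OF module_af_scale]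
lemmas af_span_sum = module.span_sum[OF module_af_scale]
lemmas af_span_scale = module.span_scale[OF module_af_scale]
lemmas af_span_mono = module.span_mono[OF module_af_scale]

lemma af_scale_mult_right: "y * af_scale p x = af_scale p (y * x)"
  by (simp add: af_scale_def mult_ac)

lemma af_span_mult:
  assumes "\<And>x. x \<in> A \<Longrightarrow> y * x \<in> af_span B" "x \<in> af_span A"
  shows "y * x \<in> af_span B"
  using assms(2)
proof (induction rule: module.span_induct_alt[OF module_af_scale, consumes 1, case_names base step])
  case base
  show ?case by (simp add: af_span_zero)
next
  case (step c x v)
  then show ?case using af_span_add[OF af_span_scale[OF assms(1)]]
    by (simp add: distrib_left af_scale_mult_right)
qed

abbreviation ring_c :: "nat \<Rightarrow> af_ring"
  where "ring_c k \<equiv> abs_af_ring (af_c k)"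

lemma ring_c_0: "ring_c 0 = 1"
  by (simp add: af_c_def comm_ring_hom.one[OF abs_hom])

text \<open>d is the degree of the monomial x and s the sum of the squares of its indices. Monomials are
  ordered by degree and, in a fixed degree, by decreasing s, so that c_p c_q with p \<ge> q is the
  leading term of c_(p,q).\<close>

definition monom_type :: "af_ring \<Rightarrow> nat \<Rightarrow> nat \<Rightarrow> bool"
  where "monom_type x d s \<longleftrightarrow> (\<exists>xs. x = prod_list (map ring_c xs) \<and> d = sum_list xs \<and> s = sum_list (map (\<lambda>k. k\<^sup>2) xs))"

lemma monom_type_ring_c: "monom_type (ring_c k) k (k\<^sup>2)"
  unfolding monom_type_def by (rule exI[of _ "[k]"]) simp

lemma monom_type_one: "monom_type 1 0 0"
  unfolding monom_type_def by (rule exI[of _ "[]"]) simp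

lemma monom_type_mult:
  assumes "monom_type x d s" "monom_type y d' s'"
  shows "monom_type (x * y) (d + d') (s + s')"
proof -
  from assms obtain xs ys where "x = prod_list (map ring_c xs)" "d = sum_list xs" "s = sum_list (map (\<lambda>k. k\<^sup>2) xs)"
    "y = prod_list (map ring_c ys)" "d' = sum_list ys" "s' = sum_list (map (\<lambda>k. k\<^sup>2) ys)"
    unfolding monom_type_def by metis
  then show ?thesis unfolding monom_type_def by (intro exI[of _ "xs @ ys"]) simp
qed

lemma monom_type_le:
  assumes "monom_type x d s"
  shows "s \<le> d\<^sup>2"
proof -
  have "sum_list (map (\<lambda>k. k\<^sup>2) xs) \<le> (sum_list xs)\<^sup>2" for xs :: "nat list"
    by (induction xs) (auto simp: power2_sum)
  then show ?thesis using assms unfolding monom_type_def by metis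
qed

definition lower :: "nat \<Rightarrow> nat \<Rightarrow> af_ring set"
  where "lower d s = {x. \<exists>d' s'. monom_type x d' s' \<and> (d' < d \<or> d' = d \<and> s < s')}"

lemma lower_mono: "d' < d \<or> d' = d \<and> s \<le> s' \<Longrightarrow> lower d' s' \<subseteq> lower d s"
  unfolding lower_def by (blast intro: less_trans le_less_trans)

lemma lower_mult:
  assumes m: "monom_type m d s" and x: "x \<in> af_span (lower d' s')"
  shows "m * x \<in> af_span (lower (d + d') (s + s'))"
proof (rule af_span_mult[OF _ x], rule af_span_base)
  fix x assume "x \<in> lower d' s'"
  then obtain e t where "monom_type x e t" "e < d' \<or> e = d' \<and> s' < t" unfolding lower_def by blast
  moreover from this have "monom_type (m * x) (d + e) (s + t)" using monom_type_mult m by blast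
  ultimately show "m * x \<in> lower (d + d') (s + s')" unfolding lower_def by force
qed

lemma lower_mult_lower:
  assumes x: "x \<in> af_span (lower d s)" and y: "y \<in> af_span (lower d' s')"
  shows "x * y \<in> af_span (lower (d + d') (s + s'))"
proof -
  have "y * x \<in> af_span (lower (d + d') (s + s'))"
  proof (rule af_span_mult[OF _ x])
    fix m assume "m \<in> lower d s"
    then obtain e t where m: "monom_type m e t" "e < d \<or> e = d \<and> s < t" unfolding lower_def by blast
    have "m * y \<in> af_span (lower (e + d') (t + s'))" by (rule lower_mult[OF m(1) y])
    moreover have "lower (e + d') (t + s') \<subseteq> lower (d + d') (s + s')" by (rule lower_mono) (use m(2) in auto)
    ultimately show "y * m \<in> af_span (lower (d + d') (s + s'))" using af_span_mono by (metis mult.commute subsetD)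
  qed
  then show ?thesis by (simp only: mult.commute)
qed

definition leads :: "af_ring \<Rightarrow> af_ring \<Rightarrow> nat \<Rightarrow> nat \<Rightarrow> bool"
  where "leads x m d s \<longleftrightarrow> monom_type m d s \<and> x - m \<in> af_span (lower d s)"

text \<open>Degree and sum of squares are additive on monomials, so leading terms multiply.\<close>

lemma leads_mult:
  assumes "leads x m d s" "leads y m' d' s'"
  shows "leads (x * y) (m * m') (d + d') (s + s')"
proof -
  have x: "monom_type m d s" "x - m \<in> af_span (lower d s)" and y: "monom_type m' d' s'" "y - m' \<in> af_span (lower d' s')"
    using assms by (auto simp: leads_def)
  have "(x - m) * (y - m') + (m * (y - m') + m' * (x - m)) \<in> af_span (lower (d + d') (s + s'))"
  proof (intro af_span_add)
    show "(x - m) * (y - m') \<in> af_span (lower (d + d') (s + s'))" by (rule lower_mult_lower[OF x(2) y(2)])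
    show "m * (y - m') \<in> af_span (lower (d + d') (s + s'))" by (rule lower_mult[OF x(1) y(2)])
    show "m' * (x - m) \<in> af_span (lower (d + d') (s + s'))"
      using lower_mult[OF y(1) x(2)] by (simp only: add.commute)
  qed
  moreover have "(x - m) * (y - m') + (m * (y - m') + m' * (x - m)) = x * y - m * m'" by (simp add: algebra_simps)
  ultimately show ?thesis using monom_type_mult[OF x(1) y(1)] by (simp only: leads_def simp_thms)
qed

lemma leads_prod:
  fixes k :: nat
  assumes "\<And>i. i < k \<Longrightarrow> leads (x i) (m i) (d i) (s i)"
  shows "leads (\<Prod>i<k. x i) (\<Prod>i<k. m i) (\<Sum>i<k. d i) (\<Sum>i<k. s i)"
  using assms
proof (induction k)
  case 0
  show ?case by (simp add: leads_def monom_type_one af_span_zero)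
next
  case (Suc k)
  then show ?case using leads_mult[of "\<Prod>i<k. x i" "\<Prod>i<k. m i" "\<Sum>i<k. d i" "\<Sum>i<k. s i" "x k" "m k" "d k" "s k"] by simp
qed

abbreviation ring_cc :: "nat \<Rightarrow> nat \<Rightarrow> af_ring"
  where "ring_cc p q \<equiv> abs_af_ring (af_cc p q)"

lemma ring_cc_diag: "0 < p \<Longrightarrow> ring_cc p p = 0"
  unfolding zero_af_ring_def af_ring.abs_eq_iff af_rel_def af_ideal_def
  by (auto intro!: module.span_base[OF module_mult])

text \<open>The term b = 0 is c_p c_q. For b > 0, a term with a > 0 has smaller degree, and the one
  with a = 0 moves b from the smaller index to the larger, which increases the sum of
  squares.\<close>

lemma leads_ring_cc:
  assumes "q \<le> p"
  shows "leads (ring_cc p q) (ring_c p * ring_c q) (p + q) (p\<^sup>2 + q\<^sup>2)"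
proof -
  define k where "k = (\<lambda>b a. (- 1) ^ b * of_nat ((b choose a) + (if b = 0 then 0 else (b - 1) choose a)) * [:0, 1:] ^ a :: int poly)"
  define T where "T = (\<lambda>b a. af_scale (k b a) (ring_c (p + b - a) * ring_c (q - b)))"
  have "ring_cc p q = (\<Sum>b\<le>q. \<Sum>a\<le>b. T b a)"
    unfolding af_cc_def comm_ring_hom.sum[OF abs_hom] T_def k_def af_scale_def af_z_def
      comm_ring_hom.mult[OF af_const_hom] comm_ring_hom.power[OF af_const_hom] comm_ring_hom.of_nat[OF af_const_hom]
      comm_ring_hom.uminus[OF af_const_hom] comm_ring_hom.one[OF af_const_hom]
      comm_ring_hom.mult[OF abs_hom] by (simp only: mult.assoc)
  also have "\<dots> = ring_c p * ring_c q + (\<Sum>b\<in>{..q} - {0}. \<Sum>a\<le>b. T b a)"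
    by (subst sum.remove[of _ 0])
      (simp_all add: T_def k_def af_scale_def comm_ring_hom.one[OF af_const_hom] comm_ring_hom.one[OF abs_hom])
  finally have eq: "ring_cc p q - ring_c p * ring_c q = (\<Sum>b\<in>{..q} - {0}. \<Sum>a\<le>b. T b a)" by simp
  have "T b a \<in> af_span (lower (p + q) (p\<^sup>2 + q\<^sup>2))" if b: "b \<in> {..q} - {0}" and a: "a \<le> b" for b a
    unfolding T_def
  proof (rule af_span_scale, rule af_span_base)
    have m: "monom_type (ring_c (p + b - a) * ring_c (q - b)) ((p + b - a) + (q - b)) ((p + b - a)\<^sup>2 + (q - b)\<^sup>2)"
      by (intro monom_type_mult monom_type_ring_c)
    have sq: "p\<^sup>2 + q\<^sup>2 < (p + b)\<^sup>2 + (q - b)\<^sup>2"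
    proof -
      obtain r where q: "q = b + r" using b by (auto simp: le_iff_add)
      obtain u where p: "p = b + r + u" using assms q by (auto simp: le_iff_add)
      have "0 < b * b" using b by simp
      then show ?thesis unfolding p q by (simp add: power2_eq_square algebra_simps)
    qed
    have "(p + b - a) + (q - b) < p + q \<or> (p + b - a) + (q - b) = p + q \<and> p\<^sup>2 + q\<^sup>2 < (p + b - a)\<^sup>2 + (q - b)\<^sup>2"
      using a b sq by (cases "a = 0") auto
    then show "ring_c (p + b - a) * ring_c (q - b) \<in> lower (p + q) (p\<^sup>2 + q\<^sup>2)" using m unfolding lower_def by blast
  qed
  then have "ring_cc p q - ring_c p * ring_c q \<in> af_span (lower (p + q) (p\<^sup>2 + q\<^sup>2))"
    unfolding eq by (intro af_span_sum) auto
  then show ?thesis using monom_type_mult[OF monom_type_ring_c monom_type_ring_c] by (simp add: leads_def)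
qed

text \<open>Every matching collects the leading terms over all positions and so gives the same
  monomial; the signs of the matchings add up to 1. An added part 0 contributes the factor c_0 =
  1.\<close>

lemma leads_af_sigma:
  assumes xs: "sorted_wrt (>) xs"
  shows "leads (af_sigma xs) (prod_list (map ring_c xs)) (sum_list xs) (sum_list (map (\<lambda>k. k\<^sup>2) xs))"
proof -
  define k where "k = (length xs + 1) div 2"
  have len: "length xs \<le> 2 * k" by (simp add: k_def)
  have all: "(\<Prod>a<2 * k. ring_c (part xs a)) = prod_list (map ring_c xs)"
  proof -
    have "(\<Prod>a<2 * k. ring_c (part xs a)) = (\<Prod>a<length xs. ring_c (part xs a))"
      using len by (intro prod.mono_neutral_right) (auto simp: part_def ring_c_0)
    also have "\<dots> = prod_list (map ring_c xs)" by (simp add: prod.list_conv_set_nth part_def lessThan_atLeast0)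
    finally show ?thesis .
  qed
  have all_sum: "(\<Sum>a<2 * k. f (part xs a)) = sum_list (map f xs)" if "f 0 = 0" for f :: "nat \<Rightarrow> nat"
  proof -
    have "(\<Sum>a<2 * k. f (part xs a)) = (\<Sum>a<length xs. f (part xs a))"
      using len that by (intro sum.mono_neutral_right) (auto simp: part_def)
    also have "\<dots> = sum_list (map f xs)" by (simp add: sum_list_sum_nth part_def lessThan_atLeast0)
    finally show ?thesis .
  qed
  let ?m = "prod_list (map ring_c xs)" and ?d = "sum_list xs" and ?s = "sum_list (map (\<lambda>k. k\<^sup>2) xs)"
  have term_leads: "leads (\<Prod>i<k. ring_cc (part xs (\<pi> (2 * i))) (part xs (\<pi> (2 * i + 1)))) ?m ?d ?s"
    if \<pi>: "\<pi> \<in> matchings k" for \<pi>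
  proof -
    have p: "\<pi> permutes {..<2 * k}" using \<pi> by (simp add: matchings_def)
    have le: "part xs b \<le> part xs a" if "a < b" for a b
      using xs that by (auto simp: part_def sorted_wrt_iff_nth_less intro: less_imp_le)
    have "leads (\<Prod>i<k. ring_cc (part xs (\<pi> (2 * i))) (part xs (\<pi> (2 * i + 1))))
      (\<Prod>i<k. ring_c (part xs (\<pi> (2 * i))) * ring_c (part xs (\<pi> (2 * i + 1))))
      (\<Sum>i<k. part xs (\<pi> (2 * i)) + part xs (\<pi> (2 * i + 1)))
      (\<Sum>i<k. (part xs (\<pi> (2 * i)))\<^sup>2 + (part xs (\<pi> (2 * i + 1)))\<^sup>2)"
      by (intro leads_prod leads_ring_cc le matchings_less(1)[OF \<pi>])
    moreover have "(\<Prod>i<k. ring_c (part xs (\<pi> (2 * i))) * ring_c (part xs (\<pi> (2 * i + 1)))) = ?m"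
      unfolding prod_pairs[of "\<lambda>a. ring_c (part xs (\<pi> a))"] all[symmetric]
      by (rule prod.permute[OF p, unfolded comp_def, symmetric])
    moreover have "(\<Sum>i<k. f (part xs (\<pi> (2 * i))) + f (part xs (\<pi> (2 * i + 1)))) = sum_list (map f xs)"
      if "f 0 = 0" for f :: "nat \<Rightarrow> nat"
    proof -
      have "(\<Sum>i<k. g (2 * i) + g (2 * i + 1)) = (\<Sum>a<2 * k. g a)" for g :: "nat \<Rightarrow> nat"
        by (induction k) simp_all
      from this[of "\<lambda>a. f (part xs (\<pi> a))"] show ?thesis
        unfolding all_sum[of f, OF that, symmetric] using sum.permute[OF p, of "\<lambda>a. f (part xs a)"] by (simp add: comp_def)
    qed
    from this[of "\<lambda>a. a"] this[of "\<lambda>a. a\<^sup>2"] calculation show ?thesis by simp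
  qed
  have mt: "monom_type ?m ?d ?s" unfolding monom_type_def by blast
  have ones: "(\<Sum>\<pi>\<in>matchings k. of_int (sign \<pi>) :: af_ring) = 1"
    using pfaffian_ones[of k, where 'a = af_ring] by (simp add: pfaffian_matchings)
  have "af_sigma xs - ?m = (\<Sum>\<pi>\<in>matchings k. of_int (sign \<pi>) * (\<Prod>i<k. ring_cc (part xs (\<pi> (2 * i))) (part xs (\<pi> (2 * i + 1)))))
    - (\<Sum>\<pi>\<in>matchings k. of_int (sign \<pi>)) * ?m"
    unfolding af_sigma_def k_def[symmetric] pfaffian_matchings ones by simp
  also have "\<dots> = (\<Sum>\<pi>\<in>matchings k. of_int (sign \<pi>) * ((\<Prod>i<k. ring_cc (part xs (\<pi> (2 * i))) (part xs (\<pi> (2 * i + 1)))) - ?m))"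
    by (simp add: sum_distrib_right sum_subtractf right_diff_distrib)
  also have "\<dots> \<in> af_span (lower ?d ?s)"
  proof (rule af_span_sum)
    fix \<pi> assume "\<pi> \<in> matchings k"
    then have x: "(\<Prod>i<k. ring_cc (part xs (\<pi> (2 * i))) (part xs (\<pi> (2 * i + 1)))) - ?m \<in> af_span (lower ?d ?s)" (is "?x \<in> _")
      using term_leads by (simp add: leads_def)
    have "of_int (sign \<pi>) * ?x = ?x \<or> of_int (sign \<pi>) * ?x = - ?x" by (auto simp: sign_def)
    then show "of_int (sign \<pi>) * ?x \<in> af_span (lower ?d ?s)" by (elim disjE) (simp_all only: x af_span_neg[OF x])
  qed
  finally show ?thesis using mt by (simp add: leads_def)
qed

text \<open>In degree d the sum of squares is at most d^2, so the order is well-founded. After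
  dropping c_0, a monomial with distinct indices is the leading term of a class. A repeated index p
  is replaced by lower terms, since c_(p,p) = 0 has leading term c_p^2.\<close>

lemma monom_in_span:
  assumes "monom_type m d s"
  shows "m \<in> af_span (af_sigma ` Collect strict_partition)"
  using assms
proof (induction d arbitrary: m s rule: less_induct)
  case (less d)
  note deg = less.IH
  show ?case using less.prems
  proof (induction "d\<^sup>2 - s" arbitrary: m s rule: less_induct)
    case less
    let ?S = "af_span (af_sigma ` Collect strict_partition)"
    have low: "lower d s \<subseteq> ?S"
    proof
      fix x assume "x \<in> lower d s"
      then obtain d' s' where x: "monom_type x d' s'" "d' < d \<or> d' = d \<and> s < s'" unfolding lower_def by blast
      from x(2) show "x \<in> ?S"
      proof
        assume "d' < d"
        then show ?thesis using deg x(1) by blast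
      next
        assume a: "d' = d \<and> s < s'"
        then have "d\<^sup>2 - s' < d\<^sup>2 - s" using monom_type_le[OF x(1)] a by (intro diff_less_mono2) auto
        then show ?thesis using less.hyps x(1) a by blast
      qed
    qed
    have span_low: "af_span (lower d s) \<subseteq> ?S"
      by (rule module.span_minimal[OF module_af_scale low]) (rule module.subspace_span[OF module_af_scale])
    obtain xs where xs: "m = prod_list (map ring_c xs)" "d = sum_list xs" "s = sum_list (map (\<lambda>k. k\<^sup>2) xs)"
      using less.prems unfolding monom_type_def by blast
    define ys where "ys = rev (sort (filter (\<lambda>k. k \<noteq> 0) xs))"
    have mset: "mset ys = mset (filter (\<lambda>k. k \<noteq> 0) xs)" by (simp add: ys_def)
    have "prod_list (map ring_c ys) = prod_list (map ring_c (filter (\<lambda>k. k \<noteq> 0) xs))"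
      by (simp add: mset flip: prod_mset_prod_list)
    also have "\<dots> = m" unfolding xs by (induction xs) (auto simp: ring_c_0)
    finally have my: "m = prod_list (map ring_c ys)" ..
    have sums: "sum_list (map f ys) = sum_list (map f xs)" if "f 0 = 0" for f :: "nat \<Rightarrow> nat"
    proof -
      have "sum_list (map f ys) = sum_list (map f (filter (\<lambda>k. k \<noteq> 0) xs))"
        by (simp add: mset flip: sum_mset_sum_list)
      also have "\<dots> = sum_list (map f xs)" using that by (induction xs) auto
      finally show ?thesis .
    qed
    have dy: "d = sum_list ys" using sums[of "\<lambda>k. k"] xs by simp
    have sy: "s = sum_list (map (\<lambda>k. k\<^sup>2) ys)" using sums[of "\<lambda>k. k\<^sup>2"] xs by simp
    have pos: "0 \<notin> set ys" by (simp add: ys_def)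
    show "m \<in> ?S"
    proof (cases "distinct ys")
      case True
      have "sorted_wrt (>) ys"
        using True by (simp add: ys_def sorted_wrt_rev strict_sorted_iff)
      then have "leads (af_sigma ys) m d s" "strict_partition ys"
        using leads_af_sigma[of ys] pos my dy sy by (auto simp: strict_partition_def)
      then have "af_sigma ys \<in> ?S" "af_sigma ys - m \<in> ?S"
        using span_low by (blast dest: leads_def[THEN iffD1] intro: af_span_base)+
      then have "af_sigma ys - (af_sigma ys - m) \<in> ?S" by (rule af_span_diff)
      then show ?thesis by simp
    next
      case False
      then obtain as bs cs p where dec: "ys = as @ [p] @ bs @ [p] @ cs" using not_distinct_decomp by blast
      then have p: "0 < p" using pos by (cases p) auto
      let ?r = "as @ bs @ cs"
      have r: "monom_type (prod_list (map ring_c ?r)) (sum_list ?r) (sum_list (map (\<lambda>k. k\<^sup>2) ?r))"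
        unfolding monom_type_def by blast
      have "- (ring_c p * ring_c p) \<in> af_span (lower (p + p) (p\<^sup>2 + p\<^sup>2))"
        using leads_ring_cc[of p p] ring_cc_diag[OF p] by (simp add: leads_def)
      then have "prod_list (map ring_c ?r) * (- (ring_c p * ring_c p)) \<in>
          af_span (lower (sum_list ?r + (p + p)) (sum_list (map (\<lambda>k. k\<^sup>2) ?r) + (p\<^sup>2 + p\<^sup>2)))"
        by (rule lower_mult[OF r])
      moreover have "sum_list ?r + (p + p) = d" "sum_list (map (\<lambda>k. k\<^sup>2) ?r) + (p\<^sup>2 + p\<^sup>2) = s"
        unfolding dy sy dec by simp_all
      moreover have "prod_list (map ring_c ?r) * (- (ring_c p * ring_c p)) = - m"
        unfolding my dec by (simp add: mult_ac)
      ultimately have "- m \<in> af_span (lower d s)" by simp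
      then have "- m \<in> ?S" using span_low by blast
      then have "- (- m) \<in> ?S" by (rule af_span_neg)
      then show ?thesis by simp
    qed
  qed
qed

lemma af_sigma_span: "r \<in> af_span (af_sigma ` Collect strict_partition)"
proof -
  have monom: "\<exists>d s. monom_type (abs_af_ring (Poly_Mapping.single k 1)) d s" for k
  proof -
    have pow: "\<exists>d s. monom_type (ring_c i ^ e) d s" for i e
      by (induction e) (auto intro: monom_type_one monom_type_mult monom_type_ring_c)
    have s: "af_c (Suc i) ^ e = Poly_Mapping.single (Poly_Mapping.single i e) 1" for i e
      using var_power[of i e] by (simp add: var_def af_c_def)
    have "\<exists>d s. monom_type (\<Prod>i\<in>K. ring_c (Suc i) ^ Poly_Mapping.lookup k i) d s" for K
      by (induction K rule: infinite_finite_induct) (use pow in \<open>auto intro: monom_type_one dest: monom_type_mult, metis monom_type_mult\<close>)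
    moreover have "(\<Prod>i\<in>K. Poly_Mapping.single (Poly_Mapping.single i (Poly_Mapping.lookup k i)) (1 :: int poly)) =
      Poly_Mapping.single (\<Sum>i\<in>K. Poly_Mapping.single i (Poly_Mapping.lookup k i)) 1" if "finite K" for K
      using that by (induction K) (simp_all add: mult_single)
    then have "abs_af_ring (Poly_Mapping.single k 1) = (\<Prod>i\<in>Poly_Mapping.keys k. ring_c (Suc i) ^ Poly_Mapping.lookup k i)"
      unfolding comm_ring_hom.prod[OF abs_hom, symmetric] comm_ring_hom.power[OF abs_hom, symmetric] s
      by (simp add: sum_keys_single)
    ultimately show ?thesis by simp
  qed
  obtain y where r: "r = abs_af_ring y" by (rule af_ring_cases)
  have "r = (\<Sum>k\<in>Poly_Mapping.keys y. af_scale (Poly_Mapping.lookup y k) (abs_af_ring (Poly_Mapping.single k 1)))"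
    unfolding r af_scale_def comm_ring_hom.mult[OF abs_hom, symmetric] comm_ring_hom.sum[OF abs_hom, symmetric]
    by (simp add: af_const_def mult_single sum_keys_single)
  also have "\<dots> \<in> af_span (af_sigma ` Collect strict_partition)"
    using monom monom_in_span by (intro af_span_sum af_span_scale) blast
  finally show ?thesis .
qed

text \<open>Membership in the span in the form that \<open>af_struct\<close> describes: a finitely
  supported family of coefficients.\<close>

lemma af_sigma_expansion:
  obtains D :: "nat list \<Rightarrow>\<^sub>0 int poly" where "Poly_Mapping.keys D \<subseteq> Collect strict_partition"
    "r = (\<Sum>\<nu>\<in>Poly_Mapping.keys D. af_scale (Poly_Mapping.lookup D \<nu>) (af_sigma \<nu>))"
proof -
  define E where "E = {r. \<exists>N d. finite N \<and> N \<subseteq> Collect strict_partition \<and> r = (\<Sum>\<nu>\<in>N. af_scale (d \<nu>) (af_sigma \<nu>))}"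
  have zero: "af_scale 0 x = 0" for x using module.scale_zero_left[OF module_af_scale] .
  have "r \<in> E" using af_sigma_span[of r]
  proof (induction rule: module.span_induct_alt[OF module_af_scale, consumes 1, case_names base step])
    case base
    show ?case unfolding E_def by (auto intro: exI[of _ "{}"])
  next
    case (step c x y)
    then obtain \<nu> N d where \<nu>: "strict_partition \<nu>" "x = af_sigma \<nu>" and N: "finite N" "N \<subseteq> Collect strict_partition"
      "y = (\<Sum>\<nu>\<in>N. af_scale (d \<nu>) (af_sigma \<nu>))" unfolding E_def by blast
    let ?d = "\<lambda>\<kappa>. (if \<kappa> = \<nu> then c else 0) + (if \<kappa> \<in> N then d \<kappa> else 0)"
    have "(\<Sum>\<kappa>\<in>insert \<nu> N. af_scale (?d \<kappa>) (af_sigma \<kappa>)) =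
      (\<Sum>\<kappa>\<in>insert \<nu> N. if \<kappa> = \<nu> then af_scale c x else 0) + (\<Sum>\<kappa>\<in>insert \<nu> N. if \<kappa> \<in> N then af_scale (d \<kappa>) (af_sigma \<kappa>) else 0)"
      unfolding module.scale_left_distrib[OF module_af_scale] sum.distrib
      by (intro arg_cong2[where f = "(+)"] sum.cong refl) (auto simp: zero \<nu>)
    also have "\<dots> = af_scale c x + y"
    proof -
      have "(\<Sum>\<kappa>\<in>insert \<nu> N. if \<kappa> \<in> N then af_scale (d \<kappa>) (af_sigma \<kappa>) else 0) = y"
        unfolding N(3) using N(1) by (intro sum.mono_neutral_cong_right) auto
      then show ?thesis using N(1) by simp
    qed
    finally show ?case unfolding E_def using N(1,2) \<nu>(1) by (auto intro!: exI[of _ "insert \<nu> N"] exI[of _ ?d])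
  qed
  then obtain N d where N: "finite N" "N \<subseteq> Collect strict_partition" "r = (\<Sum>\<nu>\<in>N. af_scale (d \<nu>) (af_sigma \<nu>))"
    unfolding E_def by blast
  define D where "D = Abs_poly_mapping (\<lambda>\<nu>. if \<nu> \<in> N then d \<nu> else 0)"
  have D: "Poly_Mapping.lookup D \<nu> = (if \<nu> \<in> N then d \<nu> else 0)" for \<nu>
    unfolding D_def by (subst Abs_poly_mapping_inverse) (use finite_subset[OF _ N(1)] in auto)
  have keys: "Poly_Mapping.keys D \<subseteq> N" using D by (auto simp: in_keys_iff split: if_splits)
  have "r = (\<Sum>\<nu>\<in>Poly_Mapping.keys D. af_scale (Poly_Mapping.lookup D \<nu>) (af_sigma \<nu>))"
    unfolding N(3) by (rule sum.mono_neutral_cong_right[OF N(1) keys]) (auto simp: D in_keys_iff zero)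
  then show thesis using that keys N(2) by blast
qed

text \<open>Spanning and independence give exactly one coefficient family, so the description
  denotes it, and its value at lam is the constant term found by evaluation.\<close>

theorem af_struct_self:
  assumes lam: "strict_partition lam"
  shows "af_struct lam mu lam = Poly_Mapping.lookup (pf_var (length lam) mu) 0"
proof -
  let ?P = "\<lambda>D. Poly_Mapping.keys D \<subseteq> Collect strict_partition \<and> af_sigma lam * af_sigma mu =
        (\<Sum>nu\<in>Poly_Mapping.keys D. af_scale (Poly_Mapping.lookup D nu) (af_sigma nu))"
  have "D = D'" if D: "?P D" and D': "?P D'" for D D' :: "nat list \<Rightarrow>\<^sub>0 int poly"
  proof (rule poly_mapping_eqI)
    fix \<nu>
    let ?N = "Poly_Mapping.keys D \<union> Poly_Mapping.keys D'"
    have N: "finite ?N" "?N \<subseteq> Collect strict_partition" using D D' by auto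
    have sup: "(\<Sum>nu\<in>Poly_Mapping.keys E. af_scale (Poly_Mapping.lookup E nu) (af_sigma nu)) =
      (\<Sum>nu\<in>?N. af_scale (Poly_Mapping.lookup E nu) (af_sigma nu))" if "Poly_Mapping.keys E \<subseteq> ?N" for E
      using that by (intro sum.mono_neutral_left)
        (auto simp: in_keys_iff module.scale_zero_left[OF module_af_scale])
    have "(\<Sum>nu\<in>?N. af_scale (Poly_Mapping.lookup D nu) (af_sigma nu)) = (\<Sum>nu\<in>?N. af_scale (Poly_Mapping.lookup D' nu) (af_sigma nu))"
      unfolding sup[OF Un_upper1, symmetric] sup[OF Un_upper2, symmetric] using D D' by metis
    then have "(\<Sum>nu\<in>?N. af_scale (Poly_Mapping.lookup D nu - Poly_Mapping.lookup D' nu) (af_sigma nu)) = 0"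
      by (simp add: module.scale_left_diff_distrib[OF module_af_scale] sum_subtractf)
    from af_sigma_independent[OF N this, of \<nu>]
    show "Poly_Mapping.lookup D \<nu> = Poly_Mapping.lookup D' \<nu>"
      by (cases "\<nu> \<in> ?N") (auto simp: in_keys_iff)
  qed
  moreover obtain D where D: "?P D" using af_sigma_expansion[of "af_sigma lam * af_sigma mu"] by metis
  ultimately have "(THE D. ?P D) = D" by (intro the_equality) (rule D, assumption)
  then have "af_struct lam mu lam = Poly_Mapping.lookup D lam" by (simp add: af_struct_def)
  also have "\<dots> = (if lam \<in> Poly_Mapping.keys D then Poly_Mapping.lookup D lam else 0)" by (simp add: in_keys_iff)
  also have "\<dots> = Poly_Mapping.lookup (eval (length lam) (af_sigma mu)) 0"
    by (rule af_sigma_times_coefficient[OF _ _ lam]) (use D in auto)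
  finally show ?thesis by (simp only: eval_sigma)
qed

section \<open>Constant terms\<close>

text \<open>The sum over t from \<open>pf_cset\<close>, with exponents in place of parts: the
  exponent of a part is one less, so a part 1 has exponent 0.\<close>

definition msum :: "'a::field \<Rightarrow> 'a set \<Rightarrow> (nat \<Rightarrow> nat) \<Rightarrow> nat \<Rightarrow> 'a"
  where "msum z V e m = (\<Sum>t\<in>PiE {..<m} (\<lambda>_. V).
    (\<Prod>a<m. weight z V (t a) * t a ^ e a) * pair_prod (schur_ratio z) m t)"

lemma msum_cong: "(\<And>a. a < m \<Longrightarrow> e a = e' a) \<Longrightarrow> msum z V e m = msum z V e' m"
  unfolding msum_def by (intro sum.cong refl arg_cong2[where f = "(*)"] prod.cong) auto

lemma weight_insert_0:
  assumes "finite V" "0 \<notin> V" "v \<in> V"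
  shows "weight z (insert 0 V) v = weight z V v * ((v + z) / v)"
proof -
  have "insert 0 V - {v} = insert 0 (V - {v})" using assms by auto
  then show ?thesis using assms by (simp add: weight_def)
qed

lemma weight_0:
  assumes "finite V" "0 \<notin> V"
  shows "weight z (insert 0 V) 0 = z * (\<Prod>u\<in>V. (u + z) / (- u))"
proof -
  have "insert 0 V - {0} = V" using assms by auto
  then show ?thesis by (simp add: weight_def)
qed

lemma pair_prod_adjacent:
  assumes skew: "\<And>u v. S u v = - S v u" and c: "Suc c < m"
  shows "pair_prod S m (t \<circ> transpose c (Suc c)) = - pair_prod S m t"
proof -
  let ?\<tau> = "transpose c (Suc c)"
  define P where "P = pairs m - {(c, Suc c)}"
  have pairs: "pairs m = insert (c, Suc c) P" "(c, Suc c) \<notin> P" "finite P"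
    using c by (auto simp: P_def pairs_def intro: finite_subset[OF _ finite_pairs[of m]])
  have into: "map_prod ?\<tau> ?\<tau> p \<in> P" if "p \<in> P" for p
    using that c by (auto simp: P_def pairs_def transpose_def split: if_splits)
  have "(\<Prod>(a, b)\<in>P. S (t (?\<tau> a)) (t (?\<tau> b))) = (\<Prod>(a, b)\<in>P. S (t a) (t b))"
    by (rule prod.reindex_bij_witness[where i = "map_prod ?\<tau> ?\<tau>" and j = "map_prod ?\<tau> ?\<tau>"])
      (use into in auto)
  moreover have "S (t (Suc c)) (t c) = - S (t c) (t (Suc c))" by (rule skew)
  ultimately show ?thesis unfolding pair_prod_def pairs(1) using pairs(2,3) by simp
qed

text \<open>Exchanging the points at the two positions keeps the product of weights and powers and
  reverses the sign of the pair product.\<close>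

lemma msum_equal_exponents:
  assumes c: "Suc c < m" "e c = e (Suc c)"
  shows "msum z V e m = - msum z V e m"
proof -
  let ?\<tau> = "transpose c (Suc c)"
  let ?\<Phi> = "\<lambda>t. (\<Prod>a<m. weight z V (t a) * t a ^ e a) * pair_prod (schur_ratio z) m t"
  have \<tau>: "?\<tau> permutes {..<m}" using c by (intro permutes_swap_id) auto
  have "msum z V e m = (\<Sum>t\<in>PiE {..<m} (\<lambda>_. V). ?\<Phi> (restrict (t \<circ> ?\<tau>) {..<m}))"
    unfolding msum_def by (rule sum_PiE_permute[OF \<tau>, symmetric])
  also have "\<dots> = (\<Sum>t\<in>PiE {..<m} (\<lambda>_. V). - ?\<Phi> t)"
  proof (rule sum.cong[OF refl])
    fix t :: "nat \<Rightarrow> 'a"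
    have "(\<Prod>a<m. weight z V (restrict (t \<circ> ?\<tau>) {..<m} a) * restrict (t \<circ> ?\<tau>) {..<m} a ^ e a) =
      (\<Prod>a<m. weight z V (t (?\<tau> a)) * t (?\<tau> a) ^ e (?\<tau> a))"
      using c(2) by (intro prod.cong refl) (auto simp: transpose_def)
    also have "\<dots> = (\<Prod>a<m. weight z V (t a) * t a ^ e a)"
      by (rule prod.permute[OF \<tau>, unfolded comp_def, symmetric])
    finally have 1: "(\<Prod>a<m. weight z V (restrict (t \<circ> ?\<tau>) {..<m} a) * restrict (t \<circ> ?\<tau>) {..<m} a ^ e a) =
      (\<Prod>a<m. weight z V (t a) * t a ^ e a)" .
    have "pair_prod (schur_ratio z) m (restrict (t \<circ> ?\<tau>) {..<m}) = pair_prod (schur_ratio z) m (t \<circ> ?\<tau>)"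
      by (rule pair_prod_cong) simp
    also have "\<dots> = - pair_prod (schur_ratio z) m t"
      by (rule pair_prod_adjacent[OF schur_ratio_skew c(1)])
    finally show "?\<Phi> (restrict (t \<circ> ?\<tau>) {..<m}) = - ?\<Phi> t" unfolding 1 by simp
  qed
  finally show ?thesis by (simp add: msum_def sum_negf)
qed

text \<open>All exponents are positive, so the point 0 is never chosen. The denominator v that it
  brings into the weight of v is absorbed by one unit of the exponent.\<close>

lemma msum_insert_0:
  assumes V: "finite V" "0 \<notin> V"
  shows "msum z (insert 0 V) (\<lambda>a. Suc (e a)) m =
    (\<Sum>B\<in>Pow {..<m}. z ^ (m - card B) * msum z V (\<lambda>a. e a + (if a \<in> B then 1 else 0)) m)"
proof -
  let ?S = "pair_prod (schur_ratio z) m"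
  have "msum z (insert 0 V) (\<lambda>a. Suc (e a)) m =
    (\<Sum>t\<in>PiE {..<m} (\<lambda>_. V). (\<Prod>a<m. weight z (insert 0 V) (t a) * t a ^ Suc (e a)) * ?S t)"
    unfolding msum_def
  proof (rule sum.mono_neutral_right)
    show "finite (PiE {..<m} (\<lambda>_. insert 0 V))" using V by (intro finite_PiE) auto
    show "PiE {..<m} (\<lambda>_. V) \<subseteq> PiE {..<m} (\<lambda>_. insert 0 V)" by (rule PiE_mono) auto
    show "\<forall>t\<in>PiE {..<m} (\<lambda>_. insert 0 V) - PiE {..<m} (\<lambda>_. V).
      (\<Prod>a<m. weight z (insert 0 V) (t a) * t a ^ Suc (e a)) * ?S t = 0"
    proof
      fix t assume t: "t \<in> PiE {..<m} (\<lambda>_. insert 0 V) - PiE {..<m} (\<lambda>_. V)"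
      then obtain a where "a < m" "t a \<notin> V" by (auto simp: PiE_def Pi_def)
      moreover from this have "t a = 0" using t by (auto simp: PiE_def Pi_def)
      ultimately have "(\<Prod>a<m. weight z (insert 0 V) (t a) * t a ^ Suc (e a)) = 0"
        by (intro prod_zero) auto
      then show "(\<Prod>a<m. weight z (insert 0 V) (t a) * t a ^ Suc (e a)) * ?S t = 0" by simp
    qed
  qed
  also have "\<dots> = (\<Sum>t\<in>PiE {..<m} (\<lambda>_. V). \<Sum>B\<in>Pow {..<m}.
    z ^ (m - card B) * ((\<Prod>a<m. weight z V (t a) * t a ^ (e a + (if a \<in> B then 1 else 0))) * ?S t))"
  proof (rule sum.cong[OF refl])
    fix t assume t: "t \<in> PiE {..<m} (\<lambda>_. V)"
    have "(\<Prod>a<m. weight z (insert 0 V) (t a) * t a ^ Suc (e a)) =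
      (\<Prod>a<m. weight z V (t a) * t a ^ e a * (t a + z))"
    proof (rule prod.cong[OF refl])
      fix a assume "a \<in> {..<m}"
      then have "t a \<in> V" using t by auto
      moreover from this have "t a \<noteq> 0" using V by auto
      ultimately show "weight z (insert 0 V) (t a) * t a ^ Suc (e a) = weight z V (t a) * t a ^ e a * (t a + z)"
        by (simp add: weight_insert_0[OF V])
    qed
    also have "\<dots> = (\<Prod>a<m. weight z V (t a) * t a ^ e a) * (\<Sum>B\<in>Pow {..<m}. (\<Prod>a\<in>B. t a) * (\<Prod>a\<in>{..<m} - B. z))"
      unfolding prod.distrib by (simp only: prod_add[OF finite_lessThan])
    also have "\<dots> = (\<Sum>B\<in>Pow {..<m}. z ^ (m - card B) * (\<Prod>a<m. weight z V (t a) * t a ^ (e a + (if a \<in> B then 1 else 0))))"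
      unfolding sum_distrib_left
    proof (rule sum.cong[OF refl])
      fix B assume "B \<in> Pow {..<m}"
      then have B: "B \<subseteq> {..<m}" "finite B" by (auto intro: finite_subset)
      have "(\<Prod>a\<in>B. t a) = (\<Prod>a<m. t a ^ (if a \<in> B then 1 else 0))"
        using B by (intro prod.mono_neutral_cong_left) auto
      moreover have "(\<Prod>a\<in>{..<m} - B. z) = z ^ (m - card B)" using B by (simp add: card_Diff_subset)
      ultimately show "(\<Prod>a<m. weight z V (t a) * t a ^ e a) * ((\<Prod>a\<in>B. t a) * (\<Prod>a\<in>{..<m} - B. z)) =
        z ^ (m - card B) * (\<Prod>a<m. weight z V (t a) * t a ^ (e a + (if a \<in> B then 1 else 0)))"
        by (simp only: power_add prod.distrib mult_ac)
    qed
    finally show "(\<Prod>a<m. weight z (insert 0 V) (t a) * t a ^ Suc (e a)) * ?S t = (\<Sum>B\<in>Pow {..<m}.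
      z ^ (m - card B) * ((\<Prod>a<m. weight z V (t a) * t a ^ (e a + (if a \<in> B then 1 else 0))) * ?S t))"
      by (simp only: sum_distrib_right mult.assoc)
  qed
  also have "\<dots> = (\<Sum>B\<in>Pow {..<m}. z ^ (m - card B) * msum z V (\<lambda>a. e a + (if a \<in> B then 1 else 0)) m)"
    unfolding msum_def sum_distrib_left by (rule sum.swap)
  finally show ?thesis .
qed

text \<open>Only the last exponent is 0, so only the last position can take the point 0; with n
  other points for n + 1 positions it has to. The weight of 0 and the ratios with 0 leave the factor
  z times the product of all u + z.\<close>

lemma msum_staircase:
  assumes V: "finite V" "0 \<notin> V" "card V = n" and nz: "\<And>v. v \<in> V \<Longrightarrow> v + z \<noteq> 0"
  shows "msum z (insert 0 V) (\<lambda>a. n - a) (Suc n) = z * (\<Prod>u\<in>V. u + z) * msum z V (\<lambda>a. n - a - 1) n"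
proof -
  let ?W = "weight z (insert 0 V)" and ?S = "schur_ratio z"
  let ?f = "\<lambda>t. (\<Prod>a<Suc n. ?W (t a) * t a ^ (n - a)) * pair_prod ?S (Suc n) t"
  let ?T = "(\<lambda>s. s(n := 0)) ` PiE {..<n} (\<lambda>_. V)"
  have inj: "inj_on (\<lambda>s. s(n := 0)) (PiE {..<n} (\<lambda>_. V))"
  proof (rule inj_onI, rule ext)
    fix s s' :: "nat \<Rightarrow> 'a" and a assume s: "s \<in> PiE {..<n} (\<lambda>_. V)" "s' \<in> PiE {..<n} (\<lambda>_. V)" "s(n := 0) = s'(n := 0)"
    show "s a = s' a"
      using fun_cong[OF s(3), of a] PiE_arb[OF s(1), of n] PiE_arb[OF s(2), of n] by (cases "a = n") auto
  qed
  have "msum z (insert 0 V) (\<lambda>a. n - a) (Suc n) = (\<Sum>t\<in>?T. ?f t)"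
    unfolding msum_def
  proof (rule sum.mono_neutral_right)
    show "finite (PiE {..<Suc n} (\<lambda>_. insert 0 V))" using V by (intro finite_PiE) auto
    show "?T \<subseteq> PiE {..<Suc n} (\<lambda>_. insert 0 V)"
      by (auto simp: PiE_def Pi_def extensional_def less_Suc_eq)
    show "\<forall>t\<in>PiE {..<Suc n} (\<lambda>_. insert 0 V) - ?T. ?f t = 0"
    proof
      fix t assume "t \<in> PiE {..<Suc n} (\<lambda>_. insert 0 V) - ?T"
      then have t: "t \<in> PiE {..<Suc n} (\<lambda>_. insert 0 V)" "t \<notin> ?T" by auto
      have tV: "t a \<in> V \<or> t a = 0" if "a < Suc n" for a using PiE_mem[OF t(1), of a] that by auto
      show "?f t = 0"
      proof (cases "\<exists>a<n. t a = 0")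
        case True
        then obtain a where "a < n" "t a = 0" by auto
        then have "(\<Prod>a<Suc n. ?W (t a) * t a ^ (n - a)) = 0" by (intro prod_zero) auto
        then show ?thesis by simp
      next
        case False
        then have low: "t a \<in> V" if "a < n" for a using tV[of a] that by auto
        have "t n \<noteq> 0"
        proof
          assume "t n = 0"
          then have "t = (t(n := undefined))(n := 0)" by auto
          moreover have "t(n := undefined) \<in> PiE {..<n} (\<lambda>_. V)"
            using low PiE_arb[OF t(1)] by (auto simp: PiE_def Pi_def extensional_def)
          ultimately show False using t(2) by blast
        qed
        then have "t ` {..<Suc n} \<subseteq> V" using low tV[of n] by (auto simp: less_Suc_eq)
        then have "card (t ` {..<Suc n}) < card {..<Suc n}" using card_mono[OF V(1), of "t ` {..<Suc n}"] V(3) by simp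
        then have "\<not> inj_on t {..<Suc n}" using card_image[of t "{..<Suc n}"] by auto
        then show ?thesis by (simp add: schur_pair_prod_noninj)
      qed
    qed
  qed
  also have "\<dots> = (\<Sum>s\<in>PiE {..<n} (\<lambda>_. V). ?f (s(n := 0)))"
    using sum.reindex[OF inj, of ?f] by (simp add: comp_def)
  also have "\<dots> = (\<Sum>s\<in>PiE {..<n} (\<lambda>_. V). z * (\<Prod>u\<in>V. u + z) *
    ((\<Prod>a<n. weight z V (s a) * s a ^ (n - a - 1)) * pair_prod ?S n s))"
  proof (rule sum.cong[OF refl])
    fix s assume s: "s \<in> PiE {..<n} (\<lambda>_. V)"
    show "?f (s(n := 0)) = z * (\<Prod>u\<in>V. u + z) *
      ((\<Prod>a<n. weight z V (s a) * s a ^ (n - a - 1)) * pair_prod ?S n s)"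
    proof (cases "inj_on s {..<n}")
      case False
      have "pair_prod ?S n (s(n := 0)) = pair_prod ?S n s" by (rule pair_prod_cong) simp
      then show ?thesis using schur_pair_prod_noninj[OF False] by (simp add: pair_prod_Suc)
    next
      case True
      have "s ` {..<n} \<subseteq> V" using s by auto
      then have img: "s ` {..<n} = V" by (rule card_subset_eq[OF V(1)]) (simp add: card_image[OF True] V(3))
      have over: "(\<Prod>a<n. g (s a)) = (\<Prod>u\<in>V. g u)" for g :: "'a \<Rightarrow> 'a"
        unfolding img[symmetric] using prod.reindex[OF True, of g] by (simp add: comp_def)
      have pp: "pair_prod ?S n (s(n := 0)) = pair_prod ?S n s" by (rule pair_prod_cong) simp
      have "(\<Prod>a<n. ?W (s a) * s a ^ (n - a)) * (\<Prod>a<n. ?S (s a) 0) =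
        (\<Prod>a<n. (weight z V (s a) * s a ^ (n - a - 1)) * - s a)"
        unfolding prod.distrib[symmetric]
      proof (rule prod.cong[OF refl])
        fix a assume a: "a \<in> {..<n}"
        then have v: "s a \<in> V" using s by auto
        then have v0: "s a \<noteq> 0" "s a + z \<noteq> 0" using V nz by auto
        have e: "n - a = Suc (n - a - 1)" using a by auto
        show "?W (s a) * s a ^ (n - a) * ?S (s a) 0 = (weight z V (s a) * s a ^ (n - a - 1)) * - s a"
        proof -
          have c: "(s a + z) / s a * s a * ?S (s a) 0 = - s a" using v0 by (simp add: schur_ratio_def)
          have "?W (s a) * s a ^ (n - a) * ?S (s a) 0 =
            weight z V (s a) * s a ^ (n - a - 1) * ((s a + z) / s a * s a * ?S (s a) 0)"
            unfolding weight_insert_0[OF V(1,2) v] by (subst e) (simp only: power_Suc mult_ac)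
          then show ?thesis unfolding c .
        qed
      qed
      also have "\<dots> = (\<Prod>a<n. weight z V (s a) * s a ^ (n - a - 1)) * (\<Prod>u\<in>V. - u)"
        by (simp only: prod.distrib over[of uminus])
      finally have 1: "(\<Prod>a<n. ?W (s a) * s a ^ (n - a)) * (\<Prod>a<n. ?S (s a) 0) =
        (\<Prod>a<n. weight z V (s a) * s a ^ (n - a - 1)) * (\<Prod>u\<in>V. - u)" .
      have 2: "?W 0 * (\<Prod>u\<in>V. - u) = z * (\<Prod>u\<in>V. u + z)"
        unfolding weight_0[OF V(1,2)] mult.assoc prod.distrib[symmetric]
        by (intro arg_cong2[where f = "(*)"] prod.cong refl) (use V(2) in auto)
      have "?f (s(n := 0)) = ?W 0 * ((\<Prod>a<n. ?W (s a) * s a ^ (n - a)) * (\<Prod>a<n. ?S (s a) 0)) * pair_prod ?S n s"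
        by (simp add: pair_prod_Suc pp)
      also have "\<dots> = (?W 0 * (\<Prod>u\<in>V. - u)) * ((\<Prod>a<n. weight z V (s a) * s a ^ (n - a - 1)) * pair_prod ?S n s)"
        unfolding 1 by (simp only: mult_ac)
      finally show ?thesis unfolding 2 .
    qed
  qed
  finally show ?thesis unfolding msum_def sum_distrib_left .
qed

section \<open>The value at c_k = binom(n,k) z^k\<close>

abbreviation \<zeta> :: "int poly"
  where "\<zeta> \<equiv> [:0, 1:]"

definition phi :: "nat \<Rightarrow> nat list \<Rightarrow> int poly"
  where "phi n xs = pf \<zeta> (cser \<zeta> (\<lambda>_. 0) {..<n}) xs"

lemma lookup_pf:
  assumes "\<And>i. i < n \<Longrightarrow> Poly_Mapping.lookup (x i) 0 = 0"
  shows "Poly_Mapping.lookup (pf af_z (cser af_z x {..<n}) xs) 0 = phi n xs"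
proof -
  have "cser \<zeta> (\<lambda>i. Poly_Mapping.lookup (x i) 0) {..<n} = cser \<zeta> (\<lambda>_. 0) {..<n}"
    unfolding cser_def using assms by (intro ext arg_cong2[where f = fps_nth] prod.cong) auto
  then show ?thesis
    unfolding comm_ring_hom.pf[OF lookup_zero_hom] comm_ring_hom.cser[OF lookup_zero_hom] phi_def
    by (simp add: lookup_af_z)
qed

lemma lookup_pf_var: "Poly_Mapping.lookup (pf_var n xs) 0 = phi n xs"
  by (rule lookup_pf) (simp add: lookup_var)

lemma cser_zero_points: "n < k \<Longrightarrow> cser \<zeta> (\<lambda>_. 0) {..<n} k = 0"
proof (induction n arbitrary: k)
  case 0
  then show ?case by (cases k) (simp_all add: cser_def)
next
  case (Suc n)
  then obtain j where j: "k = Suc j" "n < j" by (cases k) auto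
  show ?case
    using cser_insert_rec[of "{..<n}" n \<zeta> "\<lambda>_. 0" j] Suc.IH[of j] Suc.IH[of "Suc j"] j by (simp add: lessThan_Suc)
qed

text \<open>Every index p + b - a with p the first part exceeds n, where c_k is 0. So the first row
  of the Pfaffian vanishes.\<close>

lemma phi_large:
  assumes "xs \<noteq> []" "n < xs ! 0"
  shows "phi n xs = 0"
proof -
  obtain k where k: "(length xs + 1) div 2 = Suc k" using assms(1) by (cases xs) auto
  have "cc \<zeta> (cser \<zeta> (\<lambda>_. 0) {..<n}) (part xs 0) q = 0" for q
    unfolding cc_def by (intro sum.neutral ballI) (use assms in \<open>simp add: part_def cser_zero_points\<close>)
  then show ?thesis unfolding phi_def pf_def k pfaffian_Suc by simp
qed

lemma emb_pf_msum:
  assumes "finite I" "inj_on x I" "\<And>i j. i \<in> I \<Longrightarrow> j \<in> I \<Longrightarrow> x i + x j + af_z \<noteq> 0" "0 \<notin> set xs"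
  shows "emb (pf af_z (cser af_z x I) xs) = msum K_z ((\<lambda>i. emb (x i)) ` I) (\<lambda>a. xs ! a - 1) (length xs)"
  unfolding msum_def by (rule emb_pf[OF assms])

lemma emb_pf_var_msum: "0 \<notin> set xs \<Longrightarrow> emb (pf_var n xs) = msum K_z (K_var ` {..<n}) (\<lambda>a. xs ! a - 1) (length xs)"
  unfolding msum_def by (rule emb_pf_var)

lemma phi_equal_parts:
  assumes "Suc c < length xs" "xs ! c = xs ! Suc c" "0 \<notin> set xs"
  shows "phi n xs = 0"
proof -
  have "emb (pf_var n xs) = - emb (pf_var n xs)"
    unfolding emb_pf_var_msum[OF assms(3)] by (rule msum_equal_exponents) (use assms in auto)
  then have "pf_var n xs = 0" using fract_eq_neg emb_nz by blast
  then show ?thesis using lookup_pf_var[of n xs] by simp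
qed

text \<open>Of n + 1 variables the last is set to 0. The points stay distinct, so the sum over t
  applies, while the constant term is that of n + 1 free variables.\<close>

definition pf_var0 :: "nat \<Rightarrow> nat list \<Rightarrow> af_poly"
  where "pf_var0 n xs = pf af_z (cser af_z (\<lambda>i. if i < n then var i else 0) {..<Suc n}) xs"

lemma lookup_pf_var0: "Poly_Mapping.lookup (pf_var0 n xs) 0 = phi (Suc n) xs"
  unfolding pf_var0_def by (rule lookup_pf) (simp add: lookup_var)

lemma var_nz: "var i \<noteq> 0"
  using lookup_var(1)[of i i] by auto

lemma emb_pf_var0:
  assumes "0 \<notin> set xs"
  shows "emb (pf_var0 n xs) = msum K_z (insert 0 (K_var ` {..<n})) (\<lambda>a. xs ! a - 1) (length xs)"
proof -
  let ?x = "\<lambda>i. if i < n then var i else 0"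
  have "inj_on ?x {..<Suc n}" using inj_var by (auto simp: inj_on_def inj_def var_nz var_nz[symmetric])
  moreover have "?x i + ?x j + af_z \<noteq> 0" for i j
  proof
    assume "?x i + ?x j + af_z = 0"
    then have "Poly_Mapping.lookup (?x i + ?x j + af_z) 0 = 0" by simp
    then show False by (simp add: lookup_add lookup_var(2) lookup_af_z split: if_splits)
  qed
  moreover have "(\<lambda>i. emb (?x i)) ` {..<Suc n} = insert 0 (K_var ` {..<n})"
    by (auto simp: lessThan_Suc comm_ring_hom.zero[OF emb_hom] image_iff)
  ultimately show ?thesis unfolding pf_var0_def using emb_pf_msum[of "{..<Suc n}" ?x xs] assms by simp
qed

lemma K_var_image: "finite (K_var ` {..<n})" "0 \<notin> K_var ` {..<n}" "card (K_var ` {..<n}) = n"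
  using emb_nz[THEN iffD2, OF var_nz] by (auto simp: card_image inj_K_var image_iff dest: sym)

lemma nth_rho: "a < m \<Longrightarrow> rho n m ! a = n - a"
  by (simp add: rho_def)

lemma length_rho: "length (rho n m) = m"
  by (simp add: rho_def)

lemma rho_pos: "m \<le> n \<Longrightarrow> 0 \<notin> set (rho n m)"
  by (auto simp: rho_def)

text \<open>With one variable equal to 0, the weights of the others acquire the factor (v + z) / v. Expanding
  the product of these factors over the sets B of rows in which v is chosen, every nonempty B raises the
  first part above n or makes two adjacent parts equal.\<close>

lemma phi_rho_less:
  assumes "m \<le> n"
  shows "phi (Suc n) (rho (Suc n) m) = \<zeta> ^ m * phi n (rho n m)"
proof -
  define xs where "xs = (\<lambda>B. map (\<lambda>a. n - a + (if a \<in> B then 1 else 0)) [0..<m])"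
  have pos: "0 \<notin> set (xs B)" for B using assms by (auto simp: xs_def)
  have "emb (pf_var0 n (rho (Suc n) m)) = msum K_z (insert 0 (K_var ` {..<n})) (\<lambda>a. Suc (n - a - 1)) m"
    unfolding emb_pf_var0[OF rho_pos[OF le_SucI[OF assms]]] length_rho
    by (rule msum_cong) (use assms in \<open>simp add: nth_rho\<close>)
  also have "\<dots> = (\<Sum>B\<in>Pow {..<m}. K_z ^ (m - card B) * msum K_z (K_var ` {..<n}) (\<lambda>a. n - a - 1 + (if a \<in> B then 1 else 0)) m)"
    by (rule msum_insert_0[OF K_var_image(1,2)])
  also have "\<dots> = (\<Sum>B\<in>Pow {..<m}. K_z ^ (m - card B) * emb (pf_var n (xs B)))"
    unfolding emb_pf_var_msum[OF pos]
    by (intro sum.cong refl arg_cong2[where f = "(*)"]) (simp add: xs_def, rule msum_cong, use assms in simp)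
  also have "\<dots> = emb (\<Sum>B\<in>Pow {..<m}. af_z ^ (m - card B) * pf_var n (xs B))"
    by (simp add: comm_ring_hom.sum[OF emb_hom] comm_ring_hom.mult[OF emb_hom] comm_ring_hom.power[OF emb_hom])
  finally have "pf_var0 n (rho (Suc n) m) = (\<Sum>B\<in>Pow {..<m}. af_z ^ (m - card B) * pf_var n (xs B))"
    unfolding emb_eq_iff .
  from arg_cong[OF this, of "\<lambda>p. Poly_Mapping.lookup p 0"]
  have "phi (Suc n) (rho (Suc n) m) = (\<Sum>B\<in>Pow {..<m}. \<zeta> ^ (m - card B) * phi n (xs B))"
    by (simp add: lookup_pf_var0 lookup_pf_var lookup_af_z comm_ring_hom.sum[OF lookup_zero_hom]
        comm_ring_hom.mult[OF lookup_zero_hom] comm_ring_hom.power[OF lookup_zero_hom])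
  also have "\<dots> = (\<Sum>B\<in>{{}}. \<zeta> ^ (m - card B) * phi n (xs B))"
  proof (rule sum.mono_neutral_right)
    show "\<forall>B\<in>Pow {..<m} - {{}}. \<zeta> ^ (m - card B) * phi n (xs B) = 0"
    proof
      fix B assume "B \<in> Pow {..<m} - {{}}"
      then have B: "B \<subseteq> {..<m}" "B \<noteq> {}" by auto
      \<comment> \<open>The first position raised by B. If it is 0, the first part is n + 1;
        otherwise the part before it is not raised, and the two become equal.\<close>
      define c where "c = (LEAST a. a \<in> B)"
      have c: "c \<in> B" "\<And>a. a < c \<Longrightarrow> a \<notin> B"
        using B(2) LeastI_ex[of "\<lambda>a. a \<in> B"] not_less_Least by (auto simp: c_def)
      have cm: "c < m" using c(1) B(1) by auto
      have "phi n (xs B) = 0"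
      proof (cases c)
        case 0
        then show ?thesis using c(1) cm by (intro phi_large) (auto simp: xs_def)
      next
        case (Suc b)
        then show ?thesis using c(1) c(2)[of b] cm assms by (intro phi_equal_parts[of b] pos) (auto simp: xs_def)
      qed
      then show "\<zeta> ^ (m - card B) * phi n (xs B) = 0" by simp
    qed
  qed auto
  also have "\<dots> = \<zeta> ^ m * phi n (rho n m)" by (simp add: xs_def rho_def)
  finally show ?thesis .
qed

text \<open>For m = n + 1 the last part is 1 with exponent 0, so the point 0 can be chosen and the
  staircase sum takes over. The constant term of the product of all x_i + z contributes z^n.\<close>

lemma phi_rho_full: "phi (Suc n) (rho (Suc n) (Suc n)) = \<zeta> ^ Suc n * phi n (rho n n)"
proof -
  have nz: "v + K_z \<noteq> 0" if "v \<in> K_var ` {..<n}" for v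
  proof
    assume "v + K_z = 0"
    moreover obtain i where "v = K_var i" using \<open>v \<in> K_var ` {..<n}\<close> by auto
    ultimately have "emb (var i + af_z) = 0" by (simp add: comm_ring_hom.add[OF emb_hom])
    then have "var i + af_z = 0" using emb_nz by blast
    then have "Poly_Mapping.lookup (var i + af_z) 0 = 0" by simp
    then show False by (simp add: lookup_add lookup_var(2) lookup_af_z)
  qed
  have "emb (pf_var0 n (rho (Suc n) (Suc n))) = msum K_z (insert 0 (K_var ` {..<n})) (\<lambda>a. n - a) (Suc n)"
    unfolding emb_pf_var0[OF rho_pos[OF le_refl]] length_rho
    by (rule msum_cong) (simp add: nth_rho Suc_diff_le)
  also have "\<dots> = K_z * (\<Prod>u\<in>K_var ` {..<n}. u + K_z) * msum K_z (K_var ` {..<n}) (\<lambda>a. n - a - 1) n"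
    by (rule msum_staircase[OF K_var_image nz])
  also have "msum K_z (K_var ` {..<n}) (\<lambda>a. n - a - 1) n = emb (pf_var n (rho n n))"
    unfolding emb_pf_var_msum[OF rho_pos[OF le_refl]] length_rho
    by (rule msum_cong) (simp add: nth_rho)
  also have "(\<Prod>u\<in>K_var ` {..<n}. u + K_z) = emb (\<Prod>i<n. var i + af_z)"
    unfolding comm_ring_hom.prod[OF emb_hom] comm_ring_hom.add[OF emb_hom]
    using prod.reindex[OF inj_K_var, of "\<lambda>u. u + K_z" "{..<n}"] by (simp add: comp_def)
  finally have "emb (pf_var0 n (rho (Suc n) (Suc n))) = emb (af_z * (\<Prod>i<n. var i + af_z) * pf_var n (rho n n))"
    by (simp only: comm_ring_hom.mult[OF emb_hom])
  then have "pf_var0 n (rho (Suc n) (Suc n)) = af_z * (\<Prod>i<n. var i + af_z) * pf_var n (rho n n)"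
    unfolding emb_eq_iff .
  from arg_cong[OF this, of "\<lambda>p. Poly_Mapping.lookup p 0"] show ?thesis
    by (simp add: lookup_pf_var0 lookup_pf_var lookup_af_z lookup_var comm_ring_hom.mult[OF lookup_zero_hom]
        comm_ring_hom.prod[OF lookup_zero_hom] lookup_add)
qed

lemma sum_list_rho: "sum_list (rho n m) = (\<Sum>a<m. n - a)"
  by (simp add: rho_def sum_list_distinct_conv_sum_set lessThan_atLeast0)

lemma phi_rho: "m \<le> n \<Longrightarrow> phi n (rho n m) = \<zeta> ^ sum_list (rho n m)"
proof (induction n arbitrary: m)
  case 0
  then show ?case by (simp add: phi_def pf_def rho_def pfaffian_0)
next
  case (Suc n)
  show ?case
  proof (cases "m \<le> n")
    case True
    have "sum_list (rho (Suc n) m) = m + sum_list (rho n m)"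
    proof -
      have "(\<Sum>a<m. Suc n - a) = (\<Sum>a<m. 1 + (n - a))" using True by (intro sum.cong) auto
      then show ?thesis unfolding sum_list_rho sum.distrib by simp
    qed
    then show ?thesis using phi_rho_less[OF True] Suc.IH[OF True] by (simp add: power_add)
  next
    case False
    then have m: "m = Suc n" using Suc.prems by simp
    have "sum_list (rho (Suc n) (Suc n)) = Suc n + sum_list (rho n n)"
      unfolding sum_list_rho by (subst sum.lessThan_Suc_shift) simp
    then show ?thesis unfolding m using phi_rho_full[of n] Suc.IH[of n] by (simp add: power_add)
  qed
qed

text \<open>The excess of size over length is the exponent of 2 that the normalization of the
  structure constant leaves.\<close>

lemma sum_list_rho_choose:
  assumes "m \<le> n"
  shows "sum_list (rho n m) = m + ((n choose 2) - ((n - m) choose 2))"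
proof -
  have "sum_list (rho n m) + ((n - m) choose 2) = m + (n choose 2)"
    using assms
  proof (induction m)
    case 0
    then show ?case by (simp add: rho_def)
  next
    case (Suc m)
    obtain k where k: "n - m = Suc k" "n - Suc m = k" using Suc.prems by (cases "n - m") auto
    have "Suc k choose 2 = k + (k choose 2)" by (simp add: numeral_2_eq_2)
    then show ?case using Suc k by (simp add: sum_list_rho)
  qed
  moreover have "(n - m) choose 2 \<le> n choose 2" by (rule binomial_right_mono) simp
  ultimately show ?thesis by simp
qed

section \<open>The normalized structure constant\<close>

lemma two_int_poly_fract: "(2 :: int poly fract) \<noteq> 0"
proof -
  have "emb (of_nat 2 :: int poly) \<noteq> emb 0" unfolding emb_eq_iff by simp
  then show ?thesis using comm_ring_hom.of_nat[OF emb_hom, of 2] comm_ring_hom.zero[OF emb_hom] by simp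
qed

lemma frak_d_self:
  assumes "strict_partition lam"
  shows "frak_d lam mu lam = emb (phi (length lam) mu) /
    (2 powi (int (length mu) - int (sum_list mu)) * emb \<zeta> ^ sum_list mu)"
  unfolding frak_d_def Let_def af_struct_self[OF assms] lookup_pf_var emb_def
  by (simp flip: power_int_of_nat)

text \<open>The powers of z cancel. The denominator keeps 2^(L - Delta) with L - Delta = m -
  |rho(n,m)|, which is minus the exponent of the result.\<close>

lemma frak_d_rho:
  assumes "strict_partition lam" "length lam = n" "m \<le> n"
  shows "frak_d lam (rho n m) lam = 2 ^ ((n choose 2) - ((n - m) choose 2))"
proof -
  let ?E = "(n choose 2) - ((n - m) choose 2)"
  have z: "emb \<zeta> ^ k \<noteq> 0" for k using emb_eq_iff[of \<zeta> 0] by (simp add: comm_ring_hom.zero[OF emb_hom])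
  have "int m - int (sum_list (rho n m)) = - int ?E" using sum_list_rho_choose[OF assms(3)] by simp
  then have "frak_d lam (rho n m) lam = emb \<zeta> ^ sum_list (rho n m) / (2 powi (- int ?E) * emb \<zeta> ^ sum_list (rho n m))"
    unfolding frak_d_self[OF assms(1)] assms(2) phi_rho[OF assms(3)] length_rho comm_ring_hom.power[OF emb_hom] by simp
  then show ?thesis using z two_int_poly_fract by (simp add: power_int_minus divide_simps)
qed

lemma frak_d_large:
  assumes "strict_partition lam" "length lam < mu ! 0" "mu \<noteq> []"
  shows "frak_d lam mu lam = 0"
  unfolding frak_d_self[OF assms(1)] phi_large[OF assms(3,2)] by (simp add: comm_ring_hom.zero[OF emb_hom])

theorem theorem1p4:
  fixes lam mu :: "nat list" and n m :: nat
  assumes "strict_partition lam" and "strict_partition mu"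
    and "length mu = m" and "length lam = n" and "m \<le> n"
    and "diagram (rho n m) \<subseteq> diagram mu"
  shows "frak_d lam mu lam = of_nat (selt_count lam mu lam) \<and>
    selt_count lam mu lam =
      (if mu = rho n m then 2 ^ ((n choose 2) - ((n - m) choose 2)) else 0)"
proof -
  note count = selt_count_formula[OF assms]
  show ?thesis
  proof (cases "mu = rho n m")
    case True
    then show ?thesis using count frak_d_rho[OF assms(1,4,5)] by simp
  next
    case False
    \<comment> \<open>Under the containment mu can differ from rho n m only by a first part larger
      than n, and then both sides vanish.\<close>
    then have "m \<noteq> 0" "n < mu ! 0" using rho_containment[OF assms(2,3,5,6)] by (meson not_le)+
    then have "frak_d lam mu lam = 0" using frak_d_large[OF assms(1)] assms(3,4) by auto
    then show ?thesis using count False by simp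
  qed
qed

end
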